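(* Let $p$ be a prime and let $(\alpha_n)_{n\ge 1}$ be a sequence of positive real numbers satisfying $$\liminf_{n\to\infty}\frac{n\alpha_n}{\log n}>1.$$ For each $n$, let $A_n\in \mathrm{Mat}_n(\mathbb{F}_p)$ be an $\alpha_n$-balanced random matrix. Then for any $r\ge 1$ and any tuple of distinct monic irreducible nonconstant polynomials $F_1,\ldots,F_r\in\mathbb{F}_p[t]$, the joint distribution of $(\lambda^{(F_1)}(A_n),\ldots,\lambda^{(F_r)}(A_n))$ converges pointwise to the product measure $\prod_{j=1}^r\mu_{F_j}$ on $\mathbb{Y}^r$ as $n\to\infty$; that is, for all $\lambda^{(1)},\ldots,\lambda^{(r)}\in\mathbb{Y}$, $$\lim_{n\to\infty}\mathbf{P}\left(\lambda^{(F_j)}(A_n)=\lambda^{(j)}\ \text{for all } 1\le j\le r\right)=\prod_{j=1}^r\mu_{F_j}(\lambda^{(j)}),$$ where, for a monic irreducible nonconstant polynomial $F\in\mathbb{F}_p[t]$, $$\mu_F(\lambda)=\frac{1}{\#\mathrm{Aut}_F(\lambda)}\prod_{\ell=1}^{\infty}\left(1-p^{-\ell\deg F}\right),\qquad \lambda\in\mathbb{Y}.$$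
   Context: $\mathbb{F}_p$ is the field with $p$ elements and $\mathrm{Mat}_n(\mathbb{F}_p)$ the set of $n\times n$ matrices over it. Balanced matrices: for $\alpha>0$, a random variable $\xi\in\mathbb{F}_p$ is $\alpha$-balanced if $\mathbf{P}(\xi=a)\le 1-\alpha$ for every $a\in\mathbb{F}_p$. A random matrix over $\mathbb{F}_p$ is $\alpha$-balanced if its entries are independent and each is $\alpha$-balanced (the entries need not be identically distributed). Partitions: $\mathbb{Y}$ is the set of integer partitions $\lambda=(\lambda_1\ge\lambda_2\ge\cdots\ge 0)$, $\lambda_i\in\mathbb{Z}$, with $\lambda_i=0$ for all but finitely many $i$. Rational canonical form: for a monic $f(t)=t^r+a_{r-1}t^{r-1}+\cdots+a_0\in\mathbb{F}_p[t]$, the companion matrix $C(f)$ is the $r\times r$ matrix with $1$'s on the superdiagonal, last row $(-a_0,-a_1,\ldots,-a_{r-1})$, and zeros elsewhere. Every $A\in\mathrm{Mat}_n(\mathbb{F}_p)$ is conjugate under $\mathrm{GL}_n(\mathbb{F}_p)$ to a block diagonal matrix whose blocks are $C(F^{\lambda_j^{(F)}})$, where $F$ ranges over the distinct monic irreducible factors of $\det(tI_n-A)$ and $\lambda^{(F)}=(\lambda^{(F)}_1\ge\lambda^{(F)}_2\ge\cdots)\in\mathbb{Y}$ is a partition (with $j$ ranging over its positive parts) whose size $\sum_j\lambda_j^{(F)}$ is the multiplicity of $F$ in $\det(tI_n-A)$. This form is unique up to the order of blocks, so the partitions $\lambda^{(F)}=\lambda^{(F)}(A)$ are well defined; set $\lambda^{(F)}(A)$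 to be the zero partition if $F\nmid\det(tI_n-A)$. Equivalently, the $F$-primary part of the $\mathbb{F}_p[t]$-module $\mathrm{Cok}_{\mathbb{F}_p[t]}(tI_n-A)$ is isomorphic to $\bigoplus_{j\ge1}\mathbb{F}_p[t]/(F^{\lambda_j^{(F)}})$. $\mathrm{Aut}_F(\lambda)$ denotes the group of automorphisms of the $\mathbb{F}_p[t]$-module $\bigoplus_{j\ge1}\mathbb{F}_p[t]/(F^{\lambda_j})$. *)

theory Defs
  imports
    "HOL-Probability.Probability"
    "HOL-Algebra.Algebraic_Closure_Type"
    "HOL-Algebra.QuotRing"
    "HOL-Algebra.Module"
    "HOL-Algebra.Bij"
    "HOL-Algebra.Product_Groups"
    "Jordan_Normal_Form.Char_Poly"
    "Berlekamp_Zassenhaus.Finite_Field"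
begin

text \<open>The field with \<open>p\<close> elements is \<open>'p mod_ring\<close> with \<open>'p :: prime_card\<close>, so that \<open>p = CARD('p)\<close>.\<close>

definition balanced_rv :: "'w measure \<Rightarrow> real \<Rightarrow> ('w \<Rightarrow> 'a) \<Rightarrow> bool" where
  "balanced_rv M \<alpha> \<xi> \<longleftrightarrow>
     \<xi> \<in> measurable M (count_space UNIV) \<and>
     (\<forall>a. measure M {\<omega> \<in> space M. \<xi> \<omega> = a} \<le> 1 - \<alpha>)"

definition balanced_random_matrix ::
    "'w measure \<Rightarrow> nat \<Rightarrow> real \<Rightarrow> ('w \<Rightarrow> 'a mat) \<Rightarrow> bool" where
  "balanced_random_matrix M n \<alpha> A \<longleftrightarrow>
     (\<forall>\<omega> \<in> space M. A \<omega> \<in> carrier_mat n n) \<and>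
     prob_space.indep_vars M (\<lambda>_. count_space UNIV)
       (\<lambda>(i, j) \<omega>. A \<omega> $$ (i, j)) ({..<n} \<times> {..<n}) \<and>
     (\<forall>i<n. \<forall>j<n. balanced_rv M \<alpha> (\<lambda>\<omega>. A \<omega> $$ (i, j)))"

text \<open>Indices are shifted by one: \<open>l 0\<close> is the largest part, usually written \<open>\<lambda>\<^sub>1\<close>.\<close>

definition partitions :: "(nat \<Rightarrow> nat) set" where
  "partitions = {l. antimono l \<and> finite {j. l j \<noteq> 0}}"

definition partition_size :: "(nat \<Rightarrow> nat) \<Rightarrow> nat" where
  "partition_size l = (\<Sum>j | l j \<noteq> 0. l j)"

definition companion_matrix :: "'a :: comm_ring_1 poly \<Rightarrow> 'a mat" where
  "companion_matrix f = mat (Polynomial.degree f) (Polynomial.degree f)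
     (\<lambda>(i, j). if Suc i = Polynomial.degree f then - Polynomial.coeff f j else if j = Suc i then 1 else 0)"

text \<open>\<open>L\<close> collects the partitions of a rational canonical form of \<open>A\<close>, one for each polynomial;
  \<open>bs\<close> lists, in some order, the pairs \<open>(F, j)\<close> that index its blocks.\<close>

definition rational_canonical_data ::
    "'a :: field_gcd mat \<Rightarrow> ('a poly \<Rightarrow> nat \<Rightarrow> nat) \<Rightarrow> bool" where
  "rational_canonical_data A L \<longleftrightarrow>
     (let Irr = {F. monic F \<and> Factorial_Ring.irreducible F \<and> F dvd char_poly A} in
      (\<forall>F \<in> Irr. L F \<in> partitions \<and> partition_size (L F) = multiplicity F (char_poly A)) \<and>
      (\<forall>F. F \<notin> Irr \<longrightarrow> L F = (\<lambda>_. 0)) \<and>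
      (\<exists>bs. distinct bs \<and> set bs = {(F, j). F \<in> Irr \<and> L F j > 0} \<and>
        similar_mat A (diag_block_mat (map (\<lambda>(F, j). companion_matrix (F ^ L F j)) bs))))"

definition rcf_partition :: "'a :: field_gcd poly \<Rightarrow> 'a mat \<Rightarrow> nat \<Rightarrow> nat" where
  "rcf_partition F A = (THE L. rational_canonical_data A L) F"

definition quotient_module :: "('a, 'm) ring_scheme \<Rightarrow> 'a set \<Rightarrow> ('a, 'a set) module" where
  "quotient_module R J = ring.extend (R Quot J)
     (module.fields (\<lambda>a x. (J +>\<^bsub>R\<^esub> a) \<otimes>\<^bsub>R Quot J\<^esub> x))"

text \<open>The multiplicative part of a \<open>module\<close> record carries no meaning for modules;
  here it is filled componentwise.\<close>

definition direct_sum_module :: "'i set \<Rightarrow> ('i \<Rightarrow> ('a, 'b) module) \<Rightarrow> ('a, 'i \<Rightarrow> 'b) module" where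
  "direct_sum_module I N =
     \<lparr>carrier = carrier (sum_group I (\<lambda>i. add_monoid (N i))),
      mult = (\<lambda>x y. \<lambda>i\<in>I. x i \<otimes>\<^bsub>N i\<^esub> y i),
      one = (\<lambda>i\<in>I. \<one>\<^bsub>N i\<^esub>),
      zero = (\<lambda>i\<in>I. \<zero>\<^bsub>N i\<^esub>),
      add = (\<lambda>x y. \<lambda>i\<in>I. x i \<oplus>\<^bsub>N i\<^esub> y i),
      smult = (\<lambda>a x. \<lambda>i\<in>I. a \<odot>\<^bsub>N i\<^esub> x i)\<rparr>"

definition module_auto :: "('a, 'm) ring_scheme \<Rightarrow> ('a, 'b) module \<Rightarrow> ('b \<Rightarrow> 'b) set" where
  "module_auto R M = {\<phi> \<in> auto (add_monoid M).
     \<forall>a \<in> carrier R. \<forall>x \<in> carrier M. \<phi> (a \<odot>\<^bsub>M\<^esub> x) = a \<odot>\<^bsub>M\<^esub> \<phi> x}"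

definition primary_module ::
    "'a :: field poly \<Rightarrow> (nat \<Rightarrow> nat) \<Rightarrow> ('a poly, nat \<Rightarrow> 'a poly set) module" where
  "primary_module F l = direct_sum_module UNIV
     (\<lambda>j. quotient_module ring_of_type_algebra (PIdl\<^bsub>ring_of_type_algebra\<^esub> (F ^ l j)))"

definition Aut_F ::
    "'a :: field poly \<Rightarrow> (nat \<Rightarrow> nat) \<Rightarrow> ((nat \<Rightarrow> 'a poly set) \<Rightarrow> (nat \<Rightarrow> 'a poly set)) set" where
  "Aut_F F l = module_auto ring_of_type_algebra (primary_module F l)"

definition mu_F :: "'p :: prime_card mod_ring poly \<Rightarrow> (nat \<Rightarrow> nat) \<Rightarrow> real" where
  "mu_F F l = 1 / real (card (Aut_F F l)) *
     (\<Prod>k. 1 - real CARD('p) powi (- int (Suc k * Polynomial.degree F)))"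

end

theory Submission
  imports Defs "HOL-Library.Function_Algebras" "HOL-Real_Asymp.Real_Asymp"
begin

text \<open>Let \<open>F\<^sub>p[t]\<close> act on row vectors of length \<open>n\<close> with \<open>t\<close> acting as \<open>A\<close>, and fix partitions \<open>l j\<close>.
  Count the tuples \<open>x\<close> that are bases of a submodule \<open>S\<close> isomorphic to the direct sum of the \<open>F\<^sub>p[t]/(F j ^ l j i)\<close>
  and saturated: \<open>F j v \<in> S\<close> implies \<open>v \<in> S\<close>. Then \<open>S\<close> is forced to be the sum of the \<open>F j\<close>-primary parts,
  so such tuples exist exactly if \<open>A\<close> has the partitions \<open>l j\<close> at the \<open>F j\<close>, and then their number is
  the product of the \<open>#Aut\<close>. Hence the wanted probability is the expected number of saturated tuples divided by that product.

  Without saturation, an expected number of tuples with prescribed linear relations (one relation \<open>u A = v\<close> per basis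
  vector, \<open>u\<close> ranging over independent vectors) tends to 1 for balanced \<open>A\<close>, by Fourier analysis: independent
  vectors \<open>u\<close> without a nonzero combination of small support make \<open>u A\<close> nearly uniform, and the condition on
  \<open>\<alpha>\<close> controls the remaining ones. Extending \<open>x\<close> by \<open>b j\<close> vectors killed by \<open>F j\<close> modulo \<open>S\<close> counts bases of the
  \<open>F j\<close>-torsion modulo \<open>S\<close>, so these limits are the joint \<open>q\<close>-factorial moments of the numbers \<open>q ^ a j\<close> of torsion elements.
  All of them equal 1, and truncated inclusion-exclusion gives the limiting weight of \<open>a = 0\<close>, the Euler product.\<close>

section \<open>Vectors with random linear images\<close>

text \<open>The condition on \<open>\<alpha>\<close> is used at its exact constant twice. If all
  columns \<open>\<phi> i\<close> of the tuple matrix but one lie in a proper subspace, the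
  conditions hold with probability of order \<open>(1 - \<alpha>) ^ n\<close> relative to that
  subspace, against \<open>n\<close> choices of the exceptional index. And for well spread families
  the conditions for the \<open>n\<close> matrix columns multiply, so each needs a relative error
  \<open>o(1/n)\<close>.

  The pointwise Fourier estimate is too weak for the latter, since it loses the constant
  \<open>kap\<close> of the character. Averaging repairs this: over uniform families the mean of
  \<open>defect\<close> is exactly \<open>spread\<close>, and a Chernoff bound makes deviating
  families exponentially rare; for these the weak estimate suffices, as its error grows only
  subexponentially.

  Saturation is not a relation among fixed vectors, hence the detour through extended tuples. Every
  system of relations has expectation tending to 1, and the number of systems, one element of
  \<open>S\<close> per added vector, is the power of \<open>card S\<close> that appears when torsion
  bases modulo \<open>S\<close> are counted. The two cancel, which makes all factorial moments
  1.\<close>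

declare plus_fun_apply [simp del] zero_fun_apply [simp del] minus_apply [simp del] uminus_apply [simp del]

lemmas fun_apply = plus_fun_apply zero_fun_apply minus_apply uminus_apply

section \<open>Functions into a field as vectors, with the form \<open>dot\<close>\<close>

definition scal :: "'a::times \<Rightarrow> ('c \<Rightarrow> 'a) \<Rightarrow> 'c \<Rightarrow> 'a" where
  "scal a g = (\<lambda>c. a * g c)"

lemma scal_apply [simp]: "scal a g c = a * g c"
  by (simp add: scal_def)

interpretation fv: vector_space "scal :: 'a::field \<Rightarrow> ('c \<Rightarrow> 'a) \<Rightarrow> 'c \<Rightarrow> 'a"
  by standard (auto simp: scal_def fun_eq_iff fun_apply algebra_simps)

text \<open>Vectors indexed by \<open>D\<close> are total functions vanishing off \<open>D\<close>:
  pointwise addition then stays inside, and equality of vectors is equality of functions.\<close>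

definition vecs :: "'c set \<Rightarrow> ('c \<Rightarrow> 'a::zero) set" where
  "vecs D = {g. \<forall>c. c \<notin> D \<longrightarrow> g c = 0}"

definition dot :: "'c set \<Rightarrow> ('c \<Rightarrow> 'a) \<Rightarrow> ('c \<Rightarrow> 'a) \<Rightarrow> 'a::comm_semiring_0" where
  "dot D f g = (\<Sum>c\<in>D. f c * g c)"

lemma sum_fun_apply: "(\<Sum>i\<in>N. g i) c = (\<Sum>i\<in>N. g i c)"
  by (induction N rule: infinite_finite_induct) (auto simp: fun_apply)

lemma subspace_vecs: "fv.subspace (vecs D)"
  by (auto simp: fv.subspace_def vecs_def fun_apply)

lemma finite_vecs:
  assumes "finite D" shows "finite (vecs D :: ('c \<Rightarrow> 'a::{zero,finite}) set)"
proof -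
  have "vecs D \<subseteq> (\<lambda>g c. if c \<in> D then g c else 0) ` (D \<rightarrow>\<^sub>E (UNIV::'a set))"
  proof
    fix g :: "'c \<Rightarrow> 'a" assume "g \<in> vecs D"
    then show "g \<in> (\<lambda>g c. if c \<in> D then g c else 0) ` (D \<rightarrow>\<^sub>E (UNIV::'a set))"
      by (intro image_eqI[of _ _ "restrict g D"]) (auto simp: vecs_def fun_eq_iff)
  qed
  then show ?thesis by (rule finite_subset) (intro finite_imageI finite_PiE assms, auto)
qed

lemma dot_add_right: "dot D f (g + h) = dot D f g + dot D f h"
  by (simp add: dot_def fun_apply algebra_simps sum.distrib)

lemma dot_scal_right: "dot D f (scal a h) = a * dot D f h"
  by (simp add: dot_def sum_distrib_left algebra_simps)

lemma dot_scal_left: "dot D (scal a f) h = a * dot D f h"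
  by (simp add: dot_def sum_distrib_left algebra_simps)

lemma dot_zero_right [simp]: "dot D f 0 = 0"
  by (simp add: dot_def fun_apply)

lemma dot_zero_left [simp]: "dot D 0 f = 0"
  by (simp add: dot_def fun_apply)

lemma dot_sum_right: "dot D f (\<Sum>i\<in>N. g i) = (\<Sum>i\<in>N. dot D f (g i))"
  by (induction N rule: infinite_finite_induct) (auto simp: dot_add_right)

lemma dot_commute: "dot D f g = dot D g f"
  by (simp add: dot_def mult.commute)

lemma dot_nondegenerate:
  assumes "finite D" "g \<in> vecs D" "g \<noteq> (0 :: 'c \<Rightarrow> 'a::field)"
  shows "\<exists>f\<in>vecs D. dot D f g \<noteq> 0"
proof -
  obtain c where c: "g c \<noteq> 0" using assms(3) by (auto simp: fun_eq_iff fun_apply)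
  then have cD: "c \<in> D" using assms(2) by (auto simp: vecs_def)
  define f where "f = (\<lambda>x. if x = c then 1 else (0::'a))"
  have "dot D f g = (\<Sum>x\<in>D. if x = c then g x else 0)"
    unfolding dot_def f_def by (rule sum.cong) auto
  then have "dot D f g = g c" using cD assms(1) by simp
  moreover have "f \<in> vecs D" using cD by (auto simp: f_def vecs_def)
  ultimately show ?thesis using c by (metis (no_types))
qed

definition annih :: "'c set \<Rightarrow> ('c \<Rightarrow> 'a) set \<Rightarrow> ('c \<Rightarrow> 'a::comm_semiring_0) set" where
  "annih D H = {f\<in>vecs D. \<forall>h\<in>H. dot D f h = 0}"

section \<open>The law of a random linear combination of given vectors\<close>

definition pr :: "nat set \<Rightarrow> (nat \<Rightarrow> 'a \<Rightarrow> real) \<Rightarrow> (nat \<Rightarrow> 'c \<Rightarrow> 'a::field) \<Rightarrow> ('c \<Rightarrow> 'a) set \<Rightarrow> real" where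
  "pr N w \<phi> E = (\<Sum>Z\<in>(N \<rightarrow>\<^sub>E UNIV). (\<Prod>i\<in>N. w i (Z i)) * of_bool ((\<Sum>i\<in>N. scal (Z i) (\<phi> i)) \<in> E))"

lemma pr_empty [simp]: "pr {} w \<phi> E = of_bool (0 \<in> E)"
  by (simp add: pr_def)

text \<open>Conditioning on the coefficient of \<open>\<phi> i\<close>; the inductions on the index
  set below go through this step.\<close>

lemma pr_insert:
  fixes w :: "nat \<Rightarrow> 'a::{field,finite} \<Rightarrow> real"
  assumes N: "finite N" "i \<notin> N"
  shows "pr (insert i N) w \<phi> E = (\<Sum>a\<in>UNIV. w i a * pr N w \<phi> {u. scal a (\<phi> i) + u \<in> E})"
proof -
  let ?c = "\<lambda>(y, g). g(i := y)"
  have *: "(\<Prod>k\<in>insert i N. w k ((g(i := a)) k)) = w i a * (\<Prod>k\<in>N. w k (g k))" for a g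
  proof -
    have "(\<Prod>k\<in>N. w k ((g(i := a)) k)) = (\<Prod>k\<in>N. w k (g k))"
      using N by (intro prod.cong) auto
    then show ?thesis using N by simp
  qed
  have **: "(\<Sum>k\<in>insert i N. scal ((g(i := a)) k) (\<phi> k)) = scal a (\<phi> i) + (\<Sum>k\<in>N. scal (g k) (\<phi> k))" for a g
  proof -
    have "(\<Sum>k\<in>N. scal ((g(i := a)) k) (\<phi> k)) = (\<Sum>k\<in>N. scal (g k) (\<phi> k))"
      using N by (intro sum.cong) auto
    then show ?thesis using N by simp
  qed
  have "pr (insert i N) w \<phi> E = (\<Sum>Z\<in>?c ` (UNIV \<times> (N \<rightarrow>\<^sub>E UNIV)).
     (\<Prod>k\<in>insert i N. w k (Z k)) * of_bool ((\<Sum>k\<in>insert i N. scal (Z k) (\<phi> k)) \<in> E))"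
    unfolding pr_def by (subst PiE_insert_eq) simp
  also have "\<dots> = (\<Sum>(a,g)\<in>UNIV \<times> (N \<rightarrow>\<^sub>E UNIV). w i a * (\<Prod>k\<in>N. w k (g k)) *
      of_bool (scal a (\<phi> i) + (\<Sum>k\<in>N. scal (g k) (\<phi> k)) \<in> E))"
    by (subst sum.reindex[OF inj_combinator[OF N(2)]]) (simp only: * ** o_def case_prod_unfold prod.sel)
  also have "\<dots> = (\<Sum>a\<in>UNIV. w i a * pr N w \<phi> {u. scal a (\<phi> i) + u \<in> E})"
    by (simp add: sum.cartesian_product[symmetric] pr_def sum_distrib_left mult.assoc)
  finally show ?thesis .
qed

definition balanced_wt :: "real \<Rightarrow> ('a::finite \<Rightarrow> real) \<Rightarrow> bool" where
  "balanced_wt \<alpha> w \<longleftrightarrow> (\<forall>a. 0 \<le> w a \<and> w a \<le> 1 - \<alpha>) \<and> (\<Sum>a\<in>UNIV. w a) = 1"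

lemma pr_nonneg:
  assumes "\<And>i a. i \<in> N \<Longrightarrow> 0 \<le> w i a" shows "0 \<le> pr N w \<phi> E"
  unfolding pr_def by (intro sum_nonneg mult_nonneg_nonneg prod_nonneg) (auto simp: assms)

lemma pr_UNIV:
  fixes w :: "nat \<Rightarrow> 'a::{field,finite} \<Rightarrow> real"
  assumes "finite N" "\<And>i. i \<in> N \<Longrightarrow> (\<Sum>a\<in>UNIV. w i a) = 1"
  shows "pr N w \<phi> UNIV = 1"
  using assms by (induction N rule: finite_induct) (auto simp: pr_insert)

text \<open>The extremal case has two points: laws with weights
  \<open>1 - \<alpha>, \<alpha>\<close> and \<open>1 - \<beta>, \<beta>\<close> agree with exactly
  the probability on the right, written so that the biases multiply. Only a subprobability is asked
  of \<open>y\<close>, because it will hold the probabilities of finitely many disjoint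
  cosets.\<close>

lemma sum_prod_balanced_le:
  fixes x y :: "'a::finite \<Rightarrow> real"
  assumes x: "balanced_wt \<alpha> x" and y: "\<And>a. 0 \<le> y a" "\<And>a. y a \<le> 1 - \<beta>" "(\<Sum>a\<in>UNIV. y a) \<le> 1"
    and ab: "\<alpha> \<le> 1/2" "\<beta> \<le> 1/2"
  shows "(\<Sum>a\<in>UNIV. x a * y a) \<le> (1 + (1 - 2*\<alpha>) * (1 - 2*\<beta>)) / 2"
proof (cases "\<forall>a. x a \<le> 1/2")
  case True
  have "(\<Sum>a\<in>UNIV. x a * y a) \<le> (\<Sum>a\<in>UNIV. 1/2 * y a)"
    using True y(1) by (intro sum_mono mult_right_mono) auto
  also have "\<dots> = 1/2 * (\<Sum>a\<in>UNIV. y a)" by (simp add: sum_distrib_left)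
  also have "\<dots> \<le> 1/2" using y(3) by simp
  also have "\<dots> \<le> (1 + (1 - 2*\<alpha>) * (1 - 2*\<beta>)) / 2" using ab by simp
  finally show ?thesis .
next
  case False
  \<comment> \<open>Only one value can weigh more than one half. Lumping the remaining values of
    \<open>x\<close> and of \<open>y\<close> together reduces to the case of two points.\<close>
  then obtain a where a: "x a > 1/2" by (auto simp: not_le)
  have sx: "(\<Sum>b\<in>UNIV-{a}. x b) = 1 - x a" using x by (simp add: balanced_wt_def sum_diff1)
  have sy: "(\<Sum>b\<in>UNIV-{a}. y b) \<le> 1 - y a" using y by (simp add: sum_diff1)
  have x1: "x a \<le> 1" using sx sum_nonneg[of "UNIV-{a}" x] x by (auto simp: balanced_wt_def)
  have "(\<Sum>b\<in>UNIV-{a}. x b * y b) \<le> (\<Sum>b\<in>UNIV-{a}. x b * (\<Sum>c\<in>UNIV-{a}. y c))"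
    using x y by (intro sum_mono mult_left_mono member_le_sum) (auto simp: balanced_wt_def)
  also have "\<dots> = (1 - x a) * (\<Sum>c\<in>UNIV-{a}. y c)" by (simp add: sum_distrib_right[symmetric] sx)
  also have "\<dots> \<le> (1 - x a) * (1 - y a)" using sy x1 by (intro mult_left_mono) auto
  finally have 1: "(\<Sum>a\<in>UNIV. x a * y a) \<le> x a * y a + (1 - x a) * (1 - y a)"
    by (subst sum.remove[of _ a]) auto
  have 2: "x a * y a + (1 - x a) * (1 - y a) = (1 + (2 * x a - 1) * (2 * y a - 1)) / 2"
    by (simp add: field_simps)
  have "(2 * x a - 1) * (2 * y a - 1) \<le> (1 - 2*\<alpha>) * (1 - 2*\<beta>)"
  proof (cases "2 * y a - 1 \<ge> 0")
    case True
    have "x a \<le> 1 - \<alpha>" using x by (auto simp: balanced_wt_def)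
    moreover have "y a \<le> 1 - \<beta>" using y by auto
    ultimately show ?thesis using a True ab by (intro mult_mono) auto
  next
    case False
    then have "(2 * x a - 1) * (2 * y a - 1) \<le> 0" using a by (intro mult_nonneg_nonpos) auto
    also have "0 \<le> (1 - 2*\<alpha>) * (1 - 2*\<beta>)" using ab by simp
    finally show ?thesis .
  qed
  then show ?thesis using 1 2 by simp
qed

lemma pr_disjoint_sum:
  fixes w :: "nat \<Rightarrow> 'a::{field,finite} \<Rightarrow> real"
  assumes N: "finite N" "\<And>i. i \<in> N \<Longrightarrow> balanced_wt \<alpha> (w i)" and I: "finite I"
    and disj: "\<And>a b. a \<in> I \<Longrightarrow> b \<in> I \<Longrightarrow> a \<noteq> b \<Longrightarrow> E a \<inter> E b = {}"
  shows "(\<Sum>a\<in>I. pr N w \<phi> (E a)) \<le> 1"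
proof -
  have "(\<Sum>a\<in>I. pr N w \<phi> (E a)) = (\<Sum>Z\<in>(N \<rightarrow>\<^sub>E UNIV). (\<Prod>i\<in>N. w i (Z i)) *
          (\<Sum>a\<in>I. of_bool ((\<Sum>i\<in>N. scal (Z i) (\<phi> i)) \<in> E a)))"
    unfolding pr_def by (subst sum.swap) (simp add: sum_distrib_left)
  also have "\<dots> \<le> (\<Sum>Z\<in>(N \<rightarrow>\<^sub>E UNIV). (\<Prod>i\<in>N. w i (Z i)) * 1)"
  proof (intro sum_mono mult_left_mono prod_nonneg)
    fix Z
    let ?u = "\<Sum>i\<in>N. scal (Z i) (\<phi> i)"
    have "card {a\<in>I. ?u \<in> E a} \<le> 1"
      using disj I unfolding One_nat_def by (subst card_le_Suc0_iff_eq) (simp, blast)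
    then show "(\<Sum>a\<in>I. of_bool (?u \<in> E a)) \<le> (1::real)"
      using I by (simp add: sum.If_cases of_bool_def Int_def)
  qed (use N in \<open>auto simp: balanced_wt_def\<close>)
  also have "\<dots> = pr N w \<phi> UNIV" by (simp add: pr_def)
  also have "\<dots> = 1" using N by (intro pr_UNIV) (auto simp: balanced_wt_def)
  finally show ?thesis .
qed

text \<open>Modulo \<open>H\<close> different coefficients of \<open>\<phi> i\<close> lead to
  different cosets. So each index multiplies the excess of the bound over one half by
  \<open>1 - 2*\<alpha>\<close>, as in a random walk on two points.\<close>

lemma pr_coset_le:
  fixes w :: "nat \<Rightarrow> 'a::{field,finite} \<Rightarrow> real"
  assumes H: "fv.subspace H" and \<alpha>: "0 \<le> \<alpha>" "\<alpha> \<le> 1/2"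
    and S: "finite S" "\<And>i. i \<in> S \<Longrightarrow> balanced_wt \<alpha> (w i)" "\<And>i. i \<in> S \<Longrightarrow> \<phi> i \<notin> H"
  shows "pr S w \<phi> {u. u - v \<in> H} \<le> (1 + (1 - 2*\<alpha>) ^ card S) / 2"
  using S
proof (induction S arbitrary: v rule: finite_induct)
  case empty
  then show ?case by simp
next
  case (insert i S)
  \<comment> \<open>Chosen so that \<open>1 - \<beta>\<close> is the bound of the induction
    hypothesis.\<close>
  define \<beta> where "\<beta> = (1 - (1 - 2*\<alpha>) ^ card S) / 2"
  have b: "1 - \<beta> = (1 + (1 - 2*\<alpha>) ^ card S) / 2" "1 - 2 * \<beta> = (1 - 2*\<alpha>) ^ card S"
    by (auto simp: \<beta>_def field_simps)
  define y where "y = (\<lambda>a. pr S w \<phi> {u. u - (v - scal a (\<phi> i)) \<in> H})"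
  have "pr (insert i S) w \<phi> {u. u - v \<in> H} = (\<Sum>a\<in>UNIV. w i a * y a)"
    unfolding y_def using insert by (subst pr_insert) (auto simp: algebra_simps)
  also have "\<dots> \<le> (1 + (1 - 2*\<alpha>) * (1 - 2*\<beta>)) / 2"
  proof (rule sum_prod_balanced_le)
    show "balanced_wt \<alpha> (w i)" using insert by auto
    show "0 \<le> y a" for a unfolding y_def using insert by (intro pr_nonneg) (auto simp: balanced_wt_def)
    show "y a \<le> 1 - \<beta>" for a unfolding y_def b using insert by auto
    show "(\<Sum>a\<in>UNIV. y a) \<le> 1" unfolding y_def
    proof (rule pr_disjoint_sum)
      fix a b :: 'a assume ab: "a \<noteq> b"
      show "{u. u - (v - scal a (\<phi> i)) \<in> H} \<inter> {u. u - (v - scal b (\<phi> i)) \<in> H} = {}"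
      proof (rule ccontr)
        assume "\<not> ?thesis"
        then obtain u where u: "u - (v - scal a (\<phi> i)) \<in> H" "u - (v - scal b (\<phi> i)) \<in> H" by auto
        have "u - (v - scal a (\<phi> i)) - (u - (v - scal b (\<phi> i))) \<in> H"
          using fv.subspace_diff[OF H u] .
        moreover have "u - (v - scal a (\<phi> i)) - (u - (v - scal b (\<phi> i))) = scal (a - b) (\<phi> i)"
          by (auto simp: fun_eq_iff fun_apply algebra_simps)
        ultimately have "scal (a - b) (\<phi> i) \<in> H" by simp
        then have "scal (1/(a-b)) (scal (a - b) (\<phi> i)) \<in> H" using H fv.subspace_scale by blast
        moreover have "scal (1/(a-b)) (scal (a - b) (\<phi> i)) = \<phi> i" using ab by (simp only: fv.scale_scale) simp
        ultimately show False using insert by auto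
      qed
    qed (use insert in auto)
    show "\<beta> \<le> 1/2" unfolding \<beta>_def using \<alpha> by simp
  qed (use \<alpha> in auto)
  also have "\<dots> = (1 + (1 - 2*\<alpha>) ^ card (insert i S)) / 2" using insert b by simp
  finally show ?case .
qed

lemma sum_scal_mem:
  fixes \<phi> :: "nat \<Rightarrow> 'c \<Rightarrow> 'a::field"
  assumes "fv.subspace H" "\<And>i. i \<in> N \<Longrightarrow> \<phi> i \<in> H"
  shows "(\<Sum>i\<in>N. scal (Z i) (\<phi> i)) \<in> H"
  using assms by (intro fv.subspace_sum fv.subspace_scale) auto

text \<open>Reveal the coefficients on \<open>S\<close> first. They must bring the sum into the
  coset of \<open>v\<close> modulo \<open>H\<close>; then the coefficients on \<open>R\<close> have
  to hit one prescribed element of \<open>H\<close>, which costs at most \<open>M\<close>.\<close>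

lemma pr_split_le:
  fixes w :: "nat \<Rightarrow> 'a::{field,finite} \<Rightarrow> real"
  assumes H: "fv.subspace H" and S: "finite S" and R: "finite R" "\<And>i. i \<in> R \<Longrightarrow> \<phi> i \<in> H"
    and SR: "S \<inter> R = {}" and w: "\<And>i a. i \<in> S \<union> R \<Longrightarrow> 0 \<le> w i a"
    and M: "0 \<le> M" "\<And>h. h \<in> H \<Longrightarrow> pr R w \<phi> {h} \<le> M"
  shows "pr (S \<union> R) w \<phi> {v} \<le> pr S w \<phi> {u. u - v \<in> H} * M"
  using S SR w
proof (induction S arbitrary: v rule: finite_induct)
  case empty
  show ?case
  proof (cases "v \<in> H")
    case True
    then show ?thesis using M fv.subspace_neg[OF H] by simp
  next
    case False
    have "(\<Sum>i\<in>R. scal (Z i) (\<phi> i)) \<noteq> v" for Z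
      using sum_scal_mem[OF H, of R \<phi> Z] R(2) False by auto
    then have "pr R w \<phi> {v} = 0" by (simp add: pr_def)
    then show ?thesis using M by simp
  qed
next
  case (insert i S)
  have 1: "{u. scal a (\<phi> i) + u = v} = {v - scal a (\<phi> i)}" for a
    by (auto simp: eq_diff_eq add.commute)
  have 2: "scal a (\<phi> i) + u - v = u - (v - scal a (\<phi> i))" for a u
    by (simp add: diff_diff_eq2 add.commute)
  have "pr (insert i S \<union> R) w \<phi> {v} = (\<Sum>a\<in>UNIV. w i a * pr (S \<union> R) w \<phi> {v - scal a (\<phi> i)})"
    unfolding Un_insert_left
    by (subst pr_insert) (use insert.hyps insert.prems(1) R(1) in \<open>auto simp: 1\<close>)
  also have "\<dots> \<le> (\<Sum>a\<in>UNIV. w i a * (pr S w \<phi> {u. u - (v - scal a (\<phi> i)) \<in> H} * M))"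
    using insert by (intro sum_mono mult_left_mono) auto
  also have "\<dots> = pr (insert i S) w \<phi> {u. u - v \<in> H} * M"
    by (subst pr_insert) (use insert.hyps in \<open>auto simp: 2 sum_distrib_right mult.assoc\<close>)
  finally show ?case .
qed

section \<open>Collision probabilities and decay of characteristic functions\<close>

definition spread :: "('a::finite \<Rightarrow> real) \<Rightarrow> real" where
  "spread w = 1 - (\<Sum>a\<in>UNIV. (w a)\<^sup>2)"

text \<open>\<open>spread w\<close> is the probability that two independent draws differ, so the
  bound is \<open>sum_prod_balanced_le\<close> for the law paired with itself.\<close>

lemma spread_ge:
  assumes "balanced_wt \<alpha> w" "\<alpha> \<le> 1/2"
  shows "2 * \<alpha> * (1 - \<alpha>) \<le> spread w"
proof -
  have "(\<Sum>a\<in>UNIV. w a * w a) \<le> (1 + (1 - 2*\<alpha>) * (1 - 2*\<alpha>)) / 2"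
    by (rule sum_prod_balanced_le) (use assms in \<open>auto simp: balanced_wt_def\<close>)
  then show ?thesis by (simp add: spread_def power2_eq_square field_simps)
qed

lemma spread_eq:
  assumes "balanced_wt \<alpha> w"
  shows "spread w = (\<Sum>a\<in>UNIV. \<Sum>b\<in>UNIV. if a = b then 0 else w a * w b)"
proof -
  have "(\<Sum>a\<in>UNIV. \<Sum>b\<in>UNIV. if a = b then 0 else w a * w b) =
        (\<Sum>a\<in>UNIV. \<Sum>b\<in>UNIV. w a * w b - (if a = b then w a * w b else 0))"
    by (intro sum.cong) auto
  also have "\<dots> = (\<Sum>a\<in>UNIV. w a) * (\<Sum>b\<in>UNIV. w b) - (\<Sum>a\<in>UNIV. w a * w a)"
    by (simp add: sum_subtractf sum_product)
  finally show ?thesis using assms by (simp add: spread_def balanced_wt_def power2_eq_square)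
qed

lemma of_real_of_bool: "of_real (of_bool P) = of_bool P"
  by simp

lemma exp_minus_le:
  fixes u :: real assumes "0 \<le> u" shows "exp (- u) \<le> 1 - u + u\<^sup>2"
proof -
  have "1 \<le> 1 + u ^ 3" using assms by simp
  also have "1 + u ^ 3 = (1 - u + u\<^sup>2) * (1 + u)" by (simp add: algebra_simps power2_eq_square power3_eq_cube)
  also have "\<dots> \<le> (1 - u + u\<^sup>2) * exp u"
  proof (rule mult_left_mono)
    have "1 - u + u\<^sup>2 = (u - 1/2)\<^sup>2 + 3/4" by (simp add: power2_eq_square field_simps)
    then show "0 \<le> 1 - u + u\<^sup>2" by (metis add_nonneg_nonneg zero_le_power2 divide_nonneg_nonneg zero_le_numeral)
  qed simp
  finally have "exp (- u) * 1 \<le> exp (- u) * ((1 - u + u\<^sup>2) * exp u)"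
    by (intro mult_left_mono) auto
  also have "\<dots> = (1 - u + u\<^sup>2) * (exp (- u) * exp u)" by (simp only: mult_ac)
  finally show ?thesis by (simp add: mult_exp_exp)
qed

text \<open>The last assumption makes \<open>\<psi>\<close> faithful, so that one character detects
  every nonzero value of \<open>dot\<close>. On the prime field it is realised by
  \<open>std_char\<close>.\<close>

locale add_char =
  fixes \<psi> :: "'a::{field,finite} \<Rightarrow> complex"
  assumes psi_add: "\<psi> (x + y) = \<psi> x * \<psi> y"
    and norm_psi: "cmod (\<psi> x) = 1"
    and psi_neq_1: "x \<noteq> 0 \<Longrightarrow> \<psi> x \<noteq> 1"
begin

lemma psi_0 [simp]: "\<psi> 0 = 1"
  using psi_add[of 0 0] norm_psi[of 0] by auto

lemma psi_minus: "\<psi> (- x) = cnj (\<psi> x)"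
proof -
  have "\<psi> (- x) * \<psi> x = 1" using psi_add[of "-x" x] by simp
  moreover have "cnj (\<psi> x) * \<psi> x = 1"
    using complex_norm_square[of "\<psi> x"] norm_psi[of x] by (simp add: mult.commute)
  ultimately have "(\<psi> (- x) - cnj (\<psi> x)) * \<psi> x = 0" by (simp add: algebra_simps)
  moreover have "\<psi> x \<noteq> 0" using norm_psi[of x] by auto
  ultimately show ?thesis by simp
qed

lemma psi_sum: "\<psi> (sum f N) = (\<Prod>i\<in>N. \<psi> (f i))"
  by (induction N rule: infinite_finite_induct) (auto simp: psi_add)

text \<open>Translation by \<open>h\<close> permutes \<open>H\<close> and multiplies the sum by
  \<open>\<psi> (dot D f h)\<close>, which is not 1.\<close>

lemma sum_psi_subspace:
  assumes H: "fv.subspace H" and h: "h \<in> H" "dot D f h \<noteq> 0"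
  shows "(\<Sum>h\<in>H. \<psi> (dot D f h)) = 0"
proof -
  have "(\<Sum>g\<in>H. \<psi> (dot D f g)) = (\<Sum>g\<in>H. \<psi> (dot D f (g + h)))"
  proof (rule sum.reindex_bij_witness[of _ "\<lambda>g. g + h" "\<lambda>g. g - h"])
    show "a - h \<in> H" if "a \<in> H" for a using fv.subspace_diff[OF H that h(1)] .
    show "a + h \<in> H" if "a \<in> H" for a using fv.subspace_add[OF H that h(1)] .
  qed auto
  also have "\<dots> = \<psi> (dot D f h) * (\<Sum>g\<in>H. \<psi> (dot D f g))"
    by (simp add: dot_add_right psi_add sum_distrib_left mult.commute)
  finally have "(1 - \<psi> (dot D f h)) * (\<Sum>g\<in>H. \<psi> (dot D f g)) = 0"
    by (simp add: algebra_simps)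
  then show ?thesis using psi_neq_1[OF h(2)] by simp
qed

lemma sum_psi_vecs:
  assumes D: "finite D" and g: "g \<in> vecs D"
  shows "(\<Sum>f\<in>vecs D. \<psi> (dot D f g)) = (if g = 0 then of_nat (card (vecs D :: ('c \<Rightarrow> 'a) set)) else 0)"
proof (cases "g = 0")
  case False
  obtain f where f: "f \<in> vecs D" "dot D g f \<noteq> 0"
    using dot_nondegenerate[OF D g False] by (metis dot_commute)
  show ?thesis using sum_psi_subspace[OF subspace_vecs f] False by (simp add: dot_commute)
qed simp

text \<open>One character sum over \<open>vecs D\<close> and \<open>H\<close>, evaluated twice:
  summing over \<open>H\<close> first leaves the annihilator, summing over \<open>vecs D\<close>
  first leaves the zero vector of \<open>H\<close>.\<close>

lemma card_annih:
  fixes H :: "('c \<Rightarrow> 'a) set"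
  assumes D: "finite D" and H: "fv.subspace H" "H \<subseteq> vecs D"
  shows "card H * card (annih D H) = card (vecs D :: ('c \<Rightarrow> 'a) set)"
proof -
  have finH: "finite H" by (rule finite_subset[OF H(2) finite_vecs[OF D]])
  have "(\<Sum>f\<in>vecs D. \<Sum>h\<in>H. \<psi> (dot D f h)) = (\<Sum>f\<in>vecs D. if f \<in> annih D H then of_nat (card H) else 0)"
  proof (rule sum.cong)
    fix f :: "'c \<Rightarrow> 'a" assume f: "f \<in> vecs D"
    show "(\<Sum>h\<in>H. \<psi> (dot D f h)) = (if f \<in> annih D H then of_nat (card H) else 0)"
    proof (cases "f \<in> annih D H")
      case True
      then show ?thesis by (simp add: annih_def)
    next
      case False
      then obtain h where "h \<in> H" "dot D f h \<noteq> 0" using f by (auto simp: annih_def)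
      then show ?thesis using sum_psi_subspace[OF H(1)] False by simp
    qed
  qed simp
  also have "\<dots> = of_nat (card H * card (annih D H))"
  proof -
    have "vecs D \<inter> {f. f \<in> annih D H} = annih D H" by (auto simp: annih_def)
    then show ?thesis by (simp add: sum.If_cases finite_vecs[OF D])
  qed
  finally have 1: "(\<Sum>f\<in>vecs D. \<Sum>h\<in>H. \<psi> (dot D f h)) = of_nat (card H * card (annih D H))" .
  have "(\<Sum>f\<in>vecs D. \<Sum>h\<in>H. \<psi> (dot D f h)) = (\<Sum>h\<in>H. \<Sum>f\<in>vecs D. \<psi> (dot D f h))"
    by (rule sum.swap)
  also have "\<dots> = (\<Sum>h\<in>H. if h = 0 then of_nat (card (vecs D :: ('c \<Rightarrow> 'a) set)) else 0)"
    using H(2) by (intro sum.cong) (auto simp: sum_psi_vecs[OF D])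
  also have "\<dots> = of_nat (card (vecs D :: ('c \<Rightarrow> 'a) set))"
    using finH fv.subspace_0[OF H(1)] by simp
  finally have "(of_nat (card H * card (annih D H)) :: complex) = of_nat (card (vecs D :: ('c \<Rightarrow> 'a) set))"
    using 1 by simp
  then show ?thesis using of_nat_eq_iff by blast
qed

definition cf :: "('a \<Rightarrow> real) \<Rightarrow> 'a \<Rightarrow> complex" where
  "cf w x = (\<Sum>a\<in>UNIV. of_real (w a) * \<psi> (x * a))"

text \<open>The squared modulus is used because it is an expectation over pairs of independent
  draws, see \<open>defect_eq\<close>; this makes the defect comparable with
  \<open>spread\<close>.\<close>

definition defect :: "('a \<Rightarrow> real) \<Rightarrow> 'a \<Rightarrow> real" where
  "defect w x = 1 - (cmod (cf w x))\<^sup>2"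

lemma cmod_cf_squared:
  "of_real ((cmod (cf w x))\<^sup>2) = (\<Sum>a\<in>UNIV. \<Sum>b\<in>UNIV. of_real (w a * w b) * \<psi> (x * (a - b)))"
proof -
  have "of_real ((cmod (cf w x))\<^sup>2) = cf w x * cnj (cf w x)" by (rule complex_norm_square)
  also have "\<dots> = (\<Sum>a\<in>UNIV. \<Sum>b\<in>UNIV. (of_real (w a) * \<psi> (x * a)) * (of_real (w b) * \<psi> (- (x * b))))"
    by (simp add: cf_def sum_product psi_minus)
  also have "\<dots> = (\<Sum>a\<in>UNIV. \<Sum>b\<in>UNIV. of_real (w a * w b) * \<psi> (x * (a - b)))"
  proof (intro sum.cong refl)
    fix a b
    have "\<psi> (x * (a - b)) = \<psi> (x * a) * \<psi> (- (x * b))"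
      by (subst psi_add[symmetric]) (simp add: algebra_simps)
    then show "(of_real (w a) * \<psi> (x * a)) * (of_real (w b) * \<psi> (- (x * b))) = of_real (w a * w b) * \<psi> (x * (a - b))"
      by simp
  qed
  finally show ?thesis .
qed

lemma defect_eq:
  assumes "balanced_wt \<alpha> w"
  shows "defect w x = (\<Sum>a\<in>UNIV. \<Sum>b\<in>UNIV. if a = b then 0 else w a * w b * (1 - Re (\<psi> (x * (a - b)))))"
proof -
  have "(cmod (cf w x))\<^sup>2 = Re (of_real ((cmod (cf w x))\<^sup>2))" by simp
  also have "\<dots> = (\<Sum>a\<in>UNIV. \<Sum>b\<in>UNIV. w a * w b * Re (\<psi> (x * (a - b))))"
    by (subst cmod_cf_squared) simp
  finally have 1: "(cmod (cf w x))\<^sup>2 = (\<Sum>a\<in>UNIV. \<Sum>b\<in>UNIV. w a * w b * Re (\<psi> (x * (a - b))))" .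
  have 2: "(\<Sum>a\<in>UNIV. \<Sum>b\<in>UNIV. w a * w b) = 1"
    unfolding sum_product[symmetric] using assms by (simp add: balanced_wt_def)
  have "defect w x = (\<Sum>a\<in>UNIV. \<Sum>b\<in>UNIV. w a * w b * (1 - Re (\<psi> (x * (a - b)))))"
    unfolding defect_def 1 by (simp add: sum_subtractf right_diff_distrib 2)
  also have "\<dots> = (\<Sum>a\<in>UNIV. \<Sum>b\<in>UNIV. if a = b then 0 else w a * w b * (1 - Re (\<psi> (x * (a - b)))))"
    by (intro sum.cong) auto
  finally show ?thesis .
qed

lemma Re_psi: "- 1 \<le> Re (\<psi> x)" "Re (\<psi> x) \<le> 1"
  using abs_Re_le_cmod[of "\<psi> x"] norm_psi[of x] by auto

lemma defect_nonneg:
  assumes "balanced_wt \<alpha> w" shows "0 \<le> defect w x"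
  unfolding defect_eq[OF assms] using assms Re_psi
  by (intro sum_nonneg) (auto simp: balanced_wt_def intro!: mult_nonneg_nonneg)

lemma defect_le_spread:
  assumes "balanced_wt \<alpha> w" shows "defect w x \<le> 2 * spread w"
  unfolding defect_eq[OF assms] spread_eq[OF assms] sum_distrib_left
proof (intro sum_mono)
  fix a b
  have "w a * w b * (1 - Re (\<psi> (x * (a - b)))) \<le> w a * w b * 2"
    using assms Re_psi(1)[of "x * (a - b)"] by (intro mult_left_mono) (auto simp: balanced_wt_def)
  then show "(if a = b then 0 else w a * w b * (1 - Re (\<psi> (x * (a - b))))) \<le> 2 * (if a = b then 0 else w a * w b)"
    by auto
qed

text \<open>The price of a lower bound on \<open>defect\<close> that holds at every nonzero point.
  It can be small, and bounds containing it do not reach the sharp condition on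
  \<open>\<alpha>\<close>.\<close>

definition kap :: real where
  "kap = Min ((\<lambda>y. 1 - Re (\<psi> y)) ` (UNIV - {0}))"

lemma kap_pos: "0 < kap"
proof -
  have "0 < 1 - Re (\<psi> y)" if "y \<noteq> 0" for y
  proof (rule ccontr)
    assume "\<not> ?thesis"
    then have R: "Re (\<psi> y) = 1" using Re_psi(2)[of y] by simp
    then have "Im (\<psi> y) = 0" using norm_psi[of y] by (simp add: cmod_def power2_eq_square)
    then have "\<psi> y = 1" using R by (simp add: complex_eq_iff)
    then show False using psi_neq_1 that by blast
  qed
  moreover have "UNIV - {0} \<noteq> ({}::'a set)" by (metis DiffI UNIV_I empty_iff singletonD zero_neq_one)
  ultimately show ?thesis unfolding kap_def by (subst Min_gr_iff) auto
qed

lemma kap_le: "y \<noteq> 0 \<Longrightarrow> kap \<le> 1 - Re (\<psi> y)"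
  unfolding kap_def by (intro Min_le) auto

lemma defect_ge_spread:
  assumes "balanced_wt \<alpha> w" "x \<noteq> 0" shows "kap * spread w \<le> defect w x"
  unfolding defect_eq[OF assms(1)] spread_eq[OF assms(1)] sum_distrib_left
proof (intro sum_mono)
  fix a b
  have "w a * w b * kap \<le> w a * w b * (1 - Re (\<psi> (x * (a - b))))" if "a \<noteq> b"
    using assms that kap_le[of "x * (a - b)"] by (intro mult_left_mono) (auto simp: balanced_wt_def)
  then show "kap * (if a = b then 0 else w a * w b) \<le> (if a = b then 0 else w a * w b * (1 - Re (\<psi> (x * (a - b)))))"
    by (auto simp: mult_ac)
qed

text \<open>If \<open>f\<close> does not annihilate \<open>H\<close>, then \<open>dot D f h\<close>
  is uniform on the field as \<open>h\<close> runs through \<open>H\<close>, and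
  \<open>\<psi>\<close> averages to 0 over each pair of different draws. The mean of
  \<open>defect\<close> is therefore \<open>spread\<close> itself, without the loss
  \<open>kap\<close>.\<close>

lemma sum_defect:
  assumes w: "balanced_wt \<alpha> w" and D: "finite D" and H: "fv.subspace H" "H \<subseteq> vecs D"
    and f: "f \<in> vecs D" "f \<notin> annih D H"
  shows "(\<Sum>h\<in>H. defect w (dot D f h)) = card H * spread w"
proof -
  obtain h0 where h0: "h0 \<in> H" "dot D f h0 \<noteq> 0" using f by (auto simp: annih_def)
  have *: "(\<Sum>h\<in>H. \<psi> (dot D f h * (a - b))) = (if a = b then of_nat (card H) else 0)" for a b
  proof (cases "a = b")
    case False
    have "dot D (scal (a - b) f) h0 \<noteq> 0" using h0 False by (simp add: dot_scal_left)
    from sum_psi_subspace[OF H(1) h0(1) this] show ?thesis using False by (simp add: dot_scal_left mult.commute)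
  qed simp
  have "of_real (\<Sum>h\<in>H. (cmod (cf w (dot D f h)))\<^sup>2) =
     (\<Sum>h\<in>H. \<Sum>a\<in>UNIV. \<Sum>b\<in>UNIV. of_real (w a * w b) * \<psi> (dot D f h * (a - b)))"
    by (simp only: of_real_sum cmod_cf_squared)
  also have "\<dots> = (\<Sum>a\<in>UNIV. \<Sum>b\<in>UNIV. \<Sum>h\<in>H. of_real (w a * w b) * \<psi> (dot D f h * (a - b)))"
    by (subst sum.swap, intro sum.cong refl, rule sum.swap)
  also have "\<dots> = (\<Sum>a\<in>UNIV. \<Sum>b\<in>UNIV. of_real (w a * w b) * (if a = b then of_nat (card H) else 0))"
    by (simp add: sum_distrib_left[symmetric] *)
  also have "\<dots> = (\<Sum>a\<in>UNIV. of_real (w a * w a) * of_nat (card H))"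
    by (intro sum.cong refl) (subst sum.remove[of UNIV], auto intro!: sum.neutral)
  also have "\<dots> = of_real (card H * (\<Sum>a\<in>UNIV. (w a)\<^sup>2))"
    by (simp add: sum_distrib_left power2_eq_square mult.commute)
  finally have "(\<Sum>h\<in>H. (cmod (cf w (dot D f h)))\<^sup>2) = card H * (\<Sum>a\<in>UNIV. (w a)\<^sup>2)"
    using of_real_eq_iff by blast
  then show ?thesis by (simp add: defect_def spread_def sum_subtractf right_diff_distrib)
qed

lemma norm_cf_le:
  shows "cmod (cf w x) \<le> exp (- defect w x / 2)"
proof (rule power2_le_imp_le)
  have "(cmod (cf w x))\<^sup>2 = 1 + - defect w x" by (simp add: defect_def)
  also have "\<dots> \<le> exp (- defect w x)" by (rule exp_ge_add_one_self)
  also have "\<dots> = (exp (- defect w x / 2))\<^sup>2" by (simp add: exp_double[symmetric])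
  finally show "(cmod (cf w x))\<^sup>2 \<le> (exp (- defect w x / 2))\<^sup>2" .
qed simp

lemma pr_fourier:
  fixes w :: "nat \<Rightarrow> 'a \<Rightarrow> real"
  assumes D: "finite D" and N: "finite N" "\<And>i. i \<in> N \<Longrightarrow> \<phi> i \<in> vecs D" and v: "v \<in> vecs D"
  shows "(\<Sum>f\<in>vecs D. \<psi> (- dot D f v) * (\<Prod>i\<in>N. cf (w i) (dot D f (\<phi> i)))) =
     of_real (card (vecs D :: ('c \<Rightarrow> 'a) set) * pr N w \<phi> {v})"
proof -
  have 1: "\<psi> (- dot D f v) * (\<Prod>i\<in>N. cf (w i) (dot D f (\<phi> i))) =
     (\<Sum>Z\<in>(N \<rightarrow>\<^sub>E UNIV). of_real (\<Prod>i\<in>N. w i (Z i)) * \<psi> (dot D f ((\<Sum>i\<in>N. scal (Z i) (\<phi> i)) - v)))" for f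
  proof -
    have "dot D f (u - v) = dot D f u + - dot D f v" for u
      by (simp add: dot_def fun_apply right_diff_distrib sum_subtractf)
    then have *: "\<psi> (dot D f ((\<Sum>i\<in>N. scal (Z i) (\<phi> i)) - v)) =
        \<psi> (- dot D f v) * (\<Prod>i\<in>N. \<psi> (dot D f (\<phi> i) * Z i))" for Z
      by (simp only: psi_add psi_sum dot_sum_right dot_scal_right mult.commute)
    have "(\<Prod>i\<in>N. cf (w i) (dot D f (\<phi> i))) =
       (\<Sum>Z\<in>(N \<rightarrow>\<^sub>E UNIV). (\<Prod>i\<in>N. of_real (w i (Z i)) * \<psi> (dot D f (\<phi> i) * Z i)))"
      unfolding cf_def using N(1) by (subst prod_sum_PiE) auto
    then show ?thesis unfolding * by (simp add: prod.distrib sum_distrib_left mult_ac)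
  qed
  have "(\<Sum>f\<in>vecs D. \<psi> (- dot D f v) * (\<Prod>i\<in>N. cf (w i) (dot D f (\<phi> i)))) =
     (\<Sum>Z\<in>(N \<rightarrow>\<^sub>E UNIV). of_real (\<Prod>i\<in>N. w i (Z i)) * (\<Sum>f\<in>vecs D. \<psi> (dot D f ((\<Sum>i\<in>N. scal (Z i) (\<phi> i)) - v))))"
    unfolding 1 by (subst sum.swap) (simp add: sum_distrib_left)
  also have "\<dots> = (\<Sum>Z\<in>(N \<rightarrow>\<^sub>E UNIV). of_real (\<Prod>i\<in>N. w i (Z i)) *
       (of_nat (card (vecs D :: ('c \<Rightarrow> 'a) set)) * of_bool ((\<Sum>i\<in>N. scal (Z i) (\<phi> i)) \<in> {v})))"
  proof (rule sum.cong[OF refl])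
    fix Z :: "nat \<Rightarrow> 'a"
    let ?u = "\<Sum>i\<in>N. scal (Z i) (\<phi> i)"
    have "?u \<in> vecs D" by (rule sum_scal_mem[OF subspace_vecs N(2)])
    then have "?u - v \<in> vecs D" using v subspace_vecs fv.subspace_diff by blast
    then have "(\<Sum>f\<in>vecs D. \<psi> (dot D f (?u - v))) = of_nat (card (vecs D :: ('c \<Rightarrow> 'a) set)) * of_bool (?u \<in> {v})"
      by (subst sum_psi_vecs[OF D]) auto
    then show "of_real (\<Prod>i\<in>N. w i (Z i)) * (\<Sum>f\<in>vecs D. \<psi> (dot D f (?u - v))) =
      of_real (\<Prod>i\<in>N. w i (Z i)) * (of_nat (card (vecs D :: ('c \<Rightarrow> 'a) set)) * of_bool (?u \<in> {v}))" by (rule arg_cong)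
  qed
  also have "\<dots> = of_real (card (vecs D :: ('c \<Rightarrow> 'a) set) * pr N w \<phi> {v})"
    by (simp add: pr_def sum_distrib_left mult_ac of_real_of_bool del: of_real_prod)
  finally show ?thesis .
qed

text \<open>In the Fourier expansion the frequencies that annihilate \<open>H\<close> contribute 1
  each and yield the main term \<open>1 / card H\<close> by \<open>card_annih\<close>. On every
  other frequency the product of characteristic functions is at most
  \<open>exp (- e)\<close>.\<close>

lemma pr_approx:
  fixes w :: "nat \<Rightarrow> 'a \<Rightarrow> real"
  assumes D: "finite D" and H: "fv.subspace H" "H \<subseteq> vecs D"
    and R: "finite R" "\<And>i. i \<in> R \<Longrightarrow> \<phi> i \<in> H" and v: "v \<in> H"
    and w: "\<And>i. i \<in> R \<Longrightarrow> balanced_wt \<alpha> (w i)"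
    and e: "\<And>f. f \<in> vecs D \<Longrightarrow> f \<notin> annih D H \<Longrightarrow> (\<Sum>i\<in>R. defect (w i) (dot D f (\<phi> i))) \<ge> 2 * e"
  shows "\<bar>card H * pr R w \<phi> {v} - 1\<bar> \<le> card (vecs D :: ('c \<Rightarrow> 'a) set) * exp (- e)"
proof -
  let ?V = "vecs D :: ('c \<Rightarrow> 'a) set" and ?P = "annih D H"
  let ?t = "\<lambda>f. \<psi> (- dot D f v) * (\<Prod>i\<in>R. cf (w i) (dot D f (\<phi> i)))"
  have fin: "finite ?V" "?P \<subseteq> ?V" "finite ?P" using finite_vecs[OF D]
    by (auto simp: annih_def)
  have P0: "card ?P > 0" using fin by (auto simp: card_gt_0_iff annih_def vecs_def fun_apply intro!: exI[of _ 0])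
  have 1: "?t f = 1" if "f \<in> ?P" for f
  proof -
    have "cf (w i) (dot D f (\<phi> i)) = 1" if "i \<in> R" for i
    proof -
      have "cf (w i) (dot D f (\<phi> i)) = of_real (\<Sum>a\<in>UNIV. w i a)"
        using \<open>f \<in> ?P\<close> R(2)[OF that] by (simp add: annih_def cf_def)
      also have "(\<Sum>a\<in>UNIV. w i a) = 1" using w[OF that] by (simp add: balanced_wt_def)
      finally show ?thesis by simp
    qed
    then show ?thesis using that v by (simp add: annih_def)
  qed
  have "of_real (card ?V * pr R w \<phi> {v}) = (\<Sum>f\<in>?V. ?t f)"
    by (subst pr_fourier[OF D R(1)]) (use R H v in auto)
  also have "\<dots> = (\<Sum>f\<in>?P. ?t f) + (\<Sum>f\<in>?V - ?P. ?t f)"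
    by (subst sum.subset_diff[OF fin(2,1)]) (rule add.commute)
  also have "(\<Sum>f\<in>?P. ?t f) = of_nat (card ?P)" by (simp add: 1)
  finally have 2: "of_real (card ?V * pr R w \<phi> {v} - card ?P) = (\<Sum>f\<in>?V - ?P. ?t f)" by simp
  have "\<bar>card ?V * pr R w \<phi> {v} - card ?P\<bar> = cmod (\<Sum>f\<in>?V - ?P. ?t f)"
    unfolding 2[symmetric] by (metis norm_of_real real_norm_def)
  also have "\<dots> \<le> (\<Sum>f\<in>?V - ?P. exp (- e))"
  proof (rule sum_norm_le)
    fix f assume f: "f \<in> ?V - ?P"
    have "cmod (?t f) = (\<Prod>i\<in>R. cmod (cf (w i) (dot D f (\<phi> i))))"
      by (simp add: norm_mult norm_psi prod_norm)
    also have "\<dots> \<le> (\<Prod>i\<in>R. exp (- defect (w i) (dot D f (\<phi> i)) / 2))"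
      by (intro prod_mono conjI norm_ge_zero norm_cf_le)
    also have "\<dots> = exp (- (\<Sum>i\<in>R. defect (w i) (dot D f (\<phi> i))) / 2)"
      using R(1) by (simp add: exp_sum[symmetric] sum_negf sum_divide_distrib)
    also have "\<dots> \<le> exp (- e)" using e[of f] f by simp
    finally show "cmod (?t f) \<le> exp (- e)" .
  qed
  also have "\<dots> \<le> card ?V * exp (- e)"
    using fin by (simp add: card_Diff_subset)
  finally have 3: "\<bar>card ?V * pr R w \<phi> {v} - card ?P\<bar> \<le> card ?V * exp (- e)" .
  have "card ?V = card H * card ?P" using card_annih[OF D H] by simp
  then have "card ?V * pr R w \<phi> {v} - card ?P = card ?P * (card H * pr R w \<phi> {v} - 1)"
    by (simp add: algebra_simps)
  then have "\<bar>card ?V * pr R w \<phi> {v} - card ?P\<bar> = card ?P * \<bar>card H * pr R w \<phi> {v} - 1\<bar>"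
    by (simp add: abs_mult)
  moreover have "1 * \<bar>card H * pr R w \<phi> {v} - 1\<bar> \<le> card ?P * \<bar>card H * pr R w \<phi> {v} - 1\<bar>"
    using P0 by (intro mult_right_mono) auto
  ultimately show ?thesis using 3 by simp
qed

text \<open>Chernoff bound for a uniformly random family: the normalised defects lie between 0 and 2
  and have mean 1 by \<open>sum_defect\<close>.\<close>

lemma card_atypical:
  fixes w :: "nat \<Rightarrow> 'a \<Rightarrow> real" and \<epsilon> :: real
  assumes D: "finite D" and H: "fv.subspace H" "H \<subseteq> vecs D" and R: "finite R"
    and f: "f \<in> vecs D" "f \<notin> annih D H"
    and w: "\<And>i. i \<in> R \<Longrightarrow> balanced_wt \<alpha> (w i)" and \<alpha>: "0 < \<alpha>" "\<alpha> \<le> 1/2" and \<epsilon>: "0 \<le> \<epsilon>"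
  shows "card {\<phi>\<in>R \<rightarrow>\<^sub>E H. (\<Sum>i\<in>R. defect (w i) (dot D f (\<phi> i)) / spread (w i)) \<le> (1 - \<epsilon>) * card R}
     \<le> real (card H) ^ card R * exp (- \<epsilon>\<^sup>2 / 8 * card R)"
proof -
  \<comment> \<open>Minimises the final exponent \<open>2 * t\<^sup>2 - \<epsilon> * t\<close>,
    whose least value is \<open>- \<epsilon>\<^sup>2 / 8\<close>.\<close>
  define t where "t = \<epsilon> / 4"
  let ?Y = "\<lambda>i h. defect (w i) (dot D f h) / spread (w i)"
  let ?B = "{\<phi>\<in>R \<rightarrow>\<^sub>E H. (\<Sum>i\<in>R. ?Y i (\<phi> i)) \<le> (1 - \<epsilon>) * card R}"
  have finH: "finite H" by (rule finite_subset[OF H(2) finite_vecs[OF D]])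
  have finP: "finite (R \<rightarrow>\<^sub>E H)" using R finH by (intro finite_PiE) auto
  have "card ?B * exp (- t * ((1 - \<epsilon>) * card R)) = (\<Sum>\<phi>\<in>?B. exp (- t * ((1 - \<epsilon>) * card R)))" by simp
  also have "\<dots> \<le> (\<Sum>\<phi>\<in>?B. exp (- t * (\<Sum>i\<in>R. ?Y i (\<phi> i))))"
    using \<epsilon> by (intro sum_mono) (auto simp: t_def intro!: mult_left_mono)
  also have "\<dots> \<le> (\<Sum>\<phi>\<in>(R \<rightarrow>\<^sub>E H). exp (- t * (\<Sum>i\<in>R. ?Y i (\<phi> i))))"
    by (rule sum_mono2[OF finP]) auto
  also have "\<dots> = (\<Sum>\<phi>\<in>(R \<rightarrow>\<^sub>E H). \<Prod>i\<in>R. exp (- t * ?Y i (\<phi> i)))"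
    using R by (simp add: exp_sum[symmetric] sum_distrib_left sum_negf)
  also have "\<dots> = (\<Prod>i\<in>R. \<Sum>h\<in>H. exp (- t * ?Y i h))"
    using R finH by (subst prod_sum_PiE) auto
  also have "\<dots> \<le> (\<Prod>i\<in>R. card H * exp (- t + 2 * t\<^sup>2))"
  proof (intro prod_mono conjI sum_nonneg)
    fix i assume i: "i \<in> R"
    have s: "spread (w i) > 0"
    proof -
      have "0 < 2 * \<alpha> * (1 - \<alpha>)" using \<alpha> by simp
      then show ?thesis using spread_ge[OF w[OF i] \<alpha>(2)] by simp
    qed
    have "(\<Sum>h\<in>H. exp (- t * ?Y i h)) \<le> (\<Sum>h\<in>H. 1 - t * ?Y i h + 2 * t\<^sup>2 * ?Y i h)"
    proof (intro sum_mono)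
      fix h
      have Y: "0 \<le> ?Y i h" "?Y i h \<le> 2"
        using s defect_nonneg[OF w[OF i]] defect_le_spread[OF w[OF i]] by (auto simp: field_simps)
      have "exp (- (t * ?Y i h)) \<le> 1 - t * ?Y i h + (t * ?Y i h)\<^sup>2"
        using Y \<epsilon> by (intro exp_minus_le mult_nonneg_nonneg) (auto simp: t_def)
      also have "(t * ?Y i h)\<^sup>2 \<le> 2 * t\<^sup>2 * ?Y i h"
      proof -
        have "?Y i h * ?Y i h \<le> 2 * ?Y i h" using Y by (intro mult_right_mono)
        then have "t\<^sup>2 * (?Y i h * ?Y i h) \<le> t\<^sup>2 * (2 * ?Y i h)" by (intro mult_left_mono) auto
        then show ?thesis by (simp add: power2_eq_square mult_ac)
      qed
      finally show "exp (- t * ?Y i h) \<le> 1 - t * ?Y i h + 2 * t\<^sup>2 * ?Y i h" by simp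
    qed
    also have "\<dots> = card H + (2 * t\<^sup>2 - t) * ((\<Sum>h\<in>H. defect (w i) (dot D f h)) / spread (w i))"
    proof -
      have "1 - t * y + 2 * t\<^sup>2 * y = 1 + (2 * t\<^sup>2 - t) * y" for y
        by (simp add: left_diff_distrib)
      then have "(\<Sum>h\<in>H. 1 - t * ?Y i h + 2 * t\<^sup>2 * ?Y i h) = (\<Sum>h\<in>H. 1 + (2 * t\<^sup>2 - t) * ?Y i h)"
        by (simp only:)
      also have "\<dots> = card H + (2 * t\<^sup>2 - t) * (\<Sum>h\<in>H. ?Y i h)"
        by (simp add: sum.distrib sum_distrib_left)
      finally show ?thesis by (simp only: sum_divide_distrib)
    qed
    also have "\<dots> = card H * (1 + (- t + 2 * t\<^sup>2))"
      using s by (simp add: sum_defect[OF w[OF i] D H f] algebra_simps)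
    also have "\<dots> \<le> card H * exp (- t + 2 * t\<^sup>2)"
      by (intro mult_left_mono exp_ge_add_one_self) auto
    finally show "(\<Sum>h\<in>H. exp (- t * ?Y i h)) \<le> card H * exp (- t + 2 * t\<^sup>2)" .
  qed auto
  also have "\<dots> = real (card H) ^ card R * exp ((- t + 2 * t\<^sup>2) * card R)"
    by (simp add: power_mult_distrib exp_of_nat_mult[symmetric] mult.commute)
  finally have *: "card ?B * exp (- t * ((1 - \<epsilon>) * card R)) \<le> real (card H) ^ card R * exp ((- t + 2 * t\<^sup>2) * card R)" .
  have "real (card ?B) = card ?B * exp (- t * ((1 - \<epsilon>) * card R)) * exp (t * ((1 - \<epsilon>) * card R))"
    by (simp add: exp_minus)
  also have "\<dots> \<le> real (card H) ^ card R * exp ((- t + 2 * t\<^sup>2) * card R) * exp (t * ((1 - \<epsilon>) * card R))"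
    by (intro mult_right_mono *) auto
  also have "\<dots> = real (card H) ^ card R * exp ((- t + 2 * t\<^sup>2) * card R + t * ((1 - \<epsilon>) * card R))"
    by (simp only: exp_add mult.assoc)
  also have "(- t + 2 * t\<^sup>2) * card R + t * ((1 - \<epsilon>) * card R) = - \<epsilon>\<^sup>2 / 8 * card R"
    by (simp add: t_def power2_eq_square field_simps)
  finally show ?thesis .
qed

end

section \<open>Robust and typical families of vectors\<close>

context add_char
begin

definition max_pr :: "('c \<Rightarrow> 'a) set \<Rightarrow> nat set \<Rightarrow> (nat \<Rightarrow> 'a \<Rightarrow> real) \<Rightarrow> (nat \<Rightarrow> 'c \<Rightarrow> 'a) \<Rightarrow> real" where
  "max_pr H R w \<phi> = Max ((\<lambda>h. pr R w \<phi> {h}) ` H)"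

lemma pr_cong:
  fixes \<phi> \<phi>' :: "nat \<Rightarrow> 'c \<Rightarrow> 'a"
  assumes "\<And>i. i \<in> N \<Longrightarrow> \<phi> i = \<phi>' i" shows "pr N w \<phi> E = pr N w \<phi>' E"
proof -
  have "(\<Sum>i\<in>N. scal (Z i) (\<phi> i)) = (\<Sum>i\<in>N. scal (Z i) (\<phi>' i))" for Z :: "nat \<Rightarrow> 'a"
    by (intro sum.cong) (auto simp: assms)
  then show ?thesis by (simp add: pr_def)
qed

text \<open>A worst-case condition: no frequency outside the annihilator of \<open>H\<close> is
  blind to all but a few of the vectors.\<close>

definition robust :: "'c set \<Rightarrow> ('c \<Rightarrow> 'a) set \<Rightarrow> nat set \<Rightarrow> real \<Rightarrow> (nat \<Rightarrow> 'c \<Rightarrow> 'a) set" where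
  "robust D H R m = {\<phi>\<in>R \<rightarrow>\<^sub>E H. \<forall>f\<in>vecs D - annih D H. m \<le> card {i\<in>R. dot D f (\<phi> i) \<noteq> 0}}"

text \<open>The laws differ from index to index; dividing by \<open>spread\<close> gives every
  summand mean 1 over a uniform family, so that the sum has mean \<open>card R\<close>.\<close>

definition atypical :: "'c set \<Rightarrow> ('c \<Rightarrow> 'a) set \<Rightarrow> nat set \<Rightarrow> (nat \<Rightarrow> 'a \<Rightarrow> real) \<Rightarrow> real \<Rightarrow> ('c \<Rightarrow> 'a) \<Rightarrow> (nat \<Rightarrow> 'c \<Rightarrow> 'a) set" where
  "atypical D H R w \<epsilon> f =
     {\<phi>\<in>R \<rightarrow>\<^sub>E H. (\<Sum>i\<in>R. defect (w i) (dot D f (\<phi> i)) / spread (w i)) \<le> (1 - \<epsilon>) * card R}"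

lemma spread_pos:
  assumes "balanced_wt \<alpha> w" "0 < \<alpha>" "\<alpha> \<le> 1/2"
  shows "0 < spread w"
proof -
  have "0 < 2 * \<alpha> * (1 - \<alpha>)" using assms by simp
  then show ?thesis using spread_ge[OF assms(1,3)] by simp
qed

text \<open>Each of the at least \<open>m\<close> nonzero values of \<open>dot\<close> contributes
  \<open>kap * spread\<close> to the total defect, and half of the total is the Fourier
  exponent.\<close>

lemma pr_approx_robust:
  fixes w :: "nat \<Rightarrow> 'a \<Rightarrow> real" and \<alpha> m :: real
  assumes D: "finite D" and H: "fv.subspace H" "H \<subseteq> vecs D" and R: "finite R"
    and w: "\<And>i. i \<in> R \<Longrightarrow> balanced_wt \<alpha> (w i)" and \<alpha>: "0 < \<alpha>" "\<alpha> \<le> 1/2"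
    and \<phi>: "\<phi> \<in> robust D H R m" and v: "v \<in> H"
  shows "\<bar>card H * pr R w \<phi> {v} - 1\<bar> \<le> card (vecs D :: ('c \<Rightarrow> 'a) set) * exp (- (kap * \<alpha> * (1 - \<alpha>) * m))"
proof (rule pr_approx[OF D H R _ v w])
  show "\<phi> i \<in> H" if "i \<in> R" for i using \<phi> that by (auto simp: robust_def)
  fix f :: "'c \<Rightarrow> 'a" assume f: "f \<in> vecs D" "f \<notin> annih D H"
  have "2 * (kap * \<alpha> * (1 - \<alpha>) * m) \<le> (kap * (2 * \<alpha> * (1 - \<alpha>))) * card {i\<in>R. dot D f (\<phi> i) \<noteq> 0}"
  proof -
    have "m \<le> card {i\<in>R. dot D f (\<phi> i) \<noteq> 0}" using f \<phi> by (auto simp: robust_def)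
    then have "(kap * (2 * \<alpha> * (1 - \<alpha>))) * m \<le> (kap * (2 * \<alpha> * (1 - \<alpha>))) * card {i\<in>R. dot D f (\<phi> i) \<noteq> 0}"
      using \<alpha> kap_pos by (intro mult_left_mono) auto
    then show ?thesis by (simp add: mult_ac)
  qed
  also have "\<dots> = (\<Sum>i\<in>{i\<in>R. dot D f (\<phi> i) \<noteq> 0}. kap * (2 * \<alpha> * (1 - \<alpha>)))" by simp
  also have "\<dots> \<le> (\<Sum>i\<in>{i\<in>R. dot D f (\<phi> i) \<noteq> 0}. defect (w i) (dot D f (\<phi> i)))"
  proof (rule sum_mono)
    fix i assume i: "i \<in> {i\<in>R. dot D f (\<phi> i) \<noteq> 0}"
    have "kap * (2 * \<alpha> * (1 - \<alpha>)) \<le> kap * spread (w i)"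
      using i w spread_ge \<alpha> kap_pos by (intro mult_left_mono) auto
    also have "\<dots> \<le> defect (w i) (dot D f (\<phi> i))" using i w by (intro defect_ge_spread) auto
    finally show "kap * (2 * \<alpha> * (1 - \<alpha>)) \<le> defect (w i) (dot D f (\<phi> i))" .
  qed
  also have "\<dots> \<le> (\<Sum>i\<in>R. defect (w i) (dot D f (\<phi> i)))"
    using R w defect_nonneg by (intro sum_mono2) auto
  finally show "2 * (kap * \<alpha> * (1 - \<alpha>) * m) \<le> (\<Sum>i\<in>R. defect (w i) (dot D f (\<phi> i)))" .
qed

text \<open>The exponent is free of \<open>kap\<close>. For \<open>\<alpha>\<close> near
  \<open>c * ln n / n\<close> and \<open>card R\<close> near \<open>n\<close> the error is, up to
  the factor \<open>1 - \<epsilon>\<close> in the exponent, the power \<open>- c\<close> of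
  \<open>n\<close>, and this survives a product over \<open>n\<close> columns.\<close>

lemma pr_approx_typical:
  fixes w :: "nat \<Rightarrow> 'a \<Rightarrow> real" and \<alpha> \<epsilon> :: real
  assumes D: "finite D" and H: "fv.subspace H" "H \<subseteq> vecs D" and R: "finite R"
    and w: "\<And>i. i \<in> R \<Longrightarrow> balanced_wt \<alpha> (w i)" and \<alpha>: "0 < \<alpha>" "\<alpha> \<le> 1/2" and \<epsilon>: "\<epsilon> \<le> 1"
    and \<phi>: "\<phi> \<in> R \<rightarrow>\<^sub>E H" "\<And>f. f \<in> vecs D - annih D H \<Longrightarrow> \<phi> \<notin> atypical D H R w \<epsilon> f" and v: "v \<in> H"
  shows "\<bar>card H * pr R w \<phi> {v} - 1\<bar> \<le> card (vecs D :: ('c \<Rightarrow> 'a) set) * exp (- (\<alpha> * (1 - \<alpha>) * (1 - \<epsilon>) * card R))"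
proof (rule pr_approx[OF D H R _ v w])
  show "\<phi> i \<in> H" if "i \<in> R" for i using \<phi> that by auto
  fix f :: "'c \<Rightarrow> 'a" assume f: "f \<in> vecs D" "f \<notin> annih D H"
  have "(1 - \<epsilon>) * card R \<le> (\<Sum>i\<in>R. defect (w i) (dot D f (\<phi> i)) / spread (w i))"
    using \<phi> f by (fastforce simp: atypical_def)
  then have "(2 * \<alpha> * (1 - \<alpha>)) * ((1 - \<epsilon>) * card R) \<le> (2 * \<alpha> * (1 - \<alpha>)) * (\<Sum>i\<in>R. defect (w i) (dot D f (\<phi> i)) / spread (w i))"
    using \<alpha> by (intro mult_left_mono) auto
  also have "\<dots> = (\<Sum>i\<in>R. (2 * \<alpha> * (1 - \<alpha>)) * (defect (w i) (dot D f (\<phi> i)) / spread (w i)))"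
    by (rule sum_distrib_left)
  also have "\<dots> \<le> (\<Sum>i\<in>R. defect (w i) (dot D f (\<phi> i)))"
  proof (rule sum_mono)
    fix i assume i: "i \<in> R"
    have s: "0 < spread (w i)" using w[OF i] \<alpha> by (rule spread_pos)
    have "(2 * \<alpha> * (1 - \<alpha>)) * (defect (w i) (dot D f (\<phi> i)) / spread (w i)) \<le> spread (w i) * (defect (w i) (dot D f (\<phi> i)) / spread (w i))"
      using spread_ge[OF w[OF i] \<alpha>(2)] s defect_nonneg[OF w[OF i]] by (intro mult_right_mono) auto
    also have "\<dots> = defect (w i) (dot D f (\<phi> i))" using s by simp
    finally show "(2 * \<alpha> * (1 - \<alpha>)) * (defect (w i) (dot D f (\<phi> i)) / spread (w i)) \<le> defect (w i) (dot D f (\<phi> i))" .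
  qed
  finally show "2 * (\<alpha> * (1 - \<alpha>) * (1 - \<epsilon>) * card R) \<le> (\<Sum>i\<in>R. defect (w i) (dot D f (\<phi> i)))"
    by (simp only: mult_ac)
qed

lemma card_atypical_Union:
  fixes w :: "nat \<Rightarrow> nat \<Rightarrow> 'a \<Rightarrow> real" and \<epsilon> :: real
  assumes D: "finite D" and H: "fv.subspace H" "H \<subseteq> vecs D" and R: "finite R"
    and w: "\<And>i j. i \<in> R \<Longrightarrow> j < n \<Longrightarrow> balanced_wt \<alpha> (w j i)" and \<alpha>: "0 < \<alpha>" "\<alpha> \<le> 1/2" and \<epsilon>: "0 \<le> \<epsilon>"
  shows "card (\<Union>j<n. \<Union>f\<in>vecs D - annih D H. atypical D H R (w j) \<epsilon> f) \<le>
     real n * real (card (vecs D :: ('c \<Rightarrow> 'a) set)) * (real (card H) ^ card R * exp (- \<epsilon>\<^sup>2 / 8 * card R))"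
proof -
  let ?V = "vecs D :: ('c \<Rightarrow> 'a) set" and ?b = "real (card H) ^ card R * exp (- \<epsilon>\<^sup>2 / 8 * card R)"
  have finV: "finite ?V" using D by (rule finite_vecs)
  have "real (card (\<Union>j<n. \<Union>f\<in>?V - annih D H. atypical D H R (w j) \<epsilon> f)) \<le>
     (\<Sum>j<n. real (card (\<Union>f\<in>?V - annih D H. atypical D H R (w j) \<epsilon> f)))"
    unfolding of_nat_sum[symmetric] by (intro of_nat_mono card_UN_le) auto
  also have "\<dots> \<le> (\<Sum>j<n. \<Sum>f\<in>?V - annih D H. real (card (atypical D H R (w j) \<epsilon> f)))"
    unfolding of_nat_sum[symmetric] using finV by (intro of_nat_mono sum_mono card_UN_le) auto
  also have "\<dots> \<le> (\<Sum>j<n. \<Sum>f\<in>?V - annih D H. ?b)"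
    unfolding atypical_def by (intro sum_mono card_atypical[OF D H R _ _ w \<alpha> \<epsilon>]) auto
  also have "\<dots> = n * card (?V - annih D H) * ?b" by simp
  also have "\<dots> \<le> n * card ?V * ?b"
    using finV by (intro mult_right_mono mult_left_mono of_nat_mono card_mono) auto
  finally show ?thesis by simp
qed

lemma max_pr_bounds:
  assumes "finite H" "h \<in> H" and w: "\<And>i. i \<in> R \<Longrightarrow> balanced_wt \<alpha> (w i)"
  shows "pr R w \<phi> {h} \<le> max_pr H R w \<phi>" "0 \<le> max_pr H R w \<phi>"
proof -
  show 1: "pr R w \<phi> {h} \<le> max_pr H R w \<phi>" unfolding max_pr_def using assms by (intro Max_ge) auto
  have "0 \<le> pr R w \<phi> {h}" using w by (intro pr_nonneg) (auto simp: balanced_wt_def)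
  then show "0 \<le> max_pr H R w \<phi>" using 1 by simp
qed

lemma max_pr_le:
  assumes "finite H" "H \<noteq> {}" "\<And>v. v \<in> H \<Longrightarrow> \<bar>card H * pr R w \<phi> {v} - 1\<bar> \<le> e"
  shows "max_pr H R w \<phi> \<le> (1 + e) / card H"
  unfolding max_pr_def
proof (rule Max.boundedI)
  have c: "0 < real (card H)" using assms by (simp add: card_gt_0_iff)
  fix a assume "a \<in> (\<lambda>h. pr R w \<phi> {h}) ` H"
  then obtain h where h: "h \<in> H" "a = pr R w \<phi> {h}" by auto
  then have "card H * a \<le> 1 + e" using assms(3)[OF h(1)] by auto
  then show "a \<le> (1 + e) / card H" using c by (simp add: field_simps)
qed (use assms in auto)

text \<open>Families that are atypical for some column and some frequency receive the weak robust
  bound but are exponentially few; all others receive the sharp bound. These are the two summands on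
  the right.\<close>

lemma sum_robust_le:
  fixes w :: "nat \<Rightarrow> nat \<Rightarrow> 'a \<Rightarrow> real" and \<epsilon> \<alpha> m q :: real and n :: nat
  assumes D: "finite D" and H: "fv.subspace H" "H \<subseteq> vecs D" and R: "finite R"
    and w: "\<And>i j. i \<in> R \<Longrightarrow> j < n \<Longrightarrow> balanced_wt \<alpha> (w j i)" and \<alpha>: "0 < \<alpha>" "\<alpha> \<le> 1/2" and \<epsilon>: "0 \<le> \<epsilon>" "\<epsilon> \<le> 1"
  defines "q \<equiv> real (card (vecs D :: ('c \<Rightarrow> 'a) set))"
  shows "(\<Sum>\<phi>\<in>robust D H R m. \<Prod>j<n. max_pr H R (w j) \<phi>) \<le> real (card H) ^ card R / real (card H) ^ n *
     ((1 + q * exp (- (\<alpha> * (1 - \<alpha>) * (1 - \<epsilon>) * card R))) ^ n +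
      n * q * exp (- \<epsilon>\<^sup>2 / 8 * card R) * (1 + q * exp (- (kap * \<alpha> * (1 - \<alpha>) * m))) ^ n)"
proof -
  let ?V = "vecs D :: ('c \<Rightarrow> 'a) set"
  define B where "B = (\<Union>j<n. \<Union>f\<in>vecs D - annih D H. atypical D H R (w j) \<epsilon> f)"
  define b1 where "b1 = 1 + q * exp (- (\<alpha> * (1 - \<alpha>) * (1 - \<epsilon>) * card R))"
  define b0 where "b0 = 1 + q * exp (- (kap * \<alpha> * (1 - \<alpha>) * m))"
  let ?M = "\<lambda>\<phi>. \<Prod>j<n. max_pr H R (w j) \<phi>"
  have finV: "finite ?V" using D by (rule finite_vecs)
  have finH: "finite H" using H(2) finV by (rule finite_subset)
  have h0: "0 \<in> H" using H fv.subspace_0 by auto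
  then have H0: "H \<noteq> {}" by auto
  have c: "0 < real (card H)" using finH H0 by (simp add: card_gt_0_iff)
  have finP: "finite (R \<rightarrow>\<^sub>E H)" using R finH by (intro finite_PiE) auto
  have q0: "0 \<le> q" by (simp add: q_def)
  have b: "0 \<le> b1" "0 \<le> b0" using q0 by (auto simp: b1_def b0_def)
  have fin: "finite (robust D H R m)" by (rule finite_subset[OF _ finP]) (auto simp: robust_def)
  have nn: "0 \<le> max_pr H R (w j) \<phi>" if "j < n" for j \<phi>
    by (rule max_pr_bounds(2)[OF finH h0]) (use w that in auto)
  have M0: "?M \<phi> \<le> (b0 / card H) ^ n" if "\<phi> \<in> robust D H R m" for \<phi>
  proof -
    have "?M \<phi> \<le> (\<Prod>j<n. b0 / card H)"
      using pr_approx_robust[OF D H R w \<alpha> that] unfolding b0_def q_def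
      by (intro prod_mono conjI nn max_pr_le[OF finH H0]) auto
    then show ?thesis by simp
  qed
  have M1: "?M \<phi> \<le> (b1 / card H) ^ n" if "\<phi> \<in> robust D H R m - B" for \<phi>
  proof -
    have \<phi>: "\<phi> \<in> R \<rightarrow>\<^sub>E H" using that by (auto simp: robust_def)
    have "?M \<phi> \<le> (\<Prod>j<n. b1 / card H)"
    proof (intro prod_mono conjI nn)
      fix j assume j: "j \<in> {..<n}"
      have "\<phi> \<notin> atypical D H R (w j) \<epsilon> f" if "f \<in> vecs D - annih D H" for f
        using \<open>\<phi> \<in> robust D H R m - B\<close> j that by (auto simp: B_def)
      then show "max_pr H R (w j) \<phi> \<le> b1 / card H" unfolding b1_def q_def
        using j by (intro max_pr_le[OF finH H0] pr_approx_typical[OF D H R w \<alpha> \<epsilon>(2) \<phi>]) auto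
    qed auto
    then show ?thesis by simp
  qed
  have cB: "card B \<le> n * q * (real (card H) ^ card R * exp (- \<epsilon>\<^sup>2 / 8 * card R))"
    unfolding B_def q_def by (rule card_atypical_Union[OF D H R w \<alpha> \<epsilon>(1)])
  have finB: "finite B" by (rule finite_subset[OF _ finP]) (auto simp: B_def atypical_def)
  have "(\<Sum>\<phi>\<in>robust D H R m. ?M \<phi>) = (\<Sum>\<phi>\<in>robust D H R m - B. ?M \<phi>) + (\<Sum>\<phi>\<in>robust D H R m \<inter> B. ?M \<phi>)"
    by (subst sum.Int_Diff[OF fin, of _ B]) (rule add.commute)
  also have "(\<Sum>\<phi>\<in>robust D H R m - B. ?M \<phi>) \<le> (\<Sum>\<phi>\<in>robust D H R m - B. (b1 / card H) ^ n)"
    by (intro sum_mono M1)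
  also have "\<dots> \<le> (\<Sum>\<phi>\<in>(R \<rightarrow>\<^sub>E H). (b1 / card H) ^ n)"
    using b by (intro sum_mono2 finP) (auto simp: robust_def)
  also have "\<dots> = real (card H) ^ card R * (b1 / card H) ^ n" using R by (simp add: card_PiE)
  also have "(\<Sum>\<phi>\<in>robust D H R m \<inter> B. ?M \<phi>) \<le> (\<Sum>\<phi>\<in>robust D H R m \<inter> B. (b0 / card H) ^ n)"
    by (intro sum_mono M0) auto
  also have "\<dots> \<le> (\<Sum>\<phi>\<in>B. (b0 / card H) ^ n)"
    using b by (intro sum_mono2 finB) auto
  also have "\<dots> = card B * (b0 / card H) ^ n" by simp
  also have "\<dots> \<le> n * q * (real (card H) ^ card R * exp (- \<epsilon>\<^sup>2 / 8 * card R)) * (b0 / card H) ^ n"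
    using b by (intro mult_right_mono cB) auto
  finally have "(\<Sum>\<phi>\<in>robust D H R m. ?M \<phi>) \<le> real (card H) ^ card R * (b1 / card H) ^ n +
     n * q * (real (card H) ^ card R * exp (- \<epsilon>\<^sup>2 / 8 * card R)) * (b0 / card H) ^ n" by simp
  also have "\<dots> = real (card H) ^ card R / real (card H) ^ n * (b1 ^ n + n * q * exp (- \<epsilon>\<^sup>2 / 8 * card R) * b0 ^ n)"
    by (simp add: power_divide distrib_left mult_ac)
  finally show ?thesis unfolding b1_def b0_def .
qed

end

lemma abs_prod_minus_one_le:
  fixes x :: "'i \<Rightarrow> real"
  assumes "finite J" "\<And>j. j \<in> J \<Longrightarrow> \<bar>x j - 1\<bar> \<le> \<eta>"
  shows "\<bar>prod x J - 1\<bar> \<le> (1 + \<eta>) ^ card J - 1"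
  using assms
proof (induction J rule: finite_induct)
  case (insert j J)
  have \<eta>: "0 \<le> \<eta>" using insert.prems[of j] by auto
  have x: "\<bar>x j\<bar> \<le> 1 + \<eta>" using insert.prems[of j] by auto
  have "x j * prod x J - 1 = x j * (prod x J - 1) + (x j - 1)" by (simp add: algebra_simps)
  then have "\<bar>x j * prod x J - 1\<bar> \<le> \<bar>x j\<bar> * \<bar>prod x J - 1\<bar> + \<bar>x j - 1\<bar>"
    by (metis abs_mult abs_triangle_ineq)
  also have "\<dots> \<le> (1 + \<eta>) * ((1 + \<eta>) ^ card J - 1) + \<eta>"
    using insert x \<eta> by (intro add_mono mult_mono) auto
  also have "\<dots> = (1 + \<eta>) ^ card (insert j J) - 1"
    using insert by (simp add: algebra_simps)
  finally show ?case using insert by simp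
qed simp

section \<open>Covering the families of full rank by robust classes\<close>

context add_char
begin

text \<open>\<open>\<phi> i\<close> is the \<open>i\<close>-th column of a matrix with rows indexed
  by \<open>D\<close>; the condition says that these rows are linearly independent.\<close>

definition injs :: "'c set \<Rightarrow> nat \<Rightarrow> (nat \<Rightarrow> 'c \<Rightarrow> 'a) set" where
  "injs D n = {\<phi>\<in>{..<n} \<rightarrow>\<^sub>E vecs D. \<forall>f\<in>vecs D. f \<noteq> 0 \<longrightarrow> (\<exists>i<n. dot D f (\<phi> i) \<noteq> 0)}"

text \<open>Choose \<open>H\<close> of least cardinality among the subspaces that miss at most
  \<open>d * (card (vecs D) - card H)\<close> of the vectors. If \<open>f\<close> were nonzero at
  fewer than \<open>d\<close> of the vectors in \<open>H\<close>, then passing to the kernel of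
  \<open>f\<close> in \<open>H\<close> would lose fewer than \<open>d\<close> further vectors while
  the allowance grows by at least \<open>d\<close>, against minimality.\<close>

lemma robust_cover:
  fixes \<phi> :: "nat \<Rightarrow> 'c \<Rightarrow> 'a" and d :: real
  assumes D: "finite D" and \<phi>: "\<phi> \<in> {..<n} \<rightarrow>\<^sub>E vecs D" and d: "0 \<le> d"
  shows "\<exists>H. fv.subspace H \<and> H \<subseteq> vecs D \<and>
    card {i. i < n \<and> \<phi> i \<notin> H} \<le> d * (real (card (vecs D :: ('c \<Rightarrow> 'a) set)) - card H) \<and>
    (\<forall>f\<in>vecs D - annih D H. d \<le> card {i. i < n \<and> \<phi> i \<in> H \<and> dot D f (\<phi> i) \<noteq> 0})"
proof -
  let ?V = "vecs D :: ('c \<Rightarrow> 'a) set"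
  let ?P = "\<lambda>H. fv.subspace H \<and> H \<subseteq> ?V \<and> card {i. i < n \<and> \<phi> i \<notin> H} \<le> d * (real (card ?V) - card H)"
  have "{i. i < n \<and> \<phi> i \<notin> ?V} = {}" using \<phi> by auto
  then have "?P ?V" using subspace_vecs by simp
  from ex_has_least_nat[of ?P, OF this, of card]
  obtain H where H: "?P H" and min: "\<And>H'. ?P H' \<Longrightarrow> card H \<le> card H'" by blast
  have finH: "finite H" using H finite_vecs[OF D] finite_subset by blast
  have "d \<le> card {i. i < n \<and> \<phi> i \<in> H \<and> dot D f (\<phi> i) \<noteq> 0}" if f: "f \<in> vecs D - annih D H" for f
  proof -
    define H' where "H' = {h\<in>H. dot D f h = 0}"
    have sub: "fv.subspace H'" using H
      by (auto simp: H'_def fv.subspace_def dot_add_right dot_scal_right)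
    have "H' \<subset> H" using f by (auto simp: H'_def annih_def)
    then have lt: "card H' < card H" using finH by (rule psubset_card_mono[rotated])
    have "\<not> ?P H'" using min[of H'] lt by linarith
    then have "d * (real (card ?V) - card H') < card {i. i < n \<and> \<phi> i \<notin> H'}"
      using sub H \<open>H' \<subset> H\<close> by auto
    also have "{i. i < n \<and> \<phi> i \<notin> H'} = {i. i < n \<and> \<phi> i \<notin> H} \<union> {i. i < n \<and> \<phi> i \<in> H \<and> dot D f (\<phi> i) \<noteq> 0}"
      by (auto simp: H'_def)
    also have "real (card \<dots>) = real (card {i. i < n \<and> \<phi> i \<notin> H}) + card {i. i < n \<and> \<phi> i \<in> H \<and> dot D f (\<phi> i) \<noteq> 0}"
      by (subst card_Un_disjoint) auto
    finally have "d * (real (card ?V) - card H') - d * (real (card ?V) - card H) < card {i. i < n \<and> \<phi> i \<in> H \<and> dot D f (\<phi> i) \<noteq> 0}"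
      using H by linarith
    moreover have "d * 1 \<le> d * (real (card H) - real (card H'))" using lt d by (intro mult_left_mono) auto
    ultimately show ?thesis by (simp add: algebra_simps)
  qed
  then show ?thesis using H by blast
qed

definition rob_class :: "'c set \<Rightarrow> nat \<Rightarrow> ('c \<Rightarrow> 'a) set \<Rightarrow> nat set \<Rightarrow> real \<Rightarrow> (nat \<Rightarrow> 'c \<Rightarrow> 'a) set" where
  "rob_class D n H S m = {\<phi>\<in>{..<n} \<rightarrow>\<^sub>E vecs D. (\<forall>i\<in>S. \<phi> i \<notin> H) \<and> restrict \<phi> ({..<n} - S) \<in> robust D H ({..<n} - S) m}"

text \<open>In each matrix column \<open>pr_split_le\<close> separates two events: the vectors
  outside \<open>H\<close> steer the sum into a coset, which \<open>pr_coset_le\<close> bounds, and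
  the others hit a point of \<open>H\<close>, which \<open>max_pr\<close> bounds. The resulting
  bound depends on \<open>\<phi>\<close> only through its restriction to the complement of
  \<open>S\<close>, so the values on \<open>S\<close> are merely counted.\<close>

lemma sum_rob_class_le:
  fixes w :: "nat \<Rightarrow> nat \<Rightarrow> 'a \<Rightarrow> real" and \<alpha> m q :: real and n :: nat
  assumes D: "finite D" and H: "fv.subspace H" "H \<subseteq> vecs D" and S: "S \<subseteq> {..<n}"
    and w: "\<And>i j. i < n \<Longrightarrow> j < n \<Longrightarrow> balanced_wt \<alpha> (w j i)" and \<alpha>: "0 < \<alpha>" "\<alpha> \<le> 1/2"
  defines "q \<equiv> real (card (vecs D :: ('c \<Rightarrow> 'a) set))"
  shows "(\<Sum>\<phi>\<in>rob_class D n H S m. \<Prod>j<n. pr {..<n} (w j) \<phi> {\<beta> (\<phi> j)}) \<le>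
    q ^ card S * ((1 + (1 - 2 * \<alpha>) ^ card S) / 2) ^ n *
     (\<Sum>\<phi>\<in>robust D H ({..<n} - S) m. \<Prod>j<n. max_pr H ({..<n} - S) (w j) \<phi>)"
proof -
  let ?V = "vecs D :: ('c \<Rightarrow> 'a) set"
  define R where "R = {..<n} - S"
  let ?\<rho> = "(1 + (1 - 2 * \<alpha>) ^ card S) / 2"
  let ?M = "\<lambda>\<phi>. \<Prod>j<n. max_pr H R (w j) \<phi>"
  let ?h = "\<lambda>\<phi>. (restrict \<phi> S, restrict \<phi> R)"
  have finV: "finite ?V" using D by (rule finite_vecs)
  have finH: "finite H" using H(2) finV by (rule finite_subset)
  have h0: "0 \<in> H" using H fv.subspace_0 by auto
  have finS: "finite S" "finite R" using S finite_subset by (auto simp: R_def)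
  have SR: "S \<union> R = {..<n}" "S \<inter> R = {}" using S by (auto simp: R_def)
  have fin2: "finite (S \<rightarrow>\<^sub>E ?V)" using finS finV by (intro finite_PiE) auto
  have finrob: "finite (robust D H R m)"
    by (rule finite_subset[of _ "R \<rightarrow>\<^sub>E H"]) (use finS finH in \<open>auto simp: robust_def intro!: finite_PiE\<close>)
  have \<rho>0: "0 \<le> ?\<rho>" using \<alpha> by simp
  have nnM: "0 \<le> max_pr H R (w j) \<phi>" if "j < n" for j \<phi>
    by (rule max_pr_bounds(2)[OF finH h0]) (use w that R_def in auto)
  have M0: "0 \<le> ?M \<phi>" for \<phi>
    by (intro prod_nonneg) (auto intro: nnM)
  have inj: "inj_on ?h (rob_class D n H S m)"
  proof (rule inj_onI)
    fix \<phi> \<phi>' assume a: "\<phi> \<in> rob_class D n H S m" "\<phi>' \<in> rob_class D n H S m" "?h \<phi> = ?h \<phi>'"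
    show "\<phi> = \<phi>'"
    proof
      fix i
      have "i \<in> S \<Longrightarrow> \<phi> i = \<phi>' i" "i \<in> R \<Longrightarrow> \<phi> i = \<phi>' i" using a(3) by (auto simp: restrict_def fun_eq_iff split: if_splits)
      moreover have "i \<notin> {..<n} \<Longrightarrow> \<phi> i = \<phi>' i" using a(1,2) by (auto simp: rob_class_def PiE_def extensional_def)
      ultimately show "\<phi> i = \<phi>' i" using SR by blast
    qed
  qed
  have "(\<Sum>\<phi>\<in>rob_class D n H S m. \<Prod>j<n. pr {..<n} (w j) \<phi> {\<beta> (\<phi> j)}) \<le>
     (\<Sum>\<phi>\<in>rob_class D n H S m. ?\<rho> ^ n * ?M (snd (?h \<phi>)))"
  proof (rule sum_mono)
    fix \<phi> assume \<phi>: "\<phi> \<in> rob_class D n H S m"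
    have \<phi>H: "\<phi> i \<notin> H" if "i \<in> S" for i using \<phi> that by (auto simp: rob_class_def)
    have \<phi>R: "\<phi> i \<in> H" if "i \<in> R" for i
    proof -
      have "restrict \<phi> R \<in> R \<rightarrow>\<^sub>E H" using \<phi> by (auto simp: rob_class_def robust_def R_def)
      then have "restrict \<phi> R i \<in> H" using that by (rule PiE_mem)
      then show ?thesis using that by simp
    qed
    have "(\<Prod>j<n. pr {..<n} (w j) \<phi> {\<beta> (\<phi> j)}) \<le> (\<Prod>j<n. ?\<rho> * max_pr H R (w j) (restrict \<phi> R))"
    proof (intro prod_mono conjI)
      fix j assume j: "j \<in> {..<n}"
      show "0 \<le> pr {..<n} (w j) \<phi> {\<beta> (\<phi> j)}"
        using w j by (intro pr_nonneg) (auto simp: balanced_wt_def)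
      have M: "pr R (w j) \<phi> {h} \<le> max_pr H R (w j) (restrict \<phi> R)" if "h \<in> H" for h
        by (subst pr_cong[of R \<phi> "restrict \<phi> R"], simp, rule max_pr_bounds(1)[OF finH that])
           (use w j R_def in auto)
      have M0': "0 \<le> max_pr H R (w j) (restrict \<phi> R)"
        by (rule max_pr_bounds(2)[OF finH h0]) (use w j R_def in auto)
      have "pr (S \<union> R) (w j) \<phi> {\<beta> (\<phi> j)} \<le> pr S (w j) \<phi> {u. u - \<beta> (\<phi> j) \<in> H} * max_pr H R (w j) (restrict \<phi> R)"
        using w j SR \<phi>R by (intro pr_split_le[OF H(1) finS _ SR(2) _ M0' M]) (auto simp: balanced_wt_def)
      also have "\<dots> \<le> ?\<rho> * max_pr H R (w j) (restrict \<phi> R)"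
        using w j S \<phi>H \<alpha> by (intro mult_right_mono pr_coset_le H finS M0') auto
      finally show "pr {..<n} (w j) \<phi> {\<beta> (\<phi> j)} \<le> ?\<rho> * max_pr H R (w j) (restrict \<phi> R)"
        unfolding SR(1) .
    qed
    also have "\<dots> = ?\<rho> ^ n * ?M (snd (?h \<phi>))" unfolding snd_conv by (subst prod.distrib) simp
    finally show "(\<Prod>j<n. pr {..<n} (w j) \<phi> {\<beta> (\<phi> j)}) \<le> ?\<rho> ^ n * ?M (snd (?h \<phi>))" .
  qed
  also have "\<dots> = (\<Sum>p\<in>?h ` rob_class D n H S m. ?\<rho> ^ n * ?M (snd p))"
    by (subst sum.reindex[OF inj]) (simp add: o_def)
  also have "\<dots> \<le> (\<Sum>p\<in>(S \<rightarrow>\<^sub>E ?V) \<times> robust D H R m. ?\<rho> ^ n * ?M (snd p))"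
  proof (rule sum_mono2)
    show "finite ((S \<rightarrow>\<^sub>E ?V) \<times> robust D H R m)" using fin2 finrob by simp
    show "?h ` rob_class D n H S m \<subseteq> (S \<rightarrow>\<^sub>E ?V) \<times> robust D H R m"
      using S by (fastforce simp: rob_class_def R_def PiE_iff restrict_def extensional_def)
    show "0 \<le> ?\<rho> ^ n * ?M (snd p)" for p using \<rho>0 M0 by (intro mult_nonneg_nonneg zero_le_power)
  qed
  also have "\<dots> = (\<Sum>a\<in>(S \<rightarrow>\<^sub>E ?V). \<Sum>\<phi>\<in>robust D H R m. ?\<rho> ^ n * ?M \<phi>)"
    by (subst sum.cartesian_product) (simp add: case_prod_unfold)
  also have "\<dots> = q ^ card S * ?\<rho> ^ n * (\<Sum>\<phi>\<in>robust D H R m. ?M \<phi>)"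
    using finS by (simp add: card_PiE q_def sum_distrib_left[symmetric] mult.assoc)
  finally show ?thesis unfolding R_def .
qed

end

context add_char
begin

lemma annih_vecs:
  assumes "finite D" shows "annih D (vecs D) = {0 :: 'c \<Rightarrow> 'a}"
proof -
  have "f = 0" if "f \<in> vecs D" "\<forall>h\<in>vecs D. dot D f h = 0" for f :: "'c \<Rightarrow> 'a"
    using dot_nondegenerate[OF assms that(1)] that(2) by (metis dot_commute)
  moreover have "0 \<in> vecs D" by (simp add: vecs_def fun_apply)
  ultimately show ?thesis by (auto simp: annih_def)
qed

lemma defect_0: "balanced_wt \<alpha> w \<Longrightarrow> defect w 0 = 0"
  by (subst defect_eq) (auto intro!: sum.neutral)

text \<open>If a nonzero \<open>f\<close> vanished on all the vectors, its total defect would be 0,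
  far below the mean. Hence the typical families form a subset of \<open>injs\<close>, and the main
  term of the moment can be counted without regard to rank.\<close>

lemma typical_imp_inj:
  fixes \<epsilon> :: real
  assumes D: "finite D" and w: "\<And>i. i < n \<Longrightarrow> balanced_wt \<alpha> (w i)" and \<epsilon>: "\<epsilon> \<le> 1"
    and \<phi>: "\<phi> \<in> {..<n} \<rightarrow>\<^sub>E vecs D" and typc: "\<And>f. f \<in> vecs D - {0} \<Longrightarrow> \<phi> \<notin> atypical D (vecs D) {..<n} w \<epsilon> f"
  shows "\<phi> \<in> injs D n"
proof -
  have "\<exists>i<n. dot D f (\<phi> i) \<noteq> 0" if f: "f \<in> vecs D" "f \<noteq> 0" for f
  proof (rule ccontr)
    assume "\<not> ?thesis"
    then have "(\<Sum>i<n. defect (w i) (dot D f (\<phi> i)) / spread (w i)) = 0"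
      using w defect_0[OF w] by (intro sum.neutral) auto
    then have "\<phi> \<in> atypical D (vecs D) {..<n} w \<epsilon> f" using \<phi> \<epsilon> by (simp add: atypical_def)
    then show False using typc f by auto
  qed
  then show ?thesis using \<phi> by (auto simp: injs_def)
qed

text \<open>When \<open>robust_cover\<close> leaves no exceptional index, all
  \<open>\<phi> i\<close> lie in \<open>H\<close>. Full rank then forces \<open>H\<close> to be the
  whole space, since by \<open>card_annih\<close> a proper subspace is annihilated by a nonzero
  frequency.\<close>

lemma injs_cover:
  fixes \<delta> :: real
  assumes D: "finite D" and \<delta>: "0 \<le> \<delta>"
  shows "injs D n \<subseteq> robust D (vecs D) {..<n} \<delta> \<union>
    (\<Union>H\<in>{H. fv.subspace H \<and> H \<subseteq> vecs D}. \<Union>S\<in>{S. S \<subseteq> {..<n} \<and> S \<noteq> {} \<and> card S \<le> \<delta> * card (vecs D :: ('c \<Rightarrow> 'a) set)}. rob_class D n H S \<delta>)"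
proof
  let ?V = "vecs D :: ('c \<Rightarrow> 'a) set"
  fix \<phi> :: "nat \<Rightarrow> 'c \<Rightarrow> 'a" assume \<phi>: "\<phi> \<in> injs D n"
  then have \<phi>V: "\<phi> \<in> {..<n} \<rightarrow>\<^sub>E ?V" by (simp add: injs_def)
  have finV: "finite ?V" using D by (rule finite_vecs)
  from robust_cover[OF D \<phi>V \<delta>] obtain H where H: "fv.subspace H" "H \<subseteq> ?V" "card {i. i < n \<and> \<phi> i \<notin> H} \<le> \<delta> * (real (card ?V) - card H)"
    "\<And>f. f \<in> ?V - annih D H \<Longrightarrow> \<delta> \<le> card {i. i < n \<and> \<phi> i \<in> H \<and> dot D f (\<phi> i) \<noteq> 0}"
    by blast
  define S where "S = {i. i < n \<and> \<phi> i \<notin> H}"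
  have rob: "restrict \<phi> ({..<n} - S) \<in> robust D H ({..<n} - S) \<delta>"
  proof -
    have "{i \<in> {..<n} - S. dot D f (restrict \<phi> ({..<n} - S) i) \<noteq> 0} = {i. i < n \<and> \<phi> i \<in> H \<and> dot D f (\<phi> i) \<noteq> 0}" for f
      by (auto simp: S_def)
    then show ?thesis using H(4) by (auto simp: robust_def S_def)
  qed
  show "\<phi> \<in> robust D ?V {..<n} \<delta> \<union>
    (\<Union>H\<in>{H. fv.subspace H \<and> H \<subseteq> vecs D}. \<Union>S\<in>{S. S \<subseteq> {..<n} \<and> S \<noteq> {} \<and> card S \<le> \<delta> * card ?V}. rob_class D n H S \<delta>)"
  proof (cases "S = {}")
    case True
    have "H = ?V"
    proof (rule ccontr)
      assume "H \<noteq> ?V"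
      then have "H \<subset> ?V" using H(2) by blast
      then have "card H < card ?V" using finV by (rule psubset_card_mono[rotated])
      moreover have "card H * card (annih D H) = card ?V" by (rule card_annih[OF D H(1,2)])
      ultimately have c: "card (annih D H) \<noteq> 1" by auto
      have "annih D H \<noteq> {0}"
      proof
        assume e: "annih D H = {0}"
        show False using c unfolding e by simp
      qed
      moreover have "0 \<in> annih D H" by (auto simp: annih_def vecs_def fun_apply)
      ultimately obtain f where f: "f \<in> annih D H" "f \<noteq> 0" by blast
      then have fV: "f \<in> ?V" by (auto simp: annih_def)
      then obtain i where "i < n" "dot D f (\<phi> i) \<noteq> 0" using f \<phi> by (auto simp: injs_def)
      moreover have "\<phi> i \<in> H" using \<open>i < n\<close> True by (auto simp: S_def)
      ultimately show False using f by (auto simp: annih_def)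
    qed
    have "restrict \<phi> {..<n} = \<phi>" using \<phi>V by (rule PiE_restrict)
    then show ?thesis using rob True \<open>H = ?V\<close> by simp
  next
    case False
    have "real (card S) \<le> \<delta> * (real (card ?V) - card H)" using H(3) by (simp add: S_def)
    also have "\<dots> \<le> \<delta> * card ?V" using \<delta> by (intro mult_left_mono) auto
    finally have "real (card S) \<le> \<delta> * card ?V" .
    moreover have "\<phi> \<in> rob_class D n H S \<delta>" using \<phi>V rob by (auto simp: rob_class_def S_def)
    moreover have "S \<subseteq> {..<n}" by (auto simp: S_def)
    ultimately show ?thesis using H(1,2) False by (intro UnI2 UN_I[of H] UN_I[of S]) auto
  qed
qed

text \<open>The main term comes from the typical families \<open>T\<close>: there are nearly
  \<open>q ^ n\<close> of them, each of weight nearly \<open>1 / q ^ n\<close>. The errors come from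
  robust but atypical families and from the classes with a nonempty exceptional set; the last sum
  runs over the size \<open>s\<close> of that set, with \<open>n choose s\<close> positions and
  \<open>q ^ s\<close> values.\<close>

lemma moment_bound:
  fixes w :: "nat \<Rightarrow> nat \<Rightarrow> 'a \<Rightarrow> real" and \<alpha> \<epsilon> \<delta> \<kappa> q b0 b1 t :: real and n :: nat
    and \<beta> :: "('c \<Rightarrow> 'a) \<Rightarrow> 'c \<Rightarrow> 'a"
  assumes D: "finite D" and w: "\<And>i j. i < n \<Longrightarrow> j < n \<Longrightarrow> balanced_wt \<alpha> (w j i)"
    and \<alpha>: "0 < \<alpha>" "\<alpha> \<le> 1/2" and \<epsilon>: "0 \<le> \<epsilon>" "\<epsilon> \<le> 1" and \<delta>: "0 \<le> \<delta>"
    and \<beta>: "\<And>v. v \<in> vecs D \<Longrightarrow> \<beta> v \<in> vecs D"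
  defines "q \<equiv> real (card (vecs D :: ('c \<Rightarrow> 'a) set))"
  defines "\<kappa> \<equiv> \<delta> * q"
  assumes \<kappa>: "\<kappa> \<le> 1"
  defines "b1 \<equiv> (1 + q * exp (- (\<alpha> * (1 - \<alpha>) * (1 - \<epsilon>) * ((1 - \<kappa>) * n)))) ^ n"
  defines "b0 \<equiv> (1 + q * exp (- (kap * \<alpha> * (1 - \<alpha>) * (\<delta> * n)))) ^ n"
  defines "t \<equiv> n * q * exp (- \<epsilon>\<^sup>2 / 8 * ((1 - \<kappa>) * n))"
  assumes n: "0 < n"
  shows "\<bar>(\<Sum>\<phi>\<in>injs D n. \<Prod>j<n. pr {..<n} (w j) \<phi> {\<beta> (\<phi> j)}) - 1\<bar> \<le>
    (b1 - 1) + t + t * b0 + card (Pow (vecs D :: ('c \<Rightarrow> 'a) set)) * (b1 + t * b0) *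
      (\<Sum>s | (1::nat) \<le> s \<and> real s \<le> \<kappa> * n. (n choose s) * q ^ s * ((1 + (1 - 2 * \<alpha>) ^ s) / 2) ^ n)"
proof -
  let ?V = "vecs D :: ('c \<Rightarrow> 'a) set"
  define P where "P = (\<lambda>\<phi>. \<Prod>j<n. pr {..<n} (w j) \<phi> {\<beta> (\<phi> j)})"
  have finV: "finite ?V" using D by (rule finite_vecs)
  have V0: "0 \<in> ?V" using subspace_vecs by (rule fv.subspace_0)
  have V: "fv.subspace ?V" "?V \<subseteq> vecs D" using subspace_vecs by auto
  have q1: "1 \<le> q" using finV V0 card_gt_0_iff[of ?V] by (auto simp: q_def)
  have finP: "finite ({..<n} \<rightarrow>\<^sub>E ?V)" using finV by (intro finite_PiE) auto
  have cP: "real (card ({..<n} \<rightarrow>\<^sub>E ?V)) = q ^ n" by (simp add: card_PiE q_def)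
  have fini: "finite (injs D n)" by (rule finite_subset[OF _ finP]) (auto simp: injs_def)
  have \<beta>\<phi>: "\<beta> (\<phi> j) \<in> ?V" if "\<phi> \<in> {..<n} \<rightarrow>\<^sub>E ?V" "j < n" for \<phi> j using that by (auto intro!: \<beta>)
  have prnn: "0 \<le> pr {..<n} (w j) \<phi> E" if "j < n" for j \<phi> E
    using w that by (intro pr_nonneg) (auto simp: balanced_wt_def)
  have P0: "0 \<le> P \<phi>" for \<phi> unfolding P_def by (intro prod_nonneg) (auto intro: prnn)
  have \<kappa>0: "0 \<le> \<kappa>" using \<delta> q1 by (simp add: \<kappa>_def)
  have s0: "0 \<le> \<alpha> * (1 - \<alpha>) * (1 - \<epsilon>)" using \<alpha> \<epsilon> by simp
  define \<eta> where "\<eta> = q * exp (- (\<alpha> * (1 - \<alpha>) * (1 - \<epsilon>) * card {..<n}))"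
  define r0 where "r0 = 1 + q * exp (- (kap * \<alpha> * (1 - \<alpha>) * (\<delta> * n)))"
  have "\<eta> \<le> q * exp (- (\<alpha> * (1 - \<alpha>) * (1 - \<epsilon>) * ((1 - \<kappa>) * n)))"
  proof -
    have "(1 - \<kappa>) * n \<le> 1 * real n" using \<kappa>0 by (intro mult_right_mono) auto
    then have "\<alpha> * (1 - \<alpha>) * (1 - \<epsilon>) * ((1 - \<kappa>) * n) \<le> \<alpha> * (1 - \<alpha>) * (1 - \<epsilon>) * n"
      using s0 by (intro mult_left_mono) auto
    then show ?thesis unfolding \<eta>_def using q1 by (intro mult_left_mono) auto
  qed
  then have b1: "(1 + \<eta>) ^ n \<le> b1" unfolding b1_def using q1 by (intro power_mono) (auto simp: \<eta>_def)
  have b0r: "b0 = r0 ^ n" by (simp add: b0_def r0_def)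
  have r0: "0 \<le> r0" using q1 by (simp add: r0_def)
  define B where "B = (\<Union>j<n. \<Union>f\<in>?V - annih D ?V. atypical D ?V {..<n} (w j) \<epsilon> f)"
  have finB: "finite B" by (rule finite_subset[OF _ finP]) (auto simp: B_def atypical_def)
  have expt: "exp (- \<epsilon>\<^sup>2 / 8 * n) \<le> exp (- \<epsilon>\<^sup>2 / 8 * ((1 - \<kappa>) * n))"
  proof -
    have "(1 - \<kappa>) * n \<le> real n" using mult_right_mono[of "1 - \<kappa>" 1 "real n"] \<kappa>0 by simp
    then have "\<epsilon>\<^sup>2 / 8 * ((1 - \<kappa>) * n) \<le> \<epsilon>\<^sup>2 / 8 * n" by (rule mult_left_mono) simp
    then show ?thesis by simp
  qed
  have cB: "card B \<le> q ^ n * t"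
  proof -
    have "card B \<le> real n * q * (q ^ card {..<n} * exp (- \<epsilon>\<^sup>2 / 8 * card {..<n}))"
      unfolding B_def q_def by (rule card_atypical_Union[OF D V _ w \<alpha> \<epsilon>(1)]) auto
    also have "\<dots> = q ^ n * (n * q * exp (- \<epsilon>\<^sup>2 / 8 * n))" by simp
    also have "\<dots> \<le> q ^ n * t" unfolding t_def using q1 expt by (intro mult_left_mono) auto
    finally show ?thesis .
  qed
  define T where "T = ({..<n} \<rightarrow>\<^sub>E ?V) - B"
  have TI: "T \<subseteq> injs D n"
  proof
      fix \<phi> assume "\<phi> \<in> T"
      \<comment> \<open>Typicality for a single column is enough for full rank; column 0 exists
        because \<open>n\<close> is positive.\<close>
      then have "\<phi> \<in> {..<n} \<rightarrow>\<^sub>E ?V" "\<And>f. f \<in> ?V - {0} \<Longrightarrow> \<phi> \<notin> atypical D ?V {..<n} (w 0) \<epsilon> f"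
        using n by (auto simp: T_def B_def annih_vecs[OF D])
      then show "\<phi> \<in> injs D n" using typical_imp_inj[OF D, of n \<alpha> "w 0" \<epsilon> \<phi>] w n \<epsilon> by auto
  qed
  have PT: "\<bar>q ^ n * P \<phi> - 1\<bar> \<le> b1 - 1" if "\<phi> \<in> T" for \<phi>
  proof -
    have \<phi>: "\<phi> \<in> {..<n} \<rightarrow>\<^sub>E ?V" using that by (auto simp: T_def)
    have "\<bar>(\<Prod>j<n. q * pr {..<n} (w j) \<phi> {\<beta> (\<phi> j)}) - 1\<bar> \<le> (1 + \<eta>) ^ card {..<n} - 1"
    proof (rule abs_prod_minus_one_le)
      fix j assume j: "j \<in> {..<n}"
      have "\<phi> \<notin> atypical D ?V {..<n} (w j) \<epsilon> f" if "f \<in> vecs D - annih D ?V" for f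
        using \<open>\<phi> \<in> T\<close> j that by (auto simp: T_def B_def)
      then show "\<bar>q * pr {..<n} (w j) \<phi> {\<beta> (\<phi> j)} - 1\<bar> \<le> \<eta>"
        unfolding q_def \<eta>_def using j \<phi>
        by (intro pr_approx_typical[OF D V _ w \<alpha> \<epsilon>(2) \<phi>] \<beta>\<phi>) auto
    qed simp
    then show ?thesis using b1 by (simp add: P_def prod.distrib)
  qed
  have part1: "\<bar>(\<Sum>\<phi>\<in>T. P \<phi>) - 1\<bar> \<le> (b1 - 1) + t"
  proof -
    have cT: "real (card T) = q ^ n - card B"
    proof -
      have "B \<subseteq> {..<n} \<rightarrow>\<^sub>E ?V" by (auto simp: B_def atypical_def)
      then show ?thesis unfolding T_def using finB finP cP
        by (simp add: card_Diff_subset of_nat_diff card_mono)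
    qed
    have qn: "0 < q ^ n" using q1 by simp
    have "q ^ n * ((\<Sum>\<phi>\<in>T. P \<phi>) - 1) = (\<Sum>\<phi>\<in>T. q ^ n * P \<phi> - 1) + (card T - q ^ n)"
      by (simp add: sum_subtractf sum_distrib_left right_diff_distrib)
    also have "\<bar>\<dots>\<bar> \<le> (\<Sum>\<phi>\<in>T. b1 - 1) + q ^ n * t"
    proof -
      have "\<bar>\<Sum>\<phi>\<in>T. q ^ n * P \<phi> - 1\<bar> \<le> (\<Sum>\<phi>\<in>T. b1 - 1)"
        by (rule order_trans[OF sum_abs sum_mono[OF PT]])
      moreover have "\<bar>card T - q ^ n\<bar> \<le> q ^ n * t" using cT cB by simp
      ultimately show ?thesis by linarith
    qed
    also have "(\<Sum>\<phi>\<in>T. b1 - 1) \<le> q ^ n * (b1 - 1)"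
    proof -
      have "1 \<le> (1 + \<eta>) ^ n" using q1 by (intro one_le_power) (auto simp: \<eta>_def)
      then have "0 \<le> b1 - 1" using b1 by simp
      then show ?thesis using cT by (simp add: mult_right_mono)
    qed
    finally have "q ^ n * \<bar>(\<Sum>\<phi>\<in>T. P \<phi>) - 1\<bar> \<le> q ^ n * ((b1 - 1) + t)"
      using qn by (simp add: abs_mult distrib_left)
    then show ?thesis using qn by (simp only: mult_le_cancel_left_pos)
  qed
  have part2: "(\<Sum>\<phi>\<in>robust D ?V {..<n} (\<delta> * n) \<inter> B. P \<phi>) \<le> t * b0"
  proof -
    have "(\<Sum>\<phi>\<in>robust D ?V {..<n} (\<delta> * n) \<inter> B. P \<phi>) \<le> (\<Sum>\<phi>\<in>robust D ?V {..<n} (\<delta> * n) \<inter> B. (r0 / q) ^ n)"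
    proof (rule sum_mono)
      fix \<phi> assume "\<phi> \<in> robust D ?V {..<n} (\<delta> * n) \<inter> B"
      then have \<phi>: "\<phi> \<in> robust D ?V {..<n} (\<delta> * n)" "\<phi> \<in> {..<n} \<rightarrow>\<^sub>E ?V" by (auto simp: robust_def)
      have "P \<phi> \<le> (\<Prod>j<n. r0 / q)" unfolding P_def
      proof (intro prod_mono conjI)
        fix j assume j: "j \<in> {..<n}"
        show "0 \<le> pr {..<n} (w j) \<phi> {\<beta> (\<phi> j)}" using j prnn by auto
        have "\<bar>q * pr {..<n} (w j) \<phi> {\<beta> (\<phi> j)} - 1\<bar> \<le> q * exp (- (kap * \<alpha> * (1 - \<alpha>) * (\<delta> * n)))"
          unfolding q_def using j by (intro pr_approx_robust[OF D V _ w \<alpha> \<phi>(1)] \<beta>\<phi>[OF \<phi>(2)]) auto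
        then have "q * pr {..<n} (w j) \<phi> {\<beta> (\<phi> j)} \<le> r0" by (simp add: r0_def)
        then show "pr {..<n} (w j) \<phi> {\<beta> (\<phi> j)} \<le> r0 / q" using q1 by (simp add: field_simps)
      qed
      then show "P \<phi> \<le> (r0 / q) ^ n" by simp
    qed
    also have "\<dots> \<le> (\<Sum>\<phi>\<in>B. (r0 / q) ^ n)" using finB r0 q1 by (intro sum_mono2) auto
    also have "\<dots> = card B * (r0 / q) ^ n" by simp
    also have "\<dots> \<le> (q ^ n * t) * (r0 / q) ^ n" using cB r0 q1 by (intro mult_right_mono) auto
    also have "\<dots> = t * b0" using q1 by (simp add: power_divide b0r)
    finally show ?thesis .
  qed
  let ?Hs = "{H. fv.subspace H \<and> H \<subseteq> ?V}"
  let ?Ss = "{S. S \<subseteq> {..<n} \<and> S \<noteq> {} \<and> card S \<le> \<delta> * n * card ?V}"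
  let ?g = "\<lambda>s. q ^ s * ((1 + (1 - 2 * \<alpha>) ^ s) / 2) ^ n"
  have finHs: "finite ?Hs" by (rule finite_subset[of _ "Pow ?V"]) (use finV in auto)
  have finSs: "finite ?Ss" by (rule finite_subset[of _ "Pow {..<n}"]) auto
  have frob: "finite (rob_class D n H S (\<delta> * n))" for H S
    by (rule finite_subset[OF _ finP]) (auto simp: rob_class_def)
  have A0: "0 \<le> b1 + t * b0"
    using q1 by (auto simp: b1_def t_def b0_def intro!: add_nonneg_nonneg mult_nonneg_nonneg)
  have cls: "(\<Sum>\<phi>\<in>rob_class D n H S (\<delta> * n). P \<phi>) \<le> ?g (card S) * (b1 + t * b0)"
    if H: "H \<in> ?Hs" and S: "S \<in> ?Ss" for H S
  proof -
    let ?R = "{..<n} - S"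
    have finH: "finite H" using H finV finite_subset by auto
    have "0 \<in> H" using H fv.subspace_0 by auto
    then have c1: "1 \<le> real (card H)" using finH card_gt_0_iff[of H] by auto
    have cR: "real (card ?R) \<ge> (1 - \<kappa>) * n"
    proof -
      have "card S \<le> n" using S card_mono[of "{..<n}" S] by auto
      then have "real (card ?R) = real n - card S" using S finite_subset[of S "{..<n}"] by (simp add: card_Diff_subset of_nat_diff)
      moreover have "card S \<le> \<kappa> * n" using S by (simp add: \<kappa>_def q_def mult_ac)
      ultimately show ?thesis by (simp add: algebra_simps)
    qed
    have "(\<Sum>\<phi>\<in>rob_class D n H S (\<delta> * n). P \<phi>) \<le> q ^ card S * ((1 + (1 - 2 * \<alpha>) ^ card S) / 2) ^ n *
       (\<Sum>\<phi>\<in>robust D H ?R (\<delta> * n). \<Prod>j<n. max_pr H ?R (w j) \<phi>)"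
      unfolding P_def q_def using H S by (intro sum_rob_class_le[OF D _ _ _ w \<alpha>]) auto
    also have "\<dots> \<le> ?g (card S) * (b1 + t * b0)"
    proof (rule mult_left_mono)
      have "(\<Sum>\<phi>\<in>robust D H ?R (\<delta> * n). \<Prod>j<n. max_pr H ?R (w j) \<phi>) \<le> real (card H) ^ card ?R / real (card H) ^ n *
        ((1 + q * exp (- (\<alpha> * (1 - \<alpha>) * (1 - \<epsilon>) * card ?R))) ^ n +
         n * q * exp (- \<epsilon>\<^sup>2 / 8 * card ?R) * (1 + q * exp (- (kap * \<alpha> * (1 - \<alpha>) * (\<delta> * n)))) ^ n)"
        unfolding q_def using H by (intro sum_robust_le[OF D _ _ _ w \<alpha> \<epsilon>]) auto
      \<comment> \<open>Fewer indices mean fewer families in \<open>H\<close>, so the first factor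
        is at most 1, while \<open>card ?R\<close> remains large enough for both exponents.\<close>
      also have "\<dots> \<le> 1 * (b1 + t * b0)"
      proof (rule mult_mono)
        have "real (card H) ^ card ?R \<le> real (card H) ^ n"
          using c1 card_mono[of "{..<n}" ?R] by (intro power_increasing) auto
        then show "real (card H) ^ card ?R / real (card H) ^ n \<le> 1" using c1 by (simp add: divide_le_eq_1)
        have e1: "(1 + q * exp (- (\<alpha> * (1 - \<alpha>) * (1 - \<epsilon>) * card ?R))) ^ n \<le> b1"
          unfolding b1_def using q1 mult_left_mono[OF cR s0]
          by (intro power_mono add_mono mult_left_mono) auto
        have e2: "n * q * exp (- \<epsilon>\<^sup>2 / 8 * card ?R) \<le> t"
          unfolding t_def using q1 mult_left_mono[OF cR, of "\<epsilon>\<^sup>2 / 8"] by (intro mult_left_mono) auto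
        show "(1 + q * exp (- (\<alpha> * (1 - \<alpha>) * (1 - \<epsilon>) * card ?R))) ^ n +
         n * q * exp (- \<epsilon>\<^sup>2 / 8 * card ?R) * (1 + q * exp (- (kap * \<alpha> * (1 - \<alpha>) * (\<delta> * n)))) ^ n \<le> b1 + t * b0"
          unfolding b0_def using q1 by (intro add_mono e1 mult_right_mono e2) auto
      qed (use A0 q1 in \<open>auto intro!: add_nonneg_nonneg mult_nonneg_nonneg\<close>)
      finally show "(\<Sum>\<phi>\<in>robust D H ?R (\<delta> * n). \<Prod>j<n. max_pr H ?R (w j) \<phi>) \<le> b1 + t * b0" by simp
    qed (use q1 \<alpha> in \<open>auto intro!: mult_nonneg_nonneg\<close>)
    finally show ?thesis .
  qed
  have sumS: "(\<Sum>S\<in>?Ss. ?g (card S)) \<le> (\<Sum>s | (1::nat) \<le> s \<and> real s \<le> \<kappa> * n. (n choose s) * ?g s)"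
  proof -
    let ?I = "{s. 1 \<le> s \<and> real s \<le> \<kappa> * n}"
    have finI: "finite ?I"
      by (rule finite_subset[of _ "{..n}"]) (use \<kappa> mult_right_mono[OF \<kappa>, of "real n"] in auto)
    have cS: "card S \<in> ?I" if "S \<in> ?Ss" for S
      using that finite_subset[of S "{..<n}"] by (auto simp: Suc_le_eq card_gt_0_iff \<kappa>_def q_def mult_ac)
    have "(\<Sum>S\<in>?Ss. ?g (card S)) = (\<Sum>s\<in>?I. \<Sum>S\<in>{S\<in>?Ss. card S = s}. ?g (card S))"
      by (rule sum.group[symmetric, OF finSs finI]) (use cS in blast)
    also have "\<dots> \<le> (\<Sum>s\<in>?I. (n choose s) * ?g s)"
    proof (rule sum_mono)
      fix s
      have "(\<Sum>S\<in>{S\<in>?Ss. card S = s}. ?g (card S)) = card {S\<in>?Ss. card S = s} * ?g s" by simp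
      also have "\<dots> \<le> (n choose s) * ?g s"
      proof (rule mult_right_mono)
        have "card {S\<in>?Ss. card S = s} \<le> card {S. S \<subseteq> {..<n} \<and> card S = s}"
          by (rule card_mono) auto
        then show "real (card {S\<in>?Ss. card S = s}) \<le> real (n choose s)" by (simp add: n_subsets)
      qed (use q1 \<alpha> in \<open>auto intro!: mult_nonneg_nonneg\<close>)
      finally show "(\<Sum>S\<in>{S\<in>?Ss. card S = s}. ?g (card S)) \<le> (n choose s) * ?g s" .
    qed
    finally show ?thesis .
  qed
  define C where "C = (\<Union>H\<in>?Hs. \<Union>S\<in>?Ss. rob_class D n H S (\<delta> * n))"
  have finC: "finite C" unfolding C_def using finHs finSs frob by auto
  have part3: "(\<Sum>\<phi>\<in>C. P \<phi>) \<le> card (Pow ?V) * (b1 + t * b0) * (\<Sum>s | (1::nat) \<le> s \<and> real s \<le> \<kappa> * n. (n choose s) * ?g s)"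
  proof -
    have UN: "(\<Sum>\<phi>\<in>(\<Union>x\<in>I. E x). P \<phi>) \<le> (\<Sum>x\<in>I. \<Sum>\<phi>\<in>E x. P \<phi>)" if "finite I" "\<And>x. x \<in> I \<Longrightarrow> finite (E x)" for I :: "'i set" and E
      using that
    proof (induction I rule: finite_induct)
      case (insert x I)
      have "(\<Sum>\<phi>\<in>(\<Union>x\<in>insert x I. E x). P \<phi>) \<le> (\<Sum>\<phi>\<in>E x. P \<phi>) + (\<Sum>\<phi>\<in>(\<Union>x\<in>I. E x). P \<phi>)"
        using insert P0 by (auto simp: sum_Un intro!: sum_nonneg)
      then show ?case using insert by simp
    qed simp
    have "(\<Sum>\<phi>\<in>C. P \<phi>) \<le> (\<Sum>H\<in>?Hs. \<Sum>\<phi>\<in>(\<Union>S\<in>?Ss. rob_class D n H S (\<delta> * n)). P \<phi>)"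
      unfolding C_def using finHs finSs frob by (intro UN) auto
    also have "\<dots> \<le> (\<Sum>H\<in>?Hs. \<Sum>S\<in>?Ss. \<Sum>\<phi>\<in>rob_class D n H S (\<delta> * n). P \<phi>)"
      using finSs frob by (intro sum_mono UN) auto
    also have "\<dots> \<le> (\<Sum>H\<in>?Hs. \<Sum>S\<in>?Ss. ?g (card S) * (b1 + t * b0))"
      by (intro sum_mono cls)
    also have "\<dots> = card ?Hs * ((b1 + t * b0) * (\<Sum>S\<in>?Ss. ?g (card S)))"
      by (simp add: sum_distrib_left mult.commute)
    also have "\<dots> \<le> card (Pow ?V) * ((b1 + t * b0) * (\<Sum>s | (1::nat) \<le> s \<and> real s \<le> \<kappa> * n. (n choose s) * ?g s))"
    proof (rule mult_mono)
      \<comment> \<open>A crude count of subspaces is harmless: it does not depend on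
        \<open>n\<close>.\<close>
      show "real (card ?Hs) \<le> real (card (Pow ?V))"
        using finV by (intro of_nat_mono card_mono) auto
      show "(b1 + t * b0) * (\<Sum>S\<in>?Ss. ?g (card S)) \<le> (b1 + t * b0) * (\<Sum>s | (1::nat) \<le> s \<and> real s \<le> \<kappa> * n. (n choose s) * ?g s)"
        by (rule mult_left_mono[OF sumS A0])
      show "0 \<le> (b1 + t * b0) * (\<Sum>S\<in>?Ss. ?g (card S))"
        using q1 \<alpha> by (intro mult_nonneg_nonneg A0 sum_nonneg zero_le_power) auto
    qed simp
    finally show ?thesis by (simp only: mult.assoc)
  qed
  show ?thesis
  proof -
    have "(\<Sum>\<phi>\<in>injs D n. P \<phi>) = (\<Sum>\<phi>\<in>T. P \<phi>) + (\<Sum>\<phi>\<in>injs D n - T. P \<phi>)"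
      by (subst sum.subset_diff[OF TI fini]) (rule add.commute)
    moreover have "(\<Sum>\<phi>\<in>injs D n - T. P \<phi>) \<le> t * b0 + card (Pow ?V) * (b1 + t * b0) * (\<Sum>s | (1::nat) \<le> s \<and> real s \<le> \<kappa> * n. (n choose s) * ?g s)"
    proof -
      have "injs D n - T \<subseteq> (robust D ?V {..<n} (\<delta> * n) \<inter> B) \<union> C"
      proof
        fix \<phi> assume \<phi>: "\<phi> \<in> injs D n - T"
        then have "\<phi> \<in> B" by (auto simp: T_def injs_def)
        moreover have "\<phi> \<in> robust D ?V {..<n} (\<delta> * n) \<union> C"
          unfolding C_def by (rule subsetD[OF injs_cover[OF D]]) (use \<phi> \<delta> in auto)
        ultimately show "\<phi> \<in> (robust D ?V {..<n} (\<delta> * n) \<inter> B) \<union> C" by blast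
      qed
      then have "(\<Sum>\<phi>\<in>injs D n - T. P \<phi>) \<le> (\<Sum>\<phi>\<in>(robust D ?V {..<n} (\<delta> * n) \<inter> B) \<union> C. P \<phi>)"
        using finB finC P0 by (intro sum_mono2) auto
      also have "\<dots> \<le> (\<Sum>\<phi>\<in>robust D ?V {..<n} (\<delta> * n) \<inter> B. P \<phi>) + (\<Sum>\<phi>\<in>C. P \<phi>)"
        using finB finC P0 by (subst sum_Un) (auto intro!: sum_nonneg)
      finally show ?thesis using part2 part3 by linarith
    qed
    moreover have "0 \<le> (\<Sum>\<phi>\<in>injs D n - T. P \<phi>)" using P0 by (intro sum_nonneg) auto
    ultimately show ?thesis using part1 unfolding P_def[symmetric]
      by (simp add: mult.assoc)
  qed
qed

end

section \<open>The sum over exceptional sets and the limit of the moments\<close>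

lemma binomial_le_powr:
  fixes x \<kappa> q :: real
  assumes "0 < x" "x \<le> 1" "real s \<le> \<kappa> * n" "1 \<le> q" "0 \<le> \<kappa>" "s \<le> n"
  shows "(n choose s) * q ^ s \<le> ((1 + x) * (q / x) powr \<kappa>) ^ n"
proof -
  \<comment> \<open>An entropy bound with free parameter \<open>x\<close>: a single term of the
    expansion of \<open>(1 + x) ^ n\<close>.\<close>
  have "(n choose s) * x ^ s \<le> (\<Sum>k\<le>n. (n choose k) * x ^ k)"
    using assms by (intro member_le_sum[of s "{..n}" "\<lambda>k. (n choose k) * x ^ k"]) auto
  also have "\<dots> = (1 + x) ^ n" using binomial_ring[of x 1 n] by (simp add: add.commute)
  finally have 1: "(n choose s) * x ^ s \<le> (1 + x) ^ n" .
  have qx: "1 \<le> q / x" using assms by (simp add: field_simps)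
  have "(n choose s) * q ^ s = (n choose s) * x ^ s * (q / x) ^ s" using assms by (simp add: power_divide)
  also have "\<dots> \<le> (1 + x) ^ n * (q / x) ^ s" using 1 qx by (intro mult_right_mono) auto
  also have "(q / x) ^ s = (q / x) powr s" using qx by (simp add: powr_realpow)
  also have "\<dots> \<le> (q / x) powr (\<kappa> * n)" using qx assms by (intro powr_mono) auto
  also have "\<dots> = ((q / x) powr \<kappa>) ^ n"
  proof -
    have "0 < (q / x) powr \<kappa>" using qx by auto
    then show ?thesis by (simp only: powr_powr[symmetric] powr_realpow)
  qed
  finally show ?thesis using assms by (simp add: power_mult_distrib mult_left_mono)
qed

text \<open>To first order the left side is \<open>1 - \<theta>\<close>; the quadratic error only
  costs the factor \<open>1 - 2 * \<theta>0\<close> in the exponent.\<close>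

lemma half_one_plus_exp_le:
  fixes \<theta> \<theta>0 :: real
  assumes "0 \<le> \<theta>" "\<theta> \<le> \<theta>0"
  shows "(1 + exp (- (2 * \<theta>))) / 2 \<le> exp (- ((1 - 2 * \<theta>0) * \<theta>))"
proof -
  have "exp (- (2 * \<theta>)) \<le> 1 - 2 * \<theta> + (2 * \<theta>)\<^sup>2" using assms by (intro exp_minus_le) auto
  then have "(1 + exp (- (2 * \<theta>))) / 2 \<le> 1 - \<theta> + 2 * \<theta>\<^sup>2" by (simp add: power2_eq_square)
  also have "\<dots> \<le> 1 + - ((1 - 2 * \<theta>0) * \<theta>)"
    using mult_right_mono[OF assms(2,1)] by (simp add: algebra_simps power2_eq_square)
  also have "\<dots> \<le> exp (- ((1 - 2 * \<theta>0) * \<theta>))" by (rule exp_ge_add_one_self)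
  finally show ?thesis .
qed

text \<open>There are two ranges of \<open>s\<close>. As long as
  \<open>a * s \<le> \<theta>0\<close>, the bracket decays nearly like
  \<open>exp (- (a * s))\<close>, and with \<open>n choose s\<close> at most \<open>n ^ s\<close>
  the terms form a geometric series. Its first term, a single exceptional index, is where
  \<open>n * a\<close> has to exceed \<open>ln n\<close>. Beyond this range the bracket is at most
  \<open>r\<close>, a constant below 1, and \<open>r ^ n\<close> can beat the entropy of choosing at
  most \<open>\<kappa> * n\<close> indices.\<close>

lemma sparse_sum_le:
  fixes a q x \<kappa> \<theta>0 r :: real and n :: nat
  assumes n: "1 \<le> n" and a: "0 \<le> a" "a \<le> 1/2" and q: "1 \<le> q" and x: "0 < x" "x \<le> 1" and \<kappa>: "0 \<le> \<kappa>" "\<kappa> \<le> 1"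
    and \<theta>0: "0 < \<theta>0"
    and r: "r = (1 + exp (- (2 * \<theta>0))) / 2"
    and g: "n * q * exp (- ((1 - 2 * \<theta>0) * (a * n))) \<le> 1/2"
  shows "(\<Sum>s | (1::nat) \<le> s \<and> real s \<le> \<kappa> * n. (n choose s) * q ^ s * ((1 + (1 - 2 * a) ^ s) / 2) ^ n) \<le>
    2 * (n * q * exp (- ((1 - 2 * \<theta>0) * (a * n)))) + n * ((1 + x) * (q / x) powr \<kappa> * r) ^ n"
proof -
  let ?z = "n * q * exp (- ((1 - 2 * \<theta>0) * (a * n)))"
  let ?I = "{s. 1 \<le> s \<and> real s \<le> \<kappa> * n}"
  let ?y = "((1 + x) * (q / x) powr \<kappa> * r) ^ n"
  have "\<kappa> * n \<le> real n" using mult_right_mono[OF \<kappa>(2), of "real n"] by simp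
  then have I: "?I \<subseteq> {1..n}" by auto
  then have finI: "finite ?I" by (rule finite_subset) simp
  have z0: "0 \<le> ?z" using q by simp
  have "0 \<le> r" unfolding r by (simp add: add_nonneg_nonneg)
  then have y0: "0 \<le> ?y" using x by simp
  have term_le: "(n choose s) * q ^ s * ((1 + (1 - 2 * a) ^ s) / 2) ^ n \<le> ?z ^ s + ?y" if s: "s \<in> ?I" for s
  proof -
    have sn: "s \<le> n" using s I by auto
    have "(1 - 2 * a) ^ s \<le> exp (- (2 * (a * s)))"
    proof -
      have "(1 - 2 * a) ^ s \<le> exp (- (2 * a)) ^ s"
        using a exp_ge_add_one_self[of "- (2 * a)"] by (intro power_mono) auto
      then show ?thesis by (simp add: exp_of_nat_mult[symmetric] mult_ac)
    qed
    then have le: "(1 + (1 - 2 * a) ^ s) / 2 \<le> (1 + exp (- (2 * (a * s)))) / 2" by simp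
    have nn: "0 \<le> (1 + (1 - 2 * a) ^ s) / 2" using a by simp
    show ?thesis
    proof (cases "a * s \<le> \<theta>0")
      case True
      have "(1 + (1 - 2 * a) ^ s) / 2 \<le> exp (- ((1 - 2 * \<theta>0) * (a * s)))"
        using le half_one_plus_exp_le[OF _ True] a by (meson mult_nonneg_nonneg of_nat_0_le_iff order_trans)
      then have "((1 + (1 - 2 * a) ^ s) / 2) ^ n \<le> exp (- ((1 - 2 * \<theta>0) * (a * s))) ^ n"
        using nn by (rule power_mono)
      also have "\<dots> = exp (- ((1 - 2 * \<theta>0) * (a * n))) ^ s"
        by (simp add: exp_of_nat_mult[symmetric] mult_ac)
      finally have 1: "((1 + (1 - 2 * a) ^ s) / 2) ^ n \<le> exp (- ((1 - 2 * \<theta>0) * (a * n))) ^ s" .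
      have 2: "real (n choose s) \<le> real n ^ s"
        using binomial_le_pow[OF sn] by (metis of_nat_le_iff of_nat_power)
      have "(n choose s) * q ^ s * ((1 + (1 - 2 * a) ^ s) / 2) ^ n \<le> (real n ^ s * q ^ s) * exp (- ((1 - 2 * \<theta>0) * (a * n))) ^ s"
        using q nn by (intro mult_mono 1 2 mult_nonneg_nonneg zero_le_power) auto
      also have "\<dots> = ?z ^ s" by (simp add: power_mult_distrib)
      finally show ?thesis using y0 by simp
    next
      case False
      then have "(1 + (1 - 2 * a) ^ s) / 2 \<le> r" unfolding r by (intro order_trans[OF le]) simp
      then have "((1 + (1 - 2 * a) ^ s) / 2) ^ n \<le> r ^ n" using nn by (rule power_mono)
      then have "(n choose s) * q ^ s * ((1 + (1 - 2 * a) ^ s) / 2) ^ n \<le> ((1 + x) * (q / x) powr \<kappa>) ^ n * r ^ n"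
        using s sn q x \<kappa> nn by (intro mult_mono binomial_le_powr) auto
      also have "\<dots> = ?y" by (simp add: power_mult_distrib)
      finally show ?thesis using z0 zero_le_power[of ?z s] by linarith
    qed
  qed
  have "(\<Sum>s\<in>?I. (n choose s) * q ^ s * ((1 + (1 - 2 * a) ^ s) / 2) ^ n) \<le> (\<Sum>s\<in>?I. ?z ^ s + ?y)"
    by (intro sum_mono term_le)
  also have "\<dots> \<le> (\<Sum>s\<in>{1..n}. ?z ^ s + ?y)"
    using I z0 y0 by (intro sum_mono2) auto
  also have "\<dots> = (\<Sum>s\<in>{1..n}. ?z ^ s) + n * ?y" by (simp add: sum.distrib)
  also have "(\<Sum>s\<in>{1..n}. ?z ^ s) \<le> 2 * ?z"
  proof -
    have "(\<Sum>s\<in>{1..n}. ?z ^ s) = (\<Sum>s<n. ?z * ?z ^ s)"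
      by (rule sum.reindex_bij_witness[of _ Suc "\<lambda>s. s - 1"]) (auto simp flip: power_Suc)
    also have "\<dots> \<le> (\<Sum>s<n. ?z * (1/2) ^ s)"
      using g z0 by (intro sum_mono mult_left_mono power_mono) auto
    also have "\<dots> = ?z * (\<Sum>s<n. (1/2) ^ s)" by (simp add: sum_distrib_left)
    also have "\<dots> \<le> ?z * 2"
      by (rule mult_left_mono[OF _ z0]) (subst geometric_sum, auto simp: field_simps)
    finally show ?thesis by (simp only: mult.commute)
  qed
  finally show ?thesis by simp
qed

text \<open>The order of choice matters: \<open>\<theta>\<close> spends half of the room between 1
  and \<open>c\<close>, then \<open>x\<close> achieves \<open>(1 + x) * r < 1\<close>, and only then
  is \<open>\<kappa>\<close> taken so small that the entropy factor does not destroy this.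
  \<open>\<epsilon>\<close> can be equal to \<open>\<theta>\<close>.\<close>

lemma exists_sparsity_parameters:
  fixes c q :: real
  assumes c: "1 < c" and q: "1 \<le> q"
  shows "\<exists>\<theta> \<epsilon> \<kappa> x. 0 < \<theta> \<and> 1 < c * (1 - 2 * \<theta>) \<and> 0 < \<epsilon> \<and> \<epsilon> \<le> 1 \<and> 0 < \<kappa> \<and> \<kappa> < 1 \<and> 0 < x \<and> x \<le> 1 \<and>
    1 < c * (1 - \<epsilon>) * (1 - \<kappa>) \<and> (1 + x) * (q / x) powr \<kappa> * ((1 + exp (- (2 * \<theta>))) / 2) < 1"
proof -
  \<comment> \<open>Makes \<open>c * (1 - 2 * \<theta>)\<close> the midpoint
    \<open>(c + 1) / 2\<close> of 1 and \<open>c\<close>.\<close>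
  define \<theta> where "\<theta> = (c - 1) / (4 * c)"
  define r where "r = (1 + exp (- (2 * \<theta>))) / 2"
  have \<theta>: "0 < \<theta>" "\<theta> \<le> 1/4" using c by (auto simp: \<theta>_def field_simps)
  have c\<theta>: "c * (1 - 2 * \<theta>) = (c + 1) / 2" using c by (simp add: \<theta>_def field_simps)
  have r: "0 < r" "r < 1" using \<theta> by (auto simp: r_def intro!: add_pos_pos)
  define x where "x = min 1 ((1 / r - 1) / 2)"
  have x: "0 < x" "x \<le> 1" using r by (auto simp: x_def)
  have "(1 + x) * r < 1"
  proof -
    have "x < 1 / r - 1" using r by (auto simp: x_def min_def field_simps)
    then show ?thesis using r by (simp add: field_simps)
  qed
  moreover have "((\<lambda>\<kappa>. (1 + x) * (q / x) powr \<kappa> * r) \<longlongrightarrow> (1 + x) * (q / x) powr 0 * r) (at_right 0)"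
    using q x by (intro tendsto_intros) auto
  ultimately have "eventually (\<lambda>\<kappa>. (1 + x) * (q / x) powr \<kappa> * r < 1) (at_right 0)"
    using q x by (intro order_tendstoD(2)) auto
  moreover have "eventually (\<lambda>\<kappa>::real. \<kappa> \<in> {0<..<\<theta>}) (at_right 0)"
    by (rule eventually_at_right_real[OF \<theta>(1)])
  ultimately have "eventually (\<lambda>\<kappa>. (1 + x) * (q / x) powr \<kappa> * r < 1 \<and> \<kappa> \<in> {0<..<\<theta>}) (at_right 0)"
    by (rule eventually_conj)
  then have "\<exists>\<kappa>. (1 + x) * (q / x) powr \<kappa> * r < 1 \<and> \<kappa> \<in> {0<..<\<theta>}"
    by (rule eventually_happens'[OF trivial_limit_at_right_real])
  then obtain \<kappa> where \<kappa>: "(1 + x) * (q / x) powr \<kappa> * r < 1" "0 < \<kappa>" "\<kappa> < \<theta>"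
    by auto
  have "1 < (c + 1) / 2" using c by simp
  also have "\<dots> = c * (1 - 2 * \<theta>)" using c\<theta> by simp
  also have "\<dots> \<le> c * ((1 - \<theta>) * (1 - \<kappa>))"
  proof (rule mult_left_mono)
    have "0 \<le> \<theta> * \<kappa>" using \<theta> \<kappa> by simp
    moreover have "(1 - \<theta>) * (1 - \<kappa>) = 1 - \<theta> - \<kappa> + \<theta> * \<kappa>" by (simp add: algebra_simps)
    ultimately show "1 - 2 * \<theta> \<le> (1 - \<theta>) * (1 - \<kappa>)" using \<kappa> by linarith
  qed (use c in auto)
  finally have "1 < c * (1 - \<theta>) * (1 - \<kappa>)" by (simp only: mult.assoc)
  moreover have "1 < c * (1 - 2 * \<theta>)" using c\<theta> c by simp
  ultimately show ?thesis using \<theta> \<kappa> x unfolding r_def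
    by (intro exI[of _ \<theta>] exI[of _ \<theta>] exI[of _ \<kappa>] exI[of _ x]) auto
qed

lemma tendsto_n_exp_ln:
  fixes \<gamma> :: real assumes "1 < \<gamma>"
  shows "(\<lambda>n. real n * exp (- (\<gamma> * ln (real n)))) \<longlonglongrightarrow> 0"
  using assms by real_asymp

lemma tendsto_exp_ln:
  fixes \<gamma> :: real assumes "0 < \<gamma>"
  shows "(\<lambda>n. exp (- (\<gamma> * ln (real n)))) \<longlonglongrightarrow> 0"
  using assms by real_asymp

lemma tendsto_n_exp:
  fixes h :: real assumes "0 < h"
  shows "(\<lambda>n. real n * exp (- (h * real n))) \<longlonglongrightarrow> 0"
  using assms by real_asymp

lemma tendsto_n_power:
  fixes \<rho> :: real assumes "0 \<le> \<rho>" "\<rho> < 1"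
  shows "(\<lambda>n. real n * \<rho> ^ n) \<longlonglongrightarrow> 0"
  by (rule powser_times_n_limit_0) (use assms in auto)

lemma one_plus_power_le_exp:
  fixes y :: real assumes "0 \<le> y" shows "(1 + y) ^ n \<le> exp (n * y)"
proof -
  have "(1 + y) ^ n \<le> exp y ^ n" using assms by (intro power_mono exp_ge_add_one_self) auto
  then show ?thesis by (simp add: exp_of_nat_mult)
qed

text \<open>The target \<open>\<beta> (\<phi> j)\<close> may be any function of the column, since
  the estimates are uniform in the point that is hit. This is why different systems of relations
  later have the same limit.\<close>

lemma (in add_char) moment_tendsto_1:
  fixes w :: "nat \<Rightarrow> nat \<Rightarrow> nat \<Rightarrow> 'a \<Rightarrow> real" and c :: real
    and \<beta> :: "('c \<Rightarrow> 'a) \<Rightarrow> 'c \<Rightarrow> 'a"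
  assumes D: "finite D" and \<beta>: "\<And>v. v \<in> vecs D \<Longrightarrow> \<beta> v \<in> vecs D" and c: "1 < c"
    and w: "eventually (\<lambda>n. \<forall>i<n. \<forall>j<n. balanced_wt (c * ln n / n) (w n j i)) sequentially"
  shows "(\<lambda>n. \<Sum>\<phi>\<in>injs D n. \<Prod>j<n. pr {..<n} (w n j) \<phi> {\<beta> (\<phi> j)}) \<longlonglongrightarrow> 1"
proof -
  let ?V = "vecs D :: ('c \<Rightarrow> 'a) set"
  define q where "q = real (card ?V)"
  have finV: "finite ?V" using D by (rule finite_vecs)
  have "0 \<in> ?V" using subspace_vecs by (rule fv.subspace_0)
  then have q: "1 \<le> q" using finV card_gt_0_iff[of ?V] by (auto simp: q_def)
  obtain \<theta> \<epsilon> \<kappa> x where p: "0 < \<theta>" "1 < c * (1 - 2 * \<theta>)" "0 < \<epsilon>" "\<epsilon> \<le> 1" "0 < \<kappa>" "\<kappa> < 1" "0 < x" "x \<le> 1"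
    "1 < c * (1 - \<epsilon>) * (1 - \<kappa>)" "(1 + x) * (q / x) powr \<kappa> * ((1 + exp (- (2 * \<theta>))) / 2) < 1"
    using exists_sparsity_parameters[OF c q] by blast
  \<comment> \<open>Robustness is demanded at level \<open>\<delta> * n\<close>. In
    \<open>robust_cover\<close> this loses at most \<open>\<delta> * n\<close> indices per element
    of the space, in total at most the fraction \<open>\<kappa> = \<delta> * q\<close>.\<close>
  define \<delta> where "\<delta> = \<kappa> / q"
  have \<delta>: "0 < \<delta>" "\<delta> * q = \<kappa>" using p q by (auto simp: \<delta>_def)
  define a where "a = (\<lambda>n::nat. c * ln n / n)"
  define \<rho> where "\<rho> = (1 + x) * (q / x) powr \<kappa> * ((1 + exp (- (2 * \<theta>))) / 2)"
  have \<rho>: "0 \<le> \<rho>" "\<rho> < 1" using p unfolding \<rho>_def by (auto intro!: mult_nonneg_nonneg add_nonneg_nonneg)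
  define b1 where "b1 = (\<lambda>n::nat. (1 + q * exp (- (a n * (1 - a n) * (1 - \<epsilon>) * ((1 - \<kappa>) * n)))) ^ n)"
  define b0 where "b0 = (\<lambda>n::nat. (1 + q * exp (- (kap * a n * (1 - a n) * (\<delta> * n)))) ^ n)"
  define t where "t = (\<lambda>n::nat. n * q * exp (- \<epsilon>\<^sup>2 / 8 * ((1 - \<kappa>) * n)))"
  define z where "z = (\<lambda>n::nat. n * q * exp (- ((1 - 2 * \<theta>) * (a n * n))))"
  define s where "s = (\<lambda>n::nat. \<Sum>s | (1::nat) \<le> s \<and> real s \<le> \<kappa> * n. (n choose s) * q ^ s * ((1 + (1 - 2 * a n) ^ s) / 2) ^ n)"
  define bd where "bd = (\<lambda>n. (b1 n - 1) + t n + t n * b0 n + card (Pow ?V) * (b1 n + t n * b0 n) * (2 * z n + n * \<rho> ^ n))"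
  have a0: "a \<longlonglongrightarrow> 0"
  proof -
    have "(\<lambda>n. ln (real n) / real n) \<longlonglongrightarrow> 0" by real_asymp
    from tendsto_mult[OF tendsto_const[of c] this] show ?thesis by (simp add: a_def)
  qed
  have an: "a n * n = c * ln n" if "0 < n" for n using that by (simp add: a_def)
  have ev_a: "eventually (\<lambda>n. 0 < a n \<and> a n \<le> 1/2) sequentially"
  proof -
    have "eventually (\<lambda>n. a n < 1/2) sequentially" using a0 by (rule order_tendstoD) simp
    moreover have "eventually (\<lambda>n. 0 < a n) sequentially"
      using eventually_gt_at_top[of 1] by eventually_elim (use c in \<open>auto simp: a_def\<close>)
    ultimately show ?thesis by eventually_elim simp
  qed
  have ev_exp: "eventually (\<lambda>n. \<gamma>' * ln n \<le> \<gamma> * (1 - a n) * ln n) sequentially" if "\<gamma>' < \<gamma>" for \<gamma> \<gamma>'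
  proof -
    have "(\<lambda>n. \<gamma> * (1 - a n)) \<longlonglongrightarrow> \<gamma> * (1 - 0)" by (intro tendsto_intros a0)
    then have "eventually (\<lambda>n. \<gamma>' < \<gamma> * (1 - a n)) sequentially" using that by (intro order_tendstoD) auto
    then show ?thesis using eventually_ge_at_top[of 1] by eventually_elim (auto intro!: mult_right_mono)
  qed
  have b1_lim: "b1 \<longlonglongrightarrow> 1"
  proof -
    \<comment> \<open>Strictly between 1 and the limiting exponent, which leaves room to absorb the
      factor \<open>1 - a n\<close>.\<close>
    define \<gamma> where "\<gamma> = (1 + c * (1 - \<epsilon>) * (1 - \<kappa>)) / 2"
    have \<gamma>: "1 < \<gamma>" "\<gamma> < c * (1 - \<epsilon>) * (1 - \<kappa>)" using p(9) by (auto simp: \<gamma>_def)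
    have "eventually (\<lambda>n. b1 n \<le> exp (q * (real n * exp (- (\<gamma> * ln (real n)))))) sequentially"
      using ev_exp[OF \<gamma>(2)] eventually_gt_at_top[of 0]
    proof eventually_elim
      case (elim n)
      have "b1 n \<le> exp (n * (q * exp (- (a n * (1 - a n) * (1 - \<epsilon>) * ((1 - \<kappa>) * n)))))"
        unfolding b1_def using q by (intro one_plus_power_le_exp) auto
      also have "\<dots> \<le> exp (n * (q * exp (- (\<gamma> * ln (real n)))))"
      proof -
        have "a n * (1 - a n) * (1 - \<epsilon>) * ((1 - \<kappa>) * n) = (a n * n) * (1 - a n) * (1 - \<epsilon>) * (1 - \<kappa>)"
          by (simp only: mult_ac)
        also have "\<dots> = c * (1 - \<epsilon>) * (1 - \<kappa>) * (1 - a n) * ln n" unfolding an[OF elim(2)] by (simp only: mult_ac)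
        finally have eq: "a n * (1 - a n) * (1 - \<epsilon>) * ((1 - \<kappa>) * n) = c * (1 - \<epsilon>) * (1 - \<kappa>) * (1 - a n) * ln n" .
        have "\<gamma> * ln n \<le> a n * (1 - a n) * (1 - \<epsilon>) * ((1 - \<kappa>) * n)" unfolding eq by (rule elim(1))
        then show ?thesis using q by (simp add: mult_left_mono)
      qed
      finally show ?case by (simp only: mult_ac)
    qed
    moreover have "(\<lambda>n. exp (q * (real n * exp (- (\<gamma> * ln (real n)))))) \<longlonglongrightarrow> exp (q * 0)"
      by (intro tendsto_intros tendsto_n_exp_ln \<gamma>)
    moreover have "eventually (\<lambda>n. 1 \<le> b1 n) sequentially"
      unfolding b1_def using q by (intro always_eventually allI one_le_power) auto
    ultimately show ?thesis by (intro tendsto_sandwich[of "\<lambda>_. 1" b1 sequentially]) auto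
  qed
  define h where "h = \<epsilon>\<^sup>2 / 8 * (1 - \<kappa>)"
  have h: "0 < h" using p by (simp add: h_def)
  have t_eq: "t n = q * (n * exp (- (h * n)))" for n by (simp add: t_def h_def mult_ac)
  have t_lim: "t \<longlonglongrightarrow> 0"
    using tendsto_mult[OF tendsto_const[of q] tendsto_n_exp[OF h]] by (simp add: t_eq[abs_def])
  \<comment> \<open>\<open>b0\<close> may diverge because its exponent carries \<open>kap\<close>.
    Eventually it is at most \<open>exp (n * (h / 2))\<close>, however, and \<open>t\<close> decays
    like \<open>exp (- (h * n))\<close> up to a factor linear in \<open>n\<close>.\<close>
  have tb_lim: "(\<lambda>n. t n * b0 n) \<longlonglongrightarrow> 0"
  proof -
    define \<gamma> where "\<gamma> = kap * \<delta> * c"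
    have \<gamma>: "0 < \<gamma>" using kap_pos \<delta> c by (simp add: \<gamma>_def)
    have "(\<lambda>n. q * exp (- (\<gamma> / 2 * ln (real n)))) \<longlonglongrightarrow> q * 0"
      using \<gamma> by (intro tendsto_intros tendsto_exp_ln) auto
    then have "eventually (\<lambda>n. q * exp (- (\<gamma> / 2 * ln (real n))) < h / 2) sequentially"
      using h by (intro order_tendstoD) auto
    moreover have "eventually (\<lambda>n. \<gamma> / 2 * ln n \<le> \<gamma> * (1 - a n) * ln n) sequentially"
      using \<gamma> by (intro ev_exp) auto
    ultimately have "eventually (\<lambda>n. t n * b0 n \<le> q * (real n * exp (- (h / 2 * n)))) sequentially"
      using eventually_gt_at_top[of 0]
    proof eventually_elim
      case (elim n)
      have "b0 n \<le> exp (n * (q * exp (- (kap * a n * (1 - a n) * (\<delta> * n)))))"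
        unfolding b0_def using q by (intro one_plus_power_le_exp) auto
      also have "\<dots> \<le> exp (n * (h / 2))"
      proof -
        have "kap * a n * (1 - a n) * (\<delta> * n) = kap * (a n * n) * (1 - a n) * \<delta>" by (simp only: mult_ac)
        also have "\<dots> = \<gamma> * (1 - a n) * ln n" unfolding an[OF elim(3)] \<gamma>_def by (simp only: mult_ac)
        finally have eq: "kap * a n * (1 - a n) * (\<delta> * n) = \<gamma> * (1 - a n) * ln n" .
        have "\<gamma> / 2 * ln n \<le> kap * a n * (1 - a n) * (\<delta> * n)" unfolding eq by (rule elim(2))
        then have "q * exp (- (kap * a n * (1 - a n) * (\<delta> * n))) \<le> q * exp (- (\<gamma> / 2 * ln n))"
          using q by (intro mult_left_mono) auto
        also have "\<dots> \<le> h / 2" using elim by simp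
        finally have "real n * (q * exp (- (kap * a n * (1 - a n) * (\<delta> * n)))) \<le> real n * (h / 2)"
          by (rule mult_left_mono) simp
        then show ?thesis by simp
      qed
      finally have "t n * b0 n \<le> t n * exp (n * (h / 2))" using q by (intro mult_left_mono) (auto simp: t_def)
      also have "\<dots> = q * (n * (exp (- (h * n)) * exp (n * (h / 2))))" unfolding t_eq by (simp only: mult_ac)
      also have "exp (- (h * n)) * exp (n * (h / 2)) = exp (- (h / 2 * n))"
        by (simp add: mult_exp_exp field_simps)
      finally show ?case .
    qed
    moreover have "(\<lambda>n. q * (real n * exp (- (h / 2 * n)))) \<longlonglongrightarrow> q * 0"
      using h by (intro tendsto_intros tendsto_n_exp) auto
    moreover have "eventually (\<lambda>n. 0 \<le> t n * b0 n) sequentially"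
      unfolding t_def b0_def using q by (intro always_eventually allI mult_nonneg_nonneg zero_le_power) auto
    ultimately show ?thesis by (intro tendsto_sandwich[of "\<lambda>_. 0" "\<lambda>n. t n * b0 n" sequentially]) auto
  qed
  have z_lim: "z \<longlonglongrightarrow> 0"
  proof -
    have "(\<lambda>n. q * (real n * exp (- (c * (1 - 2 * \<theta>) * ln (real n))))) \<longlonglongrightarrow> q * 0"
      by (intro tendsto_intros tendsto_n_exp_ln p)
    moreover have "eventually (\<lambda>n. q * (real n * exp (- (c * (1 - 2 * \<theta>) * ln (real n)))) = z n) sequentially"
      using eventually_gt_at_top[of 0]
    proof eventually_elim
      case (elim n)
      have e: "(1 - 2 * \<theta>) * (a n * n) = c * (1 - 2 * \<theta>) * ln n" unfolding an[OF elim] by (simp only: mult_ac)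
      show ?case unfolding z_def e by (simp only: mult_ac)
    qed
    ultimately show ?thesis by (simp add: tendsto_cong)
  qed
  have "bd \<longlonglongrightarrow> (1 - 1) + 0 + 0 + real (card (Pow ?V)) * (1 + 0) * (2 * 0 + 0)"
    unfolding bd_def by (intro tendsto_intros b1_lim t_lim tb_lim z_lim tendsto_n_power \<rho>)
  then have bd_lim: "bd \<longlonglongrightarrow> 0" by simp
  have "eventually (\<lambda>n. z n < 1/2) sequentially" using z_lim by (rule order_tendstoD) simp
  then have "eventually (\<lambda>n. norm ((\<Sum>\<phi>\<in>injs D n. \<Prod>j<n. pr {..<n} (w n j) \<phi> {\<beta> (\<phi> j)}) - 1) \<le> bd n) sequentially"
    using w ev_a eventually_ge_at_top[of 1]
  proof eventually_elim
    case (elim n)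
    have w': "balanced_wt (a n) (w n j i)" if "i < n" "j < n" for i j using elim that by (auto simp: a_def)
    have a: "0 < a n" "a n \<le> 1/2" and n: "0 < n" "1 \<le> n" using elim by auto
    have "\<bar>(\<Sum>\<phi>\<in>injs D n. \<Prod>j<n. pr {..<n} (w n j) \<phi> {\<beta> (\<phi> j)}) - 1\<bar> \<le>
      (b1 n - 1) + t n + t n * b0 n + card (Pow ?V) * (b1 n + t n * b0 n) * s n"
      using moment_bound[where \<delta> = \<delta> and \<epsilon> = \<epsilon>, OF D w' a _ p(4) _ \<beta> _ n(1)] p \<delta>
      unfolding b1_def b0_def t_def s_def q_def by simp
    also have "\<dots> \<le> bd n"
    proof -
      have "s n \<le> 2 * z n + n * \<rho> ^ n"
        unfolding s_def z_def \<rho>_def using elim a q p by (intro sparse_sum_le n) (auto simp: z_def)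
      then have "card (Pow ?V) * (b1 n + t n * b0 n) * s n \<le> card (Pow ?V) * (b1 n + t n * b0 n) * (2 * z n + n * \<rho> ^ n)"
        using q by (intro mult_left_mono mult_nonneg_nonneg add_nonneg_nonneg)
          (auto simp: b1_def t_def b0_def intro!: mult_nonneg_nonneg)
      then show ?thesis by (simp add: bd_def)
    qed
    finally show ?case by simp
  qed
  then have "(\<lambda>n. (\<Sum>\<phi>\<in>injs D n. \<Prod>j<n. pr {..<n} (w n j) \<phi> {\<beta> (\<phi> j)}) - 1) \<longlonglongrightarrow> 0"
    using bd_lim by (rule Lim_null_comparison)
  then show ?thesis by (simp add: LIM_zero_iff)
qed

section \<open>Inclusion-exclusion over a finite field\<close>

text \<open>The Moebius value \<open>(-1) ^ b * q ^ (b choose 2)\<close> of the lattice of subspaces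
  of dimension \<open>b\<close>, divided by the number of ordered bases of such a space.\<close>

definition bonf_coeff :: "real \<Rightarrow> nat \<Rightarrow> real" where
  "bonf_coeff q b = (-1) ^ b / (\<Prod>i=1..b. q ^ i - 1)"

text \<open>At \<open>z = q ^ a\<close> this counts the linearly independent \<open>b\<close>-tuples
  in a space of dimension \<open>a\<close> over a field with \<open>q\<close> elements.\<close>

definition qfall :: "real \<Rightarrow> real \<Rightarrow> nat \<Rightarrow> real" where
  "qfall q z b = (\<Prod>i<b. z - q ^ i)"

definition bonf_sum :: "real \<Rightarrow> nat \<Rightarrow> real \<Rightarrow> real" where
  "bonf_sum q m z = (\<Sum>b\<le>m. bonf_coeff q b * qfall q z b)"

text \<open>The product shows at a glance what the truncated sum does at \<open>z = q ^ a\<close>: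
  it is 1 for \<open>a = 0\<close>, it is 0 for \<open>a\<close> from 1 to \<open>m\<close>, and
  beyond that it has the sign of \<open>(-1) ^ m\<close>. Even and odd truncations therefore enclose
  the indicator of \<open>a = 0\<close>.\<close>

lemma bonf_sum_closed:
  assumes "1 < q"
  shows "bonf_sum q m z = (\<Prod>i=1..m. (q ^ i - z) / (q ^ i - 1))"
proof (induction m)
  case 0
  show ?case by (simp add: bonf_sum_def bonf_coeff_def qfall_def)
next
  case (Suc m)
  have nz: "q ^ i - 1 \<noteq> 0" if "1 \<le> i" for i
    using one_less_power[OF assms, of i] that by auto
  let ?d = "\<Prod>i=1..m. q ^ i - 1" and ?n = "\<Prod>i=1..m. z - q ^ i"
  have d0: "?d \<noteq> 0" using nz by auto
  have e0: "q ^ Suc m - 1 \<noteq> 0" by (rule nz) simp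
  have n1: "(\<Prod>i=1..m. q ^ i - z) = (-1) ^ m * ?n"
  proof -
    have "(\<Prod>i=1..m. q ^ i - z) = (\<Prod>i=1..m. (-1) * (z - q ^ i))" by (intro prod.cong) auto
    also have "\<dots> = (-1) ^ m * ?n" by (subst prod.distrib) simp
    finally show ?thesis .
  qed
  have n2: "qfall q z (Suc m) = (z - 1) * ?n"
    unfolding qfall_def by (subst prod.lessThan_Suc_shift) (simp add: prod.atLeast1_atMost_eq)
  have "bonf_sum q (Suc m) z = bonf_sum q m z + bonf_coeff q (Suc m) * qfall q z (Suc m)"
    by (simp add: bonf_sum_def)
  also have "\<dots> = (-1) ^ m * ?n / ?d - (-1) ^ m * ((z - 1) * ?n) / (?d * (q ^ Suc m - 1))"
    unfolding Suc.IH prod_dividef n1 n2 bonf_coeff_def by simp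
  also have "\<dots> = ((-1) ^ m * ?n * (q ^ Suc m - 1) - (-1) ^ m * ((z - 1) * ?n)) / (?d * (q ^ Suc m - 1))"
    using d0 e0 by (simp add: diff_divide_distrib)
  also have "\<dots> = ((-1) ^ m * ?n * (q ^ Suc m - z)) / (?d * (q ^ Suc m - 1))"
    by (rule arg_cong2[of _ _ _ _ "(/)"]) (simp_all add: algebra_simps)
  also have "\<dots> = (\<Prod>i=1..Suc m. (q ^ i - z) / (q ^ i - 1))"
  proof -
    have "(\<Prod>i=1..Suc m. q ^ i - z) = (-1) ^ m * ?n * (q ^ Suc m - z)" unfolding n1[symmetric] by simp
    moreover have "(\<Prod>i=1..Suc m. q ^ i - 1) = ?d * (q ^ Suc m - 1)" by simp
    ultimately show ?thesis unfolding prod_dividef by (simp only:)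
  qed
  finally show ?case .
qed

lemma bonf_sum_0:
  assumes "1 < q" shows "bonf_sum q m (q ^ 0) = 1"
proof -
  have "(q ^ i - 1) / (q ^ i - 1) = 1" if "1 \<le> i" for i
    using one_less_power[OF assms, of i] that by auto
  then show ?thesis unfolding bonf_sum_closed[OF assms] by (intro prod.neutral) auto
qed

lemma bonf_sum_sign:
  assumes "1 < q" "0 < a" shows "0 \<le> (-1) ^ m * bonf_sum q m (q ^ a)"
proof (cases "a \<le> m")
  case True
  then have "bonf_sum q m (q ^ a) = 0"
    unfolding bonf_sum_closed[OF assms(1)] using assms by (intro prod_zero) auto
  then show ?thesis by simp
next
  case False
  have "(-1) ^ m * bonf_sum q m (q ^ a) = (\<Prod>i=1..m. (-1) * ((q ^ i - q ^ a) / (q ^ i - 1)))"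
    unfolding bonf_sum_closed[OF assms(1)] by (subst prod.distrib) simp
  also have "\<dots> \<ge> 0"
  proof (rule prod_nonneg)
    fix i assume i: "i \<in> {1..m}"
    have "q ^ i \<le> q ^ a" using assms False i by (intro power_increasing) auto
    moreover have "1 < q ^ i" using assms i by (intro one_less_power) auto
    ultimately show "0 \<le> (-1) * ((q ^ i - q ^ a) / (q ^ i - 1))" by (simp add: divide_le_0_iff)
  qed
  finally show ?thesis .
qed

lemma bonf_upper:
  assumes "1 < q" shows "of_bool (a = 0) \<le> bonf_sum q (2 * m) (q ^ a)"
  using bonf_sum_0[OF assms, of "2 * m"] bonf_sum_sign[OF assms, of a "2 * m"] by (cases "a = 0") auto

lemma bonf_lower:
  assumes "1 < q" shows "bonf_sum q (Suc (2 * m)) (q ^ a) \<le> of_bool (a = 0)"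
  using bonf_sum_0[OF assms, of "Suc (2 * m)"] bonf_sum_sign[OF assms, of a "Suc (2 * m)"] by (cases "a = 0") auto

definition euler_prod :: "real \<Rightarrow> real" where
  "euler_prod q = (\<Prod>k. 1 - 1 / q ^ Suc k)"

lemma summable_bonf:
  assumes q: "1 < q" shows "summable (\<lambda>b. bonf_coeff q b * x ^ b)"
proof -
  have "(\<lambda>b. \<bar>x\<bar> / (q ^ Suc b - 1)) \<longlonglongrightarrow> 0" using q by real_asymp
  then have "eventually (\<lambda>b. \<bar>x\<bar> / (q ^ Suc b - 1) < 1/2) sequentially" by (rule order_tendstoD) simp
  then obtain N where N: "\<And>b. N \<le> b \<Longrightarrow> \<bar>x\<bar> / (q ^ Suc b - 1) < 1/2" by (auto simp: eventually_sequentially)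
  show ?thesis
  proof (rule summable_ratio_test[of "1/2" N])
    fix b assume b: "N \<le> b"
    have pos: "0 < q ^ Suc b - 1" using one_less_power[of q "Suc b"] q by simp
    have "norm (bonf_coeff q (Suc b) * x ^ Suc b) = (\<bar>x\<bar> / (q ^ Suc b - 1)) * norm (bonf_coeff q b * x ^ b)"
      using pos by (simp add: bonf_coeff_def abs_mult power_abs)
    also have "\<dots> \<le> 1/2 * norm (bonf_coeff q b * x ^ b)"
      using N[OF b] by (intro mult_right_mono) auto
    finally show "norm (bonf_coeff q (Suc b) * x ^ Suc b) \<le> 1/2 * norm (bonf_coeff q b * x ^ b)" .
  qed simp
qed

text \<open>An identity of Euler. The power series \<open>f\<close> with these coefficients
  satisfies \<open>f (q * x) = (1 - x) * f x\<close>; following it from 1 through the points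
  \<open>1 / q ^ N\<close> to 0, where \<open>f\<close> is continuous with value 1, produces the
  product.\<close>

lemma bonf_coeff_sums:
  assumes q: "1 < q" shows "bonf_coeff q sums euler_prod q"
proof -
  define f where "f = (\<lambda>x. \<Sum>b. bonf_coeff q b * x ^ b)"
  have s: "(\<lambda>b. bonf_coeff q b * x ^ b) sums f x" for x
    unfolding f_def by (rule summable_sums[OF summable_bonf[OF q]])
  have rec: "f (q * x) = (1 - x) * f x" for x
  proof -
    have "(\<lambda>b. bonf_coeff q b * (q * x) ^ b - bonf_coeff q b * x ^ b) sums (f (q * x) - f x)"
      by (rule sums_diff[OF s s])
    then have "(\<lambda>b. bonf_coeff q (Suc b) * (q * x) ^ Suc b - bonf_coeff q (Suc b) * x ^ Suc b) sums (f (q * x) - f x)"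
      by (subst sums_Suc_iff) (simp add: bonf_coeff_def)
    also have "(\<lambda>b. bonf_coeff q (Suc b) * (q * x) ^ Suc b - bonf_coeff q (Suc b) * x ^ Suc b) = (\<lambda>b. - x * (bonf_coeff q b * x ^ b))"
    proof
      fix b
      have pos: "0 < q ^ Suc b - 1" using one_less_power[of q "Suc b"] q by simp
      have "bonf_coeff q (Suc b) * (q * x) ^ Suc b - bonf_coeff q (Suc b) * x ^ Suc b =
        bonf_coeff q (Suc b) * (q ^ Suc b - 1) * x ^ Suc b" by (simp add: power_mult_distrib algebra_simps)
      also have "bonf_coeff q (Suc b) * (q ^ Suc b - 1) = - bonf_coeff q b"
        using pos by (simp add: bonf_coeff_def)
      finally show "bonf_coeff q (Suc b) * (q * x) ^ Suc b - bonf_coeff q (Suc b) * x ^ Suc b = - x * (bonf_coeff q b * x ^ b)"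
        by simp
    qed
    finally have "(\<lambda>b. - x * (bonf_coeff q b * x ^ b)) sums (f (q * x) - f x)" .
    moreover have "(\<lambda>b. - x * (bonf_coeff q b * x ^ b)) sums (- x * f x)" by (rule sums_mult[OF s])
    ultimately have "f (q * x) - f x = - x * f x" by (rule sums_unique2)
    then show ?thesis by (simp add: algebra_simps)
  qed
  have prod: "f 1 = (\<Prod>k<N. 1 - 1 / q ^ Suc k) * f (1 / q ^ N)" for N
  proof (induction N)
    case (Suc N)
    have "f (1 / q ^ N) = f (q * (1 / q ^ Suc N))" using q by simp
    also have "\<dots> = (1 - 1 / q ^ Suc N) * f (1 / q ^ Suc N)" by (rule rec)
    finally show ?case using Suc.IH by simp
  qed simp
  have f0: "f 0 = 1" unfolding f_def powser_zero by (simp add: bonf_coeff_def)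
  have "isCont f 0" unfolding f_def
    by (rule isCont_powser[of _ 1]) (use summable_bonf[OF q, of 1] in auto)
  moreover have "(\<lambda>N. 1 / q ^ N) \<longlonglongrightarrow> 0" using q by real_asymp
  ultimately have flim: "(\<lambda>N. f (1 / q ^ N)) \<longlonglongrightarrow> 1" using f0 by (metis isCont_tendsto_compose)
  have conv: "convergent_prod (\<lambda>k. 1 - 1 / q ^ Suc k)"
  proof -
    have "summable (\<lambda>k. norm (- (1 / q ^ Suc k)))"
    proof -
      have "summable (\<lambda>k. (1 / q) * (1 / q) ^ k)" using q by (intro summable_mult summable_geometric) auto
      then show ?thesis using q by (simp add: power_divide)
    qed
    then have "abs_convergent_prod (\<lambda>k. 1 + - (1 / q ^ Suc k))"
      by (subst summable_imp_abs_convergent_prod) auto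
    then show ?thesis using abs_convergent_prod_imp_convergent_prod by fastforce
  qed
  have "(\<lambda>N. \<Prod>k\<le>N. 1 - 1 / q ^ Suc k) \<longlonglongrightarrow> euler_prod q"
    unfolding euler_prod_def by (rule convergent_prod_LIMSEQ[OF conv])
  then have "(\<lambda>N. \<Prod>k<N. 1 - 1 / q ^ Suc k) \<longlonglongrightarrow> euler_prod q"
    by (subst filterlim_sequentially_Suc[symmetric]) (simp only: lessThan_Suc_atMost)
  from tendsto_mult[OF this flim] have "(\<lambda>N. f 1) \<longlonglongrightarrow> euler_prod q" unfolding prod[symmetric] by simp
  then have "f 1 = euler_prod q" using LIMSEQ_unique tendsto_const by blast
  then show ?thesis using s[of 1] by simp
qed

text \<open>Lower bounds cannot be multiplied, since \<open>S j\<close> may be negative. Instead one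
  factor at a time is replaced, while the others stay at their nonnegative upper bounds.\<close>

lemma prod_diff_le_sum:
  fixes U I S :: "'j \<Rightarrow> real"
  assumes "finite J" "\<And>j. j \<in> J \<Longrightarrow> 0 \<le> I j" "\<And>j. j \<in> J \<Longrightarrow> I j \<le> U j" "\<And>j. j \<in> J \<Longrightarrow> S j \<le> I j"
  shows "prod U J - prod I J \<le> (\<Sum>j\<in>J. (U j - S j) * prod U (J - {j}))"
  using assms
proof (induction J rule: finite_induct)
  case (insert j J)
  have U0: "0 \<le> U k" if "k \<in> insert j J" for k using insert.prems(1,2)[OF that] by linarith
  have SU: "S j \<le> U j" using insert.prems(2,3)[of j] by simp
  have PU: "0 \<le> prod U J" by (rule prod_nonneg) (use U0 in auto)
  have PIU: "prod I J \<le> prod U J" using insert.prems by (intro prod_mono) auto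
  have "prod U (insert j J) - prod I (insert j J) = (U j - I j) * prod U J + I j * (prod U J - prod I J)"
    using insert.hyps by (simp add: algebra_simps)
  also have "\<dots> \<le> (U j - S j) * prod U J + U j * (prod U J - prod I J)"
    using insert.prems PU PIU by (intro add_mono mult_right_mono) auto
  also have "\<dots> \<le> (U j - S j) * prod U J + U j * (\<Sum>k\<in>J. (U k - S k) * prod U (J - {k}))"
    using insert.IH insert.prems SU U0[of j] by (intro add_mono mult_left_mono) auto
  also have "\<dots> = (\<Sum>k\<in>insert j J. (U k - S k) * prod U (insert j J - {k}))"
  proof -
    have "(\<Sum>k\<in>J. (U k - S k) * prod U (insert j J - {k})) = U j * (\<Sum>k\<in>J. (U k - S k) * prod U (J - {k}))"
      unfolding sum_distrib_left
    proof (rule sum.cong[OF refl])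
      fix k assume k: "k \<in> J"
      then have "insert j J - {k} = insert j (J - {k})" using insert.hyps by auto
      then show "(U k - S k) * prod U (insert j J - {k}) = U j * ((U k - S k) * prod U (J - {k}))"
        using insert.hyps by simp
    qed
    moreover have "insert j J - {j} = J" using insert.hyps by auto
    ultimately show ?thesis using insert.hyps by simp
  qed
  finally show ?case .
qed simp

text \<open>For each truncation order \<open>m\<close> the limit in \<open>n\<close> is taken first
  and \<open>m\<close> grows afterwards, so no uniformity in \<open>m\<close> enters.\<close>

lemma tendsto_iterated_squeeze:
  fixes y :: "nat \<Rightarrow> real"
  assumes U: "\<And>m n. y n \<le> U m n" "\<And>m. U m \<longlonglongrightarrow> u m" "u \<longlonglongrightarrow> P"
    and L: "\<And>m n. L m n \<le> y n" "\<And>m. L m \<longlonglongrightarrow> l m" "l \<longlonglongrightarrow> P"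
  shows "y \<longlonglongrightarrow> P"
proof (rule order_tendstoI)
  fix x assume "P < x"
  then have "eventually (\<lambda>m. u m < x) sequentially" by (rule order_tendstoD[OF U(3)])
  then obtain m where "u m < x" by (auto simp: eventually_sequentially)
  then have "eventually (\<lambda>n. U m n < x) sequentially" by (rule order_tendstoD[OF U(2)])
  then show "eventually (\<lambda>n. y n < x) sequentially" by eventually_elim (rule le_less_trans[OF U(1)])
next
  fix x assume "x < P"
  then have "eventually (\<lambda>m. x < l m) sequentially" by (rule order_tendstoD[OF L(3)])
  then obtain m where "x < l m" by (auto simp: eventually_sequentially)
  then have "eventually (\<lambda>n. x < L m n) sequentially" by (rule order_tendstoD[OF L(2)])
  then show "eventually (\<lambda>n. x < y n) sequentially" by eventually_elim (rule less_le_trans[OF _ L(1)])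
qed

text \<open>Method of moments: the joint \<open>q\<close>-factorial moments determine the limiting weight of the event that all
  exponents vanish, since truncated inclusion-exclusion bounds its indicator from both sides.\<close>

lemma qfall_moments_imp_zero_limit:
  fixes W :: "nat \<Rightarrow> 'y \<Rightarrow> real" and a :: "nat \<Rightarrow> 'y \<Rightarrow> 'j \<Rightarrow> nat" and q :: "'j \<Rightarrow> real"
  assumes J: "finite J" and q: "\<And>j. j \<in> J \<Longrightarrow> 1 < q j"
    and W: "\<And>n y. y \<in> Y n \<Longrightarrow> 0 \<le> W n y"
    and lim: "\<And>b. (\<lambda>n. \<Sum>y\<in>Y n. W n y * (\<Prod>j\<in>J. qfall (q j) (q j ^ a n y j) (b j))) \<longlonglongrightarrow> 1"
  shows "(\<lambda>n. \<Sum>y\<in>Y n. W n y * of_bool (\<forall>j\<in>J. a n y j = 0)) \<longlonglongrightarrow> (\<Prod>j\<in>J. euler_prod (q j))"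
proof -
  define S where "S = (\<lambda>m n y j. bonf_sum (q j) (m j) (q j ^ a n y j))"
  define E where "E = (\<lambda>m n. \<Sum>y\<in>Y n. W n y * (\<Prod>j\<in>J. S m n y j))"
  define u where "u = (\<lambda>m j. \<Sum>b\<le>m j. bonf_coeff (q j) b)"
  have E_lim: "E m \<longlonglongrightarrow> (\<Prod>j\<in>J. u m j)" for m
  proof -
    have "(\<Prod>j\<in>J. S m n y j) = (\<Sum>b\<in>(\<Pi>\<^sub>E j\<in>J. {..m j}). (\<Prod>j\<in>J. bonf_coeff (q j) (b j)) * (\<Prod>j\<in>J. qfall (q j) (q j ^ a n y j) (b j)))" for n y
      unfolding S_def bonf_sum_def using J by (subst prod_sum_PiE) (auto simp: prod.distrib)
    then have eq: "E m n = (\<Sum>b\<in>(\<Pi>\<^sub>E j\<in>J. {..m j}). (\<Prod>j\<in>J. bonf_coeff (q j) (b j)) *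
      (\<Sum>y\<in>Y n. W n y * (\<Prod>j\<in>J. qfall (q j) (q j ^ a n y j) (b j))))" for n
      unfolding E_def by (simp add: sum_distrib_left mult.left_commute) (rule sum.swap)
    have "(\<lambda>n. \<Sum>b\<in>(\<Pi>\<^sub>E j\<in>J. {..m j}). (\<Prod>j\<in>J. bonf_coeff (q j) (b j)) *
      (\<Sum>y\<in>Y n. W n y * (\<Prod>j\<in>J. qfall (q j) (q j ^ a n y j) (b j)))) \<longlonglongrightarrow> (\<Sum>b\<in>(\<Pi>\<^sub>E j\<in>J. {..m j}). (\<Prod>j\<in>J. bonf_coeff (q j) (b j)) * 1)"
      by (intro tendsto_intros lim)
    moreover have "(\<Sum>b\<in>(\<Pi>\<^sub>E j\<in>J. {..m j}). (\<Prod>j\<in>J. bonf_coeff (q j) (b j)) * 1) = (\<Prod>j\<in>J. u m j)"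
      unfolding u_def using J by (subst prod_sum_PiE) auto
    ultimately show ?thesis unfolding eq[abs_def, symmetric] by simp
  qed
  define ev where "ev = (\<lambda>(M::nat) (j::'j). 2 * M)"
  \<comment> \<open>Odd order at \<open>k\<close> and even order elsewhere: only the factor at
    \<open>k\<close> turns into a lower bound.\<close>
  define od where "od = (\<lambda>(k::'j) (M::nat) (j::'j). if j = k then Suc (2 * M) else 2 * M)"
  have u_lim: "(\<lambda>M. u (m M) j) \<longlonglongrightarrow> euler_prod (q j)" if "j \<in> J" "filterlim (\<lambda>M. m M j) sequentially sequentially" for m j
  proof -
    have "(\<lambda>n. \<Sum>b\<le>n. bonf_coeff (q j) b) \<longlonglongrightarrow> euler_prod (q j)"
      using bonf_coeff_sums[OF q[OF that(1)]] by (simp add: sums_def_le)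
    then show ?thesis unfolding u_def by (rule filterlim_compose[OF _ that(2)])
  qed
  have fl: "filterlim (\<lambda>M. ev M j) sequentially sequentially" "filterlim (\<lambda>M. od k M j) sequentially sequentially" for j k
    by (rule filterlim_subseq, simp add: strict_mono_def ev_def od_def)+
  have ev_lim: "(\<lambda>M. \<Prod>j\<in>J. u (ev M) j) \<longlonglongrightarrow> (\<Prod>j\<in>J. euler_prod (q j))"
    by (intro tendsto_prod u_lim fl)
  have od_lim: "(\<lambda>M. \<Prod>j\<in>J. u (od k M) j) \<longlonglongrightarrow> (\<Prod>j\<in>J. euler_prod (q j))" for k
    by (intro tendsto_prod u_lim fl)
  define I where "I = (\<lambda>n y j. of_bool (a n y j = 0) :: real)"
  have I: "0 \<le> I n y j" "I n y j \<le> S (ev M) n y j" "S (od j M) n y j \<le> I n y j" if "j \<in> J" for n y j M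
    using bonf_upper[OF q[OF that]] bonf_lower[OF q[OF that]] by (auto simp: I_def S_def ev_def od_def)
  have Iprod: "of_bool (\<forall>j\<in>J. a n y j = 0) = (\<Prod>j\<in>J. I n y j)" for n y
    using J by (auto simp: I_def prod_zero_iff)
  \<comment> \<open>The lower bound from \<open>prod_diff_le_sum\<close>, rearranged into
    expectations of products of truncated sums, whose limits are known.\<close>
  define L where "L = (\<lambda>M n. E (ev M) n - (\<Sum>k\<in>J. E (ev M) n - E (od k M) n))"
  have S_od: "S (od k M) n y j = S (ev M) n y j" if "j \<noteq> k" for k M n y j
    using that by (simp add: S_def od_def ev_def)
  show ?thesis
  proof (rule tendsto_iterated_squeeze[where U = "\<lambda>M. E (ev M)" and L = L])
    fix M n
    show "(\<Sum>y\<in>Y n. W n y * of_bool (\<forall>j\<in>J. a n y j = 0)) \<le> E (ev M) n"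
      unfolding E_def Iprod using I by (intro sum_mono mult_left_mono prod_mono W) auto
    have "(\<Sum>y\<in>Y n. W n y * ((\<Prod>j\<in>J. S (ev M) n y j) - (\<Prod>j\<in>J. I n y j))) \<le>
      (\<Sum>y\<in>Y n. W n y * (\<Sum>k\<in>J. (\<Prod>j\<in>J. S (ev M) n y j) - (\<Prod>j\<in>J. S (od k M) n y j)))"
    proof (intro sum_mono mult_left_mono W)
      fix y
      have "(\<Prod>j\<in>J. S (ev M) n y j) - (\<Prod>j\<in>J. I n y j) \<le> (\<Sum>k\<in>J. (S (ev M) n y k - S (od k M) n y k) * prod (S (ev M) n y) (J - {k}))"
        by (rule prod_diff_le_sum[OF J, of "I n y" "S (ev M) n y" "\<lambda>k. S (od k M) n y k"]) (use I in auto)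
      also have "\<dots> = (\<Sum>k\<in>J. (\<Prod>j\<in>J. S (ev M) n y j) - (\<Prod>j\<in>J. S (od k M) n y j))"
      proof (rule sum.cong[OF refl])
        fix k assume k: "k \<in> J"
        have "prod (S (od k M) n y) (J - {k}) = prod (S (ev M) n y) (J - {k})"
          by (intro prod.cong) (auto simp: S_od)
        then show "(S (ev M) n y k - S (od k M) n y k) * prod (S (ev M) n y) (J - {k}) =
          (\<Prod>j\<in>J. S (ev M) n y j) - (\<Prod>j\<in>J. S (od k M) n y j)"
          using prod.remove[OF J k, of "S (ev M) n y"] prod.remove[OF J k, of "S (od k M) n y"]
          by (simp add: left_diff_distrib)
      qed
      finally show "(\<Prod>j\<in>J. S (ev M) n y j) - (\<Prod>j\<in>J. I n y j) \<le> (\<Sum>k\<in>J. (\<Prod>j\<in>J. S (ev M) n y j) - (\<Prod>j\<in>J. S (od k M) n y j))" .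
    qed
    also have "\<dots> = (\<Sum>k\<in>J. E (ev M) n - E (od k M) n)"
      unfolding E_def sum_subtractf[symmetric] right_diff_distrib[symmetric] sum_distrib_left by (rule sum.swap)
    finally show "L M n \<le> (\<Sum>y\<in>Y n. W n y * of_bool (\<forall>j\<in>J. a n y j = 0))"
      unfolding L_def Iprod by (simp add: E_def right_diff_distrib sum_subtractf)
  next
    fix M
    show "E (ev M) \<longlonglongrightarrow> (\<Prod>j\<in>J. u (ev M) j)" by (rule E_lim)
    show "L M \<longlonglongrightarrow> (\<Prod>j\<in>J. u (ev M) j) - (\<Sum>k\<in>J. (\<Prod>j\<in>J. u (ev M) j) - (\<Prod>j\<in>J. u (od k M) j))"
      unfolding L_def by (intro tendsto_intros E_lim)
  next
    show "(\<lambda>M. \<Prod>j\<in>J. u (ev M) j) \<longlonglongrightarrow> (\<Prod>j\<in>J. euler_prod (q j))" by (rule ev_lim)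
    have "(\<lambda>M. (\<Prod>j\<in>J. u (ev M) j) - (\<Sum>k\<in>J. (\<Prod>j\<in>J. u (ev M) j) - (\<Prod>j\<in>J. u (od k M) j))) \<longlonglongrightarrow>
      (\<Prod>j\<in>J. euler_prod (q j)) - (\<Sum>k\<in>J. (\<Prod>j\<in>J. euler_prod (q j)) - (\<Prod>j\<in>J. euler_prod (q j)))"
      by (intro tendsto_intros ev_lim od_lim)
    then show "(\<lambda>M. (\<Prod>j\<in>J. u (ev M) j) - (\<Sum>k\<in>J. (\<Prod>j\<in>J. u (ev M) j) - (\<Prod>j\<in>J. u (od k M) j))) \<longlonglongrightarrow>
      (\<Prod>j\<in>J. euler_prod (q j))" by simp
  qed
qed

section \<open>Finite modules over polynomial rings\<close>

text \<open>Residues modulo a polynomial of degree \<open>d\<close>. The description by coefficients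
  covers the zero polynomial, also for \<open>d = 0\<close>.\<close>

definition rpoly :: "nat \<Rightarrow> 'a::zero poly set" where
  "rpoly d = {g. \<forall>i\<ge>d. Polynomial.coeff g i = 0}"

lemma zero_rpoly [simp]: "0 \<in> rpoly d"
  by (simp add: rpoly_def)

lemma rpoly_0: "rpoly 0 = {0}"
  by (auto simp: rpoly_def poly_eq_iff)

lemma rpoly_Suc: "rpoly (Suc d) = (\<lambda>(a, g). pCons a g) ` (UNIV \<times> rpoly d)"
proof -
  have "g \<in> (\<lambda>(a, g). pCons a g) ` (UNIV \<times> rpoly d)" if "g \<in> rpoly (Suc d)" for g :: "'a poly"
  proof (cases g)
    case (pCons a h)
    have "Polynomial.coeff h i = 0" if "d \<le> i" for i
      using \<open>g \<in> rpoly (Suc d)\<close> that pCons by (auto simp: rpoly_def dest: spec[of _ "Suc i"])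
    then show ?thesis using pCons by (auto simp: rpoly_def)
  qed
  then show ?thesis by (auto simp: rpoly_def coeff_pCons split: nat.splits)
qed

lemma card_rpoly:
  "finite (rpoly d :: 'a::{finite,zero} poly set)" "card (rpoly d :: 'a poly set) = CARD('a) ^ d"
proof -
  have "finite (rpoly d :: 'a poly set) \<and> card (rpoly d :: 'a poly set) = CARD('a) ^ d"
  proof (induction d)
    case (Suc d)
    have "inj_on (\<lambda>(a, g). pCons a g) (UNIV \<times> (rpoly d :: 'a poly set))" by (auto simp: inj_on_def)
    then show ?case using Suc unfolding rpoly_Suc by (simp add: card_image card_cartesian_product)
  qed (simp add: rpoly_0)
  then show "finite (rpoly d :: 'a poly set)" "card (rpoly d :: 'a poly set) = CARD('a) ^ d" by auto
qed

lemma rpoly_iff: "g \<in> rpoly d \<longleftrightarrow> g = 0 \<or> Polynomial.degree g < d"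
  by (auto simp: rpoly_def coeff_eq_0 not_less intro: leading_coeff_0_iff[THEN iffD1])

lemma mod_rpoly:
  fixes f g :: "'a::field poly" assumes "f \<noteq> 0" shows "g mod f \<in> rpoly (Polynomial.degree f)"
  using degree_mod_less[OF assms, of g] by (auto simp: rpoly_iff)

lemma dvd_rpoly_imp_0:
  fixes f g :: "'a::field poly" assumes "f dvd g" "g \<in> rpoly (Polynomial.degree f)" shows "g = 0"
  using assms dvd_imp_degree_le[of f g] by (cases "g = 0") (auto simp: rpoly_iff)

lemma diff_rpoly: "g \<in> rpoly d \<Longrightarrow> h \<in> rpoly d \<Longrightarrow> g - h \<in> rpoly d" for g :: "'a::ab_group_add poly"
  by (simp add: rpoly_def)

section \<open>Spans and independence modulo a submodule\<close>

locale poly_module = M: Modules.module scale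
  for scale :: "'a::{field_gcd,finite} poly \<Rightarrow> 'b::ab_group_add \<Rightarrow> 'b"
begin

notation scale (infixr \<open>\<star>\<close> 75)

definition comb :: "'k set \<Rightarrow> ('k \<Rightarrow> 'a poly) \<Rightarrow> ('k \<Rightarrow> 'b) \<Rightarrow> 'b" where
  "comb K g x = (\<Sum>k\<in>K. g k \<star> x k)"

definition spn :: "'k set \<Rightarrow> ('k \<Rightarrow> 'b) \<Rightarrow> 'b set" where
  "spn K x = range (\<lambda>g. comb K g x)"

text \<open>Encodes that the \<open>x k\<close> have orders \<open>f k\<close> modulo
  \<open>U\<close> and are independent there: for a submodule \<open>U\<close>, the quotient of
  \<open>U\<close> plus the span of \<open>x\<close> by \<open>U\<close> is the direct sum of the
  cyclic modules with annihilators \<open>f k\<close>.\<close>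

definition basis_mod :: "'b set \<Rightarrow> 'k set \<Rightarrow> ('k \<Rightarrow> 'a poly) \<Rightarrow> ('k \<Rightarrow> 'b) \<Rightarrow> bool" where
  "basis_mod U K f x \<longleftrightarrow> (\<forall>g. comb K g x \<in> U \<longleftrightarrow> (\<forall>k\<in>K. f k dvd g k))"

definition ssum :: "'b set \<Rightarrow> 'b set \<Rightarrow> 'b set" where
  "ssum U W = {u + w |u w. u \<in> U \<and> w \<in> W}"

lemma comb_cong: "(\<And>k. k \<in> K \<Longrightarrow> g k \<star> x k = g' k \<star> x' k) \<Longrightarrow> comb K g x = comb K g' x'"
  unfolding comb_def by (rule sum.cong) auto

lemma comb_add: "comb K (\<lambda>k. g k + h k) x = comb K g x + comb K h x"
  by (simp add: comb_def M.scale_left_distrib sum.distrib)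

lemma comb_diff: "comb K (\<lambda>k. g k - h k) x = comb K g x - comb K h x"
  by (simp add: comb_def M.scale_left_diff_distrib sum_subtractf)

lemma comb_scale: "comb K (\<lambda>k. c * g k) x = c \<star> comb K g x"
  by (simp add: comb_def M.scale_sum_right)

lemma comb_zero [simp]: "comb K (\<lambda>k. 0) x = 0"
  by (simp add: comb_def)

lemma comb_empty [simp]: "comb {} g x = 0"
  by (simp add: comb_def)

lemma comb_insert: "finite K \<Longrightarrow> k \<notin> K \<Longrightarrow> comb (insert k K) g x = g k \<star> x k + comb K g x"
  by (simp add: comb_def)

lemma comb_single:
  assumes "finite K" "k \<in> K" shows "comb K (\<lambda>i. if i = k then g else 0) x = g \<star> x k"
proof -
  have "comb K (\<lambda>i. if i = k then g else 0) x = (\<Sum>i\<in>K. if i = k then g \<star> x i else 0)"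
    unfolding comb_def by (rule sum.cong) auto
  then show ?thesis using assms by simp
qed

lemma comb_extend:
  assumes "finite K" "L \<subseteq> K" shows "comb K (\<lambda>i. if i \<in> L then g i else 0) x = comb L g x"
proof -
  have "comb K (\<lambda>i. if i \<in> L then g i else 0) x = (\<Sum>i\<in>K. if i \<in> L then g i \<star> x i else 0)"
    unfolding comb_def by (rule sum.cong) auto
  also have "\<dots> = (\<Sum>i\<in>K \<inter> L. g i \<star> x i)" using assms(1) by (simp add: sum.inter_restrict)
  also have "K \<inter> L = L" using assms(2) by auto
  finally show ?thesis by (simp add: comb_def)
qed

lemma comb_mem:
  assumes "M.subspace U" "\<And>k. k \<in> K \<Longrightarrow> g k \<star> x k \<in> U" shows "comb K g x \<in> U"
  unfolding comb_def using assms by (intro M.subspace_sum) auto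

lemma comb_in_spn: "comb K g x \<in> spn K x"
  by (auto simp: spn_def)

lemma subspace_spn: "M.subspace (spn K x)"
proof (rule M.subspaceI)
  show "0 \<in> spn K x" unfolding spn_def by (rule range_eqI[of _ _ "\<lambda>k. 0"]) simp
next
  fix u v assume "u \<in> spn K x" "v \<in> spn K x"
  then obtain g h where "u = comb K g x" "v = comb K h x" by (auto simp: spn_def)
  then have "u + v = comb K (\<lambda>k. g k + h k) x" by (simp add: comb_add)
  then show "u + v \<in> spn K x" by (simp add: comb_in_spn)
next
  fix c u assume "u \<in> spn K x"
  then obtain g where "u = comb K g x" by (auto simp: spn_def)
  then have "c \<star> u = comb K (\<lambda>k. c * g k) x" by (simp add: comb_scale)
  then show "c \<star> u \<in> spn K x" by (simp add: comb_in_spn)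
qed

lemma spn_le:
  assumes "M.subspace U" "\<And>k. k \<in> K \<Longrightarrow> x k \<in> U" shows "spn K x \<subseteq> U"
  using assms by (auto simp: spn_def intro!: comb_mem M.subspace_scale)

lemma spn_gen: "finite K \<Longrightarrow> k \<in> K \<Longrightarrow> x k \<in> spn K x"
  using comb_in_spn[of K "\<lambda>i. if i = k then 1 else 0" x] by (simp add: comb_single)

lemma spn_empty [simp]: "spn {} x = {0}"
  by (auto simp: spn_def)

lemma spn_cong: "(\<And>k. k \<in> K \<Longrightarrow> x k = y k) \<Longrightarrow> spn K x = spn K y"
  unfolding spn_def comb_def by (intro image_cong refl sum.cong) auto

lemma basis_mod_cong:
  assumes "\<And>k. k \<in> K \<Longrightarrow> x k = y k" "\<And>k. k \<in> K \<Longrightarrow> f k = h k"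
  shows "basis_mod U K f x = basis_mod U K h y"
proof -
  have "comb K g x = comb K g y" for g using assms by (intro comb_cong) auto
  then show ?thesis using assms(2) by (simp add: basis_mod_def)
qed

lemma subspace_ssum: "M.subspace U \<Longrightarrow> M.subspace W \<Longrightarrow> M.subspace (ssum U W)"
proof (rule M.subspaceI)
  assume U: "M.subspace U" and W: "M.subspace W"
  show "0 \<in> ssum U W" using M.subspace_0[OF U] M.subspace_0[OF W] unfolding ssum_def by force
  show "x + y \<in> ssum U W" if "x \<in> ssum U W" "y \<in> ssum U W" for x y
  proof -
    obtain u w u' w' where *: "x = u + w" "y = u' + w'" "u \<in> U" "w \<in> W" "u' \<in> U" "w' \<in> W"
      using \<open>x \<in> ssum U W\<close> \<open>y \<in> ssum U W\<close> by (auto simp: ssum_def)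
    then have "x + y = (u + u') + (w + w')" by (simp add: algebra_simps)
    then show ?thesis using * M.subspace_add[OF U] M.subspace_add[OF W] unfolding ssum_def by blast
  qed
  show "c \<star> x \<in> ssum U W" if x: "x \<in> ssum U W" for c x
  proof -
    obtain u w where *: "x = u + w" "u \<in> U" "w \<in> W" using x by (auto simp: ssum_def)
    then have "c \<star> x = c \<star> u + c \<star> w" by (simp add: M.scale_right_distrib)
    then show ?thesis using * M.subspace_scale[OF U] M.subspace_scale[OF W] unfolding ssum_def by blast
  qed
qed

lemma ssum_left: "M.subspace W \<Longrightarrow> U \<subseteq> ssum U W"
  by (auto simp: ssum_def) (metis M.subspace_0 add.right_neutral)

lemma ssum_right: "M.subspace U \<Longrightarrow> W \<subseteq> ssum U W"
  by (auto simp: ssum_def) (metis M.subspace_0 add.left_neutral)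

lemma ssum_le: "M.subspace V \<Longrightarrow> U \<subseteq> V \<Longrightarrow> W \<subseteq> V \<Longrightarrow> ssum U W \<subseteq> V"
  by (auto simp: ssum_def intro: M.subspace_add)

lemma ssum_zero [simp]: "ssum {0} W = W"
  by (auto simp: ssum_def)

lemma basis_mod_D:
  assumes "basis_mod U K f x"
  shows "comb K g x \<in> U \<Longrightarrow> k \<in> K \<Longrightarrow> f k dvd g k"
    and "(\<And>k. k \<in> K \<Longrightarrow> f k dvd g k) \<Longrightarrow> comb K g x \<in> U"
  using assms by (auto simp: basis_mod_def)

lemma basis_mod_gen:
  assumes "basis_mod U K f x" "finite K" "k \<in> K"
  shows "f k \<star> x k \<in> U" "g \<star> x k \<in> U \<longleftrightarrow> f k dvd g"
proof -
  show *: "g \<star> x k \<in> U \<longleftrightarrow> f k dvd g" for g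
  proof
    assume "g \<star> x k \<in> U"
    then have "comb K (\<lambda>i. if i = k then g else 0) x \<in> U" using assms by (simp add: comb_single)
    from basis_mod_D(1)[OF assms(1) this assms(3)] show "f k dvd g" by simp
  next
    assume "f k dvd g"
    then have "comb K (\<lambda>i. if i = k then g else 0) x \<in> U" by (intro basis_mod_D(2)[OF assms(1)]) auto
    then show "g \<star> x k \<in> U" using assms by (simp add: comb_single)
  qed
  show "f k \<star> x k \<in> U" by (simp add: *)
qed

lemma basis_mod_subset:
  assumes "basis_mod U K f x" "finite K" "L \<subseteq> K" shows "basis_mod U L f x"
  unfolding basis_mod_def
proof
  fix g
  have "comb L g x \<in> U \<longleftrightarrow> comb K (\<lambda>i. if i \<in> L then g i else 0) x \<in> U"
    by (simp only: comb_extend[OF assms(2,3)])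
  also have "\<dots> \<longleftrightarrow> (\<forall>k\<in>K. f k dvd (if k \<in> L then g k else 0))"
    using assms(1) unfolding basis_mod_def by (rule spec)
  also have "\<dots> \<longleftrightarrow> (\<forall>k\<in>L. f k dvd g k)" using assms(3) by auto
  finally show "comb L g x \<in> U \<longleftrightarrow> (\<forall>k\<in>L. f k dvd g k)" .
qed

text \<open>Division with remainder by the \<open>f k\<close> provides normal forms; they are unique
  by \<open>basis_mod\<close> applied to a difference of residues.\<close>

lemma bij_ssum_spn:
  assumes b: "basis_mod U K f x" and U: "M.subspace U" and K: "finite K" and f: "\<And>k. k \<in> K \<Longrightarrow> f k \<noteq> 0"
  shows "bij_betw (\<lambda>(u, g). u + comb K g x) (U \<times> (\<Pi>\<^sub>E k\<in>K. rpoly (Polynomial.degree (f k)))) (ssum U (spn K x))"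
  unfolding bij_betw_def
proof
  let ?P = "\<Pi>\<^sub>E k\<in>K. rpoly (Polynomial.degree (f k))"
  show "inj_on (\<lambda>(u, g). u + comb K g x) (U \<times> ?P)"
  proof (rule inj_onI, clarify)
    fix u g u' g' assume a: "u \<in> U" "u' \<in> U" "g \<in> ?P" "g' \<in> ?P" "u + comb K g x = u' + comb K g' x"
    then have "comb K (\<lambda>k. g k - g' k) x = u' - u" by (simp add: comb_diff algebra_simps)
    then have "comb K (\<lambda>k. g k - g' k) x \<in> U" using M.subspace_diff[OF U a(2,1)] by simp
    then have "f k dvd g k - g' k" if "k \<in> K" for k using basis_mod_D(1)[OF b _ that] by blast
    moreover have "g k - g' k \<in> rpoly (Polynomial.degree (f k))" if "k \<in> K" for k
      using a(3,4) that by (intro diff_rpoly) auto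
    ultimately have "g k = g' k" if "k \<in> K" for k using dvd_rpoly_imp_0 that by (metis eq_iff_diff_eq_0)
    then have "g = g'" using a(3,4) by (intro PiE_ext) auto
    then show "u = u' \<and> g = g'" using a(5) by simp
  qed
  show "(\<lambda>(u, g). u + comb K g x) ` (U \<times> ?P) = ssum U (spn K x)"
  proof
    show "(\<lambda>(u, g). u + comb K g x) ` (U \<times> ?P) \<subseteq> ssum U (spn K x)"
      unfolding ssum_def using comb_in_spn by fast
    show "ssum U (spn K x) \<subseteq> (\<lambda>(u, g). u + comb K g x) ` (U \<times> ?P)"
    proof
      fix y assume "y \<in> ssum U (spn K x)"
      then obtain u g where y: "y = u + comb K g x" "u \<in> U" by (auto simp: ssum_def spn_def)
      define r where "r = (\<lambda>k\<in>K. g k mod f k)"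
      have "comb K g x = comb K (\<lambda>k. g k div f k * f k) x + comb K r x"
        unfolding comb_add[symmetric] by (rule comb_cong) (simp add: r_def)
      moreover have "comb K (\<lambda>k. g k div f k * f k) x \<in> U" by (rule basis_mod_D(2)[OF b]) simp
      ultimately have "y = (u + comb K (\<lambda>k. g k div f k * f k) x) + comb K r x" "u + comb K (\<lambda>k. g k div f k * f k) x \<in> U"
        using y M.subspace_add[OF U] by (auto simp: add.assoc)
      moreover have "r \<in> ?P" using f mod_rpoly by (auto simp: r_def)
      ultimately show "y \<in> (\<lambda>(u, g). u + comb K g x) ` (U \<times> ?P)"
        by (intro image_eqI[of _ _ "(u + comb K (\<lambda>k. g k div f k * f k) x, r)"]) auto
    qed
  qed
qed

lemma card_ssum_spn:
  assumes "basis_mod U K f x" "M.subspace U" "finite K" "\<And>k. k \<in> K \<Longrightarrow> f k \<noteq> 0"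
  shows "card (ssum U (spn K x)) = card U * (\<Prod>k\<in>K. CARD('a) ^ Polynomial.degree (f k))"
  using bij_betw_same_card[OF bij_ssum_spn[OF assms]] assms(3)
  by (simp add: card_cartesian_product card_PiE card_rpoly)

lemma card_spn:
  assumes "basis_mod {0} K f x" "finite K" "\<And>k. k \<in> K \<Longrightarrow> f k \<noteq> 0"
  shows "card (spn K x) = (\<Prod>k\<in>K. CARD('a) ^ Polynomial.degree (f k))"
  using card_ssum_spn[OF assms(1) _ assms(2,3)] by simp

lemma irreducible_not_dvd_combine:
  fixes F g :: "'a poly"
  assumes "Factorial_Ring.irreducible F" "\<not> F dvd g"
  obtains a b where "a * g + b * F = 1"
proof -
  have "coprime F g" using assms prime_elem_imp_coprime irreducible_imp_prime_elem_gcd by blast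
  then have "gcd g F = 1" by (simp add: gcd.commute coprime_iff_gcd_eq_1[symmetric] coprime_commute)
  then show ?thesis using bezout_coefficients[of g F "fst (bezout_coefficients g F)" "snd (bezout_coefficients g F)"] that
    by (metis prod.collapse)
qed

lemma subspace_combine:
  assumes W: "M.subspace W" and "g \<star> v \<in> W" "F \<star> v \<in> W" "a * g + b * F = 1"
  shows "v \<in> W"
proof -
  have "v = (a * g + b * F) \<star> v" using assms(4) by simp
  also have "\<dots> = a \<star> (g \<star> v) + b \<star> (F \<star> v)" by (simp only: M.scale_left_distrib M.scale_scale)
  finally show ?thesis using W assms(2,3) by (metis M.subspace_add M.subspace_scale)
qed

text \<open>If a multiple \<open>g \<star> v\<close> fell into \<open>ssum U (spn L w)\<close> with
  \<open>g\<close> prime to the irreducible \<open>h l\<close>, Bezout would pull \<open>v\<close>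
  itself into it. Independence of a new vector is thus a single non-membership, and bases can be
  counted vector by vector.\<close>

lemma basis_mod_insert_irreducible:
  assumes U: "M.subspace U" and L: "finite L" "l \<notin> L" and F: "Factorial_Ring.irreducible (h l)"
  shows "basis_mod U (insert l L) h (w(l := v)) \<longleftrightarrow>
    basis_mod U L h w \<and> h l \<star> v \<in> U \<and> v \<notin> ssum U (spn L w)"
proof
  have upd: "comb L g (w(l := v)) = comb L g w" for g using L by (intro comb_cong) auto
  have ins: "comb (insert l L) g (w(l := v)) = g l \<star> v + comb L g w" for g
    using L by (simp add: comb_insert upd)
  {
    assume b: "basis_mod U (insert l L) h (w(l := v))"
    have "basis_mod U L h (w(l := v))" by (rule basis_mod_subset[OF b]) (use L in auto)
    then have "basis_mod U L h w" by (subst basis_mod_cong[of L w "w(l := v)" h h]) (use L in auto)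
    moreover have "h l \<star> v \<in> U" using basis_mod_gen(1)[OF b, of l] L by simp
    moreover have "v \<notin> ssum U (spn L w)"
    proof
      assume "v \<in> ssum U (spn L w)"
      then obtain u g where v: "v = u + comb L g w" "u \<in> U" by (auto simp: ssum_def spn_def)
      let ?g = "(\<lambda>k. - g k)(l := 1)"
      have "comb (insert l L) ?g (w(l := v)) = v + comb L (\<lambda>k. - g k) w"
        unfolding ins using L by (auto intro!: comb_cong)
      also have "comb L (\<lambda>k. - g k) w = - comb L g w" by (simp add: comb_def sum_negf)
      finally have eq: "comb (insert l L) ?g (w(l := v)) = v + - comb L g w" .
      have "comb (insert l L) ?g (w(l := v)) \<in> U" unfolding eq using v by simp
      from basis_mod_D(1)[OF b this, of l] have "h l dvd 1" by simp
      then show False using F by (simp add: Factorial_Ring.irreducible_def)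
    qed
    ultimately show "basis_mod U L h w \<and> h l \<star> v \<in> U \<and> v \<notin> ssum U (spn L w)" by blast
  }
  {
    assume r: "basis_mod U L h w \<and> h l \<star> v \<in> U \<and> v \<notin> ssum U (spn L w)"
    then have b: "basis_mod U L h w" and hv: "h l \<star> v \<in> U" and nv: "v \<notin> ssum U (spn L w)" by auto
    have S: "M.subspace (ssum U (spn L w))" by (rule subspace_ssum[OF U subspace_spn])
    show "basis_mod U (insert l L) h (w(l := v))"
      unfolding basis_mod_def ins
    proof (intro allI iffI)
      fix g assume g: "g l \<star> v + comb L g w \<in> U"
      have gl: "h l dvd g l"
      proof (rule ccontr)
        assume "\<not> h l dvd g l"
        then obtain a b where ab: "a * g l + b * h l = 1" using irreducible_not_dvd_combine[OF F] by blast
        have "g l \<star> v = (g l \<star> v + comb L g w) + comb L (\<lambda>k. - g k) w" by (simp add: comb_def sum_negf)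
        then have "g l \<star> v \<in> ssum U (spn L w)" using g comb_in_spn[of L _ w] unfolding ssum_def by blast
        moreover have "h l \<star> v \<in> ssum U (spn L w)" using hv ssum_left[OF subspace_spn] by blast
        ultimately show False using subspace_combine[OF S _ _ ab] nv by blast
      qed
      then obtain d where "g l = h l * d" by (auto simp: dvd_def)
      then have "g l \<star> v = d \<star> (h l \<star> v)" by (simp add: mult.commute)
      then have "g l \<star> v \<in> U" using M.subspace_scale[OF U hv, of d] by simp
      then have "comb L g w \<in> U" using M.subspace_diff[OF U g] by fastforce
      then show "\<forall>k\<in>insert l L. h k dvd g k" using gl basis_mod_D(1)[OF b] by blast
    next
      fix g assume g: "\<forall>k\<in>insert l L. h k dvd g k"
      then obtain d where "g l = h l * d" by (auto simp: dvd_def)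
      then have "g l \<star> v = d \<star> (h l \<star> v)" by (simp add: mult.commute)
      then have "g l \<star> v \<in> U" using M.subspace_scale[OF U hv, of d] by simp
      moreover have "comb L g w \<in> U" using g by (intro basis_mod_D(2)[OF b]) auto
      ultimately show "g l \<star> v + comb L g w \<in> U" by (rule M.subspace_add[OF U])
    qed
  }
qed

end

section \<open>Torsion modulo a submodule and the number of its bases\<close>

context poly_module
begin

definition tors :: "'a poly \<Rightarrow> 'b set \<Rightarrow> 'b set \<Rightarrow> 'b set" where
  "tors F U V = {v\<in>V. F \<star> v \<in> U}"

lemma subspace_tors:
  assumes "M.subspace U" "M.subspace V" shows "M.subspace (tors F U V)"
proof (rule M.subspaceI)
  show "c \<star> x \<in> tors F U V" if "x \<in> tors F U V" for c x
    using that assms M.subspace_scale[of U "F \<star> x" c] M.subspace_scale[of V x c]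
    by (simp add: tors_def mult.commute)
qed (use assms in \<open>auto simp: tors_def M.scale_right_distrib M.subspace_0 M.subspace_add\<close>)

lemma irreducible_dvd_mult:
  fixes F g h :: "'a poly"
  assumes "Factorial_Ring.irreducible F" "F dvd g * h" shows "F dvd g \<or> F dvd h"
  using assms irreducible_imp_prime_elem_gcd prime_elem_dvd_mult_iff by blast

text \<open>Generators whose order is a different irreducible drop out:
  \<open>h l dvd F * g l\<close> gives \<open>h l dvd g l\<close> for them. This is what separates
  the counts for different polynomials.\<close>

lemma tors_Int_ssum:
  assumes b: "basis_mod U L h w" and L: "finite L" and h: "\<And>l. l \<in> L \<Longrightarrow> Factorial_Ring.irreducible (h l)"
    and w: "\<And>l. l \<in> L \<Longrightarrow> w l \<in> V" and UV: "M.subspace U" "M.subspace V" "U \<subseteq> V"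
    and F: "\<And>l. l \<in> L \<Longrightarrow> h l \<noteq> F \<Longrightarrow> \<not> h l dvd F"
  shows "tors F U V \<inter> ssum U (spn L w) = ssum U (spn {l\<in>L. h l = F} w)"
proof
  let ?L = "{l\<in>L. h l = F}"
  show "tors F U V \<inter> ssum U (spn L w) \<subseteq> ssum U (spn ?L w)"
  proof
    fix y assume y: "y \<in> tors F U V \<inter> ssum U (spn L w)"
    then obtain u g where yu: "y = u + comb L g w" "u \<in> U" by (auto simp: ssum_def spn_def)
    have "F \<star> y - F \<star> u \<in> U" using y yu UV by (auto simp: tors_def intro!: M.subspace_diff M.subspace_scale)
    then have "comb L (\<lambda>l. F * g l) w \<in> U" using yu by (simp add: comb_scale M.scale_right_distrib)
    then have d: "h l dvd F * g l" if "l \<in> L" for l using basis_mod_D(1)[OF b _ that] by blast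
    have "h l dvd g l" if "l \<in> L - ?L" for l
      using irreducible_dvd_mult[OF h d] F that by blast
    then have "g l \<star> w l \<in> U" if "l \<in> L - ?L" for l using basis_mod_gen(2)[OF b L] that by blast
    then have "comb (L - ?L) g w \<in> U" by (intro comb_mem UV) auto
    then have "u + comb (L - ?L) g w \<in> U" using M.subspace_add[OF UV(1)] yu by blast
    moreover have "y = (u + comb (L - ?L) g w) + comb ?L g w"
      unfolding yu(1) comb_def using L by (subst sum.subset_diff[of ?L L]) (auto simp: add.assoc)
    ultimately show "y \<in> ssum U (spn ?L w)" using comb_in_spn[of ?L g w] unfolding ssum_def by blast
  qed
  show "ssum U (spn ?L w) \<subseteq> tors F U V \<inter> ssum U (spn L w)"
  proof -
    have T: "M.subspace (tors F U V)" by (rule subspace_tors[OF UV(1,2)])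
    have "U \<subseteq> tors F U V" using UV M.subspace_scale by (auto simp: tors_def)
    moreover have "spn ?L w \<subseteq> tors F U V"
    proof (rule spn_le[OF T])
      fix l assume "l \<in> ?L"
      then show "w l \<in> tors F U V" using basis_mod_gen(1)[OF b L, of l] w by (auto simp: tors_def)
    qed
    ultimately have 1: "ssum U (spn ?L w) \<subseteq> tors F U V" by (rule ssum_le[OF T])
    have S: "M.subspace (ssum U (spn L w))" by (rule subspace_ssum[OF UV(1) subspace_spn])
    have "spn ?L w \<subseteq> ssum U (spn L w)"
      using spn_gen[OF L] ssum_right[OF UV(1), of "spn L w"] by (intro spn_le[OF S]) auto
    then have "ssum U (spn ?L w) \<subseteq> ssum U (spn L w)"
      using ssum_left[OF subspace_spn, of U] by (intro ssum_le[OF S]) auto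
    then show ?thesis using 1 by blast
  qed
qed

lemma irreducible_neq_0: "Factorial_Ring.irreducible (F :: 'a poly) \<Longrightarrow> F \<noteq> 0"
  by (auto simp: Factorial_Ring.irreducible_def)

lemma card_tors_diff_ssum:
  assumes b: "basis_mod U L h w" and L: "finite L" and h: "\<And>l. l \<in> L \<Longrightarrow> Factorial_Ring.irreducible (h l)"
    and w: "\<And>l. l \<in> L \<Longrightarrow> w l \<in> V" and UV: "M.subspace U" "M.subspace V" "U \<subseteq> V" "finite V"
    and F: "\<And>l. l \<in> L \<Longrightarrow> h l \<noteq> F \<Longrightarrow> \<not> h l dvd F"
  shows "real (card (tors F U V - ssum U (spn L w))) =
    real (card (tors F U V)) - card U * (CARD('a) ^ Polynomial.degree F) ^ card {l\<in>L. h l = F}"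
proof -
  let ?L = "{l\<in>L. h l = F}"
  have finT: "finite (tors F U V)" using UV(4) by (simp add: tors_def)
  have "basis_mod U ?L h w" by (rule basis_mod_subset[OF b L]) auto
  then have "card (ssum U (spn ?L w)) = card U * (\<Prod>l\<in>?L. CARD('a) ^ Polynomial.degree (h l))"
    using L h irreducible_neq_0 by (intro card_ssum_spn UV) auto
  also have "(\<Prod>l\<in>?L. CARD('a) ^ Polynomial.degree (h l)) = (\<Prod>l\<in>?L. CARD('a) ^ Polynomial.degree F)"
    by (intro prod.cong) auto
  finally have "card (tors F U V \<inter> ssum U (spn L w)) = card U * (CARD('a) ^ Polynomial.degree F) ^ card ?L"
    by (subst tors_Int_ssum[OF b L _ _ UV(1-3)]) (use h w F in simp_all)
  moreover have "real (card (tors F U V - ssum U (spn L w))) = real (card (tors F U V)) - real (card (tors F U V \<inter> ssum U (spn L w)))"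
    using finT card_mono[OF finT, of "tors F U V \<inter> ssum U (spn L w)"] by (simp add: card_Diff_subset_Int of_nat_diff)
  ultimately show ?thesis by simp
qed

text \<open>The generators are added one by one. A new one of colour \<open>j\<close> is a torsion
  vector outside \<open>U\<close> plus the span of its predecessors; inside the
  \<open>F j\<close>-torsion only the predecessors of the same colour count, and \<open>i\<close> of
  them exclude \<open>card U\<close> times the \<open>i\<close>-th power of the size of the residue
  field.\<close>

lemma card_bases_mod:
  fixes F :: "'j \<Rightarrow> 'a poly" and c :: "'l \<Rightarrow> 'j"
  assumes UV: "M.subspace U" "M.subspace V" "U \<subseteq> V" "finite V" and L: "finite L" and J: "finite J" "c ` L \<subseteq> J"
    and F: "\<And>j. j \<in> J \<Longrightarrow> Factorial_Ring.irreducible (F j)" "\<And>j k. j \<in> J \<Longrightarrow> k \<in> J \<Longrightarrow> j \<noteq> k \<Longrightarrow> \<not> F j dvd F k"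
  shows "real (card {w\<in>L \<rightarrow>\<^sub>E V. basis_mod U L (\<lambda>l. F (c l)) w}) =
    (\<Prod>j\<in>J. \<Prod>i<card {l\<in>L. c l = j}. real (card (tors (F j) U V)) - card U * (CARD('a) ^ Polynomial.degree (F j)) ^ i)"
  using L J(2)
proof (induction L rule: finite_induct)
  case empty
  have "basis_mod U {} (\<lambda>l. F (c l)) w" for w using M.subspace_0[OF UV(1)] by (simp add: basis_mod_def)
  then have "{w \<in> {} \<rightarrow>\<^sub>E V. basis_mod U {} (\<lambda>l. F (c l)) w} = {\<lambda>x. undefined}" by auto
  then show ?case by simp
next
  case (insert l L)
  let ?h = "\<lambda>l. F (c l)"
  let ?B = "\<lambda>L. {w\<in>L \<rightarrow>\<^sub>E V. basis_mod U L ?h w}"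
  let ?Z = "tors (F (c l)) U V" and ?W = "\<lambda>w. ssum U (spn L w)"
  let ?t = "\<lambda>j i. real (card (tors (F j) U V)) - card U * (CARD('a) ^ Polynomial.degree (F j)) ^ i"
  have cl: "c l \<in> J" "\<And>k. k \<in> L \<Longrightarrow> c k \<in> J" using insert.prems by auto
  have irr: "Factorial_Ring.irreducible (?h k)" if "k \<in> insert l L" for k using that cl F by auto
  have finB: "finite (?B L)" using insert.hyps UV by (auto intro!: finite_PiE)
  have finZ: "finite ?Z" using UV(4) by (simp add: tors_def)
  have B_insert: "?B (insert l L) = (\<lambda>(w, v). w(l := v)) ` (SIGMA w:?B L. ?Z - ?W w)"
  proof
    show "?B (insert l L) \<subseteq> (\<lambda>(w, v). w(l := v)) ` (SIGMA w:?B L. ?Z - ?W w)"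
    proof
      fix w' assume w': "w' \<in> ?B (insert l L)"
      define w where "w = w'(l := undefined)"
      have e: "w' = w(l := w' l)" by (simp add: w_def)
      have w: "w \<in> L \<rightarrow>\<^sub>E V" using w' insert.hyps by (auto simp: w_def PiE_iff extensional_def)
      have "basis_mod U (insert l L) ?h (w(l := w' l))" using w' e by simp
      then have "basis_mod U L ?h w \<and> ?h l \<star> w' l \<in> U \<and> w' l \<notin> ?W w"
        by (subst (asm) basis_mod_insert_irreducible[OF UV(1) insert.hyps]) (use irr in auto)
      then show "w' \<in> (\<lambda>(w, v). w(l := v)) ` (SIGMA w:?B L. ?Z - ?W w)"
        using w w' e by (intro image_eqI[of _ _ "(w, w' l)"]) (auto simp: tors_def)
    qed
    show "(\<lambda>(w, v). w(l := v)) ` (SIGMA w:?B L. ?Z - ?W w) \<subseteq> ?B (insert l L)"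
    proof clarify
      fix w v assume a: "w \<in> L \<rightarrow>\<^sub>E V" "basis_mod U L ?h w" "v \<in> ?Z" "v \<notin> ?W w"
      have "w(l := v) \<in> insert l L \<rightarrow>\<^sub>E V" using a by (auto simp: tors_def PiE_iff extensional_def)
      moreover have "basis_mod U (insert l L) ?h (w(l := v))"
        by (subst basis_mod_insert_irreducible[OF UV(1) insert.hyps]) (use irr a in \<open>auto simp: tors_def\<close>)
      ultimately show "w(l := v) \<in> insert l L \<rightarrow>\<^sub>E V \<and> basis_mod U (insert l L) ?h (w(l := v))" by blast
    qed
  qed
  have inj: "inj_on (\<lambda>(w, v). w(l := v)) (SIGMA w:?B L. ?Z - ?W w)"
  proof (rule inj_onI, clarify)
    fix w v w' v' assume a: "w \<in> L \<rightarrow>\<^sub>E V" "w' \<in> L \<rightarrow>\<^sub>E V" "w(l := v) = w'(l := v')"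
    have "w k = w' k" for k
      using fun_cong[OF a(3), of k] PiE_arb[OF a(1) insert.hyps(2)] PiE_arb[OF a(2) insert.hyps(2)] by (cases "k = l") auto
    moreover have "v = v'" using fun_cong[OF a(3), of l] by simp
    ultimately show "w = w' \<and> v = v'" by auto
  qed
  have cd: "real (card (?Z - ?W w)) = ?t (c l) (card {k\<in>L. c k = c l})" if w: "w \<in> ?B L" for w
  proof -
    have e: "{k\<in>L. ?h k = F (c l)} = {k\<in>L. c k = c l}"
      using F(2) cl by (auto, metis dvd_refl)
    have "real (card (?Z - ?W w)) = ?t (c l) (card {k\<in>L. ?h k = F (c l)})"
      by (rule card_tors_diff_ssum[OF _ insert.hyps(1) irr _ UV]) (use w cl F in \<open>auto, metis\<close>)
    then show ?thesis unfolding e .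
  qed
  have "real (card (?B (insert l L))) = (\<Sum>w\<in>?B L. real (card (?Z - ?W w)))"
    unfolding B_insert card_image[OF inj] using finB finZ by (subst card_SigmaI) auto
  also have "\<dots> = real (card (?B L)) * ?t (c l) (card {k\<in>L. c k = c l})"
    by (subst sum.cong[OF refl cd]) auto
  also have "real (card (?B L)) = (\<Prod>j\<in>J. \<Prod>i<card {k\<in>L. c k = j}. ?t j i)"
    using insert by auto
  also have "(\<Prod>j\<in>J. \<Prod>i<card {k\<in>L. c k = j}. ?t j i) * ?t (c l) (card {k\<in>L. c k = c l}) =
    (\<Prod>j\<in>J. \<Prod>i<card {k\<in>insert l L. c k = j}. ?t j i)"
  proof -
    have s1: "card {k\<in>insert l L. c k = c l} = Suc (card {k\<in>L. c k = c l})"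
    proof -
      have "{k\<in>insert l L. c k = c l} = insert l {k\<in>L. c k = c l}" by auto
      then show ?thesis using insert.hyps by simp
    qed
    have s2: "{k\<in>insert l L. c k = j} = {k\<in>L. c k = j}" if "j \<noteq> c l" for j using that by auto
    have p0: "(\<Prod>i<card {k\<in>insert l L. c k = c l}. ?t (c l) i) = (\<Prod>i<card {k\<in>L. c k = c l}. ?t (c l) i) * ?t (c l) (card {k\<in>L. c k = c l})"
      unfolding s1 prod.lessThan_Suc ..
    have eq1: "(\<Prod>j\<in>J - {c l}. \<Prod>i<card {k\<in>insert l L. c k = j}. ?t j i) = (\<Prod>j\<in>J - {c l}. \<Prod>i<card {k\<in>L. c k = j}. ?t j i)"
    proof (rule prod.cong[OF refl])
      fix j assume "j \<in> J - {c l}"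
      then have "j \<noteq> c l" by simp
      then have e: "{k\<in>insert l L. c k = j} = {k\<in>L. c k = j}" by (rule s2)
      show "(\<Prod>i<card {k\<in>insert l L. c k = j}. ?t j i) = (\<Prod>i<card {k\<in>L. c k = j}. ?t j i)" unfolding e ..
    qed
    show ?thesis unfolding prod.remove[OF J(1) cl(1)] p0 eq1 by (simp only: mult_ac)
  qed
  finally show ?case .
qed

text \<open>The quotient of \<open>tors F U V\<close> by \<open>U\<close> is a vector space over the
  residue field of \<open>F\<close>. A longest independent tuple exists since \<open>V\<close> is
  finite, and it spans.\<close>

lemma exists_tors_exponent:
  assumes UV: "M.subspace U" "M.subspace V" "U \<subseteq> V" "finite V" and F: "Factorial_Ring.irreducible F"
  shows "\<exists>a. card (tors F U V) = card U * (CARD('a) ^ Polynomial.degree F) ^ a"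
proof -
  let ?P = "\<lambda>m. \<exists>w. (\<forall>l\<in>{..<m::nat}. w l \<in> V) \<and> basis_mod U {..<m} (\<lambda>_. F) w"
  have finT: "finite (tors F U V)" using UV(4) by (simp add: tors_def)
  have TU: "M.subspace (tors F U V)" by (rule subspace_tors[OF UV(1,2)])
  have deg: "0 < Polynomial.degree F" using F by (metis irreducible_not_unit is_unit_iff_degree irreducible_neq_0 neq0_conv)
  have U0: "0 < card U" using UV M.subspace_0 finite_subset by (fastforce simp: card_gt_0_iff)
  have sub: "ssum U (spn {..<m} w) \<subseteq> tors F U V" and cardw: "card (ssum U (spn {..<m} w)) = card U * (CARD('a) ^ Polynomial.degree F) ^ m"
    if "\<forall>l\<in>{..<m::nat}. w l \<in> V" "basis_mod U {..<m} (\<lambda>_. F) w" for m w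
  proof -
    have "U \<subseteq> tors F U V" using UV M.subspace_scale by (auto simp: tors_def)
    moreover have "spn {..<m} w \<subseteq> tors F U V"
      using that basis_mod_gen(1)[OF that(2)] by (intro spn_le[OF TU]) (auto simp: tors_def)
    ultimately show "ssum U (spn {..<m} w) \<subseteq> tors F U V" by (rule ssum_le[OF TU])
    show "card (ssum U (spn {..<m} w)) = card U * (CARD('a) ^ Polynomial.degree F) ^ m"
      using card_ssum_spn[OF that(2) UV(1)] irreducible_neq_0[OF F] by simp
  qed
  have bound: "m \<le> card (tors F U V)" if "?P m" for m
  proof -
    obtain w where w: "\<forall>l\<in>{..<m::nat}. w l \<in> V" "basis_mod U {..<m} (\<lambda>_. F) w" using \<open>?P m\<close> by blast
    have Q: "2 \<le> CARD('a) ^ Polynomial.degree F"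
    proof -
      have "card {0, 1 :: 'a} \<le> CARD('a)" by (rule card_mono) auto
      then have "2 \<le> CARD('a)" by simp
      then show ?thesis using deg self_le_power[of "CARD('a)" "Polynomial.degree F"] by linarith
    qed
    have "m < 2 ^ m" by (rule less_exp)
    also have "\<dots> \<le> (CARD('a) ^ Polynomial.degree F) ^ m" using Q by (intro power_mono) auto
    also have "\<dots> \<le> card U * (CARD('a) ^ Polynomial.degree F) ^ m" using U0 by simp
    also have "\<dots> = card (ssum U (spn {..<m} w))" using cardw[OF w] by simp
    also have "\<dots> \<le> card (tors F U V)" by (rule card_mono[OF finT sub[OF w]])
    finally show ?thesis by simp
  qed
  have P0: "?P 0" using M.subspace_0[OF UV(1)] by (auto simp: basis_mod_def)
  define m where "m = (GREATEST m. ?P m)"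
  have Pm: "?P m" unfolding m_def by (rule GreatestI_nat[of ?P 0, OF P0 bound])
  have not: "\<not> ?P (Suc m)"
  proof
    assume "?P (Suc m)"
    then have "Suc m \<le> m" unfolding m_def by (rule Greatest_le_nat[of ?P, OF _ bound])
    then show False by simp
  qed
  obtain w where w: "\<forall>l\<in>{..<m::nat}. w l \<in> V" "basis_mod U {..<m} (\<lambda>_. F) w" using Pm by blast
  have "tors F U V \<subseteq> ssum U (spn {..<m} w)"
  proof
    fix v assume v: "v \<in> tors F U V"
    show "v \<in> ssum U (spn {..<m} w)"
    proof (rule ccontr)
      assume "v \<notin> ssum U (spn {..<m} w)"
      then have "basis_mod U (insert m {..<m}) (\<lambda>_. F) (w(m := v))"
        using v w F UV by (subst basis_mod_insert_irreducible) (auto simp: tors_def)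
      moreover have "\<forall>l\<in>{..<Suc m}. (w(m := v)) l \<in> V" using w v by (auto simp: tors_def less_Suc_eq)
      ultimately have "?P (Suc m)" unfolding lessThan_Suc by blast
      then show False using not by blast
    qed
  qed
  then have "tors F U V = ssum U (spn {..<m} w)" using sub[OF w] by blast
  then show ?thesis using cardw[OF w] by auto
qed

definition tors_exp :: "'a poly \<Rightarrow> 'b set \<Rightarrow> 'b set \<Rightarrow> nat" where
  "tors_exp F U V = (SOME a. card (tors F U V) = card U * (CARD('a) ^ Polynomial.degree F) ^ a)"

lemma card_tors:
  assumes "M.subspace U" "M.subspace V" "U \<subseteq> V" "finite V" "Factorial_Ring.irreducible F"
  shows "card (tors F U V) = card U * (CARD('a) ^ Polynomial.degree F) ^ tors_exp F U V"
  unfolding tors_exp_def by (rule someI_ex[OF exists_tors_exponent[OF assms]])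

lemma tors_exp_eq_0_iff:
  assumes UV: "M.subspace U" "M.subspace V" "U \<subseteq> V" "finite V" and F: "Factorial_Ring.irreducible F"
  shows "tors_exp F U V = 0 \<longleftrightarrow> tors F U V = U"
proof -
  have sub: "U \<subseteq> tors F U V" using UV M.subspace_scale by (auto simp: tors_def)
  have fin: "finite (tors F U V)" using UV(4) by (simp add: tors_def)
  have U0: "0 < card U" using UV M.subspace_0 finite_subset by (fastforce simp: card_gt_0_iff)
  have deg: "0 < Polynomial.degree F" using F by (metis irreducible_not_unit is_unit_iff_degree irreducible_neq_0 neq0_conv)
  have "card {0, 1 :: 'a} \<le> CARD('a)" by (rule card_mono) auto
  then have "1 < CARD('a)" by simp
  then have Q: "1 < CARD('a) ^ Polynomial.degree F" using deg by (rule one_less_power)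
  have "tors_exp F U V = 0 \<longleftrightarrow> card (tors F U V) = card U"
    using card_tors[OF assms] U0 Q by auto
  also have "\<dots> \<longleftrightarrow> tors F U V = U" using card_subset_eq[OF fin sub] by auto
  finally show ?thesis .
qed

text \<open>With \<open>card U\<close> taken out of every factor, the count becomes a power of
  \<open>card U\<close> times the product of \<open>qfall\<close> at the torsion exponents, the form
  required by the method of moments.\<close>

lemma card_bases_mod_qfall:
  fixes F :: "'j \<Rightarrow> 'a poly" and b :: "'j \<Rightarrow> nat"
  assumes UV: "M.subspace U" "M.subspace V" "U \<subseteq> V" "finite V" and J: "finite J"
    and F: "\<And>j. j \<in> J \<Longrightarrow> Factorial_Ring.irreducible (F j)" "\<And>j k. j \<in> J \<Longrightarrow> k \<in> J \<Longrightarrow> j \<noteq> k \<Longrightarrow> \<not> F j dvd F k"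
  defines "L \<equiv> SIGMA j:J. {..<b j}"
  shows "real (card {w\<in>L \<rightarrow>\<^sub>E V. basis_mod U L (\<lambda>l. F (fst l)) w}) =
    real (card U) ^ card L * (\<Prod>j\<in>J. qfall (real CARD('a) ^ Polynomial.degree (F j)) ((real CARD('a) ^ Polynomial.degree (F j)) ^ tors_exp (F j) U V) (b j))"
proof -
  have L: "finite L" "fst ` L \<subseteq> J" using J by (auto simp: L_def)
  have cL: "card {l\<in>L. fst l = j} = b j" if "j \<in> J" for j
  proof -
    have "{l\<in>L. fst l = j} = Pair j ` {..<b j}" using that by (auto simp: L_def)
    then show ?thesis by (simp add: card_image inj_on_def)
  qed
  have "real (card {w\<in>L \<rightarrow>\<^sub>E V. basis_mod U L (\<lambda>l. F (fst l)) w}) =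
    (\<Prod>j\<in>J. \<Prod>i<card {l\<in>L. fst l = j}. real (card (tors (F j) U V)) - card U * (CARD('a) ^ Polynomial.degree (F j)) ^ i)"
    by (rule card_bases_mod[OF UV L(1) J L(2) F])
  also have "\<dots> = (\<Prod>j\<in>J. real (card U) ^ b j * qfall (real CARD('a) ^ Polynomial.degree (F j)) ((real CARD('a) ^ Polynomial.degree (F j)) ^ tors_exp (F j) U V) (b j))"
  proof (rule prod.cong[OF refl])
    fix j assume j: "j \<in> J"
    have "real (card (tors (F j) U V)) - card U * (CARD('a) ^ Polynomial.degree (F j)) ^ i =
      real (card U) * ((real CARD('a) ^ Polynomial.degree (F j)) ^ tors_exp (F j) U V - (real CARD('a) ^ Polynomial.degree (F j)) ^ i)" for i
      unfolding card_tors[OF UV F(1)[OF j]] by (simp add: right_diff_distrib)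
    then show "(\<Prod>i<card {l\<in>L. fst l = j}. real (card (tors (F j) U V)) - card U * (CARD('a) ^ Polynomial.degree (F j)) ^ i) =
      real (card U) ^ b j * qfall (real CARD('a) ^ Polynomial.degree (F j)) ((real CARD('a) ^ Polynomial.degree (F j)) ^ tors_exp (F j) U V) (b j)"
      by (simp only: cL[OF j] qfall_def prod.distrib) simp
  qed
  also have "\<dots> = real (card U) ^ card L * (\<Prod>j\<in>J. qfall (real CARD('a) ^ Polynomial.degree (F j)) ((real CARD('a) ^ Polynomial.degree (F j)) ^ tors_exp (F j) U V) (b j))"
    using J by (simp add: prod.distrib L_def power_sum)
  finally show ?thesis .
qed

end

section \<open>Row vectors as a module\<close>

text \<open>The polynomial \<open>f\<close> evaluated at the operator \<open>T\<close> and applied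
  to \<open>v\<close>, by Horner's rule; with \<open>pact_pCons\<close> the module laws become
  inductions on \<open>f\<close>.\<close>

definition pact :: "(('c \<Rightarrow> 'a::comm_ring_1) \<Rightarrow> 'c \<Rightarrow> 'a) \<Rightarrow> 'a poly \<Rightarrow> ('c \<Rightarrow> 'a) \<Rightarrow> 'c \<Rightarrow> 'a" where
  "pact T f v = fold_coeffs (\<lambda>a u. scal a v + T u) f 0"

locale lin_op =
  fixes T :: "('c \<Rightarrow> 'a::{field_gcd,finite}) \<Rightarrow> 'c \<Rightarrow> 'a"
  assumes T_add: "T (u + v) = T u + T v"
    and T_scal: "T (scal a u) = scal a (T u)"
begin

lemma T_0 [simp]: "T 0 = 0"
  using T_add[of 0 0] by simp

lemma pact_0 [simp]: "pact T 0 v = 0"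
  by (simp add: pact_def)

lemma pact_pCons: "pact T (pCons a f) v = scal a v + T (pact T f v)"
proof (cases "a = 0 \<and> f = 0")
  case False
  then show ?thesis by (auto simp: pact_def fold_coeffs_pCons_coeff_not_0_eq fold_coeffs_pCons_not_0_0_eq)
qed simp

lemma pact_add_right: "pact T f (u + v) = pact T f u + pact T f v"
  by (induction f) (simp_all add: pact_pCons T_add fv.scale_right_distrib algebra_simps)

lemma pact_add_left: "pact T (f + g) v = pact T f v + pact T g v"
proof (induction f arbitrary: g)
  case (pCons a f)
  obtain b h where "g = pCons b h" by (cases g)
  then show ?case using pCons.IH[of h] by (simp add: pact_pCons T_add fv.scale_left_distrib add_ac)
qed simp

lemma pact_smult: "pact T (Polynomial.smult c f) v = scal c (pact T f v)"
  by (induction f) (simp_all add: pact_pCons T_scal fv.scale_right_distrib del: scal_apply)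

lemma pact_mult: "pact T (f * g) v = pact T f (pact T g v)"
  by (induction f) (simp_all add: pact_pCons pact_add_left pact_smult)

sublocale poly_module "pact T"
proof unfold_locales
  show "pact T 1 v = v" for v by (simp add: one_pCons pact_pCons)
qed (simp_all add: pact_add_right pact_add_left pact_mult)

abbreviation tpow :: "nat \<Rightarrow> ('c \<Rightarrow> 'a) \<Rightarrow> 'c \<Rightarrow> 'a" where
  "tpow e v \<equiv> pact T (Polynomial.monom 1 e) v"

lemma tpow_0: "tpow 0 v = v"
  by (simp add: monom_0 pact_pCons)

lemma tpow_Suc: "tpow (Suc e) v = T (tpow e v)"
  by (simp add: monom_Suc pact_pCons)

lemma pact_eq_sum:
  assumes "f \<in> rpoly d" shows "pact T f v = (\<Sum>e<d. scal (Polynomial.coeff f e) (tpow e v))"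
proof -
  have "f = (\<Sum>e<d. Polynomial.smult (Polynomial.coeff f e) (Polynomial.monom 1 e))"
    using assms by (intro poly_eqI) (auto simp: coeff_sum rpoly_def if_distrib sum.delta cong: if_cong)
  then have "pact T f v = pact T (\<Sum>e<d. Polynomial.smult (Polynomial.coeff f e) (Polynomial.monom 1 e)) v" by simp
  also have "\<dots> = (\<Sum>e<d. scal (Polynomial.coeff f e) (tpow e v))"
    by (simp add: M.scale_sum_left pact_smult)
  finally show ?thesis .
qed

lemma comb_rpoly_apply:
  assumes "finite K" "\<And>k. k \<in> K \<Longrightarrow> g k \<in> rpoly (d k)"
  shows "comb K g x i = (\<Sum>(k, e)\<in>(SIGMA k:K. {..<d k}). Polynomial.coeff (g k) e * tpow e (x k) i)"
proof -
  have "comb K g x i = (\<Sum>k\<in>K. \<Sum>e<d k. Polynomial.coeff (g k) e * tpow e (x k) i)"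
    unfolding comb_def sum_fun_apply
  proof (rule sum.cong[OF refl])
    fix k assume k: "k \<in> K"
    show "pact T (g k) (x k) i = (\<Sum>e<d k. Polynomial.coeff (g k) e * tpow e (x k) i)"
      unfolding pact_eq_sum[OF assms(2)[OF k]] by (simp add: sum_fun_apply)
  qed
  then show ?thesis using assms(1) by (simp add: sum.Sigma)
qed

end

text \<open>\<open>Z\<close> is the transpose of the matrix: \<open>Z j\<close> is its \<open>j\<close>-th column, so that the columns of a row-vector product are independent.\<close>

definition mop :: "nat \<Rightarrow> (nat \<Rightarrow> nat \<Rightarrow> 'a) \<Rightarrow> (nat \<Rightarrow> 'a) \<Rightarrow> nat \<Rightarrow> 'a::comm_ring_1" where
  "mop n Z v = (\<lambda>j. if j < n then \<Sum>i<n. v i * Z j i else 0)"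

lemma lin_op_mop: "lin_op (mop n Z :: (nat \<Rightarrow> 'a::{field_gcd,finite}) \<Rightarrow> nat \<Rightarrow> 'a)"
  by standard (auto simp: mop_def fun_eq_iff fun_apply algebra_simps sum.distrib sum_distrib_left)

lemma mop_in_vecs: "mop n Z v \<in> vecs {..<n}"
  by (simp add: mop_def vecs_def)

text \<open>\<open>n\<close> and \<open>Z\<close> remain parameters, because later sums run over all
  matrices of a given size.\<close>

global_interpretation mo: lin_op "mop n Z :: (nat \<Rightarrow> 'a::{field_gcd,finite}) \<Rightarrow> nat \<Rightarrow> 'a"
  for n :: nat and Z :: "nat \<Rightarrow> nat \<Rightarrow> 'a::{field_gcd,finite}"
  by (rule lin_op_mop)

lemma mo_subspace_vecs:
  fixes Z :: "nat \<Rightarrow> nat \<Rightarrow> 'a::{field_gcd,finite}"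
  shows "mo.M.subspace n Z (vecs {..<n})"
proof (rule mo.M.subspaceI)
  show "(0 :: nat \<Rightarrow> 'a) \<in> vecs {..<n}" by (rule fv.subspace_0[OF subspace_vecs])
  show "u + v \<in> vecs {..<n}" if "u \<in> vecs {..<n}" "v \<in> vecs {..<n}" for u v :: "nat \<Rightarrow> 'a"
    using that fv.subspace_add[OF subspace_vecs] by blast
  fix f and v :: "nat \<Rightarrow> 'a" assume v: "v \<in> vecs {..<n}"
  show "pact (mop n Z) f v \<in> vecs {..<n}"
  proof (induction f)
    case 0
    show ?case using fv.subspace_0[OF subspace_vecs] by simp
  next
    case (pCons a f)
    have "scal a v \<in> vecs {..<n}" using v by (rule fv.subspace_scale[OF subspace_vecs])
    then show ?case unfolding mo.pact_pCons by (rule fv.subspace_add[OF subspace_vecs _ mop_in_vecs])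
  qed
qed

section \<open>Tuples with prescribed relations in Krylov coordinates\<close>

definition rel_tuples :: "nat \<Rightarrow> (nat \<Rightarrow> nat \<Rightarrow> 'a) \<Rightarrow> 'k set \<Rightarrow> ('k \<Rightarrow> 'a poly) \<Rightarrow> ('k \<Rightarrow> 'k \<Rightarrow> 'a poly) \<Rightarrow>
    ('k \<Rightarrow> nat \<Rightarrow> 'a::{field_gcd,finite}) set" where
  "rel_tuples n Z K f C = {x\<in>K \<rightarrow>\<^sub>E vecs {..<n}. (\<forall>k\<in>K. pact (mop n Z) (f k) (x k) = mo.comb n Z K (C k) x) \<and>
     (\<forall>g. (\<forall>k\<in>K. g k \<in> rpoly (Polynomial.degree (f k))) \<longrightarrow> mo.comb n Z K g x = 0 \<longrightarrow> (\<forall>k\<in>K. g k = 0))}"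

definition krylov_idx :: "'k set \<Rightarrow> ('k \<Rightarrow> 'a::zero poly) \<Rightarrow> ('k \<times> nat) set" where
  "krylov_idx K f = (SIGMA k:K. {..<Polynomial.degree (f k)})"

text \<open>Multiplication by \<open>t\<close> in the coordinates given by \<open>t ^ e\<close>
  applied to the \<open>k\<close>-th vector: a shift, except at the top power, which the relation
  for \<open>k\<close> expresses through lower ones.\<close>

definition krylov_map :: "'k set \<Rightarrow> ('k \<Rightarrow> 'a poly) \<Rightarrow> ('k \<Rightarrow> 'k \<Rightarrow> 'a poly) \<Rightarrow> ('k \<times> nat \<Rightarrow> 'a) \<Rightarrow> 'k \<times> nat \<Rightarrow> 'a::comm_ring_1" where
  "krylov_map K f C u = (\<lambda>(k, e). if (k, e) \<in> krylov_idx K f then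
     if Suc e < Polynomial.degree (f k) then u (k, Suc e)
     else (\<Sum>(m, e')\<in>krylov_idx K f. Polynomial.coeff (C k m) e' * u (m, e')) - (\<Sum>e'<Polynomial.degree (f k). Polynomial.coeff (f k) e' * u (k, e'))
   else 0)"

lemma krylov_map_vecs: "krylov_map K f C u \<in> vecs (krylov_idx K f)"
  by (auto simp: krylov_map_def vecs_def)

lemma (in lin_op) monic_pact:
  assumes "monic f"
  shows "pact T f v = tpow (Polynomial.degree f) v + (\<Sum>e<Polynomial.degree f. scal (Polynomial.coeff f e) (tpow e v))"
proof -
  have "f \<in> rpoly (Suc (Polynomial.degree f))" by (auto simp: rpoly_iff)
  from pact_eq_sum[OF this, of v] show ?thesis using assms by (simp add: add.commute)
qed

text \<open>Arrange the vectors \<open>t ^ e\<close> applied to \<open>x k\<close> as rows of a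
  matrix; \<open>to x i\<close> is its \<open>i\<close>-th column. Independence of the rows is the
  condition of \<open>injs\<close>. That the rows arise from one another by the matrix and satisfy
  the relations becomes one equation for each \<open>j\<close>, which involves only the column
  \<open>Z j\<close>. The rows with \<open>e = 0\<close> determine the others, hence
  \<open>fro\<close>.\<close>

lemma card_rel_tuples:
  fixes f :: "'k \<Rightarrow> 'a::{field_gcd,finite} poly" and Z :: "nat \<Rightarrow> nat \<Rightarrow> 'a"
  assumes K: "finite K" and f: "\<And>k. k \<in> K \<Longrightarrow> monic (f k) \<and> 0 < Polynomial.degree (f k)"
    and C: "\<And>k m. k \<in> K \<Longrightarrow> m \<in> K \<Longrightarrow> C k m \<in> rpoly (Polynomial.degree (f m))"
  defines "D \<equiv> krylov_idx K f"
  shows "card (rel_tuples n Z K f C) = card {\<phi>\<in>{..<n} \<rightarrow>\<^sub>E vecs D. (\<forall>u\<in>vecs D. u \<noteq> 0 \<longrightarrow> (\<exists>i<n. dot D u (\<phi> i) \<noteq> 0)) \<and>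
     (\<forall>j<n. (\<Sum>i<n. scal (Z j i) (\<phi> i)) = krylov_map K f C (\<phi> j))}" (is "_ = card ?I")
proof -
  let ?d = "\<lambda>k. Polynomial.degree (f k)"
  let ?V = "vecs {..<n} :: (nat \<Rightarrow> 'a) set"
  let ?tp = "mo.tpow n Z"
  have D: "finite D" "D = (SIGMA k:K. {..<?d k})" using K by (auto simp: D_def krylov_idx_def)
  define to where "to = (\<lambda>x. \<lambda>i\<in>{..<n}. \<lambda>(k, e). if (k, e) \<in> D then ?tp e (x k) i else (0::'a))"
  define fro where "fro = (\<lambda>\<phi> :: nat \<Rightarrow> 'k \<times> nat \<Rightarrow> 'a. \<lambda>k\<in>K. \<lambda>i. if i < n then \<phi> i (k, 0) else 0)"
  have tpV: "?tp e v \<in> ?V" if "v \<in> ?V" for e v using that mo.M.subspace_scale[OF mo_subspace_vecs] by blast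
  have toV: "to x \<in> {..<n} \<rightarrow>\<^sub>E vecs D" for x by (auto simp: to_def vecs_def)
  have to_app: "to x i (k, e) = ?tp e (x k) i" if "i < n" "(k, e) \<in> D" for x i k e using that by (simp add: to_def)
  have comb_dot: "mo.comb n Z K g x i = dot D (\<lambda>(k, e). Polynomial.coeff (g k) e) (to x i)"
    if "\<And>k. k \<in> K \<Longrightarrow> g k \<in> rpoly (?d k)" "i < n" for g x i
  proof -
    have "mo.comb n Z K g x i = (\<Sum>(k, e)\<in>D. Polynomial.coeff (g k) e * ?tp e (x k) i)"
      unfolding D(2) by (rule mo.comb_rpoly_apply[OF K that(1)])
    also have "\<dots> = dot D (\<lambda>(k, e). Polynomial.coeff (g k) e) (to x i)"
      unfolding dot_def by (intro sum.cong) (auto simp: to_app that(2))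
    finally show ?thesis .
  qed
  have vec0: "v = 0" if "v \<in> ?V" "\<And>i. i < n \<Longrightarrow> v i = 0" for v
    using that by (auto simp: fun_eq_iff fun_apply vecs_def)
  have combV: "mo.comb n Z K g x \<in> ?V" if "x \<in> K \<rightarrow>\<^sub>E ?V" for g x
    using that by (intro mo.comb_mem mo_subspace_vecs mo.M.subspace_scale[OF mo_subspace_vecs]) auto
  have inj_iff: "(\<forall>g. (\<forall>k\<in>K. g k \<in> rpoly (?d k)) \<longrightarrow> mo.comb n Z K g x = 0 \<longrightarrow> (\<forall>k\<in>K. g k = 0)) \<longleftrightarrow>
      (\<forall>u\<in>vecs D. u \<noteq> 0 \<longrightarrow> (\<exists>i<n. dot D u (to x i) \<noteq> 0))" if x: "x \<in> K \<rightarrow>\<^sub>E ?V" for x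
  proof
    assume *: "\<forall>g. (\<forall>k\<in>K. g k \<in> rpoly (?d k)) \<longrightarrow> mo.comb n Z K g x = 0 \<longrightarrow> (\<forall>k\<in>K. g k = 0)"
    show "\<forall>u\<in>vecs D. u \<noteq> 0 \<longrightarrow> (\<exists>i<n. dot D u (to x i) \<noteq> 0)"
    proof (intro ballI impI, rule ccontr)
      fix u assume u: "u \<in> vecs D" "u \<noteq> 0" "\<not> (\<exists>i<n. dot D u (to x i) \<noteq> 0)"
      define g where "g = (\<lambda>k. \<Sum>e<?d k. Polynomial.monom (u (k, e)) e)"
      have cg: "Polynomial.coeff (g k) e = (if e < ?d k then u (k, e) else 0)" for k e
        by (simp add: g_def coeff_sum if_distrib sum.delta cong: if_cong)
      have g: "g k \<in> rpoly (?d k)" for k by (simp add: rpoly_def cg)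
      have "mo.comb n Z K g x = 0"
      proof (rule vec0[OF combV[OF x]])
        fix i assume i: "i < n"
        have "mo.comb n Z K g x i = dot D (\<lambda>(k, e). Polynomial.coeff (g k) e) (to x i)" by (rule comb_dot[OF g i])
        also have "\<dots> = dot D u (to x i)" unfolding dot_def by (intro sum.cong) (auto simp: cg D(2))
        finally show "mo.comb n Z K g x i = 0" using u(3) i by simp
      qed
      then have g0: "\<forall>k\<in>K. g k = 0" using * g by blast
      have "u (k, e) = 0" for k e
      proof (cases "(k, e) \<in> D")
        case True
        then have "u (k, e) = Polynomial.coeff (g k) e" by (auto simp: cg D(2))
        then show ?thesis using g0 True by (auto simp: D(2))
      next
        case False
        then show ?thesis using u(1) by (auto simp: vecs_def)
      qed
      then show False using u(2) by (auto simp: fun_eq_iff fun_apply)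
    qed
  next
    assume *: "\<forall>u\<in>vecs D. u \<noteq> 0 \<longrightarrow> (\<exists>i<n. dot D u (to x i) \<noteq> 0)"
    show "\<forall>g. (\<forall>k\<in>K. g k \<in> rpoly (?d k)) \<longrightarrow> mo.comb n Z K g x = 0 \<longrightarrow> (\<forall>k\<in>K. g k = 0)"
    proof (intro allI impI)
      fix g assume g: "\<forall>k\<in>K. g k \<in> rpoly (?d k)" "mo.comb n Z K g x = 0"
      define u where "u = (\<lambda>(k, e). if (k, e) \<in> D then Polynomial.coeff (g k) e else 0)"
      have uV: "u \<in> vecs D" by (auto simp: u_def vecs_def)
      have "dot D u (to x i) = 0" if "i < n" for i
      proof -
        have "dot D u (to x i) = dot D (\<lambda>(k, e). Polynomial.coeff (g k) e) (to x i)"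
          unfolding dot_def by (intro sum.cong) (auto simp: u_def)
        also have "\<dots> = mo.comb n Z K g x i" using g(1) that by (intro comb_dot[symmetric]) auto
        finally show ?thesis using g(2) by (simp add: fun_apply)
      qed
      then have u0: "u = 0" using * uV by blast
      show "\<forall>k\<in>K. g k = 0"
      proof
        fix k assume k: "k \<in> K"
        have "Polynomial.coeff (g k) e = 0" for e
        proof (cases "e < ?d k")
          case True
          then have "Polynomial.coeff (g k) e = u (k, e)" using k by (simp add: u_def D(2))
          then show ?thesis using u0 by (simp add: fun_apply)
        next
          case False
          then show ?thesis using g(1) k by (auto simp: rpoly_def)
        qed
        then show "g k = 0" by (simp add: poly_eq_iff)
      qed
    qed
  qed
  have mop_app: "(\<Sum>i<n. scal (Z j i) (to x i)) (k, e) = ?tp (Suc e) (x k) j"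
    if "x \<in> K \<rightarrow>\<^sub>E ?V" "j < n" "(k, e) \<in> D" for x j k e
    using that by (simp add: sum_fun_apply to_app mo.tpow_Suc mop_def mult.commute)
  have rel_iff: "(\<forall>k\<in>K. pact (mop n Z) (f k) (x k) = mo.comb n Z K (C k) x) \<longleftrightarrow>
      (\<forall>j<n. (\<Sum>i<n. scal (Z j i) (to x i)) = krylov_map K f C (to x j))" if x: "x \<in> K \<rightarrow>\<^sub>E ?V" for x
  proof -
    \<comment> \<open>At the top power the equation is the relation for \<open>k\<close> read in
      coordinate \<open>j\<close>; below it, it defines the next row.\<close>
    have top: "(\<Sum>i<n. scal (Z j i) (to x i)) (k, ?d k - 1) = krylov_map K f C (to x j) (k, ?d k - 1) \<longleftrightarrow>
       pact (mop n Z) (f k) (x k) j = mo.comb n Z K (C k) x j" if "j < n" "k \<in> K" for j k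
    proof -
      have dk: "0 < ?d k" "monic (f k)" using f that by auto
      have inD: "(k, ?d k - 1) \<in> D" using dk that by (simp add: D(2))
      have "krylov_map K f C (to x j) (k, ?d k - 1) =
        (\<Sum>(m, e')\<in>D. Polynomial.coeff (C k m) e' * to x j (m, e')) - (\<Sum>e'<?d k. Polynomial.coeff (f k) e' * to x j (k, e'))"
        using inD dk unfolding D_def by (simp add: krylov_map_def)
      also have "(\<Sum>(m, e')\<in>D. Polynomial.coeff (C k m) e' * to x j (m, e')) = mo.comb n Z K (C k) x j"
        using comb_dot[of "C k" j x] C[OF that(2)] that(1) by (simp add: dot_def case_prod_unfold)
      also have "(\<Sum>e'<?d k. Polynomial.coeff (f k) e' * to x j (k, e')) = (\<Sum>e'<?d k. Polynomial.coeff (f k) e' * ?tp e' (x k) j)"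
        using that by (intro sum.cong) (auto simp: to_app D(2))
      finally have 1: "krylov_map K f C (to x j) (k, ?d k - 1) =
        mo.comb n Z K (C k) x j - (\<Sum>e'<?d k. Polynomial.coeff (f k) e' * ?tp e' (x k) j)" .
      have 2: "(\<Sum>i<n. scal (Z j i) (to x i)) (k, ?d k - 1) = ?tp (?d k) (x k) j"
        using mop_app[OF x that(1) inD] dk by simp
      have 3: "pact (mop n Z) (f k) (x k) j = ?tp (?d k) (x k) j + (\<Sum>e'<?d k. Polynomial.coeff (f k) e' * ?tp e' (x k) j)"
        by (subst mo.monic_pact[OF dk(2)]) (simp add: fun_apply sum_fun_apply)
      show ?thesis unfolding 1 2 3 by (auto simp: algebra_simps)
    qed
    have low: "(\<Sum>i<n. scal (Z j i) (to x i)) (k, e) = krylov_map K f C (to x j) (k, e)"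
      if "j < n" "(k, e) \<in> D" "Suc e < ?d k" for j k e
    proof -
      have "(k, Suc e) \<in> D" using that by (simp add: D(2))
      then show ?thesis using mop_app[OF x that(1,2)] that to_app[OF that(1), of k "Suc e" x]
        unfolding D_def by (simp add: krylov_map_def)
    qed
    have out: "(\<Sum>i<n. scal (Z j i) (to x i)) (k, e) = krylov_map K f C (to x j) (k, e)"
      if "(k, e) \<notin> D" for j k e
    proof -
      have "to x i (k, e) = 0" if "i < n" for i using that \<open>(k, e) \<notin> D\<close> by (simp add: to_def)
      then have "(\<Sum>i<n. scal (Z j i) (to x i)) (k, e) = 0" by (simp add: sum_fun_apply)
      then show ?thesis using that unfolding D_def by (simp add: krylov_map_def)
    qed
    have eq_iff: "(\<Sum>i<n. scal (Z j i) (to x i)) = krylov_map K f C (to x j) \<longleftrightarrow>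
      (\<forall>k\<in>K. pact (mop n Z) (f k) (x k) j = mo.comb n Z K (C k) x j)" if j: "j < n" for j
    proof
      assume "(\<Sum>i<n. scal (Z j i) (to x i)) = krylov_map K f C (to x j)"
      then show "\<forall>k\<in>K. pact (mop n Z) (f k) (x k) j = mo.comb n Z K (C k) x j" using top[OF j] by metis
    next
      assume *: "\<forall>k\<in>K. pact (mop n Z) (f k) (x k) j = mo.comb n Z K (C k) x j"
      show "(\<Sum>i<n. scal (Z j i) (to x i)) = krylov_map K f C (to x j)"
      proof
        fix p :: "'k \<times> nat"
        obtain k e where p: "p = (k, e)" by (cases p)
        show "(\<Sum>i<n. scal (Z j i) (to x i)) p = krylov_map K f C (to x j) p"
        proof (cases "(k, e) \<in> D")
          case True
          then have k: "k \<in> K" "e < ?d k" by (auto simp: D(2))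
          show ?thesis
          proof (cases "Suc e < ?d k")
            case True
            then show ?thesis using low[OF j \<open>(k, e) \<in> D\<close>] p by simp
          next
            case False
            then have "e = ?d k - 1" using k by simp
            then show ?thesis using top[OF j k(1)] * k(1) p by simp
          qed
        next
          case False
          then show ?thesis using out p by simp
        qed
      qed
    qed
    have "(pact (mop n Z) (f k) (x k) = mo.comb n Z K (C k) x) \<longleftrightarrow>
      (\<forall>j<n. pact (mop n Z) (f k) (x k) j = mo.comb n Z K (C k) x j)" if k: "k \<in> K" for k
    proof
      assume *: "\<forall>j<n. pact (mop n Z) (f k) (x k) j = mo.comb n Z K (C k) x j"
      have "pact (mop n Z) (f k) (x k) \<in> ?V" using x k mo.M.subspace_scale[OF mo_subspace_vecs] by blast
      moreover have "mo.comb n Z K (C k) x \<in> ?V" by (rule combV[OF x])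
      ultimately show "pact (mop n Z) (f k) (x k) = mo.comb n Z K (C k) x"
        using * by (auto simp: fun_eq_iff vecs_def) (metis not_le)
    qed simp
    then show ?thesis using eq_iff by blast
  qed
  have fro_to: "fro (to x) = x" if x: "x \<in> K \<rightarrow>\<^sub>E ?V" for x
  proof
    fix k
    show "fro (to x) k = x k"
    proof (cases "k \<in> K")
      case True
      then have "(k, 0) \<in> D" using f by (simp add: D(2))
      then have "fro (to x) k i = x k i" for i
        using True PiE_mem[OF x True] by (auto simp: fro_def to_app mo.tpow_0 vecs_def)
      then show ?thesis by (rule ext)
    next
      case False
      then show ?thesis using PiE_arb[OF x] by (simp add: fro_def)
    qed
  qed
  have froV: "fro \<phi> \<in> K \<rightarrow>\<^sub>E ?V" for \<phi> by (auto simp: fro_def vecs_def)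
  have to_fro: "to (fro \<phi>) = \<phi>" if \<phi>: "\<phi> \<in> ?I" for \<phi>
  proof -
    have \<phi>V: "\<phi> \<in> {..<n} \<rightarrow>\<^sub>E vecs D" using \<phi> by auto
    \<comment> \<open>The shift equations force row \<open>e\<close> to be \<open>t ^ e\<close>
      applied to row 0.\<close>
    have tp: "\<forall>i<n. ?tp e (fro \<phi> k) i = \<phi> i (k, e)" if "(k, e) \<in> D" for k e
      using that
    proof (induction e)
      case 0
      then have "k \<in> K" by (auto simp: D(2))
      then show ?case by (simp add: mo.tpow_0 fro_def)
    next
      case (Suc e)
      then have ke: "(k, e) \<in> D" "Suc e < ?d k" by (auto simp: D(2))
      show ?case
      proof (intro allI impI)
        fix i assume i: "i < n"
        have "?tp (Suc e) (fro \<phi> k) i = (\<Sum>l<n. ?tp e (fro \<phi> k) l * Z i l)" using i by (simp add: mo.tpow_Suc mop_def)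
        also have "\<dots> = (\<Sum>l<n. scal (Z i l) (\<phi> l)) (k, e)"
          using Suc.IH[OF ke(1)] by (simp add: sum_fun_apply mult.commute)
        also have "\<dots> = krylov_map K f C (\<phi> i) (k, e)" using \<phi> i by simp
        also have "\<dots> = \<phi> i (k, Suc e)" using ke unfolding D_def by (simp add: krylov_map_def)
        finally show "?tp (Suc e) (fro \<phi> k) i = \<phi> i (k, Suc e)" .
      qed
    qed
    show ?thesis
    proof (rule PiE_ext[OF toV \<phi>V])
      fix i assume i: "i \<in> {..<n}"
      show "to (fro \<phi>) i = \<phi> i"
      proof
        fix p :: "'k \<times> nat"
        obtain k e where p: "p = (k, e)" by (cases p)
        show "to (fro \<phi>) i p = \<phi> i p"
        proof (cases "p \<in> D")
          case True
          then show ?thesis using i p tp[of k e] by (simp add: to_app)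
        next
          case False
          then show ?thesis using PiE_mem[OF \<phi>V i] PiE_mem[OF toV i] by (auto simp: vecs_def p)
        qed
      qed
    qed
  qed
  have "bij_betw to (rel_tuples n Z K f C) ?I"
  proof (rule bij_betw_byWitness[where f' = fro])
    show "\<forall>x\<in>rel_tuples n Z K f C. fro (to x) = x" using fro_to by (auto simp: rel_tuples_def)
    show "\<forall>\<phi>\<in>?I. to (fro \<phi>) = \<phi>" using to_fro by blast
    show "to ` rel_tuples n Z K f C \<subseteq> ?I"
      using toV inj_iff rel_iff by (auto simp: rel_tuples_def)
    show "fro ` ?I \<subseteq> rel_tuples n Z K f C"
    proof clarify
      fix \<phi> assume "\<phi> \<in> {..<n} \<rightarrow>\<^sub>E vecs D" "\<forall>u\<in>vecs D. u \<noteq> 0 \<longrightarrow> (\<exists>i<n. dot D u (\<phi> i) \<noteq> 0)"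
        "\<forall>j<n. (\<Sum>i<n. scal (Z j i) (\<phi> i)) = krylov_map K f C (\<phi> j)"
      then have \<phi>: "\<phi> \<in> ?I" by simp
      then have "(\<forall>u\<in>vecs D. u \<noteq> 0 \<longrightarrow> (\<exists>i<n. dot D u (to (fro \<phi>) i) \<noteq> 0)) \<and>
        (\<forall>j<n. (\<Sum>i<n. scal (Z j i) (to (fro \<phi>) i)) = krylov_map K f C (to (fro \<phi>) j))"
        by (simp add: to_fro[OF \<phi>])
      then show "fro \<phi> \<in> rel_tuples n Z K f C"
        unfolding inj_iff[OF froV, symmetric] rel_iff[OF froV, symmetric] using froV by (simp add: rel_tuples_def)
    qed
  qed
  then show ?thesis by (rule bij_betw_same_card)
qed

section \<open>Extending a basis by vectors independent modulo its span\<close>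

context poly_module
begin

lemma comb_Plus:
  assumes "finite K" "finite L"
  shows "comb (K <+> L) g y = comb K (g \<circ> Inl) (y \<circ> Inl) + comb L (g \<circ> Inr) (y \<circ> Inr)"
  unfolding comb_def by (subst sum.Plus[OF assms]) simp

lemma spn_rpoly:
  assumes b: "basis_mod {0} K f x" and K: "finite K" and f: "\<And>k. k \<in> K \<Longrightarrow> f k \<noteq> 0" and y: "y \<in> spn K x"
  shows "\<exists>c\<in>(\<Pi>\<^sub>E k\<in>K. rpoly (Polynomial.degree (f k))). y = comb K c x"
proof -
  have "bij_betw (\<lambda>(u, g). u + comb K g x) ({0} \<times> (\<Pi>\<^sub>E k\<in>K. rpoly (Polynomial.degree (f k)))) (ssum {0} (spn K x))"
    by (rule bij_ssum_spn[OF b _ K f]) simp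
  then have "y \<in> (\<lambda>(u, g). u + comb K g x) ` ({0} \<times> (\<Pi>\<^sub>E k\<in>K. rpoly (Polynomial.degree (f k))))"
    using y by (simp add: bij_betw_def)
  then show ?thesis by auto
qed

text \<open>\<open>f k\<close> kills \<open>x k\<close>, and \<open>h l\<close> sends
  \<open>w l\<close> into the span of \<open>x\<close>, so every combination can be reduced to
  residues without leaving the coset in question. Linear independence of all residues together is
  thus independence in two stages.\<close>

lemma reduced_independent_iff:
  assumes K: "finite K" and L: "finite L" and f: "\<And>k. k \<in> K \<Longrightarrow> f k \<noteq> 0" and h: "\<And>l. l \<in> L \<Longrightarrow> h l \<noteq> 0"
    and fx: "\<And>k. k \<in> K \<Longrightarrow> f k \<star> x k = 0" and hw: "\<And>l. l \<in> L \<Longrightarrow> h l \<star> w l \<in> spn K x"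
  shows "(\<forall>g g'. (\<forall>k\<in>K. g k \<in> rpoly (Polynomial.degree (f k))) \<longrightarrow> (\<forall>l\<in>L. g' l \<in> rpoly (Polynomial.degree (h l))) \<longrightarrow>
      comb K g x + comb L g' w = 0 \<longrightarrow> (\<forall>k\<in>K. g k = 0) \<and> (\<forall>l\<in>L. g' l = 0)) \<longleftrightarrow>
    basis_mod {0} K f x \<and> basis_mod (spn K x) L h w"
proof
  assume b: "basis_mod {0} K f x \<and> basis_mod (spn K x) L h w"
  show "\<forall>g g'. (\<forall>k\<in>K. g k \<in> rpoly (Polynomial.degree (f k))) \<longrightarrow> (\<forall>l\<in>L. g' l \<in> rpoly (Polynomial.degree (h l))) \<longrightarrow>
      comb K g x + comb L g' w = 0 \<longrightarrow> (\<forall>k\<in>K. g k = 0) \<and> (\<forall>l\<in>L. g' l = 0)"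
  proof (intro allI impI)
    fix g g' assume g: "\<forall>k\<in>K. g k \<in> rpoly (Polynomial.degree (f k))" and g': "\<forall>l\<in>L. g' l \<in> rpoly (Polynomial.degree (h l))"
      and 0: "comb K g x + comb L g' w = 0"
    have "comb L g' w = - comb K g x" using 0 by (simp add: eq_neg_iff_add_eq_0 add.commute)
    then have "comb L g' w \<in> spn K x" using M.subspace_neg[OF subspace_spn comb_in_spn] by simp
    then have g'0: "\<forall>l\<in>L. g' l = 0" using basis_mod_D(1)[of "spn K x" L h w g'] b g' dvd_rpoly_imp_0 by blast
    then have "comb L g' w = comb L (\<lambda>_. 0) w" by (intro comb_cong) auto
    then have "comb K g x \<in> {0}" using 0 by simp
    then have "\<forall>k\<in>K. g k = 0" using basis_mod_D(1)[of "{0}" K f x g] b g dvd_rpoly_imp_0 by blast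
    then show "(\<forall>k\<in>K. g k = 0) \<and> (\<forall>l\<in>L. g' l = 0)" using g'0 by blast
  qed
next
  assume ind: "\<forall>g g'. (\<forall>k\<in>K. g k \<in> rpoly (Polynomial.degree (f k))) \<longrightarrow> (\<forall>l\<in>L. g' l \<in> rpoly (Polynomial.degree (h l))) \<longrightarrow>
      comb K g x + comb L g' w = 0 \<longrightarrow> (\<forall>k\<in>K. g k = 0) \<and> (\<forall>l\<in>L. g' l = 0)"
  have modK: "comb K g x = comb K (\<lambda>k. g k mod f k) x" for g
  proof (rule comb_cong)
    fix k assume k: "k \<in> K"
    have "g k \<star> x k = (g k div f k * f k + g k mod f k) \<star> x k" by simp
    also have "\<dots> = (g k div f k) \<star> (f k \<star> x k) + (g k mod f k) \<star> x k"
      by (simp only: M.scale_left_distrib M.scale_scale)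
    finally show "g k \<star> x k = (g k mod f k) \<star> x k" using fx[OF k] by simp
  qed
  have b1: "basis_mod {0} K f x"
    unfolding basis_mod_def
  proof (intro allI iffI ballI)
    fix g k assume 0: "comb K g x \<in> {0}" and k: "k \<in> K"
    have "comb K (\<lambda>k. g k mod f k) x + comb L (\<lambda>_. 0) w = 0" using 0 modK[of g] by simp
    then have "\<forall>k\<in>K. g k mod f k = 0" using ind[rule_format, of "\<lambda>k. g k mod f k" "\<lambda>_. 0"] f mod_rpoly by auto
    then show "f k dvd g k" using k by (simp add: mod_eq_0_iff_dvd)
  next
    fix g assume "\<forall>k\<in>K. f k dvd g k"
    then have "comb K (\<lambda>k. g k mod f k) x = comb K (\<lambda>_. 0) x" by (intro comb_cong) (simp add: mod_eq_0_iff_dvd)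
    then show "comb K g x \<in> {0}" using modK[of g] by simp
  qed
  have b2: "basis_mod (spn K x) L h w"
    unfolding basis_mod_def
  proof (intro allI iffI ballI)
    fix g l assume g: "comb L g w \<in> spn K x" and l: "l \<in> L"
    have eq: "comb L g w = comb L (\<lambda>l. g l div h l * h l) w + comb L (\<lambda>l. g l mod h l) w"
      unfolding comb_add[symmetric] by (rule comb_cong) simp
    have "comb L (\<lambda>l. g l div h l * h l) w \<in> spn K x"
    proof (rule comb_mem[OF subspace_spn])
      fix l assume l: "l \<in> L"
      have "(g l div h l * h l) \<star> w l = (g l div h l) \<star> (h l \<star> w l)" by simp
      then show "(g l div h l * h l) \<star> w l \<in> spn K x"
        using M.subspace_scale[OF subspace_spn hw[OF l]] by metis
    qed
    then have "comb L (\<lambda>l. g l mod h l) w \<in> spn K x"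
      using M.subspace_diff[OF subspace_spn g] eq by fastforce
    then obtain c where c: "c \<in> (\<Pi>\<^sub>E k\<in>K. rpoly (Polynomial.degree (f k)))" "comb L (\<lambda>l. g l mod h l) w = comb K c x"
      using spn_rpoly[OF b1 K f] by blast
    have "comb K (\<lambda>k. 0 - c k) x + comb L (\<lambda>l. g l mod h l) w = 0"
      unfolding comb_diff using c(2) by simp
    moreover have "\<forall>k\<in>K. 0 - c k \<in> rpoly (Polynomial.degree (f k))" using c(1) by (intro ballI diff_rpoly) auto
    ultimately have "\<forall>l\<in>L. g l mod h l = 0"
      using ind[rule_format, of "\<lambda>k. 0 - c k" "\<lambda>l. g l mod h l"] h mod_rpoly by auto
    then show "h l dvd g l" using l by (simp add: mod_eq_0_iff_dvd)
  next
    fix g assume g: "\<forall>l\<in>L. h l dvd g l"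
    show "comb L g w \<in> spn K x"
    proof (rule comb_mem[OF subspace_spn])
      fix l assume l: "l \<in> L"
      obtain d where "g l = h l * d" using bspec[OF g l] by (rule dvdE)
      then have "g l \<star> w l = d \<star> (h l \<star> w l)" by (simp add: mult.commute)
      then show "g l \<star> w l \<in> spn K x" using M.subspace_scale[OF subspace_spn hw[OF l]] by metis
    qed
  qed
  show "basis_mod {0} K f x \<and> basis_mod (spn K x) L h w" using b1 b2 by blast
qed

end

lemma ball_Plus: "(\<forall>s\<in>K <+> L. P s) \<longleftrightarrow> (\<forall>k\<in>K. P (Inl k)) \<and> (\<forall>l\<in>L. P (Inr l))"
  by (blast intro: InlI InrI elim: PlusE)

text \<open>Right-hand sides of the relations: zero for an old generator, and for a new generator
  \<open>l\<close> the combination of old ones with coefficients \<open>C l\<close>.\<close>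

definition rel_coeffs :: "('l \<Rightarrow> 'k \<Rightarrow> 'a) \<Rightarrow> 'k + 'l \<Rightarrow> 'k + 'l \<Rightarrow> 'a::zero" where
  "rel_coeffs C s t = (case s of Inl _ \<Rightarrow> 0 | Inr l \<Rightarrow> (case t of Inl k \<Rightarrow> C l k | Inr _ \<Rightarrow> 0))"

text \<open>One function on the disjoint sum instead of a pair, so that it is itself a tuple to
  which \<open>rel_tuples\<close> applies.\<close>

definition ext_pairs :: "nat \<Rightarrow> (nat \<Rightarrow> nat \<Rightarrow> 'a) \<Rightarrow> 'k set \<Rightarrow> ('k \<Rightarrow> 'a poly) \<Rightarrow> 'l set \<Rightarrow> ('l \<Rightarrow> 'a poly) \<Rightarrow>
    ('k + 'l \<Rightarrow> nat \<Rightarrow> 'a::{field_gcd,finite}) set" where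
  "ext_pairs n Z K f L h = {y\<in>K <+> L \<rightarrow>\<^sub>E vecs {..<n}. mo.basis_mod n Z {0} K f (y \<circ> Inl) \<and>
     mo.basis_mod n Z (mo.spn n Z K (y \<circ> Inl)) L h (y \<circ> Inr)}"

lemma rel_tuples_iff_ext_pairs:
  fixes f :: "'k \<Rightarrow> 'a::{field_gcd,finite} poly" and h :: "'l \<Rightarrow> 'a poly" and Z :: "nat \<Rightarrow> nat \<Rightarrow> 'a"
  assumes K: "finite K" and L: "finite L" and f: "\<And>k. k \<in> K \<Longrightarrow> f k \<noteq> 0" and h: "\<And>l. l \<in> L \<Longrightarrow> h l \<noteq> 0"
  shows "y \<in> rel_tuples n Z (K <+> L) (case_sum f h) (rel_coeffs C) \<longleftrightarrow>
    y \<in> ext_pairs n Z K f L h \<and> (\<forall>l\<in>L. pact (mop n Z) (h l) (y (Inr l)) = mo.comb n Z K (C l) (y \<circ> Inl))"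
proof -
  let ?fh = "case_sum f h" and ?x = "y \<circ> Inl" and ?w = "y \<circ> Inr"
  have rc: "mo.comb n Z (K <+> L) (rel_coeffs C (Inl k)) y = 0" "mo.comb n Z (K <+> L) (rel_coeffs C (Inr l)) y = mo.comb n Z K (C l) ?x" for k l
  proof -
    have "rel_coeffs C (Inl k) \<circ> Inl = (\<lambda>_. 0)" "rel_coeffs C (Inl k) \<circ> Inr = (\<lambda>_. 0)"
      "rel_coeffs C (Inr l) \<circ> Inl = C l" "rel_coeffs C (Inr l) \<circ> Inr = (\<lambda>_. 0)"
      by (auto simp: rel_coeffs_def fun_eq_iff)
    then show "mo.comb n Z (K <+> L) (rel_coeffs C (Inl k)) y = 0" "mo.comb n Z (K <+> L) (rel_coeffs C (Inr l)) y = mo.comb n Z K (C l) ?x"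
      unfolding mo.comb_Plus[OF K L] by simp_all
  qed
  have rel: "(\<forall>k\<in>K <+> L. pact (mop n Z) (?fh k) (y k) = mo.comb n Z (K <+> L) (rel_coeffs C k) y) \<longleftrightarrow>
    (\<forall>k\<in>K. pact (mop n Z) (f k) (?x k) = 0) \<and> (\<forall>l\<in>L. pact (mop n Z) (h l) (?w l) = mo.comb n Z K (C l) ?x)"
    unfolding ball_Plus by (simp add: rc)
  have ind: "(\<forall>g. (\<forall>k\<in>K <+> L. g k \<in> rpoly (Polynomial.degree (?fh k))) \<longrightarrow> mo.comb n Z (K <+> L) g y = 0 \<longrightarrow> (\<forall>k\<in>K <+> L. g k = 0)) \<longleftrightarrow>
    (\<forall>g g'. (\<forall>k\<in>K. g k \<in> rpoly (Polynomial.degree (f k))) \<longrightarrow> (\<forall>l\<in>L. g' l \<in> rpoly (Polynomial.degree (h l))) \<longrightarrow>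
      mo.comb n Z K g ?x + mo.comb n Z L g' ?w = 0 \<longrightarrow> (\<forall>k\<in>K. g k = 0) \<and> (\<forall>l\<in>L. g' l = 0))" (is "?A \<longleftrightarrow> ?B")
  proof
    assume ?A
    show ?B
    proof (intro allI impI)
      fix g g' assume a: "\<forall>k\<in>K. g k \<in> rpoly (Polynomial.degree (f k))" "\<forall>l\<in>L. g' l \<in> rpoly (Polynomial.degree (h l))"
        "mo.comb n Z K g ?x + mo.comb n Z L g' ?w = 0"
      have c0: "mo.comb n Z (K <+> L) (case_sum g g') y = 0"
        unfolding mo.comb_Plus[OF K L] using a(3) by (simp add: case_sum_o_inj)
      have c1: "\<forall>k\<in>K <+> L. case_sum g g' k \<in> rpoly (Polynomial.degree (?fh k))" using a(1,2) by (simp add: ball_Plus)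
      have "\<forall>k\<in>K <+> L. case_sum g g' k = 0"
        by (rule \<open>?A\<close>[THEN spec[of _ "case_sum g g'"], THEN mp, THEN mp, OF c1 c0])
      then show "(\<forall>k\<in>K. g k = 0) \<and> (\<forall>l\<in>L. g' l = 0)" by (simp add: ball_Plus)
    qed
  next
    assume ?B
    show ?A
    proof (intro allI impI)
      fix g assume a: "\<forall>k\<in>K <+> L. g k \<in> rpoly (Polynomial.degree (?fh k))" "mo.comb n Z (K <+> L) g y = 0"
      then have c0: "mo.comb n Z K (g \<circ> Inl) ?x + mo.comb n Z L (g \<circ> Inr) ?w = 0"
        unfolding mo.comb_Plus[OF K L] by simp
      have c1: "\<forall>k\<in>K. (g \<circ> Inl) k \<in> rpoly (Polynomial.degree (f k))" "\<forall>l\<in>L. (g \<circ> Inr) l \<in> rpoly (Polynomial.degree (h l))"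
        using a(1) by (simp_all add: ball_Plus)
      have "(\<forall>k\<in>K. (g \<circ> Inl) k = 0) \<and> (\<forall>l\<in>L. (g \<circ> Inr) l = 0)"
        by (rule \<open>?B\<close>[THEN spec[of _ "g \<circ> Inl"], THEN spec[of _ "g \<circ> Inr"], THEN mp, THEN mp, THEN mp, OF c1 c0])
      then show "\<forall>k\<in>K <+> L. g k = 0" by (simp add: ball_Plus)
    qed
  qed
  have key: "B' \<longleftrightarrow> mo.basis_mod n Z {0} K f ?x \<and> mo.basis_mod n Z (mo.spn n Z K ?x) L h ?w"
    if fx: "\<forall>k\<in>K. pact (mop n Z) (f k) (?x k) = 0" and hw: "\<forall>l\<in>L. pact (mop n Z) (h l) (?w l) = mo.comb n Z K (C l) ?x"
      and B': "B' = (\<forall>g g'. (\<forall>k\<in>K. g k \<in> rpoly (Polynomial.degree (f k))) \<longrightarrow> (\<forall>l\<in>L. g' l \<in> rpoly (Polynomial.degree (h l))) \<longrightarrow>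
      mo.comb n Z K g ?x + mo.comb n Z L g' ?w = 0 \<longrightarrow> (\<forall>k\<in>K. g k = 0) \<and> (\<forall>l\<in>L. g' l = 0))" for B'
    unfolding B' by (rule mo.reduced_independent_iff[OF K L f h]) (use fx hw mo.comb_in_spn in auto)
  have fx: "\<forall>k\<in>K. pact (mop n Z) (f k) (?x k) = 0" if "mo.basis_mod n Z {0} K f ?x"
    using mo.basis_mod_gen(1)[OF that K] by auto
  show ?thesis
    unfolding rel_tuples_def ext_pairs_def mem_Collect_eq rel ind
    using key fx by (auto simp: o_def)
qed

lemma irreducible_degree_pos:
  fixes F :: "'a::field_gcd poly" assumes "Factorial_Ring.irreducible F" shows "0 < Polynomial.degree F"
proof -
  have "F \<noteq> 0" "\<not> is_unit F" using assms by (auto simp: Factorial_Ring.irreducible_def)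
  then show ?thesis using is_unit_iff_degree[of F] by auto
qed

section \<open>Expected numbers of tuples\<close>

definition mats :: "nat \<Rightarrow> (nat \<Rightarrow> nat \<Rightarrow> 'a) set" where
  "mats n = {..<n} \<rightarrow>\<^sub>E ({..<n} \<rightarrow>\<^sub>E UNIV)"

definition mat_wt :: "nat \<Rightarrow> (nat \<Rightarrow> nat \<Rightarrow> 'a \<Rightarrow> real) \<Rightarrow> (nat \<Rightarrow> nat \<Rightarrow> 'a) \<Rightarrow> real" where
  "mat_wt n w Z = (\<Prod>j<n. \<Prod>i<n. w j i (Z j i))"

lemma finite_mats: "finite (mats n :: (nat \<Rightarrow> nat \<Rightarrow> 'a::finite) set)"
  unfolding mats_def by (intro finite_PiE) auto

text \<open>After exchanging the sums over matrices and families, the condition for \<open>j\<close>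
  concerns the column \<open>Z j\<close> alone. The sum over matrices therefore factors into the
  probabilities \<open>pr\<close>.\<close>

lemma sum_mat_wt_card:
  fixes w :: "nat \<Rightarrow> nat \<Rightarrow> 'a::{field,finite} \<Rightarrow> real" and P :: "(nat \<Rightarrow> 'c \<Rightarrow> 'a) set"
  assumes P: "finite P"
  shows "(\<Sum>Z\<in>mats n. mat_wt n w Z * card {\<phi>\<in>P. \<forall>j<n. (\<Sum>i<n. scal (Z j i) (\<phi> i)) = \<beta> (\<phi> j)}) =
    (\<Sum>\<phi>\<in>P. \<Prod>j<n. pr {..<n} (w j) \<phi> {\<beta> (\<phi> j)})"
proof -
  have "real (card {\<phi>\<in>P. \<forall>j<n. (\<Sum>i<n. scal (Z j i) (\<phi> i)) = \<beta> (\<phi> j)}) =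
    (\<Sum>\<phi>\<in>P. \<Prod>j<n. of_bool ((\<Sum>i<n. scal (Z j i) (\<phi> i)) \<in> {\<beta> (\<phi> j)}))" for Z
  proof -
    have "(\<Prod>j<n. of_bool ((\<Sum>i<n. scal (Z j i) (\<phi> i)) \<in> {\<beta> (\<phi> j)})) = (of_bool (\<forall>j<n. (\<Sum>i<n. scal (Z j i) (\<phi> i)) = \<beta> (\<phi> j)) :: real)" for \<phi>
      by (auto simp: prod_zero_iff)
    then show ?thesis using P by (simp add: of_bool_def sum.If_cases Int_def)
  qed
  then have "(\<Sum>Z\<in>mats n. mat_wt n w Z * card {\<phi>\<in>P. \<forall>j<n. (\<Sum>i<n. scal (Z j i) (\<phi> i)) = \<beta> (\<phi> j)}) =
    (\<Sum>Z\<in>mats n. \<Sum>\<phi>\<in>P. \<Prod>j<n. (\<Prod>i<n. w j i (Z j i)) * of_bool ((\<Sum>i<n. scal (Z j i) (\<phi> i)) \<in> {\<beta> (\<phi> j)}))"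
    by (simp only: mat_wt_def sum_distrib_left prod.distrib)
  also have "\<dots> = (\<Sum>\<phi>\<in>P. \<Sum>Z\<in>mats n. \<Prod>j<n. (\<Prod>i<n. w j i (Z j i)) * of_bool ((\<Sum>i<n. scal (Z j i) (\<phi> i)) \<in> {\<beta> (\<phi> j)}))"
    by (rule sum.swap)
  also have "\<dots> = (\<Sum>\<phi>\<in>P. \<Prod>j<n. pr {..<n} (w j) \<phi> {\<beta> (\<phi> j)})"
  proof (rule sum.cong[OF refl])
    fix \<phi>
    show "(\<Sum>Z\<in>mats n. \<Prod>j<n. (\<Prod>i<n. w j i (Z j i)) * of_bool ((\<Sum>i<n. scal (Z j i) (\<phi> i)) \<in> {\<beta> (\<phi> j)})) =
      (\<Prod>j<n. pr {..<n} (w j) \<phi> {\<beta> (\<phi> j)})"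
      unfolding pr_def mats_def by (subst prod_sum_PiE) (auto intro!: finite_PiE)
  qed
  finally show ?thesis .
qed

text \<open>The limit does not depend on \<open>C\<close>, so that for tuples with unspecified
  relations the expectation tends to the number of possible \<open>C\<close>.\<close>

lemma rel_tuples_tendsto_1:
  fixes f :: "'k \<Rightarrow> 'a::{field_gcd,finite} poly" and w :: "nat \<Rightarrow> nat \<Rightarrow> nat \<Rightarrow> 'a \<Rightarrow> real" and c :: real
  assumes \<psi>: "add_char (\<psi> :: 'a \<Rightarrow> complex)" and c: "1 < c"
    and w: "eventually (\<lambda>n. \<forall>i<n. \<forall>j<n. balanced_wt (c * ln n / n) (w n j i)) sequentially"
    and K: "finite K" and f: "\<And>k. k \<in> K \<Longrightarrow> monic (f k) \<and> 0 < Polynomial.degree (f k)"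
    and C: "\<And>k m. k \<in> K \<Longrightarrow> m \<in> K \<Longrightarrow> C k m \<in> rpoly (Polynomial.degree (f m))"
  shows "(\<lambda>n. \<Sum>Z\<in>mats n. mat_wt n (w n) Z * card (rel_tuples n Z K f C)) \<longlonglongrightarrow> 1"
proof -
  interpret add_char \<psi> by (rule \<psi>)
  let ?D = "krylov_idx K f"
  have D: "finite ?D" using K by (simp add: krylov_idx_def)
  have fin: "finite (injs ?D n)" for n
    by (rule finite_subset[of _ "{..<n} \<rightarrow>\<^sub>E vecs ?D"]) (auto simp: injs_def intro!: finite_PiE finite_vecs D)
  have "(\<Sum>Z\<in>mats n. mat_wt n (w n) Z * card (rel_tuples n Z K f C)) =
    (\<Sum>\<phi>\<in>injs ?D n. \<Prod>j<n. pr {..<n} (w n j) \<phi> {krylov_map K f C (\<phi> j)})" for n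
  proof -
    have "card (rel_tuples n Z K f C) = card {\<phi>\<in>injs ?D n. \<forall>j<n. (\<Sum>i<n. scal (Z j i) (\<phi> i)) = krylov_map K f C (\<phi> j)}" for Z
    proof -
      have "card (rel_tuples n Z K f C) = card {\<phi>\<in>{..<n} \<rightarrow>\<^sub>E vecs ?D. (\<forall>u\<in>vecs ?D. u \<noteq> 0 \<longrightarrow> (\<exists>i<n. dot ?D u (\<phi> i) \<noteq> 0)) \<and>
        (\<forall>j<n. (\<Sum>i<n. scal (Z j i) (\<phi> i)) = krylov_map K f C (\<phi> j))}"
        by (rule card_rel_tuples[OF K f C])
      also have "{\<phi>\<in>{..<n} \<rightarrow>\<^sub>E vecs ?D. (\<forall>u\<in>vecs ?D. u \<noteq> 0 \<longrightarrow> (\<exists>i<n. dot ?D u (\<phi> i) \<noteq> 0)) \<and>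
        (\<forall>j<n. (\<Sum>i<n. scal (Z j i) (\<phi> i)) = krylov_map K f C (\<phi> j))} =
        {\<phi>\<in>injs ?D n. \<forall>j<n. (\<Sum>i<n. scal (Z j i) (\<phi> i)) = krylov_map K f C (\<phi> j)}"
        by (rule Collect_cong) (simp only: injs_def mem_Collect_eq conj_assoc)
      finally show ?thesis .
    qed
    then show ?thesis by (simp only: sum_mat_wt_card[OF fin])
  qed
  moreover have "(\<lambda>n. \<Sum>\<phi>\<in>injs ?D n. \<Prod>j<n. pr {..<n} (w n j) \<phi> {krylov_map K f C (\<phi> j)}) \<longlonglongrightarrow> 1"
    by (rule moment_tendsto_1[OF D _ c w]) (rule krylov_map_vecs)
  ultimately show ?thesis by (simp only:)
qed

lemma finite_ext_pairs:
  assumes "finite K" "finite L" shows "finite (ext_pairs n Z K f L h)"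
  by (rule finite_subset[of _ "K <+> L \<rightarrow>\<^sub>E vecs {..<n}"])
     (use assms in \<open>auto simp: ext_pairs_def intro!: finite_PiE finite_vecs\<close>)

text \<open>\<open>h l\<close> maps the new vector \<open>l\<close> into the span of the old ones,
  where coefficients reduced modulo the \<open>f k\<close> are unique. So every extended tuple obeys
  exactly one system of relations.\<close>

lemma card_ext_pairs:
  fixes f :: "'k \<Rightarrow> 'a::{field_gcd,finite} poly" and h :: "'l \<Rightarrow> 'a poly" and Z :: "nat \<Rightarrow> nat \<Rightarrow> 'a"
  assumes K: "finite K" and L: "finite L" and f: "\<And>k. k \<in> K \<Longrightarrow> f k \<noteq> 0" and h: "\<And>l. l \<in> L \<Longrightarrow> h l \<noteq> 0"
  shows "card (ext_pairs n Z K f L h) =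
    (\<Sum>C\<in>(L \<rightarrow>\<^sub>E (\<Pi>\<^sub>E k\<in>K. rpoly (Polynomial.degree (f k)))). card (rel_tuples n Z (K <+> L) (case_sum f h) (rel_coeffs C)))"
proof -
  let ?R = "\<Pi>\<^sub>E k\<in>K. rpoly (Polynomial.degree (f k)) :: ('k \<Rightarrow> 'a poly) set"
  let ?T = "\<lambda>C. rel_tuples n Z (K <+> L) (case_sum f h) (rel_coeffs C)"
  have iff: "y \<in> ?T C \<longleftrightarrow> y \<in> ext_pairs n Z K f L h \<and> (\<forall>l\<in>L. pact (mop n Z) (h l) (y (Inr l)) = mo.comb n Z K (C l) (y \<circ> Inl))" for y C
    by (rule rel_tuples_iff_ext_pairs[OF K L f h])
  have UN: "ext_pairs n Z K f L h = (\<Union>C\<in>(L \<rightarrow>\<^sub>E ?R). ?T C)"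
  proof
    show "(\<Union>C\<in>(L \<rightarrow>\<^sub>E ?R). ?T C) \<subseteq> ext_pairs n Z K f L h" using iff by blast
    show "ext_pairs n Z K f L h \<subseteq> (\<Union>C\<in>(L \<rightarrow>\<^sub>E ?R). ?T C)"
    proof
      fix y assume y: "y \<in> ext_pairs n Z K f L h"
      have b: "mo.basis_mod n Z {0} K f (y \<circ> Inl)" "mo.basis_mod n Z (mo.spn n Z K (y \<circ> Inl)) L h (y \<circ> Inr)"
        using y by (auto simp: ext_pairs_def)
      have "\<exists>c\<in>?R. pact (mop n Z) (h l) (y (Inr l)) = mo.comb n Z K c (y \<circ> Inl)" if "l \<in> L" for l
        using mo.basis_mod_gen(1)[OF b(2) L that] by (intro mo.spn_rpoly[OF b(1) K f]) auto
      then obtain C where C: "\<And>l. l \<in> L \<Longrightarrow> C l \<in> ?R \<and> pact (mop n Z) (h l) (y (Inr l)) = mo.comb n Z K (C l) (y \<circ> Inl)"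
        by metis
      have "restrict C L \<in> L \<rightarrow>\<^sub>E ?R" using C by auto
      moreover have "y \<in> ?T (restrict C L)" unfolding iff using y C by auto
      ultimately show "y \<in> (\<Union>C\<in>(L \<rightarrow>\<^sub>E ?R). ?T C)" by blast
    qed
  qed
  have "card (\<Union>C\<in>(L \<rightarrow>\<^sub>E ?R). ?T C) = (\<Sum>C\<in>(L \<rightarrow>\<^sub>E ?R). card (?T C))"
  proof (rule card_UN_disjoint)
    show "finite (L \<rightarrow>\<^sub>E ?R)" using K L by (intro finite_PiE) (auto simp: card_rpoly)
    show "\<forall>C\<in>(L \<rightarrow>\<^sub>E ?R). finite (?T C)"
      using finite_subset[OF _ finite_ext_pairs[OF K L, of n Z f h]] iff by blast
    show "\<forall>C\<in>(L \<rightarrow>\<^sub>E ?R). \<forall>C'\<in>(L \<rightarrow>\<^sub>E ?R). C \<noteq> C' \<longrightarrow> ?T C \<inter> ?T C' = {}"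
    proof (intro ballI impI, rule ccontr)
      fix C C' assume CC: "C \<in> L \<rightarrow>\<^sub>E ?R" "C' \<in> L \<rightarrow>\<^sub>E ?R" "C \<noteq> C'" and "?T C \<inter> ?T C' \<noteq> {}"
      then obtain y where y: "y \<in> ?T C" "y \<in> ?T C'" by blast
      have b: "mo.basis_mod n Z {0} K f (y \<circ> Inl)" using y(1) unfolding iff by (simp add: ext_pairs_def)
      have "C l = C' l" if l: "l \<in> L" for l
      proof (rule PiE_ext)
        show R: "C l \<in> ?R" "C' l \<in> ?R" using CC l by auto
        fix k assume k: "k \<in> K"
        have "mo.comb n Z K (C l) (y \<circ> Inl) = mo.comb n Z K (C' l) (y \<circ> Inl)"
          using y l unfolding iff by metis
        then have "mo.comb n Z K (\<lambda>k. C l k - C' l k) (y \<circ> Inl) \<in> {0}" by (simp add: mo.comb_diff)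
        from mo.basis_mod_D(1)[OF b this k] have "f k dvd C l k - C' l k" .
        moreover have "C l k - C' l k \<in> rpoly (Polynomial.degree (f k))" using R k by (intro diff_rpoly) auto
        ultimately show "C l k = C' l k" using dvd_rpoly_imp_0 by fastforce
      qed
      then have "C = C'" using CC by (intro PiE_ext) auto
      then show False using CC by blast
    qed
  qed
  then show ?thesis using UN by simp
qed

lemma ext_pairs_tendsto:
  fixes f :: "'k \<Rightarrow> 'a::{field_gcd,finite} poly" and h :: "'l \<Rightarrow> 'a poly" and w :: "nat \<Rightarrow> nat \<Rightarrow> nat \<Rightarrow> 'a \<Rightarrow> real" and c :: real
  assumes \<psi>: "add_char (\<psi> :: 'a \<Rightarrow> complex)" and c: "1 < c"
    and w: "eventually (\<lambda>n. \<forall>i<n. \<forall>j<n. balanced_wt (c * ln n / n) (w n j i)) sequentially"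
    and K: "finite K" and f: "\<And>k. k \<in> K \<Longrightarrow> monic (f k) \<and> 0 < Polynomial.degree (f k)"
    and L: "finite L" and h: "\<And>l. l \<in> L \<Longrightarrow> monic (h l) \<and> 0 < Polynomial.degree (h l)"
  shows "(\<lambda>n. \<Sum>Z\<in>mats n. mat_wt n (w n) Z * card (ext_pairs n Z K f L h)) \<longlonglongrightarrow>
    (\<Prod>k\<in>K. real CARD('a) ^ Polynomial.degree (f k)) ^ card L"
proof -
  let ?R = "\<Pi>\<^sub>E k\<in>K. rpoly (Polynomial.degree (f k)) :: ('k \<Rightarrow> 'a poly) set"
  have nz: "f k \<noteq> 0" if "k \<in> K" for k using f[OF that] by auto
  have nzh: "h l \<noteq> 0" if "l \<in> L" for l using h[OF that] by auto
  have "(\<Sum>Z\<in>mats n. mat_wt n (w n) Z * card (ext_pairs n Z K f L h)) =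
    (\<Sum>C\<in>(L \<rightarrow>\<^sub>E ?R). \<Sum>Z\<in>mats n. mat_wt n (w n) Z * card (rel_tuples n Z (K <+> L) (case_sum f h) (rel_coeffs C)))" for n
    by (subst sum.swap) (simp add: card_ext_pairs[OF K L nz nzh] sum_distrib_left)
  moreover have "(\<lambda>n. \<Sum>C\<in>(L \<rightarrow>\<^sub>E ?R). \<Sum>Z\<in>mats n. mat_wt n (w n) Z * card (rel_tuples n Z (K <+> L) (case_sum f h) (rel_coeffs C))) \<longlonglongrightarrow>
    (\<Sum>C\<in>(L \<rightarrow>\<^sub>E ?R). 1)"
  proof (intro tendsto_sum rel_tuples_tendsto_1[OF \<psi> c w])
    show "finite (K <+> L)" using K L by simp
    show "monic (case_sum f h k) \<and> 0 < Polynomial.degree (case_sum f h k)" if "k \<in> K <+> L" for k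
      using that f h by auto
    show "rel_coeffs C s t \<in> rpoly (Polynomial.degree (case_sum f h t))"
      if "C \<in> L \<rightarrow>\<^sub>E ?R" "s \<in> K <+> L" "t \<in> K <+> L" for C s t
    proof -
      have "C l k \<in> rpoly (Polynomial.degree (f k))" if "l \<in> L" "k \<in> K" for l k
        using PiE_mem[OF PiE_mem[OF \<open>C \<in> L \<rightarrow>\<^sub>E ?R\<close> that(1)] that(2)] .
      then show ?thesis using that by (auto simp: rel_coeffs_def)
    qed
  qed
  moreover have "(\<Sum>C\<in>(L \<rightarrow>\<^sub>E ?R). 1) = (\<Prod>k\<in>K. real CARD('a) ^ Polynomial.degree (f k)) ^ card L"
    using K L by (simp add: card_PiE card_rpoly)
  ultimately show ?thesis by simp
qed

definition basis_tuples :: "nat \<Rightarrow> (nat \<Rightarrow> nat \<Rightarrow> 'a) \<Rightarrow> 'k set \<Rightarrow> ('k \<Rightarrow> 'a poly) \<Rightarrow> ('k \<Rightarrow> nat \<Rightarrow> 'a::{field_gcd,finite}) set" where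
  "basis_tuples n Z K f = {x\<in>K \<rightarrow>\<^sub>E vecs {..<n}. mo.basis_mod n Z {0} K f x}"

lemma finite_basis_tuples: "finite K \<Longrightarrow> finite (basis_tuples n Z K f)"
  by (rule finite_subset[of _ "K \<rightarrow>\<^sub>E vecs {..<n}"]) (auto simp: basis_tuples_def intro!: finite_PiE finite_vecs)

lemma card_ext_pairs_fibres:
  fixes f :: "'k \<Rightarrow> 'a::{field_gcd,finite} poly" and h :: "'l \<Rightarrow> 'a poly" and Z :: "nat \<Rightarrow> nat \<Rightarrow> 'a"
  assumes K: "finite K" and L: "finite L"
  shows "card (ext_pairs n Z K f L h) =
    (\<Sum>x\<in>basis_tuples n Z K f. card {w\<in>L \<rightarrow>\<^sub>E vecs {..<n}. mo.basis_mod n Z (mo.spn n Z K x) L h w})"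
proof -
  let ?W = "\<lambda>x. {w\<in>L \<rightarrow>\<^sub>E vecs {..<n}. mo.basis_mod n Z (mo.spn n Z K x) L h w}"
  let ?to = "\<lambda>y. (\<lambda>k\<in>K. y (Inl k), \<lambda>l\<in>L. y (Inr l)) :: ('k \<Rightarrow> nat \<Rightarrow> 'a) \<times> ('l \<Rightarrow> nat \<Rightarrow> 'a)"
  let ?fro = "\<lambda>(x, w). \<lambda>s\<in>K <+> L. case_sum x w s"
  have finW: "finite (?W x)" for x using L by (auto intro!: finite_PiE finite_vecs)
  have c1: "mo.basis_mod n Z {0} K f x = mo.basis_mod n Z {0} K f x'" "mo.spn n Z K x = mo.spn n Z K x'"
    if "\<And>k. k \<in> K \<Longrightarrow> x k = x' k" for x x'
    using that by (auto intro!: mo.basis_mod_cong mo.spn_cong)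
  have c2: "mo.basis_mod n Z U L h w = mo.basis_mod n Z U L h w'" if "\<And>l. l \<in> L \<Longrightarrow> w l = w' l" for U w w'
    using that by (auto intro!: mo.basis_mod_cong)
  have "bij_betw ?to (ext_pairs n Z K f L h) (SIGMA x:basis_tuples n Z K f. ?W x)"
  proof (rule bij_betw_byWitness[where f' = ?fro])
    show "\<forall>y\<in>ext_pairs n Z K f L h. ?fro (?to y) = y"
    proof
      fix y assume y: "y \<in> ext_pairs n Z K f L h"
      then have yP: "y \<in> K <+> L \<rightarrow>\<^sub>E vecs {..<n}" by (simp add: ext_pairs_def)
      show "?fro (?to y) = y"
      proof
        fix s show "?fro (?to y) s = y s" using PiE_arb[OF yP, of s] by (cases s) auto
      qed
    qed
    show "\<forall>p\<in>(SIGMA x:basis_tuples n Z K f. ?W x). ?to (?fro p) = p"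
    proof (rule ballI)
      fix p :: "('k \<Rightarrow> nat \<Rightarrow> 'a) \<times> ('l \<Rightarrow> nat \<Rightarrow> 'a)"
      assume p: "p \<in> (SIGMA x:basis_tuples n Z K f. ?W x)"
      obtain x w where xw: "p = (x, w)" by (cases p)
      from p have "x \<in> K \<rightarrow>\<^sub>E vecs {..<n}" "w \<in> L \<rightarrow>\<^sub>E vecs {..<n}" unfolding xw by (auto simp: basis_tuples_def)
      then have "(\<lambda>k\<in>K. (\<lambda>s\<in>K <+> L. case_sum x w s) (Inl k)) = x" "(\<lambda>l\<in>L. (\<lambda>s\<in>K <+> L. case_sum x w s) (Inr l)) = w"
        by (auto simp: fun_eq_iff PiE_iff extensional_def)
      then show "?to (?fro p) = p" unfolding xw by simp
    qed
    show "?to ` ext_pairs n Z K f L h \<subseteq> (SIGMA x:basis_tuples n Z K f. ?W x)"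
    proof (rule image_subsetI)
      fix y assume y: "y \<in> ext_pairs n Z K f L h"
      have e1: "mo.basis_mod n Z {0} K f (\<lambda>k\<in>K. y (Inl k)) = mo.basis_mod n Z {0} K f (y \<circ> Inl)"
        "mo.spn n Z K (\<lambda>k\<in>K. y (Inl k)) = mo.spn n Z K (y \<circ> Inl)" by (rule c1, simp)+
      have e2: "mo.basis_mod n Z U L h (\<lambda>l\<in>L. y (Inr l)) = mo.basis_mod n Z U L h (y \<circ> Inr)" for U by (rule c2) simp
      have "y (Inl k) \<in> vecs {..<n}" if "k \<in> K" for k using y that by (auto simp: ext_pairs_def)
      moreover have "y (Inr k) \<in> vecs {..<n}" if "k \<in> L" for k using y that by (auto simp: ext_pairs_def)
      ultimately show "?to y \<in> (SIGMA x:basis_tuples n Z K f. ?W x)"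
        using y unfolding mem_Sigma_iff basis_tuples_def ext_pairs_def mem_Collect_eq e1 e2 by auto
    qed
    show "?fro ` (SIGMA x:basis_tuples n Z K f. ?W x) \<subseteq> ext_pairs n Z K f L h"
    proof (rule image_subsetI)
      fix p :: "('k \<Rightarrow> nat \<Rightarrow> 'a) \<times> ('l \<Rightarrow> nat \<Rightarrow> 'a)"
      assume p: "p \<in> (SIGMA x:basis_tuples n Z K f. ?W x)"
      obtain x w where xw: "p = (x, w)" by (cases p)
      have x: "x \<in> basis_tuples n Z K f" and w: "w \<in> L \<rightarrow>\<^sub>E vecs {..<n}" "mo.basis_mod n Z (mo.spn n Z K x) L h w"
        using p unfolding xw by auto
      let ?y = "\<lambda>s\<in>K <+> L. case_sum x w s"
      have e1: "mo.basis_mod n Z {0} K f (?y \<circ> Inl) = mo.basis_mod n Z {0} K f x"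
        "mo.spn n Z K (?y \<circ> Inl) = mo.spn n Z K x" by (rule c1, simp add: InlI)+
      have e2: "mo.basis_mod n Z U L h (?y \<circ> Inr) = mo.basis_mod n Z U L h w" for U by (rule c2) (simp add: InrI)
      have "?y \<in> K <+> L \<rightarrow>\<^sub>E vecs {..<n}" using x w by (auto simp: basis_tuples_def)
      then show "?fro p \<in> ext_pairs n Z K f L h"
        unfolding xw prod.case ext_pairs_def mem_Collect_eq e1 e2 using x w by (auto simp: basis_tuples_def)
    qed
  qed
  then have "card (ext_pairs n Z K f L h) = card (SIGMA x:basis_tuples n Z K f. ?W x)" by (rule bij_betw_same_card)
  also have "\<dots> = (\<Sum>x\<in>basis_tuples n Z K f. card (?W x))"
    using finite_basis_tuples[OF K] finW by (intro card_SigmaI) auto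
  finally show ?thesis .
qed

text \<open>The method of moments is applied to \<open>Y n\<close>, the pairs of a matrix and a
  basis tuple. Its total weight need not be 1, but it tends to 1, being the moment for
  \<open>b = 0\<close>. Saturation at \<open>F j\<close> is the vanishing of the torsion
  exponent.\<close>

theorem saturated_tuples_tendsto:
  fixes f :: "'k \<Rightarrow> 'a::{field_gcd,finite} poly" and F :: "'j \<Rightarrow> 'a poly" and w :: "nat \<Rightarrow> nat \<Rightarrow> nat \<Rightarrow> 'a \<Rightarrow> real" and c :: real
  assumes \<psi>: "add_char (\<psi> :: 'a \<Rightarrow> complex)" and c: "1 < c"
    and w: "eventually (\<lambda>n. \<forall>i<n. \<forall>j<n. balanced_wt (c * ln n / n) (w n j i)) sequentially"
    and w0: "\<And>n i j a. i < n \<Longrightarrow> j < n \<Longrightarrow> 0 \<le> w n j i a"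
    and K: "finite K" and f: "\<And>k. k \<in> K \<Longrightarrow> monic (f k) \<and> 0 < Polynomial.degree (f k)"
    and J: "finite J" and F: "\<And>j. j \<in> J \<Longrightarrow> monic (F j) \<and> Factorial_Ring.irreducible (F j)"
      "\<And>i j. i \<in> J \<Longrightarrow> j \<in> J \<Longrightarrow> i \<noteq> j \<Longrightarrow> \<not> F i dvd F j"
  shows "(\<lambda>n. \<Sum>Z\<in>mats n. mat_wt n (w n) Z *
      card {x\<in>basis_tuples n Z K f. \<forall>j\<in>J. mo.tors n Z (F j) (mo.spn n Z K x) (vecs {..<n}) = mo.spn n Z K x}) \<longlonglongrightarrow>
    (\<Prod>j\<in>J. euler_prod (real CARD('a) ^ Polynomial.degree (F j)))"
proof -
  let ?V = "\<lambda>n. vecs {..<n} :: (nat \<Rightarrow> 'a) set"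
  define N where "N = (\<Prod>k\<in>K. real CARD('a) ^ Polynomial.degree (f k))"
  have N: "0 < N" unfolding N_def by (intro prod_pos) auto
  have nz: "f k \<noteq> 0" if "k \<in> K" for k using f[OF that] by auto
  have degF: "0 < Polynomial.degree (F j)" if "j \<in> J" for j
    using F(1)[OF that] irreducible_degree_pos by blast
  let ?q = "\<lambda>j. real CARD('a) ^ Polynomial.degree (F j)"
  have q1: "1 < ?q j" if "j \<in> J" for j
  proof -
    have "card {0, 1 :: 'a} \<le> CARD('a)" by (rule card_mono) auto
    then have "1 < real CARD('a)" by simp
    then show ?thesis using degF[OF that] by (rule one_less_power)
  qed
  have spn: "mo.M.subspace n Z (mo.spn n Z K x)" "mo.spn n Z K x \<subseteq> ?V n" if "x \<in> basis_tuples n Z K f" for n Z x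
  proof -
    show "mo.M.subspace n Z (mo.spn n Z K x)" by (rule mo.subspace_spn)
    show "mo.spn n Z K x \<subseteq> ?V n"
      by (rule mo.spn_le[OF mo_subspace_vecs]) (use that in \<open>auto simp: basis_tuples_def\<close>)
  qed
  have finV: "finite (?V n)" for n by (rule finite_vecs) simp
  define Y where "Y = (\<lambda>n. SIGMA Z:mats n. basis_tuples n Z K f)"
  define a where "a = (\<lambda>n (Z, x) j. mo.tors_exp n Z (F j) (mo.spn n Z K x) (?V n))"
  define W where "W = (\<lambda>n (Z, x :: 'k \<Rightarrow> nat \<Rightarrow> 'a). mat_wt n (w n) Z)"
  have sumY: "(\<Sum>y\<in>Y n. W n y * g y) = (\<Sum>Z\<in>mats n. mat_wt n (w n) Z * (\<Sum>x\<in>basis_tuples n Z K f. g (Z, x)))" for n g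
  proof -
    have "(\<Sum>Z\<in>mats n. mat_wt n (w n) Z * (\<Sum>x\<in>basis_tuples n Z K f. g (Z, x))) =
      (\<Sum>Z\<in>mats n. \<Sum>x\<in>basis_tuples n Z K f. mat_wt n (w n) Z * g (Z, x))"
      by (simp only: sum_distrib_left)
    also have "\<dots> = (\<Sum>(Z, x)\<in>(SIGMA Z:mats n. basis_tuples n Z K f). mat_wt n (w n) Z * g (Z, x))"
      by (rule sum.Sigma) (simp_all add: finite_mats finite_basis_tuples[OF K])
    also have "\<dots> = (\<Sum>y\<in>Y n. W n y * g y)" unfolding Y_def by (rule sum.cong) (auto simp: W_def)
    finally show ?thesis by simp
  qed
  have "(\<lambda>n. \<Sum>y\<in>Y n. W n y * of_bool (\<forall>j\<in>J. a n y j = 0)) \<longlonglongrightarrow> (\<Prod>j\<in>J. euler_prod (?q j))"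
  proof (rule qfall_moments_imp_zero_limit[OF J q1])
    show "0 \<le> W n y" if "y \<in> Y n" for n y
      unfolding W_def mat_wt_def using w0 by (auto simp: case_prod_unfold intro!: prod_nonneg)
  next
    fix b :: "'j \<Rightarrow> nat"
    define L where "L = (SIGMA j:J. {..<b j})"
    have L: "finite L" using J by (simp add: L_def)
    \<comment> \<open>All spans have the same cardinality \<open>N\<close>, so its power can be
      divided out of the moments; it cancels the limit in \<open>ext_pairs_tendsto\<close>.\<close>
    have cnt: "real (card {v\<in>L \<rightarrow>\<^sub>E ?V n. mo.basis_mod n Z (mo.spn n Z K x) L (\<lambda>l. F (fst l)) v}) =
      N ^ card L * (\<Prod>j\<in>J. qfall (?q j) (?q j ^ a n (Z, x) j) (b j))" if x: "x \<in> basis_tuples n Z K f" for n Z x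
    proof -
      have "real (card (mo.spn n Z K x)) = N"
        using mo.card_spn[of n Z K f x] x K nz by (simp add: basis_tuples_def N_def)
      then show ?thesis
        using mo.card_bases_mod_qfall[OF spn(1)[OF x] mo_subspace_vecs spn(2)[OF x] finV J, of F b] F
        unfolding L_def a_def by simp
    qed
    have "(\<Sum>y\<in>Y n. W n y * (\<Prod>j\<in>J. qfall (?q j) (?q j ^ a n y j) (b j))) =
      (\<Sum>Z\<in>mats n. mat_wt n (w n) Z * card (ext_pairs n Z K f L (\<lambda>l. F (fst l)))) / N ^ card L" for n
    proof -
      have "(\<Sum>Z\<in>mats n. mat_wt n (w n) Z * card (ext_pairs n Z K f L (\<lambda>l. F (fst l)))) =
        (\<Sum>Z\<in>mats n. mat_wt n (w n) Z * (\<Sum>x\<in>basis_tuples n Z K f. N ^ card L * (\<Prod>j\<in>J. qfall (?q j) (?q j ^ a n (Z, x) j) (b j))))"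
        unfolding card_ext_pairs_fibres[OF K L] by (simp add: cnt)
      also have "\<dots> = N ^ card L * (\<Sum>y\<in>Y n. W n y * (\<Prod>j\<in>J. qfall (?q j) (?q j ^ a n y j) (b j)))"
        unfolding sumY by (simp add: sum_distrib_left mult_ac)
      finally show ?thesis using N by simp
    qed
    moreover have "(\<lambda>n. (\<Sum>Z\<in>mats n. mat_wt n (w n) Z * card (ext_pairs n Z K f L (\<lambda>l. F (fst l)))) / N ^ card L) \<longlonglongrightarrow>
      N ^ card L / N ^ card L"
    proof (rule tendsto_divide)
      show "(\<lambda>n. \<Sum>Z\<in>mats n. mat_wt n (w n) Z * card (ext_pairs n Z K f L (\<lambda>l. F (fst l)))) \<longlonglongrightarrow> N ^ card L"
        unfolding N_def by (rule ext_pairs_tendsto[OF \<psi> c w K f L]) (use F degF in \<open>auto simp: L_def\<close>)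
    qed (use N in auto)
    ultimately show "(\<lambda>n. \<Sum>y\<in>Y n. W n y * (\<Prod>j\<in>J. qfall (?q j) (?q j ^ a n y j) (b j))) \<longlonglongrightarrow> 1"
      using N by simp
  qed
  moreover have "(\<Sum>y\<in>Y n. W n y * of_bool (\<forall>j\<in>J. a n y j = 0)) = (\<Sum>Z\<in>mats n. mat_wt n (w n) Z *
      card {x\<in>basis_tuples n Z K f. \<forall>j\<in>J. mo.tors n Z (F j) (mo.spn n Z K x) (?V n) = mo.spn n Z K x})" for n
  proof -
    have "(\<Sum>x\<in>basis_tuples n Z K f. of_bool (\<forall>j\<in>J. a n (Z, x) j = 0)) =
      real (card {x\<in>basis_tuples n Z K f. \<forall>j\<in>J. mo.tors n Z (F j) (mo.spn n Z K x) (?V n) = mo.spn n Z K x})" for Z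
    proof -
      have "a n (Z, x) j = 0 \<longleftrightarrow> mo.tors n Z (F j) (mo.spn n Z K x) (?V n) = mo.spn n Z K x"
        if "x \<in> basis_tuples n Z K f" "j \<in> J" for x j
        unfolding a_def prod.case using F(1)[OF that(2)] by (intro mo.tors_exp_eq_0_iff spn[OF that(1)] mo_subspace_vecs finV) auto
      then have eq: "{x\<in>basis_tuples n Z K f. \<forall>j\<in>J. mo.tors n Z (F j) (mo.spn n Z K x) (?V n) = mo.spn n Z K x} =
        {x\<in>basis_tuples n Z K f. \<forall>j\<in>J. a n (Z, x) j = 0}" by auto
      show ?thesis unfolding eq by (subst sum_of_bool_eq, rule finite_basis_tuples[OF K], simp only: Int_def mem_Collect_eq)
    qed
    then show ?thesis unfolding sumY by simp
  qed
  ultimately show ?thesis by simp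
qed

section \<open>Cyclic decompositions\<close>

lemma exists_monic_irreducible_factor:
  fixes g :: "'a::field_gcd poly"
  assumes "g \<noteq> 0" "\<not> is_unit g"
  shows "\<exists>F. monic F \<and> Factorial_Ring.irreducible F \<and> F dvd g"
proof -
  obtain G where G: "G dvd g" "Factorial_Ring.prime G" using prime_divisor_exists[OF assms] by blast
  have irr: "Factorial_Ring.irreducible G" using G(2) by (intro prime_elem_imp_irreducible) simp
  have G0: "G \<noteq> 0" using irr by (auto simp: Factorial_Ring.irreducible_def)
  define c where "c = inverse (Polynomial.lead_coeff G)"
  have c: "c \<noteq> 0" using G0 by (simp add: c_def)
  have u: "is_unit [:c:]" using c by (simp add: is_unit_triv)
  have "Factorial_Ring.irreducible ([:c:] * G)" using irr irreducible_mult_unit_left[OF u] by blast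
  moreover have "monic ([:c:] * G)" using G0 by (simp add: c_def)
  moreover have "[:c:] * G dvd g" using G(1) c by (simp add: smult_dvd)
  ultimately show ?thesis by blast
qed

lemma monic_irreducible_dvd_eq:
  fixes F G :: "'a::field_gcd poly"
  assumes "monic F" "monic G" "Factorial_Ring.irreducible F" "Factorial_Ring.irreducible G" "F dvd G"
  shows "F = G"
proof -
  obtain c where c: "G = F * c" using assms(5) by (rule dvdE)
  have "is_unit c"
    using assms(3,4) c irreducible_not_unit irreducibleD by blast
  then obtain d where d: "c = [:d:]" by (rule is_unit_polyE)
  have "Polynomial.lead_coeff G = Polynomial.lead_coeff F * d" using c d by (simp add: lead_coeff_mult)
  then have "d = 1" using assms by simp
  then show ?thesis using c d by (simp add: one_pCons[symmetric])
qed

context poly_module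
begin

text \<open>Pigeonhole: there are more polynomials of degree below \<open>card V\<close> than
  vectors in \<open>V\<close>.\<close>

lemma exists_annihilator:
  assumes "finite V" "M.subspace V" "v \<in> V"
  shows "\<exists>g. g \<noteq> 0 \<and> g \<star> v = 0"
proof -
  have "\<not> inj_on (\<lambda>g. g \<star> v) (rpoly (card V) :: 'a poly set)"
  proof
    assume "inj_on (\<lambda>g. g \<star> v) (rpoly (card V) :: 'a poly set)"
    then have "card (rpoly (card V) :: 'a poly set) \<le> card V"
      by (rule card_inj_on_le) (use assms M.subspace_scale in auto)
    moreover have "card V < card (rpoly (card V) :: 'a poly set)"
    proof -
      have "card {0, 1 :: 'a} \<le> CARD('a)" by (rule card_mono) auto
      then have "2 ^ card V \<le> CARD('a) ^ card V" by (intro power_mono) auto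
      then show ?thesis unfolding card_rpoly using less_exp[of "card V"] by linarith
    qed
    ultimately show False by simp
  qed
  then obtain g h where gh: "g \<noteq> h" "g \<star> v = h \<star> v" by (auto simp: inj_on_def)
  then have "g - h \<noteq> 0 \<and> (g - h) \<star> v = 0" by (simp add: M.scale_left_diff_distrib)
  then show ?thesis by blast
qed

text \<open>Take a nonzero \<open>g\<close> of least degree that carries some vector from outside
  \<open>S\<close> into \<open>S\<close>, and split off an irreducible factor. By minimality the
  cofactor leaves that vector outside, and the irreducible factor does the rest.\<close>

lemma exists_irreducible_torsion:
  assumes V: "finite V" "M.subspace V" and S: "M.subspace S" and y: "y \<in> V" "y \<notin> S"
  shows "\<exists>G y'. monic G \<and> Factorial_Ring.irreducible G \<and> y' \<in> V \<and> y' \<notin> S \<and> G \<star> y' \<in> S"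
proof -
  let ?P = "\<lambda>g. g \<noteq> 0 \<and> (\<exists>y\<in>V. y \<notin> S \<and> g \<star> y \<in> S)"
  obtain g0 where "g0 \<noteq> 0" "g0 \<star> y = 0" using exists_annihilator[OF V y(1)] by blast
  then have "?P g0" using y M.subspace_0[OF S] by metis
  from ex_has_least_nat[of ?P, OF this, of Polynomial.degree]
  obtain g where g: "?P g" and min: "\<And>h. ?P h \<Longrightarrow> Polynomial.degree g \<le> Polynomial.degree h" by blast
  obtain z where z: "z \<in> V" "z \<notin> S" "g \<star> z \<in> S" using g by blast
  have "\<not> is_unit g"
  proof
    assume "is_unit g"
    then obtain h where h: "1 = g * h" by (rule dvdE)
    have "z = h \<star> (g \<star> z)" by (simp only: M.scale_scale mult.commute[of h] h[symmetric] M.scale_one)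
    then show False using z M.subspace_scale[OF S z(3), of h] by metis
  qed
  then obtain F where F: "monic F" "Factorial_Ring.irreducible F" "F dvd g"
    using exists_monic_irreducible_factor g by blast
  obtain h where h: "g = F * h" using F(3) by (rule dvdE)
  have h0: "h \<noteq> 0" using g h by auto
  have F0: "F \<noteq> 0" using irreducible_neq_0[OF F(2)] .
  have "Polynomial.degree h < Polynomial.degree g"
    using h h0 F0 irreducible_degree_pos[OF F(2)] by (simp add: degree_mult_eq)
  then have "\<not> ?P h" using min[of h] by linarith
  then have "h \<star> z \<notin> S" using h0 z by blast
  moreover have "F \<star> (h \<star> z) \<in> S" using z(3) h by simp
  moreover have "h \<star> z \<in> V" using M.subspace_scale[OF V(2) z(1)] .
  ultimately show ?thesis using F by blast
qed

lemma irreducible_power_combine: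
  fixes F g :: "'a poly"
  assumes "Factorial_Ring.irreducible F" "\<not> F dvd g"
  shows "\<exists>a b. a * g + b * F ^ k = 1"
proof -
  have "coprime F g" using assms prime_elem_imp_coprime irreducible_imp_prime_elem_gcd by blast
  then have "coprime g (F ^ k)" by (simp add: coprime_commute)
  then have "gcd g (F ^ k) = 1" by simp
  then show ?thesis using bezout_coefficients[of g "F ^ k" "fst (bezout_coefficients g (F ^ k))" "snd (bezout_coefficients g (F ^ k))"]
    by (intro exI[of _ "fst (bezout_coefficients g (F ^ k))"] exI[of _ "snd (bezout_coefficients g (F ^ k))"]) simp
qed

text \<open>The power of \<open>F\<close> dividing \<open>g\<close> is raised step by step: a
  cofactor prime to \<open>F\<close> would by Bezout kill \<open>F ^ i \<star> v\<close>, and with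
  it \<open>F ^ m \<star> v\<close>.\<close>

lemma annihilator_prime_power:
  assumes F: "Factorial_Ring.irreducible F" and m: "F ^ Suc m \<star> v = 0" "F ^ m \<star> v \<noteq> 0"
  shows "g \<star> v = 0 \<longleftrightarrow> F ^ Suc m dvd g"
proof
  assume "F ^ Suc m dvd g"
  then obtain h where "g = F ^ Suc m * h" by (rule dvdE)
  then have "g \<star> v = h \<star> (F ^ Suc m \<star> v)" by (simp only: M.scale_scale mult.commute[of h])
  then show "g \<star> v = 0" unfolding m(1) by simp
next
  assume g: "g \<star> v = 0"
  have "F ^ i dvd g" if "i \<le> Suc m" for i
    using that
  proof (induction i)
    case (Suc i)
    then obtain h where h: "g = F ^ i * h" by (meson Suc_leD dvdE)
    have "F dvd h"
    proof (rule ccontr)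
      assume "\<not> F dvd h"
      then obtain a b where ab: "a * h + b * F ^ (Suc m - i) = 1" using irreducible_power_combine[OF F] by blast
      have "h \<star> (F ^ i \<star> v) = 0" using g h by (simp add: mult.commute)
      moreover have "F ^ (Suc m - i) \<star> (F ^ i \<star> v) = 0"
        using m(1) Suc.prems by (simp add: power_add[symmetric] del: power_Suc)
      ultimately have "F ^ i \<star> v \<in> {0}" using subspace_combine[of "{0}" h "F ^ i \<star> v" "F ^ (Suc m - i)" a b] ab by simp
      then have "F ^ (m - i) \<star> (F ^ i \<star> v) = 0" by simp
      then show False using m(2) Suc.prems by (simp add: power_add[symmetric])
    qed
    then show ?case using h by (auto simp: dvd_def)
  qed simp
  then show "F ^ Suc m dvd g" by blast
qed

definition cyc :: "'b \<Rightarrow> 'b set" where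
  "cyc v = range (\<lambda>g. g \<star> v)"

lemma subspace_cyc: "M.subspace (cyc v)"
proof -
  have "cyc v = spn {()} (\<lambda>_. v)"
  proof -
    have "\<exists>g'. g \<star> v = comb {()} g' (\<lambda>_. v)" for g by (rule exI[of _ "\<lambda>_. g"]) (simp add: comb_def)
    then show ?thesis by (auto simp: cyc_def spn_def comb_def)
  qed
  then show ?thesis using subspace_spn by metis
qed

lemma cyc_self: "v \<in> cyc v"
  unfolding cyc_def by (rule range_eqI[of _ _ 1]) simp

lemma cyc_le: "M.subspace V \<Longrightarrow> v \<in> V \<Longrightarrow> cyc v \<subseteq> V"
  by (auto simp: cyc_def intro: M.subspace_scale)

text \<open>Let \<open>W\<close> be a largest submodule meeting \<open>cyc v\<close> trivially. If
  the sum were proper, an irreducible \<open>G\<close> would carry some outside vector into it;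
  after a correction by a multiple of \<open>v\<close> the image lies in \<open>W\<close>, and
  \<open>W\<close> could be enlarged. The correction for \<open>G = F\<close> depends on
  \<open>v\<close> having the largest \<open>F\<close>-power order.\<close>

lemma exists_complement:
  assumes V: "finite V" "M.subspace V" and v: "v \<in> V"
    and F: "monic F" "Factorial_Ring.irreducible F" and m: "F ^ Suc m \<star> v = 0" "F ^ m \<star> v \<noteq> 0"
    and max: "\<And>y k. y \<in> V \<Longrightarrow> F ^ k \<star> y = 0 \<Longrightarrow> F ^ Suc m \<star> y = 0"
  shows "\<exists>W. M.subspace W \<and> W \<subseteq> V \<and> W \<inter> cyc v = {0} \<and> ssum (cyc v) W = V"
proof -
  let ?P = "\<lambda>W. M.subspace W \<and> W \<subseteq> V \<and> W \<inter> cyc v = {0}"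
  let ?U = "cyc v"
  have U: "M.subspace ?U" "?U \<subseteq> V" using subspace_cyc cyc_le[OF V(2) v] by auto
  have P0: "?P {0}" using M.subspace_0[OF V(2)] M.subspace_0[OF U(1)] by auto
  have bound: "\<forall>W. ?P W \<longrightarrow> card W < Suc (card V)" using V(1) by (auto simp: less_Suc_eq_le intro: card_mono)
  obtain W where W: "?P W" and maxW: "\<And>W'. ?P W' \<Longrightarrow> card W' \<le> card W"
    using ex_has_greatest_nat[of ?P "{0}" card "Suc (card V)", OF P0 bound] by blast
  let ?S = "ssum ?U W"
  have S: "M.subspace ?S" using subspace_ssum U W by blast
  have SV: "?S \<subseteq> V" using ssum_le[OF V(2)] U W by blast
  have WS: "W \<subseteq> ?S" by (rule ssum_right[OF U(1)])
  have US: "?U \<subseteq> ?S" using ssum_left W by blast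
  have "?S = V"
  proof (rule ccontr)
    assume "?S \<noteq> V"
    then obtain y0 where "y0 \<in> V" "y0 \<notin> ?S" using SV by blast
    then obtain G y where G: "monic G" "Factorial_Ring.irreducible G" and y: "y \<in> V" "y \<notin> ?S" "G \<star> y \<in> ?S"
      using exists_irreducible_torsion[OF V S] by blast
    have "\<exists>y'. y' \<in> V \<and> y' \<notin> ?S \<and> G \<star> y' \<in> W"
    proof (cases "G = F")
      case False
      \<comment> \<open>\<open>G\<close> is invertible modulo \<open>F ^ Suc m\<close>, which kills
        \<open>v\<close>, so the component in \<open>cyc v\<close> is a multiple by \<open>G\<close>
        and can be subtracted.\<close>
      then have "\<not> F dvd G" using monic_irreducible_dvd_eq F G by blast
      then obtain a b where ab: "a * G + b * F ^ Suc m = 1" using irreducible_power_combine[OF F(2)] by blast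
      obtain g w where gw: "G \<star> y = g \<star> v + w" "w \<in> W" using y(3) by (auto simp: ssum_def cyc_def)
      let ?y = "y - (a * g) \<star> v"
      have "g \<star> v = (g * (a * G + b * F ^ Suc m)) \<star> v" using ab by simp
      also have "\<dots> = (g * a * G) \<star> v + (g * b) \<star> (F ^ Suc m \<star> v)"
        by (simp only: M.scale_scale distrib_left M.scale_left_distrib mult.assoc)
      finally have gv: "g \<star> v = (g * a * G) \<star> v" by (simp only: m(1) M.scale_zero_right add_0_right)
      have "G \<star> ?y = G \<star> y - (g * a * G) \<star> v" by (simp add: M.scale_right_diff_distrib mult_ac)
      then have "G \<star> ?y = w" using gw(1) gv by simp
      moreover have cv: "(a * g) \<star> v \<in> ?U" by (auto simp: cyc_def)
      moreover have "?y \<in> V" using V(2) y(1) U(2) cv by (auto intro: M.subspace_diff)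
      moreover have "?y \<notin> ?S"
      proof
        assume "?y \<in> ?S"
        then have "?y + (a * g) \<star> v \<in> ?S" using cv US S by (blast intro: M.subspace_add)
        then show False using y(2) by simp
      qed
      ultimately show ?thesis using gw(2) by metis
    next
      case True
      \<comment> \<open>Multiplying \<open>y\<close> by the part \<open>c'\<close> of an annihilator
        prime to \<open>F\<close> makes it \<open>F\<close>-primary without moving it into
        \<open>?S\<close>. Only then does the maximality of the order of \<open>v\<close> say
        something about it.\<close>
      obtain c where c: "c \<noteq> 0" "c \<star> y = 0" using exists_annihilator[OF V y(1)] by blast
      obtain s c' where sc: "c = F ^ s * c'" "\<not> F dvd c'"
        using multiplicity_decompose'[of c F] c(1) irreducible_not_unit[OF F(2)] by (metis mult.commute)
      obtain a b where ab: "a * c' + b * F = 1" using irreducible_not_dvd_combine[OF F(2) sc(2)] by blast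
      let ?z = "c' \<star> y"
      have zV: "?z \<in> V" using V(2) y(1) by (rule M.subspace_scale)
      have zS: "?z \<notin> ?S" using subspace_combine[OF S _ _ ab, of y] y(2,3) True by blast
      have FzS: "F \<star> ?z \<in> ?S"
      proof -
        have "F \<star> ?z = c' \<star> (F \<star> y)" by (simp add: mult.commute)
        then show ?thesis using y(3) True M.subspace_scale[OF S] by metis
      qed
      have "F ^ s \<star> ?z = 0" using c(2) sc(1) by simp
      then have Fm: "F ^ Suc m \<star> ?z = 0" using max zV by blast
      obtain g w where gw: "F \<star> ?z = g \<star> v + w" "w \<in> W" using FzS by (auto simp: ssum_def cyc_def)
      \<comment> \<open>Since \<open>cyc v\<close> and \<open>W\<close> meet trivially, both
        components vanish; hence \<open>F\<close> divides \<open>g\<close>.\<close>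
      have "F ^ m \<star> (g \<star> v + w) = 0" unfolding gw(1)[symmetric] using Fm by (simp add: mult_ac)
      then have 0: "(F ^ m * g) \<star> v = - (F ^ m \<star> w)" by (simp add: M.scale_right_distrib eq_neg_iff_add_eq_0)
      moreover have "(F ^ m * g) \<star> v \<in> ?U" by (auto simp: cyc_def)
      moreover have "- (F ^ m \<star> w) \<in> W" using W gw(2) by (blast intro: M.subspace_neg M.subspace_scale)
      ultimately have "(F ^ m * g) \<star> v = 0" using W by (metis IntI singletonD)
      then have "F ^ Suc m dvd F ^ m * g" using annihilator_prime_power[OF F(2) m] by blast
      then have "F ^ m * F dvd F ^ m * g" by (simp add: mult.commute)
      then have "F dvd g" using irreducible_neq_0[OF F(2)] by simp
      then obtain g' where g': "g = F * g'" by (rule dvdE)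
      let ?y = "?z - g' \<star> v"
      have "F \<star> ?y = w" using gw(1) g' by (simp add: M.scale_right_diff_distrib)
      moreover have cv: "g' \<star> v \<in> ?U" by (auto simp: cyc_def)
      moreover have "?y \<in> V" using V(2) zV U(2) cv by (auto intro: M.subspace_diff)
      moreover have "?y \<notin> ?S"
      proof
        assume "?y \<in> ?S"
        then have "?y + g' \<star> v \<in> ?S" using cv US S by (blast intro: M.subspace_add)
        then show False using zS by simp
      qed
      ultimately show ?thesis using gw(2) True by metis
    qed
    then obtain y' where y': "y' \<in> V" "y' \<notin> ?S" "G \<star> y' \<in> W" by blast
    let ?W = "ssum W (cyc y')"
    have W': "M.subspace ?W" using subspace_ssum W subspace_cyc by blast
    have W'V: "?W \<subseteq> V" using ssum_le[OF V(2)] W cyc_le[OF V(2) y'(1)] by blast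
    have "?W \<inter> ?U = {0}"
    proof
      show "{0} \<subseteq> ?W \<inter> ?U" using M.subspace_0[OF W'] M.subspace_0[OF U(1)] by blast
      show "?W \<inter> ?U \<subseteq> {0}"
      proof
        fix u assume u: "u \<in> ?W \<inter> ?U"
        then obtain w c where wc: "u = w + c \<star> y'" "w \<in> W" by (auto simp: ssum_def cyc_def)
        have "c \<star> y' = u - w" using wc by simp
        moreover have "u - w \<in> ?S" using u wc(2) US WS S by (blast intro: M.subspace_diff)
        ultimately have cS: "c \<star> y' \<in> ?S" by simp
        have "G dvd c"
        proof (rule ccontr)
          assume "\<not> G dvd c"
          then obtain a b where "a * c + b * G = 1" using irreducible_not_dvd_combine[OF G(2)] by blast
          then show False using subspace_combine[OF S cS, of G a b] y'(2,3) WS by blast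
        qed
        then obtain d where "c = G * d" by (rule dvdE)
        then have "c \<star> y' = d \<star> (G \<star> y')" by (simp add: mult.commute)
        then have "c \<star> y' \<in> W" using y'(3) W M.subspace_scale by metis
        then have "u \<in> W" unfolding wc(1) using wc(2) W M.subspace_add by blast
        then show "u \<in> {0}" using u W by blast
      qed
    qed
    then have "card ?W \<le> card W" using maxW W' W'V by blast
    moreover have "W \<subset> ?W"
    proof -
      have "W \<subseteq> ?W" using ssum_left subspace_cyc by blast
      moreover have "y' \<in> ?W" using ssum_right[of W "cyc y'"] W cyc_self by blast
      moreover have "y' \<notin> W" using y'(2) WS by blast
      ultimately show ?thesis by blast
    qed
    moreover have "finite ?W" using W'V V(1) by (rule finite_subset)
    ultimately show False using psubset_card_mono[of ?W W] by linarith
  qed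
  then show ?thesis using W by blast
qed

text \<open>Induction on the size: pick an irreducible with nontrivial torsion, split off a cyclic
  submodule of largest order among the powers of it, and decompose the complement.\<close>

theorem exists_cyclic_decomposition:
  assumes "finite V" "M.subspace V"
  shows "\<exists>(K :: nat set) F m x. finite K \<and> (\<forall>k\<in>K. monic (F k) \<and> Factorial_Ring.irreducible (F k) \<and> 0 < m k \<and> x k \<in> V) \<and>
    basis_mod {0} K (\<lambda>k. F k ^ m k) x \<and> spn K x = V"
  using assms
proof (induction "card V" arbitrary: V rule: less_induct)
  case less
  note V = less.prems
  show ?case
  proof (cases "V = {0}")
    case True
    have "basis_mod {0} ({} :: nat set) f x" for f x by (simp add: basis_mod_def)
    then show ?thesis using True by (intro exI[of _ "{}"]) auto
  next
    case False
    then obtain y where "y \<in> V" "y \<notin> {0}" using M.subspace_0[OF V(2)] by blast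
    then obtain F z where F: "monic F" "Factorial_Ring.irreducible F" and z: "z \<in> V" "z \<noteq> 0" "F \<star> z = 0"
      using exists_irreducible_torsion[OF V, of "{0}" y] by auto
    define P where "P = {y\<in>V. \<exists>k. F ^ k \<star> y = 0}"
    define ex where "ex = (\<lambda>y. LEAST k. F ^ k \<star> y = 0)"
    have exD: "F ^ ex y \<star> y = 0" if "y \<in> P" for y unfolding ex_def using that by (auto simp: P_def intro: LeastI)
    have zP: "z \<in> P" using z by (auto simp: P_def intro: exI[of _ 1])
    have finP: "finite P" using V by (simp add: P_def)
    obtain v where v: "v \<in> P" "\<And>y. y \<in> P \<Longrightarrow> ex y \<le> ex v"
    proof -
      have "Max (ex ` P) \<in> ex ` P" using finP zP by (intro Max_in) auto
      then obtain v where "v \<in> P" "ex v = Max (ex ` P)" by auto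
      moreover have "ex y \<le> Max (ex ` P)" if "y \<in> P" for y using that finP by (intro Max_ge) auto
      ultimately show ?thesis using that by simp
    qed
    have "ex z \<noteq> 0"
    proof
      assume "ex z = 0"
      then show False using exD[OF zP] z(2) by simp
    qed
    then obtain m where m: "ex v = Suc m" using v(2)[OF zP] by (cases "ex v") auto
    have m1: "F ^ Suc m \<star> v = 0" using exD[OF v(1)] m by simp
    have m2: "F ^ m \<star> v \<noteq> 0" using not_less_Least[of m "\<lambda>k. F ^ k \<star> v = 0"] m by (auto simp: ex_def)
    have max: "F ^ Suc m \<star> y = 0" if "y \<in> V" "F ^ k \<star> y = 0" for y k
    proof -
      have yP: "y \<in> P" using that by (auto simp: P_def)
      have "F ^ Suc m = F ^ (Suc m - ex y) * F ^ ex y" using v(2)[OF yP] m by (simp only: power_add[symmetric]) simp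
      then have "F ^ Suc m \<star> y = F ^ (Suc m - ex y) \<star> (F ^ ex y \<star> y)" by (simp only: M.scale_scale)
      then show ?thesis using exD[OF yP] by simp
    qed
    have vV: "v \<in> V" using v by (simp add: P_def)
    obtain W where W: "M.subspace W" "W \<subseteq> V" "W \<inter> cyc v = {0}" "ssum (cyc v) W = V"
      using exists_complement[OF V vV F m1 m2] max by blast
    have v0: "v \<noteq> 0" using m2 by auto
    then have "v \<notin> W" using W(3) cyc_self by blast
    then have "W \<subset> V" using W(2) vV by blast
    then have "card W < card V" using V(1) by (rule psubset_card_mono[rotated])
    moreover have "finite W" using W(2) V(1) by (rule finite_subset)
    ultimately obtain K :: "nat set" and F' m' x where IH: "finite K" "\<forall>k\<in>K. monic (F' k) \<and> Factorial_Ring.irreducible (F' k) \<and> 0 < m' k \<and> x k \<in> W"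
      "basis_mod {0} K (\<lambda>k. F' k ^ m' k) x" "spn K x = W"
      using less.hyps[of W] W(1) by blast
    obtain k0 where k0: "k0 \<notin> K" using IH(1) ex_new_if_finite infinite_UNIV_nat by blast
    let ?F = "F'(k0 := F)" and ?m = "m'(k0 := Suc m)" and ?x = "x(k0 := v)"
    have combe: "comb (insert k0 K) g ?x = g k0 \<star> v + comb K g x" for g
    proof -
      have "comb K g ?x = comb K g x" using k0 by (intro comb_cong) auto
      then show ?thesis using comb_insert[OF IH(1) k0, of g ?x] by simp
    qed
    have b: "basis_mod {0} (insert k0 K) (\<lambda>k. ?F k ^ ?m k) ?x"
      unfolding basis_mod_def
    proof
      fix g
      have combW: "comb K g x \<in> W" using IH(4) comb_in_spn by blast
      have "comb (insert k0 K) g ?x \<in> {0} \<longleftrightarrow> g k0 \<star> v = 0 \<and> comb K g x = 0"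
      proof
        assume "comb (insert k0 K) g ?x \<in> {0}"
        then have e: "g k0 \<star> v = - comb K g x" unfolding combe by (simp add: eq_neg_iff_add_eq_0)
        moreover have "- comb K g x \<in> W" using combW W(1) M.subspace_neg by blast
        moreover have "g k0 \<star> v \<in> cyc v" by (auto simp: cyc_def)
        ultimately have "g k0 \<star> v = 0" using W(3) by (metis IntI singletonD)
        then show "g k0 \<star> v = 0 \<and> comb K g x = 0" using e by simp
      next
        assume "g k0 \<star> v = 0 \<and> comb K g x = 0"
        then show "comb (insert k0 K) g ?x \<in> {0}" unfolding combe by simp
      qed
      also have "g k0 \<star> v = 0 \<longleftrightarrow> F ^ Suc m dvd g k0" by (rule annihilator_prime_power[OF F(2) m1 m2])
      also have "comb K g x = 0 \<longleftrightarrow> (\<forall>k\<in>K. F' k ^ m' k dvd g k)" using IH(3) unfolding basis_mod_def by simp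
      also have "F ^ Suc m dvd g k0 \<and> (\<forall>k\<in>K. F' k ^ m' k dvd g k) \<longleftrightarrow> (\<forall>k\<in>insert k0 K. ?F k ^ ?m k dvd g k)"
      proof -
        have "k \<noteq> k0" if "k \<in> K" for k using that k0 by blast
        then show ?thesis by auto
      qed
      finally show "comb (insert k0 K) g ?x \<in> {0} \<longleftrightarrow> (\<forall>k\<in>insert k0 K. ?F k ^ ?m k dvd g k)" .
    qed
    have s: "spn (insert k0 K) ?x = V"
    proof
      show "spn (insert k0 K) ?x \<subseteq> V"
        using IH(2) W(2) vV by (intro spn_le[OF V(2)]) auto
      show "V \<subseteq> spn (insert k0 K) ?x"
      proof
        fix y assume "y \<in> V"
        then obtain g w where y: "y = g \<star> v + w" "w \<in> W" using W(4) by (auto simp: ssum_def cyc_def)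
        obtain h where h: "w = comb K h x" using y(2) IH(4) by (auto simp: spn_def)
        have "comb (insert k0 K) (h(k0 := g)) ?x = g \<star> v + comb K (h(k0 := g)) x" unfolding combe by simp
        also have "comb K (h(k0 := g)) x = comb K h x" using k0 by (intro comb_cong) auto
        finally show "y \<in> spn (insert k0 K) ?x" using y h comb_in_spn by metis
      qed
    qed
    show ?thesis
      using b s IH(1,2) F vV W(2) k0 by (intro exI[of _ "insert k0 K"] exI[of _ ?F] exI[of _ ?m] exI[of _ ?x]) auto
  qed
qed

text \<open>These cardinalities are the invariants that recover the partition at \<open>G\<close>. A
  summand of order \<open>G ^ m\<close> contributes a kernel of dimension
  \<open>degree G * min m i\<close>, and a summand at another irreducible contributes
  nothing.\<close>

lemma card_power_kernel:
  assumes K: "finite K" and b: "basis_mod {0} K (\<lambda>k. F k ^ m k) x" and F: "\<And>k. k \<in> K \<Longrightarrow> monic (F k) \<and> Factorial_Ring.irreducible (F k)"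
    and G: "monic G" "Factorial_Ring.irreducible G"
  shows "card {v\<in>spn K x. G ^ i \<star> v = 0} = CARD('a) ^ (Polynomial.degree G * (\<Sum>k\<in>{k\<in>K. F k = G}. min (m k) i))"
proof -
  let ?f = "\<lambda>k. F k ^ m k"
  let ?d = "\<lambda>k. Polynomial.degree (?f k)"
  have f0: "?f k \<noteq> 0" if "k \<in> K" for k using F[OF that] irreducible_neq_0 by auto
  have df: "?d k = m k * Polynomial.degree (F k)" if "k \<in> K" for k
    using F[OF that] irreducible_neq_0 by (simp add: degree_power_eq)
  define R where "R = (\<lambda>k. {g\<in>rpoly (?d k). ?f k dvd G ^ i * g})"
  have "bij_betw (\<lambda>g. comb K g x) (\<Pi>\<^sub>E k\<in>K. R k) {v\<in>spn K x. G ^ i \<star> v = 0}"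
  proof -
    have bij: "bij_betw (\<lambda>(u, g). u + comb K g x) ({0} \<times> (\<Pi>\<^sub>E k\<in>K. rpoly (?d k))) (ssum {0} (spn K x))"
      by (rule bij_ssum_spn[OF b _ K f0]) auto
    have inj: "inj_on (\<lambda>g. comb K g x) (\<Pi>\<^sub>E k\<in>K. rpoly (?d k))"
    proof (rule inj_onI)
      fix g h assume "g \<in> (\<Pi>\<^sub>E k\<in>K. rpoly (?d k))" "h \<in> (\<Pi>\<^sub>E k\<in>K. rpoly (?d k))" "comb K g x = comb K h x"
      then have "(0, g) = (0 :: 'b, h)" using bij by (intro inj_onD[OF bij_betw_imp_inj_on[OF bij]]) auto
      then show "g = h" by simp
    qed
    have kil: "G ^ i \<star> comb K g x = 0 \<longleftrightarrow> (\<forall>k\<in>K. ?f k dvd G ^ i * g k)" for g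
    proof -
      have "G ^ i \<star> comb K g x = 0 \<longleftrightarrow> comb K (\<lambda>k. G ^ i * g k) x \<in> {0}" by (simp add: comb_scale)
      also have "\<dots> \<longleftrightarrow> (\<forall>k\<in>K. ?f k dvd G ^ i * g k)" using b unfolding basis_mod_def by (rule spec)
      finally show ?thesis .
    qed
    have RR: "g \<in> (\<Pi>\<^sub>E k\<in>K. R k) \<longleftrightarrow> g \<in> (\<Pi>\<^sub>E k\<in>K. rpoly (?d k)) \<and> (\<forall>k\<in>K. ?f k dvd G ^ i * g k)" for g
      by (auto simp: R_def PiE_iff)
    show ?thesis
      unfolding bij_betw_def
    proof
      show "inj_on (\<lambda>g. comb K g x) (\<Pi>\<^sub>E k\<in>K. R k)" by (rule inj_on_subset[OF inj]) (use RR in blast)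
      show "(\<lambda>g. comb K g x) ` (\<Pi>\<^sub>E k\<in>K. R k) = {v\<in>spn K x. G ^ i \<star> v = 0}"
      proof
        show "(\<lambda>g. comb K g x) ` (\<Pi>\<^sub>E k\<in>K. R k) \<subseteq> {v\<in>spn K x. G ^ i \<star> v = 0}"
          using RR kil comb_in_spn by blast
        show "{v\<in>spn K x. G ^ i \<star> v = 0} \<subseteq> (\<lambda>g. comb K g x) ` (\<Pi>\<^sub>E k\<in>K. R k)"
        proof
          fix v assume v: "v \<in> {v\<in>spn K x. G ^ i \<star> v = 0}"
          then have "v \<in> spn K x" by simp
          then have "\<exists>c\<in>(\<Pi>\<^sub>E k\<in>K. rpoly (?d k)). v = comb K c x" by (intro spn_rpoly[OF b K]) (use f0 in auto)
          then obtain c where c: "c \<in> (\<Pi>\<^sub>E k\<in>K. rpoly (?d k))" "v = comb K c x" by (rule bexE)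
          have "G ^ i \<star> comb K c x = 0" using v c(2) by simp
          then have "c \<in> (\<Pi>\<^sub>E k\<in>K. R k)" unfolding RR kil using c(1) by simp
          then show "v \<in> (\<lambda>g. comb K g x) ` (\<Pi>\<^sub>E k\<in>K. R k)" using c(2) by blast
        qed
      qed
    qed
  qed
  then have "card {v\<in>spn K x. G ^ i \<star> v = 0} = card (\<Pi>\<^sub>E k\<in>K. R k)" by (rule bij_betw_same_card[symmetric])
  also have "\<dots> = (\<Prod>k\<in>K. card (R k))" by (rule card_PiE[OF K])
  also have "\<dots> = (\<Prod>k\<in>K. if F k = G then CARD('a) ^ (Polynomial.degree G * min (m k) i) else 1)"
  proof (rule prod.cong[OF refl])
    fix k assume k: "k \<in> K"
    show "card (R k) = (if F k = G then CARD('a) ^ (Polynomial.degree G * min (m k) i) else 1)"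
    proof (cases "F k = G")
      case False
      have "R k = {0}"
      proof
        show "R k \<subseteq> {0}"
        proof
          fix g assume g: "g \<in> R k"
          have "\<not> F k dvd G" using False monic_irreducible_dvd_eq F[OF k] G by blast
          then have "coprime (F k) G" using F[OF k] prime_elem_imp_coprime irreducible_imp_prime_elem_gcd by blast
          then have "coprime (?f k) (G ^ i)" by simp
          then have "?f k dvd g" using g by (simp add: R_def coprime_dvd_mult_right_iff)
          then show "g \<in> {0}" using dvd_rpoly_imp_0 g by (auto simp: R_def)
        qed
      qed (simp add: R_def)
      then show ?thesis using False by simp
    next
      case True
      show ?thesis
      proof (cases "m k \<le> i")
        case le: True
        then have "?f k dvd G ^ i * g" for g using True by (simp add: le_imp_power_dvd)
        then have "R k = rpoly (?d k)" by (auto simp: R_def)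
        then show ?thesis using True le df[OF k] by (simp add: card_rpoly mult.commute)
      next
        case False
        have G0: "G \<noteq> 0" using irreducible_neq_0[OF G(2)] .
        have dm: "Polynomial.degree (G ^ (m k - i)) = (m k - i) * Polynomial.degree G" using G0 by (simp add: degree_power_eq)
        have ile: "i * Polynomial.degree G \<le> m k * Polynomial.degree G" using False by (intro mult_le_mono1) simp
        have e: "?f k = G ^ i * G ^ (m k - i)" using True False by (simp add: power_add[symmetric])
        have "R k = (\<lambda>h. G ^ (m k - i) * h) ` rpoly (i * Polynomial.degree G)"
        proof
          show "R k \<subseteq> (\<lambda>h. G ^ (m k - i) * h) ` rpoly (i * Polynomial.degree G)"
          proof
            fix g assume g: "g \<in> R k"
            then have "G ^ (m k - i) dvd g" using G0 unfolding R_def e by simp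
            then obtain h where h: "g = G ^ (m k - i) * h" by (rule dvdE)
            have "h \<in> rpoly (i * Polynomial.degree G)"
            proof (cases "h = 0")
              case False
              then have "(m k - i) * Polynomial.degree G + Polynomial.degree h < m k * Polynomial.degree G"
                using g h G0 df[OF k] True dm by (auto simp: R_def rpoly_iff degree_mult_eq)
              then have "Polynomial.degree h < i * Polynomial.degree G" using ile unfolding diff_mult_distrib by linarith
              then show ?thesis by (simp add: rpoly_iff)
            qed simp
            then show "g \<in> (\<lambda>h. G ^ (m k - i) * h) ` rpoly (i * Polynomial.degree G)" using h by blast
          qed
          show "(\<lambda>h. G ^ (m k - i) * h) ` rpoly (i * Polynomial.degree G) \<subseteq> R k"
          proof
            fix g assume "g \<in> (\<lambda>h. G ^ (m k - i) * h) ` rpoly (i * Polynomial.degree G)"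
            then obtain h where h: "g = G ^ (m k - i) * h" "h \<in> rpoly (i * Polynomial.degree G)" by blast
            have "g \<in> rpoly (?d k)"
            proof (cases "h = 0")
              case False
              then have "Polynomial.degree h < i * Polynomial.degree G" using h(2) by (simp add: rpoly_iff)
              then have "(m k - i) * Polynomial.degree G + Polynomial.degree h < m k * Polynomial.degree G"
                using ile unfolding diff_mult_distrib by linarith
              then show ?thesis using h(1) False G0 df[OF k] True dm by (simp add: rpoly_iff degree_mult_eq)
            qed (use h in simp)
            moreover have "?f k dvd G ^ i * g" unfolding e h(1) by simp
            ultimately show "g \<in> R k" by (simp add: R_def)
          qed
        qed
        moreover have "inj_on (\<lambda>h. G ^ (m k - i) * h) (rpoly (i * Polynomial.degree G))" using G0 by (simp add: inj_on_def)
        ultimately show ?thesis using True False by (simp add: card_image card_rpoly mult.commute)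
      qed
    qed
  qed
  also have "\<dots> = (\<Prod>k\<in>{k\<in>K. F k = G}. CARD('a) ^ (Polynomial.degree G * min (m k) i))"
    using K by (simp add: prod.inter_filter)
  also have "\<dots> = CARD('a) ^ (Polynomial.degree G * (\<Sum>k\<in>{k\<in>K. F k = G}. min (m k) i))"
    by (simp add: power_sum sum_distrib_left)
  finally show ?thesis .
qed

end

section \<open>Partitions and their invariants\<close>

lemma down_closed_eq_lessThan:
  fixes D :: "nat set"
  assumes "finite D" "\<And>i j. j \<in> D \<Longrightarrow> i \<le> j \<Longrightarrow> i \<in> D"
  shows "D = {..<card D}"
proof (rule Set.set_eqI)
  fix j
  show "j \<in> D \<longleftrightarrow> j \<in> {..<card D}"
  proof
    assume "j \<in> D"
    then have "{..j} \<subseteq> D" using assms(2) by auto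
    then have "card {..j} \<le> card D" using assms(1) by (intro card_mono)
    then show "j \<in> {..<card D}" by simp
  next
    assume j: "j \<in> {..<card D}"
    show "j \<in> D"
    proof (rule ccontr)
      assume nj: "j \<notin> D"
      have "D \<subseteq> {..<j}"
      proof
        fix i assume "i \<in> D"
        then show "i \<in> {..<j}" using assms(2)[of i j] nj by (cases "i < j") auto
      qed
      then have "card D \<le> card {..<j}" by (intro card_mono) auto
      then show False using j by simp
    qed
  qed
qed

text \<open>The increment from \<open>i\<close> to \<open>Suc i\<close> is the number of parts
  larger than \<open>i\<close>, a part of the conjugate partition. As the parts decrease, this
  number determines which indices carry them.\<close>

lemma partition_eqI:
  assumes l: "l \<in> partitions" and l': "l' \<in> partitions"
    and eq: "\<And>i. (\<Sum>j | l j \<noteq> 0. min (l j) i) = (\<Sum>j | l' j \<noteq> 0. min (l' j) i)"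
  shows "l = l'"
proof -
  have card: "(\<Sum>j | l j \<noteq> 0. min (l j) (Suc i)) = (\<Sum>j | l j \<noteq> 0. min (l j) i) + card {j. i < l j}"
    if "l \<in> partitions" for l :: "nat \<Rightarrow> nat" and i
  proof -
    have fin: "finite {j. l j \<noteq> 0}" using that by (simp add: partitions_def)
    have "(\<Sum>j | l j \<noteq> 0. min (l j) (Suc i)) = (\<Sum>j | l j \<noteq> 0. min (l j) i + (if i < l j then 1 else 0))"
      by (rule sum.cong) auto
    also have "\<dots> = (\<Sum>j | l j \<noteq> 0. min (l j) i) + card {j\<in>{j. l j \<noteq> 0}. i < l j}"
      using fin by (simp add: sum.distrib sum.If_cases Int_def)
    also have "{j\<in>{j. l j \<noteq> 0}. i < l j} = {j. i < l j}" by auto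
    finally show ?thesis .
  qed
  have seg: "{j. i < l j} = {..<card {j. i < l j}}" if "l \<in> partitions" for l :: "nat \<Rightarrow> nat" and i
  proof (rule down_closed_eq_lessThan)
    show "finite {j. i < l j}" using that by (auto simp: partitions_def elim: rev_finite_subset)
    show "i' \<in> {j. i < l j}" if "j \<in> {j. i < l j}" "i' \<le> j" for i' j
      using that \<open>l \<in> partitions\<close> by (auto simp: partitions_def dest: antimonoD[of l i' j])
  qed
  have "card {j. i < l j} = card {j. i < l' j}" for i
    using card[OF l, of i] card[OF l', of i] eq[of i] eq[of "Suc i"] by simp
  then have "{j. i < l j} = {j. i < l' j}" for i using seg[OF l, of i] seg[OF l', of i] by simp
  then have "i < l j \<longleftrightarrow> i < l' j" for i j by blast
  then have "l j \<le> l' j \<and> l' j \<le> l j" for j by (meson less_irrefl not_le)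
  then show ?thesis by (intro ext antisym) auto
qed

lemma exists_partition_enumeration:
  fixes m :: "'k \<Rightarrow> nat"
  assumes "finite K" "\<And>k. k \<in> K \<Longrightarrow> 0 < m k"
  shows "\<exists>l \<sigma>. l \<in> partitions \<and> bij_betw \<sigma> {j. 0 < l j} K \<and> (\<forall>j. 0 < l j \<longrightarrow> m (\<sigma> j) = l j)"
proof -
  obtain xs where xs: "set xs = K" "distinct xs" using finite_distinct_list[OF assms(1)] by blast
  define ks where "ks = rev (sort_key m xs)"
  have ks: "set ks = K" "distinct ks" using xs by (auto simp: ks_def)
  define l where "l = (\<lambda>j. if j < length ks then m (ks ! j) else 0)"
  have pos: "0 < l j \<longleftrightarrow> j < length ks" for j
    using assms(2)[of "ks ! j"] ks(1) nth_mem[of j ks] by (simp add: l_def)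
  have srt: "sorted (rev (map m ks))" by (simp add: ks_def rev_map)
  have "antimono l"
  proof (rule antimonoI)
    fix i j :: nat assume ij: "i \<le> j"
    show "l j \<le> l i"
    proof (cases "j < length ks")
      case True
      then show ?thesis using sorted_rev_nth_mono[OF srt ij] ij by (simp add: l_def)
    qed (simp add: l_def)
  qed
  moreover have "{j. l j \<noteq> 0} = {..<length ks}" using pos by auto
  ultimately have "l \<in> partitions" by (simp add: partitions_def)
  moreover have "bij_betw (nth ks) {j. 0 < l j} K"
    using bij_betw_nth[OF ks(2), of "{..<length ks}"] ks(1) pos by (auto simp: lessThan_def)
  moreover have "\<forall>j. 0 < l j \<longrightarrow> m (ks ! j) = l j" using pos by (simp add: l_def)
  ultimately show ?thesis by blast
qed

context poly_module
begin

lemma comb_reindex: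
  assumes "bij_betw h K' K" shows "comb K' (\<lambda>k. g (h k)) (\<lambda>k. x (h k)) = comb K g x"
  unfolding comb_def by (rule sum.reindex_bij_betw[OF assms, of "\<lambda>k. g k \<star> x k"])

lemma comb_reindex':
  assumes "bij_betw h K' K" shows "comb K' g (\<lambda>k. x (h k)) = comb K (\<lambda>k. g (inv_into K' h k)) x"
proof -
  have "comb K' g (\<lambda>k. x (h k)) = comb K' (\<lambda>k. g (inv_into K' h (h k))) (\<lambda>k. x (h k))"
    using assms by (intro comb_cong) (simp add: bij_betw_def)
  then show ?thesis using comb_reindex[OF assms, of "\<lambda>k. g (inv_into K' h k)" x] by simp
qed

lemma basis_mod_reindex:
  assumes h: "bij_betw h K' K" and b: "basis_mod U K f x"
  shows "basis_mod U K' (\<lambda>k. f (h k)) (\<lambda>k. x (h k))"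
  unfolding basis_mod_def
proof
  fix g
  have "comb K' g (\<lambda>k. x (h k)) \<in> U \<longleftrightarrow> (\<forall>k\<in>K. f k dvd g (inv_into K' h k))"
    unfolding comb_reindex'[OF h] using b by (simp add: basis_mod_def)
  also have "\<dots> \<longleftrightarrow> (\<forall>k\<in>h ` K'. f k dvd g (inv_into K' h k))" using h by (simp add: bij_betw_def)
  also have "\<dots> \<longleftrightarrow> (\<forall>k\<in>K'. f (h k) dvd g k)" using bij_betw_inv_into_left[OF h] by simp
  finally show "comb K' g (\<lambda>k. x (h k)) \<in> U \<longleftrightarrow> (\<forall>k\<in>K'. f (h k) dvd g k)" .
qed

lemma spn_reindex:
  assumes h: "bij_betw h K' K" shows "spn K' (\<lambda>k. x (h k)) = spn K x"
proof
  show "spn K' (\<lambda>k. x (h k)) \<subseteq> spn K x"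
    unfolding spn_def by (auto simp: comb_reindex'[OF h])
  show "spn K x \<subseteq> spn K' (\<lambda>k. x (h k))"
  proof
    fix v assume "v \<in> spn K x"
    then obtain g where "v = comb K g x" by (auto simp: spn_def)
    then have "v = comb K' (\<lambda>k. g (h k)) (\<lambda>k. x (h k))" using comb_reindex[OF h] by simp
    then show "v \<in> spn K' (\<lambda>k. x (h k))" by (simp only: comb_in_spn)
  qed
qed

end

section \<open>Companion matrices\<close>

lemma sum_lessThan_add: "(\<Sum>b<m + n. h b) = (\<Sum>b<m. h b) + (\<Sum>b<n. h (m + b))"
  for m n :: nat and h :: "nat \<Rightarrow> 'a::comm_monoid_add"
  by (induction n) (simp_all add: add_ac)

lemma mat_mult_index_sum:
  assumes "A \<in> carrier_mat n m" "B \<in> carrier_mat m k" "i < n" "j < k"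
  shows "(A * B) $$ (i, j) = (\<Sum>b<m. A $$ (i, b) * B $$ (b, j))"
  using assms by (simp add: scalar_prod_def atLeast0LessThan)

text \<open>Row \<open>off d k + e\<close> of a block diagonal matrix with blocks of sizes \<open>d\<close> is row \<open>e\<close> of block \<open>k\<close>.\<close>

definition off :: "(nat \<Rightarrow> nat) \<Rightarrow> nat \<Rightarrow> nat" where
  "off d k = (\<Sum>i<k. d i)"

lemma off_less:
  assumes "k < L" "e < d k" shows "off d k + e < off d L"
proof -
  have "off d (Suc k) \<le> off d L" unfolding off_def using assms(1) by (intro sum_mono2) auto
  then show ?thesis using assms(2) by (simp add: off_def)
qed

lemma bij_off: "bij_betw (\<lambda>(k, e). off d k + e) (SIGMA k:{..<L}. {..<d k}) {..<off d L}"
proof -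
  have inj: "inj_on (\<lambda>(k, e). off d k + e) (SIGMA k:{..<L}. {..<d k})"
  proof (rule inj_onI, clarify)
    fix k e k' e' assume a: "k < L" "e < d k" "k' < L" "e' < d k'" "off d k + e = off d k' + e'"
    have "k = k'"
    proof (cases rule: linorder_cases[of k k'])
      case less
      then show ?thesis using off_less[of k k' e d] a by simp
    next
      case greater
      then show ?thesis using off_less[of k' k e' d] a by simp
    qed simp
    then show "k = k' \<and> e = e'" using a by simp
  qed
  have "(\<lambda>(k, e). off d k + e) ` (SIGMA k:{..<L}. {..<d k}) = {..<off d L}"
  proof (rule card_subset_eq)
    show "(\<lambda>(k, e). off d k + e) ` (SIGMA k:{..<L}. {..<d k}) \<subseteq> {..<off d L}"
      using off_less by auto
    show "card ((\<lambda>(k, e). off d k + e) ` (SIGMA k:{..<L}. {..<d k})) = card {..<off d L}"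
      unfolding card_image[OF inj] by (simp add: off_def)
  qed simp
  then show ?thesis using inj by (simp add: bij_betw_def)
qed

definition companion_diag :: "'a::comm_ring_1 poly list \<Rightarrow> 'a mat" where
  "companion_diag fs = diag_block_mat (map companion_matrix fs)"

abbreviation degs :: "'a::zero poly list \<Rightarrow> nat \<Rightarrow> nat" where
  "degs fs \<equiv> \<lambda>k. Polynomial.degree (fs ! k)"

lemma companion_matrix_carrier: "companion_matrix f \<in> carrier_mat (Polynomial.degree f) (Polynomial.degree f)"
  by (simp add: companion_matrix_def)

lemma off_degs_Cons: "off (degs (f # fs)) (Suc k) = Polynomial.degree f + off (degs fs) k"
  unfolding off_def sum.lessThan_Suc_shift by simp

lemma companion_diag_carrier:
  "companion_diag fs \<in> carrier_mat (off (degs fs) (length fs)) (off (degs fs) (length fs))"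
proof (induction fs)
  case Nil
  then show ?case by (simp add: companion_diag_def off_def)
next
  case (Cons f fs)
  then show ?case using companion_matrix_carrier[of f]
    by (auto simp: companion_diag_def off_degs_Cons Let_def)
qed

lemma companion_diag_Cons:
  fixes f :: "'a::comm_ring_1 poly"
  defines "d \<equiv> Polynomial.degree f"
  shows "companion_diag (f # fs) = four_block_mat (companion_matrix f) (0\<^sub>m d (off (degs fs) (length fs)))
    (0\<^sub>m (off (degs fs) (length fs)) d) (companion_diag fs)"
  using companion_matrix_carrier[of f] companion_diag_carrier[of fs]
  by (simp add: companion_diag_def Let_def d_def)

text \<open>Read on rows, the matrix shifts within each block and closes the block with the relation
  of its polynomial. This identifies the rows of a conjugating matrix with Krylov vectors.\<close>

lemma companion_diag_row:
  assumes "k < length fs" "e < degs fs k"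
  shows "(\<Sum>b<off (degs fs) (length fs). companion_diag fs $$ (off (degs fs) k + e, b) * q b) =
    (if Suc e = degs fs k then - (\<Sum>j<degs fs k. Polynomial.coeff (fs ! k) j * q (off (degs fs) k + j))
     else q (off (degs fs) k + Suc e))"
  using assms
proof (induction fs arbitrary: k q)
  case (Cons f fs)
  let ?d = "Polynomial.degree f" and ?N = "off (degs fs) (length fs)"
  let ?B = "companion_diag (f # fs)"
  have C: "dim_row (companion_matrix f) = ?d" "dim_col (companion_matrix f) = ?d"
    using companion_matrix_carrier[of f] by auto
  have D: "dim_row (companion_diag fs) = ?N" "dim_col (companion_diag fs) = ?N"
    using companion_diag_carrier[of fs] by auto
  have split: "(\<Sum>b<off (degs (f # fs)) (length (f # fs)). ?B $$ (a, b) * q b) =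
      (\<Sum>b<?d. ?B $$ (a, b) * q b) + (\<Sum>b<?N. ?B $$ (a, ?d + b) * q (?d + b))" for a
    unfolding list.size(4) add_Suc_right off_degs_Cons add_0_right by (rule sum_lessThan_add)
  show ?case
  proof (cases k)
    case 0
    then have e: "e < ?d" using Cons.prems by simp
    have 1: "?B $$ (e, b) = companion_matrix f $$ (e, b)" if "b < ?d" for b
      unfolding companion_diag_Cons using that e C D by simp
    have 2: "?B $$ (e, ?d + b) = 0" if "b < ?N" for b
      unfolding companion_diag_Cons using that e C D by simp
    have "(\<Sum>b<off (degs (f # fs)) (length (f # fs)). ?B $$ (e, b) * q b) = (\<Sum>b<?d. companion_matrix f $$ (e, b) * q b)"
      unfolding split using 1 2 by simp
    also have "\<dots> = (if Suc e = ?d then - (\<Sum>j<?d. Polynomial.coeff f j * q j) else q (Suc e))"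
    proof (cases "Suc e = ?d")
      case True
      then show ?thesis using e by (simp add: companion_matrix_def sum_negf)
    next
      case False
      have "(\<Sum>b<?d. companion_matrix f $$ (e, b) * q b) = (\<Sum>b<?d. if b = Suc e then q b else 0)"
        using e False by (intro sum.cong) (auto simp: companion_matrix_def)
      then show ?thesis using e False by simp
    qed
    finally show ?thesis using 0 by (simp add: off_def)
  next
    case (Suc k')
    have k': "k' < length fs" "e < degs fs k'" using Cons.prems Suc by auto
    have lt: "off (degs fs) k' + e < ?N" using off_less[OF k'(1), of e "degs fs"] k'(2) by simp
    let ?a = "?d + off (degs fs) k' + e"
    have 1: "?B $$ (?a, b) = 0" if "b < ?d" for b
      unfolding companion_diag_Cons using that lt C D by simp
    have 2: "?B $$ (?a, ?d + b) = companion_diag fs $$ (off (degs fs) k' + e, b)" if "b < ?N" for b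
      unfolding companion_diag_Cons using that lt C D by (simp add: add.assoc)
    have "(\<Sum>b<off (degs (f # fs)) (length (f # fs)). ?B $$ (?a, b) * q b) =
        (\<Sum>b<?N. companion_diag fs $$ (off (degs fs) k' + e, b) * q (?d + b))"
      unfolding split using 1 2 by simp
    also note Cons.IH[OF k', of "\<lambda>b. q (?d + b)"]
    finally show ?thesis using Suc by (simp add: off_degs_Cons add_ac)
  qed
qed simp

lemma char_poly_four_block_diag:
  fixes A B :: "'a::field mat"
  assumes A: "A \<in> carrier_mat n n" and B: "B \<in> carrier_mat m m"
  shows "char_poly (four_block_mat A (0\<^sub>m n m) (0\<^sub>m m n) B) = char_poly A * char_poly B"
proof -
  have "char_poly_matrix (four_block_mat A (0\<^sub>m n m) (0\<^sub>m m n) B) =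
      four_block_mat (char_poly_matrix A) (0\<^sub>m n m) (0\<^sub>m m n) (char_poly_matrix B)"
    by (rule eq_matI) (use A B in \<open>auto simp: char_poly_matrix_def\<close>)
  then show ?thesis unfolding char_poly_def
    using det_four_block_mat_upper_right_zero[of "char_poly_matrix A" n "0\<^sub>m n m" m "0\<^sub>m m n" "char_poly_matrix B"] A B by simp
qed

text \<open>Expansion along the first column: the minor at the top is the characteristic matrix for
  \<open>g\<close>, and the minor at the bottom is lower triangular with \<open>- 1\<close> on its
  diagonal, whose sign cancels that of the cofactor.\<close>

lemma char_poly_companion_matrix:
  fixes f :: "'a::field poly"
  assumes "monic f" "0 < Polynomial.degree f"
  shows "char_poly (companion_matrix f) = f"
  using assms
proof (induction f)
  case (pCons a g)
  have g0: "g \<noteq> 0" using pCons.prems by auto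
  let ?r = "Polynomial.degree g"
  have mg: "monic g" using pCons.prems g0 by simp
  define f where "f = pCons a g"
  have df: "Polynomial.degree f = Suc ?r" using g0 by (simp add: f_def)
  define B where "B = char_poly_matrix (companion_matrix f)"
  have B: "B \<in> carrier_mat (Suc ?r) (Suc ?r)" using companion_matrix_carrier[of f] df by (simp add: B_def)
  have Bij: "B $$ (i, j) = (if i = j then [:0, 1:] else 0) + (if i = ?r then [:Polynomial.coeff f j:] else if j = Suc i then - 1 else 0)"
    if "i < Suc ?r" "j < Suc ?r" for i j
    using that df by (auto simp: B_def char_poly_matrix_def companion_matrix_def one_pCons)
  have det: "det B = (\<Sum>i<Suc ?r. B $$ (i, 0) * cofactor B i 0)" by (rule laplace_expansion_column[OF B]) simp
  have "det B = f"
  proof (cases "?r = 0")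
    case True
    then have g1: "g = 1" using mg monic_degree_0 by blast
    have "det (mat_delete B 0 0) = 1" using B True by (intro det_dim_zero) (auto simp: mat_delete_def)
    then have "cofactor B 0 0 = 1" by (simp add: cofactor_def)
    then show ?thesis unfolding det using True Bij[of 0 0] by (simp add: f_def g1 one_pCons)
  next
    case False
    have "det B = B $$ (0, 0) * cofactor B 0 0 + (\<Sum>i<?r. B $$ (Suc i, 0) * cofactor B (Suc i) 0)"
      unfolding det by (rule sum.lessThan_Suc_shift)
    also have "(\<Sum>i<?r. B $$ (Suc i, 0) * cofactor B (Suc i) 0) = (\<Sum>i<?r. if i = ?r - 1 then [:a:] * cofactor B ?r 0 else 0)"
      using False by (intro sum.cong) (auto simp: Bij f_def)
    also have "\<dots> = [:a:] * cofactor B ?r 0" using False by simp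
    also have "cofactor B 0 0 = g"
    proof -
      have "mat_delete B 0 0 = char_poly_matrix (companion_matrix g)"
      proof (rule eq_matI)
        fix i j assume "i < dim_row (char_poly_matrix (companion_matrix g))" "j < dim_col (char_poly_matrix (companion_matrix g))"
        then have ij: "i < ?r" "j < ?r" using companion_matrix_carrier[of g] by (auto simp: char_poly_matrix_def)
        have "mat_delete B 0 0 $$ (i, j) = B $$ (Suc i, Suc j)" using ij B by (simp add: mat_delete_def)
        also have "\<dots> = char_poly_matrix (companion_matrix g) $$ (i, j)"
          using ij by (auto simp: Bij f_def char_poly_matrix_def companion_matrix_def one_pCons)
        finally show "mat_delete B 0 0 $$ (i, j) = char_poly_matrix (companion_matrix g) $$ (i, j)" .
      qed (use B companion_matrix_carrier[of g] in \<open>auto simp: mat_delete_def char_poly_matrix_def\<close>)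
      then show ?thesis using pCons.IH[OF mg] False by (simp add: cofactor_def char_poly_def)
    qed
    also have "cofactor B ?r 0 = 1"
    proof -
      let ?D = "mat_delete B ?r 0"
      have D: "?D \<in> carrier_mat ?r ?r" using B by (auto simp: mat_delete_def)
      have Dij: "?D $$ (i, j) = (if i = Suc j then [:0, 1:] else if j = i then - 1 else 0)" if "i < ?r" "j < ?r" for i j
        using that B Bij[of i "Suc j"] by (auto simp: mat_delete_def)
      have "det ?D = prod_list (diag_mat ?D)" by (rule det_lower_triangular[OF _ D]) (simp add: Dij)
      also have "diag_mat ?D = replicate ?r (- 1)"
        by (rule nth_equalityI) (use D Dij in \<open>auto simp: diag_mat_def\<close>)
      also have "prod_list (replicate ?r (- 1 :: 'a poly)) = (- 1) ^ ?r" by simp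
      finally show ?thesis by (simp add: cofactor_def power_add[symmetric])
    qed
    finally show ?thesis using Bij[of 0 0] False by (simp add: f_def)
  qed
  then show ?case by (simp add: B_def f_def char_poly_def)
qed simp

lemma char_poly_companion_diag:
  fixes fs :: "'a::field poly list"
  assumes "\<And>f. f \<in> set fs \<Longrightarrow> monic f \<and> 0 < Polynomial.degree f"
  shows "char_poly (companion_diag fs) = prod_list fs"
  using assms
proof (induction fs)
  case Nil
  have "char_poly (companion_diag ([] :: 'a poly list)) = 1"
    unfolding char_poly_def by (rule det_dim_zero) (simp add: companion_diag_def)
  then show ?case by simp
next
  case (Cons f fs)
  then show ?case
    by (simp add: companion_diag_Cons char_poly_four_block_diag[OF companion_matrix_carrier companion_diag_carrier]
        char_poly_companion_matrix)
qed

section \<open>Companion form and cyclic bases of the row module\<close>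

definition mat_rows :: "nat \<Rightarrow> 'a mat \<Rightarrow> nat \<Rightarrow> nat \<Rightarrow> 'a::zero" where
  "mat_rows n Q a = (\<lambda>i. if i < n then Q $$ (a, i) else 0)"

lemma mop_mat_rows:
  fixes A Q :: "'a::comm_ring_1 mat"
  assumes "Q \<in> carrier_mat N n" "A \<in> carrier_mat n n" "a < N"
  shows "mop n (\<lambda>j i. A $$ (i, j)) (mat_rows n Q a) = mat_rows n (Q * A) a"
proof
  fix j
  show "mop n (\<lambda>j i. A $$ (i, j)) (mat_rows n Q a) j = mat_rows n (Q * A) a j"
    using mat_mult_index_sum[OF assms(1,2,3), of j] by (auto simp: mop_def mat_rows_def)
qed

lemma card_vecs_lessThan: "card (vecs {..<n} :: (nat \<Rightarrow> 'a::{zero,finite}) set) = CARD('a) ^ n"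
proof -
  have "bij_betw (\<lambda>v. restrict v {..<n}) (vecs {..<n} :: (nat \<Rightarrow> 'a) set) ({..<n} \<rightarrow>\<^sub>E UNIV)"
  proof (rule bij_betwI[where g = "\<lambda>v i. if i < n then v i else 0"])
    show "(\<lambda>v i. if i < n then v i else 0) \<in> ({..<n} \<rightarrow>\<^sub>E UNIV) \<rightarrow> (vecs {..<n} :: (nat \<Rightarrow> 'a) set)"
      by (rule funcsetI) (simp add: vecs_def)
    show "(\<lambda>i. if i < n then restrict v {..<n} i else 0) = v" if "v \<in> vecs {..<n}" for v :: "nat \<Rightarrow> 'a"
      using that by (intro ext) (simp add: vecs_def)
    show "restrict (\<lambda>i. if i < n then v i else 0) {..<n} = v" if "v \<in> {..<n} \<rightarrow>\<^sub>E UNIV" for v :: "nat \<Rightarrow> 'a"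
      using that by (intro ext) (simp add: PiE_iff extensional_def)
  qed simp
  from bij_betw_same_card[OF this] show ?thesis by (simp add: card_PiE)
qed

context lin_op
begin

lemma monic_annihilates_iff:
  assumes "monic f"
  shows "pact T f v = 0 \<longleftrightarrow> tpow (Polynomial.degree f) v = - (\<Sum>e<Polynomial.degree f. scal (Polynomial.coeff f e) (tpow e v))"
proof -
  have "f \<in> rpoly (Suc (Polynomial.degree f))" by (simp add: rpoly_iff)
  from pact_eq_sum[OF this, of v] have "pact T f v = (\<Sum>e<Polynomial.degree f. scal (Polynomial.coeff f e) (tpow e v)) + tpow (Polynomial.degree f) v"
    using assms by (simp del: scal_apply)
  then show ?thesis by (simp add: eq_neg_iff_add_eq_0 add.commute)
qed

end

lemma sum_off:
  "(\<Sum>(k, e)\<in>(SIGMA k:{..<L}. {..<d k}). h k e (off d k + e)) =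
   (\<Sum>a<off d L. case inv_into (SIGMA k:{..<L}. {..<d k}) (\<lambda>(k, e). off d k + e) a of (k, e) \<Rightarrow> h k e a)"
proof -
  let ?S = "SIGMA k:{..<L}. {..<d k}" and ?\<phi> = "\<lambda>(k, e). off d k + e"
  have "(\<Sum>s\<in>?S. (\<lambda>a. case inv_into ?S ?\<phi> a of (k, e) \<Rightarrow> h k e a) (?\<phi> s)) =
      (\<Sum>a<off d L. case inv_into ?S ?\<phi> a of (k, e) \<Rightarrow> h k e a)"
    by (rule sum.reindex_bij_betw[OF bij_off])
  moreover have "(\<Sum>s\<in>?S. (\<lambda>a. case inv_into ?S ?\<phi> a of (k, e) \<Rightarrow> h k e a) (?\<phi> s)) =
      (\<Sum>(k, e)\<in>?S. h k e (off d k + e))"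
  proof (rule sum.cong[OF refl])
    fix s assume s: "s \<in> ?S"
    obtain k e where ke: "s = (k, e)" by (cases s)
    have "inv_into ?S ?\<phi> (?\<phi> s) = s" by (rule bij_betw_inv_into_left[OF bij_off s])
    then show "(\<lambda>a. case inv_into ?S ?\<phi> a of (k, e) \<Rightarrow> h k e a) (?\<phi> s) = (case s of (k, e) \<Rightarrow> h k e (off d k + e))"
      unfolding ke by simp
  qed
  ultimately show ?thesis by simp
qed

text \<open>\<open>A = P * B * Q\<close> gives \<open>Q * A = B * Q\<close>, so the rows of
  \<open>Q\<close> within a block are the successive images of its first row under \<open>A\<close>.
  Invertibility of \<open>Q\<close> yields independence of the residues, and a cardinality count
  yields the span.\<close>

lemma similar_companion_diag_imp_basis:
  fixes A :: "'a::{field_gcd,finite} mat" and fs :: "'a poly list"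
  defines "Z \<equiv> \<lambda>j i. A $$ (i, j)"
  assumes A: "A \<in> carrier_mat n n" and fs: "\<And>f. f \<in> set fs \<Longrightarrow> monic f \<and> 0 < Polynomial.degree f"
    and sim: "similar_mat A (companion_diag fs)"
  shows "\<exists>x. (\<forall>k<length fs. x k \<in> vecs {..<n}) \<and> mo.basis_mod n Z {0} {..<length fs} (\<lambda>k. fs ! k) x \<and>
    mo.spn n Z {..<length fs} x = vecs {..<n}"
proof -
  let ?B = "companion_diag fs" and ?L = "length fs" and ?d = "degs fs"
  let ?S = "SIGMA k:{..<?L}. {..<?d k}"
  obtain m P Q where PQ: "{A, ?B, P, Q} \<subseteq> carrier_mat m m" "P * Q = 1\<^sub>m m" "Q * P = 1\<^sub>m m" "A = P * ?B * Q"
    using similar_matD[OF sim] by blast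
  have mn: "m = n" using PQ(1) A by auto
  have N: "off ?d ?L = n" using PQ(1) mn companion_diag_carrier[of fs] by auto
  have B: "?B \<in> carrier_mat n n" and P: "P \<in> carrier_mat n n" and Q: "Q \<in> carrier_mat n n" using PQ(1) mn by auto
  have QA: "Q * A = ?B * Q"
  proof -
    have "Q * A = Q * (P * (?B * Q))" using PQ(4) P B Q by (simp add: assoc_mult_mat[of _ n n _ n _ n])
    also have "\<dots> = (Q * P) * (?B * Q)" by (rule assoc_mult_mat[symmetric]) (use P B Q in auto)
    finally show ?thesis using PQ(3) mn B Q by simp
  qed
  let ?r = "mat_rows n Q"
  define x where "x = (\<lambda>k. ?r (off ?d k))"
  have fk: "monic (fs ! k)" "0 < ?d k" if "k < ?L" for k using fs that by auto
  have lt: "off ?d k + e < n" if "k < ?L" "e < ?d k" for k e using off_less[OF that(1), of e ?d] that(2) N by simp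
  have T: "mop n Z (?r (off ?d k + e)) i = (if Suc e = ?d k then - (\<Sum>j<?d k. Polynomial.coeff (fs ! k) j * ?r (off ?d k + j) i)
      else ?r (off ?d k + Suc e) i)" if ke: "k < ?L" "e < ?d k" for k e i
  proof (cases "i < n")
    case True
    have "mop n Z (?r (off ?d k + e)) i = (?B * Q) $$ (off ?d k + e, i)"
      unfolding Z_def mop_mat_rows[OF Q A lt[OF ke]] QA using True by (simp add: mat_rows_def)
    also have "\<dots> = (\<Sum>b<off ?d ?L. ?B $$ (off ?d k + e, b) * Q $$ (b, i))"
      using mat_mult_index_sum[OF B Q lt[OF ke] True] N by simp
    also note companion_diag_row[OF ke, of "\<lambda>b. Q $$ (b, i)"]
    finally show ?thesis using True by (simp add: mat_rows_def)
  qed (simp add: mop_def mat_rows_def)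
  have tp: "mo.tpow n Z e (x k) = ?r (off ?d k + e)" if "k < ?L" "e < ?d k" for k e
    using that(2)
  proof (induction e)
    case 0
    show ?case by (simp add: mo.tpow_0 x_def)
  next
    case (Suc e)
    then have "mo.tpow n Z (Suc e) (x k) = mop n Z (?r (off ?d k + e))" by (simp add: mo.tpow_Suc)
    also have "\<dots> = ?r (off ?d k + Suc e)" by (rule ext) (use T[OF that(1), of e] Suc.prems in simp)
    finally show ?case .
  qed
  have fx: "pact (mop n Z) (fs ! k) (x k) = 0" if k: "k \<in> {..<?L}" for k
  proof -
    obtain e where e: "?d k = Suc e" using fk(2)[of k] k by (cases "?d k") auto
    have "mo.tpow n Z (?d k) (x k) = mop n Z (?r (off ?d k + e))" using tp[of k e] k e by (simp add: mo.tpow_Suc)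
    also have "\<dots> = - (\<Sum>j<?d k. scal (Polynomial.coeff (fs ! k) j) (mo.tpow n Z j (x k)))"
    proof
      fix i
      have "mop n Z (?r (off ?d k + e)) i = - (\<Sum>j<?d k. Polynomial.coeff (fs ! k) j * ?r (off ?d k + j) i)"
        using T[of k e i] k e by simp
      also have "(\<Sum>j<?d k. Polynomial.coeff (fs ! k) j * ?r (off ?d k + j) i) = (\<Sum>j<?d k. scal (Polynomial.coeff (fs ! k) j) (mo.tpow n Z j (x k)) i)"
        by (rule sum.cong) (use tp k in auto)
      finally show "mop n Z (?r (off ?d k + e)) i = (- (\<Sum>j<?d k. scal (Polynomial.coeff (fs ! k) j) (mo.tpow n Z j (x k)))) i"
        by (simp add: fun_apply sum_fun_apply del: scal_apply)
    qed
    finally show ?thesis using mo.monic_annihilates_iff[OF fk(1)] k by simp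
  qed
  have f0: "fs ! k \<noteq> 0" if "k \<in> {..<?L}" for k using fk[of k] that by auto
  have b: "mo.basis_mod n Z {0} {..<?L} (\<lambda>k. fs ! k) x"
  proof -
    \<comment> \<open>The form expected by \<open>reduced_independent_iff\<close>, with an empty
      second family.\<close>
    have "(\<forall>g g'. (\<forall>k\<in>{..<?L}. g k \<in> rpoly (?d k)) \<longrightarrow> (\<forall>l\<in>{} :: nat set. g' l \<in> rpoly (Polynomial.degree (1 :: 'a poly))) \<longrightarrow>
      mo.comb n Z {..<?L} g x + mo.comb n Z {} g' (\<lambda>_. 0) = 0 \<longrightarrow> (\<forall>k\<in>{..<?L}. g k = 0) \<and> (\<forall>l\<in>{}. g' l = 0))"
    proof (intro allI impI conjI ballI)
      fix g :: "nat \<Rightarrow> 'a poly" and g' :: "nat \<Rightarrow> 'a poly" and k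
      assume g: "\<forall>k\<in>{..<?L}. g k \<in> rpoly (?d k)" and "mo.comb n Z {..<?L} g x + mo.comb n Z {} g' (\<lambda>_. 0) = 0"
        and k: "k \<in> {..<?L}"
      then have 0: "mo.comb n Z {..<?L} g x = 0" by simp
      define c where "c a = (case inv_into ?S (\<lambda>(k, e). off ?d k + e) a of (k, e) \<Rightarrow> Polynomial.coeff (g k) e)" for a
      have sm: "(\<Sum>a<n. c a * Q $$ (a, i)) = 0" if i: "i < n" for i
      proof -
        have "(\<Sum>a<n. c a * Q $$ (a, i)) = (\<Sum>a<off ?d ?L. case inv_into ?S (\<lambda>(k, e). off ?d k + e) a of (k, e) \<Rightarrow> Polynomial.coeff (g k) e * Q $$ (a, i))"
          unfolding N by (rule sum.cong) (auto simp: c_def split: prod.split)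
        also have "\<dots> = (\<Sum>(k, e)\<in>?S. Polynomial.coeff (g k) e * Q $$ (off ?d k + e, i))" by (rule sum_off[symmetric])
        also have "\<dots> = (\<Sum>(k, e)\<in>?S. Polynomial.coeff (g k) e * mo.tpow n Z e (x k) i)"
          by (rule sum.cong) (use tp i in \<open>auto simp: mat_rows_def\<close>)
        also have "\<dots> = mo.comb n Z {..<?L} g x i" by (rule mo.comb_rpoly_apply[symmetric]) (use g in auto)
        finally show ?thesis using 0 by (simp add: fun_apply)
      qed
      \<comment> \<open>Multiplying the vanishing combination of rows of \<open>Q\<close> by
        \<open>P\<close> isolates each coefficient.\<close>
      have c0: "c b = 0" if b: "b < n" for b
      proof -
        have "0 = (\<Sum>i<n. (\<Sum>a<n. c a * Q $$ (a, i)) * P $$ (i, b))" using sm by simp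
        also have "\<dots> = (\<Sum>i<n. \<Sum>a<n. c a * (Q $$ (a, i) * P $$ (i, b)))" by (simp add: sum_distrib_right mult.assoc)
        also have "\<dots> = (\<Sum>a<n. \<Sum>i<n. c a * (Q $$ (a, i) * P $$ (i, b)))" by (rule sum.swap)
        also have "\<dots> = (\<Sum>a<n. c a * (Q * P) $$ (a, b))"
          by (rule sum.cong) (use mat_mult_index_sum[OF Q P] b in \<open>auto simp: sum_distrib_left\<close>)
        also have "\<dots> = (\<Sum>a<n. if a = b then c a else 0)" unfolding PQ(3) mn by (rule sum.cong) (use b in auto)
        finally show ?thesis using b by simp
      qed
      have z1: "Polynomial.coeff (g k) e = 0" if e: "e < ?d k" for e
      proof -
        have "inv_into ?S (\<lambda>(k, e). off ?d k + e) ((\<lambda>(k, e). off ?d k + e) (k, e)) = (k, e)"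
          by (rule bij_betw_inv_into_left[OF bij_off]) (use k e in auto)
        then show ?thesis using c0[OF lt[of k e]] k e by (simp add: c_def)
      qed
      have z2: "Polynomial.coeff (g k) e = 0" if "\<not> e < ?d k" for e using bspec[OF g k] that by (simp add: rpoly_def)
      show "g k = 0"
      proof (rule poly_eqI)
        fix e
        show "Polynomial.coeff (g k) e = Polynomial.coeff 0 e" using z1[of e] z2[of e] by (cases "e < ?d k") auto
      qed
    qed auto
    then show ?thesis
      using mo.reduced_independent_iff[where n=n and Z=Z and K="{..<?L}" and L="{} :: nat set" and f="\<lambda>k. fs ! k" and h="\<lambda>_. 1" and x=x and w="\<lambda>_. 0"]
        f0 fx by simp
  qed
  have xv: "x k \<in> vecs {..<n}" for k by (simp add: x_def mat_rows_def vecs_def)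
  have "mo.spn n Z {..<?L} x = vecs {..<n}"
  proof (rule card_subset_eq)
    show "finite (vecs {..<n} :: (nat \<Rightarrow> 'a) set)" by (rule finite_vecs) simp
    show "mo.spn n Z {..<?L} x \<subseteq> vecs {..<n}" by (rule mo.spn_le[OF mo_subspace_vecs]) (rule xv)
    have "card (mo.spn n Z {..<?L} x) = (\<Prod>k\<in>{..<?L}. CARD('a) ^ ?d k)" by (rule mo.card_spn[OF b]) (use f0 in auto)
    also have "\<dots> = CARD('a) ^ n" unfolding N[symmetric] off_def by (rule power_sum[symmetric])
    also have "\<dots> = card (vecs {..<n} :: (nat \<Rightarrow> 'a) set)" by (simp add: card_vecs_lessThan)
    finally show "card (mo.spn n Z {..<?L} x) = card (vecs {..<n} :: (nat \<Rightarrow> 'a) set)" .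
  qed
  then show ?thesis using xv b by blast
qed

text \<open>The Krylov vectors are the rows of \<open>Q\<close>, and the reduced coefficients of the
  unit vectors are the rows of \<open>P\<close>. Then \<open>P * Q\<close> is the identity by
  construction.\<close>

lemma basis_imp_similar_companion_diag:
  fixes A :: "'a::{field_gcd,finite} mat" and fs :: "'a poly list"
  defines "Z \<equiv> \<lambda>j i. A $$ (i, j)"
  assumes A: "A \<in> carrier_mat n n" and fs: "\<And>f. f \<in> set fs \<Longrightarrow> monic f \<and> 0 < Polynomial.degree f"
    and b: "mo.basis_mod n Z {0} {..<length fs} (\<lambda>k. fs ! k) x" and s: "mo.spn n Z {..<length fs} x = vecs {..<n}"
  shows "similar_mat A (companion_diag fs)"
proof -
  let ?B = "companion_diag fs" and ?L = "length fs" and ?d = "degs fs"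
  let ?S = "SIGMA k:{..<?L}. {..<?d k}" and ?\<phi> = "\<lambda>(k, e). off (degs fs) k + e"
  have fk: "monic (fs ! k)" "0 < ?d k" if "k < ?L" for k using fs that by auto
  have f0: "fs ! k \<noteq> 0" if "k \<in> {..<?L}" for k using fk[of k] that by auto
  \<comment> \<open>The cardinality of the module, computed from its dimension and from its basis,
    shows that the degrees add up to \<open>n\<close>.\<close>
  have N: "off ?d ?L = n"
  proof -
    have "CARD('a) ^ n = card (mo.spn n Z {..<?L} x)" unfolding s by (simp add: card_vecs_lessThan)
    also have "\<dots> = (\<Prod>k\<in>{..<?L}. CARD('a) ^ ?d k)" by (rule mo.card_spn[OF b]) (use f0 in auto)
    also have "\<dots> = CARD('a) ^ off ?d ?L" unfolding off_def by (rule power_sum[symmetric])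
    finally have e: "CARD('a) ^ n = CARD('a) ^ off ?d ?L" .
    have "card {0, 1 :: 'a} \<le> CARD('a)" by (rule card_mono) auto
    then have "1 < CARD('a)" by simp
    then show ?thesis using power_inject_exp[of "CARD('a)" n "off ?d ?L"] e by simp
  qed
  have B: "?B \<in> carrier_mat n n" using companion_diag_carrier[of fs] N by simp
  have xv: "x k \<in> vecs {..<n}" if "k < ?L" for k
    unfolding s[symmetric] by (rule mo.spn_gen) (use that in auto)
  define Q where "Q = mat n n (\<lambda>(a, i). case inv_into ?S ?\<phi> a of (k, e) \<Rightarrow> mo.tpow n Z e (x k) i)"
  have lt: "off ?d k + e < n" if "k < ?L" "e < ?d k" for k e using off_less[OF that(1), of e ?d] that(2) N by simp
  have Qv: "Q $$ (off ?d k + e, i) = mo.tpow n Z e (x k) i" if "k < ?L" "e < ?d k" "i < n" for k e i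
  proof -
    have "inv_into ?S ?\<phi> (?\<phi> (k, e)) = (k, e)"
      by (rule bij_betw_inv_into_left[OF bij_off]) (use that in auto)
    then show ?thesis using lt[OF that(1,2)] that(3) by (simp add: Q_def)
  qed
  have Q: "Q \<in> carrier_mat n n" by (simp add: Q_def)
  have "\<exists>c. c \<in> (\<Pi>\<^sub>E k\<in>{..<?L}. rpoly (?d k)) \<and> (\<lambda>j. if j = i then 1 else 0) = mo.comb n Z {..<?L} c x"
    if i: "i \<in> {..<n}" for i
    unfolding Bex_def[symmetric]
  proof (rule mo.spn_rpoly[OF b])
    show "(\<lambda>j. if j = i then 1 else 0) \<in> mo.spn n Z {..<?L} x" unfolding s using i by (simp add: vecs_def)
  qed (use f0 in auto)
  from bchoice[OF ballI, OF this]
  obtain c where "\<forall>i\<in>{..<n}. c i \<in> (\<Pi>\<^sub>E k\<in>{..<?L}. rpoly (?d k)) \<and> (\<lambda>j. if j = i then 1 else 0) = mo.comb n Z {..<?L} (c i) x"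
    by (rule exE)
  then have c: "c i \<in> (\<Pi>\<^sub>E k\<in>{..<?L}. rpoly (?d k))" "(\<lambda>j. if j = i then 1 else 0) = mo.comb n Z {..<?L} (c i) x"
    if "i < n" for i using that by simp_all
  define P where "P = mat n n (\<lambda>(i, a). case inv_into ?S ?\<phi> a of (k, e) \<Rightarrow> Polynomial.coeff (c i k) e)"
  have P: "P \<in> carrier_mat n n" by (simp add: P_def)
  have PQ: "P * Q = 1\<^sub>m n"
  proof (rule eq_matI)
    fix i j assume "i < dim_row (1\<^sub>m n :: 'a mat)" "j < dim_col (1\<^sub>m n :: 'a mat)"
    then have ij: "i < n" "j < n" by auto
    have "(P * Q) $$ (i, j) = (\<Sum>a<n. P $$ (i, a) * Q $$ (a, j))" by (rule mat_mult_index_sum[OF P Q ij])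
    also have "\<dots> = (\<Sum>a<off ?d ?L. case inv_into ?S ?\<phi> a of (k, e) \<Rightarrow> Polynomial.coeff (c i k) e * Q $$ (a, j))"
      unfolding N by (rule sum.cong) (use ij in \<open>auto simp: P_def split: prod.split\<close>)
    also have "\<dots> = (\<Sum>(k, e)\<in>?S. Polynomial.coeff (c i k) e * Q $$ (off ?d k + e, j))" by (rule sum_off[symmetric])
    also have "\<dots> = (\<Sum>(k, e)\<in>?S. Polynomial.coeff (c i k) e * mo.tpow n Z e (x k) j)"
      by (rule sum.cong) (use Qv ij in auto)
    also have "\<dots> = mo.comb n Z {..<?L} (c i) x j"
      by (rule mo.comb_rpoly_apply[symmetric]) (use c(1)[OF ij(1)] in \<open>auto simp: PiE_iff\<close>)
    also have "\<dots> = (if j = i then 1 else 0)" using fun_cong[OF c(2)[OF ij(1)], of j] by simp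
    finally show "(P * Q) $$ (i, j) = 1\<^sub>m n $$ (i, j)" using ij by auto
  qed (use P Q in auto)
  have QP: "Q * P = 1\<^sub>m n" by (rule mat_mult_left_right_inverse[OF P Q PQ])
  have BQ: "?B * Q = Q * A"
  proof (rule eq_matI)
    fix a i assume "a < dim_row (Q * A)" "i < dim_col (Q * A)"
    then have ai: "a < n" "i < n" using Q A by auto
    have "a \<in> ?\<phi> ` ?S" using bij_betw_imp_surj_on[OF bij_off, of ?d ?L] ai(1) N by simp
    then obtain k e where ke: "k < ?L" "e < ?d k" "a = off ?d k + e" by auto
    have "mat_rows n Q a = mo.tpow n Z e (x k)"
    proof
      fix j
      have "mo.tpow n Z e (x k) \<in> vecs {..<n}" by (rule mo.M.subspace_scale[OF mo_subspace_vecs xv[OF ke(1)]])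
      then show "mat_rows n Q a j = mo.tpow n Z e (x k) j" using Qv[OF ke(1,2)] ke(3) by (auto simp: mat_rows_def vecs_def)
    qed
    then have "mop n Z (mo.tpow n Z e (x k)) i = (Q * A) $$ (a, i)"
      using mop_mat_rows[OF Q A ai(1)] ai(2) by (simp add: Z_def mat_rows_def)
    then have r: "(Q * A) $$ (a, i) = mo.tpow n Z (Suc e) (x k) i" by (simp add: mo.tpow_Suc)
    have "(?B * Q) $$ (a, i) = (\<Sum>b<off ?d ?L. ?B $$ (off ?d k + e, b) * Q $$ (b, i))"
      using mat_mult_index_sum[OF B Q ai] N ke(3) by simp
    also note companion_diag_row[OF ke(1,2), of "\<lambda>b. Q $$ (b, i)"]
    also have "(if Suc e = ?d k then - (\<Sum>j<?d k. Polynomial.coeff (fs ! k) j * Q $$ (off ?d k + j, i)) else Q $$ (off ?d k + Suc e, i)) =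
        mo.tpow n Z (Suc e) (x k) i"
    proof (cases "Suc e = ?d k")
      case True
      have "pact (mop n Z) (fs ! k) (x k) \<in> {0}" by (rule mo.basis_mod_gen(1)[OF b]) (use ke in auto)
      then have "mo.tpow n Z (?d k) (x k) = - (\<Sum>j<?d k. scal (Polynomial.coeff (fs ! k) j) (mo.tpow n Z j (x k)))"
        using mo.monic_annihilates_iff[OF fk(1)[OF ke(1)]] by simp
      then have "mo.tpow n Z (Suc e) (x k) i = (- (\<Sum>j<?d k. scal (Polynomial.coeff (fs ! k) j) (mo.tpow n Z j (x k)))) i"
        unfolding True by simp
      also have "\<dots> = - (\<Sum>j<?d k. Polynomial.coeff (fs ! k) j * mo.tpow n Z j (x k) i)"
        by (simp add: fun_apply sum_fun_apply)
      also have "\<dots> = - (\<Sum>j<?d k. Polynomial.coeff (fs ! k) j * Q $$ (off ?d k + j, i))"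
        using Qv[OF ke(1) _ ai(2)] by simp
      finally show ?thesis using True by simp
    next
      case False
      then show ?thesis using Qv[OF ke(1), of "Suc e" i] ke(2) ai(2) by simp
    qed
    finally show "(?B * Q) $$ (a, i) = (Q * A) $$ (a, i)" using r by simp
  qed (use B Q A in auto)
  have "A = P * ?B * Q"
  proof -
    have "P * ?B * Q = P * (Q * A)" unfolding BQ[symmetric] by (rule assoc_mult_mat[OF P B Q])
    also have "\<dots> = (P * Q) * A" by (rule assoc_mult_mat[OF P Q A, symmetric])
    finally show ?thesis using PQ A by simp
  qed
  then show ?thesis by (intro similar_matI[OF _ PQ QP]) (use A B P Q in auto)
qed

section \<open>Rational canonical form\<close>

lemma card_field_gt_1: "1 < CARD('a::{field,finite})"
proof -
  have "card {0, 1 :: 'a} \<le> CARD('a)" by (rule card_mono) auto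
  then show ?thesis by simp
qed

abbreviation blocks :: "('a::field_gcd poly \<Rightarrow> nat \<Rightarrow> nat) \<Rightarrow> ('a poly \<times> nat) set" where
  "blocks L \<equiv> {(F, j). 0 < L F j}"

lemma rational_canonical_data_irreducible:
  assumes "rational_canonical_data A L" "0 < L F j"
  shows "monic F \<and> Factorial_Ring.irreducible F \<and> F dvd char_poly A"
  using assms by (auto simp: rational_canonical_data_def Let_def fun_eq_iff)

lemma rational_canonical_data_partition:
  assumes "rational_canonical_data A L" shows "L F \<in> partitions"
proof -
  have "(\<lambda>_. 0) \<in> partitions" by (simp add: partitions_def antimono_def)
  then show ?thesis using assms
    by (cases "monic F \<and> Factorial_Ring.irreducible F \<and> F dvd char_poly A")
      (auto simp: rational_canonical_data_def Let_def)
qed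

text \<open>Passes from the list of blocks to a basis indexed by the pairs \<open>(F, j)\<close>,
  after which the order of the blocks no longer appears.\<close>

lemma rational_canonical_data_basis:
  fixes A :: "'a::{field_gcd,finite} mat"
  defines "Z \<equiv> \<lambda>j i. A $$ (i, j)"
  assumes A: "A \<in> carrier_mat n n" and L: "rational_canonical_data A L"
  shows "finite (blocks L) \<and> (\<exists>x. mo.basis_mod n Z {0} (blocks L) (\<lambda>(F, j). F ^ L F j) x \<and>
    mo.spn n Z (blocks L) x = vecs {..<n})"
proof -
  obtain bs where bs: "distinct bs" "set bs = {(F, j). (monic F \<and> Factorial_Ring.irreducible F \<and> F dvd char_poly A) \<and> L F j > 0}"
      and sim: "similar_mat A (diag_block_mat (map (\<lambda>(F, j). companion_matrix (F ^ L F j)) bs))"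
    using L by (auto simp: rational_canonical_data_def Let_def)
  have sbs: "set bs = blocks L" unfolding bs(2) using rational_canonical_data_irreducible[OF L] by auto
  let ?f = "\<lambda>(F, j). F ^ L F j"
  let ?fs = "map ?f bs"
  have e: "companion_diag ?fs = diag_block_mat (map (\<lambda>(F, j). companion_matrix (F ^ L F j)) bs)"
    unfolding companion_diag_def map_map comp_def case_prod_unfold ..
  have fs: "monic f \<and> 0 < Polynomial.degree f" if f: "f \<in> set ?fs" for f
  proof -
    obtain F j where F: "(F, j) \<in> set bs" "f = F ^ L F j" using f by auto
    then have Fi: "monic F" "Factorial_Ring.irreducible F" "0 < L F j" unfolding bs(2) by auto
    have "monic (F ^ L F j)" by (rule monic_power[OF Fi(1)])
    moreover have "0 < Polynomial.degree (F ^ L F j)"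
      using irreducible_degree_pos[OF Fi(2)] mo.irreducible_neq_0[OF Fi(2)] Fi(3) by (simp add: degree_power_eq)
    ultimately show ?thesis unfolding F(2) by blast
  qed
  have ss: "similar_mat A (companion_diag ?fs)" using sim unfolding e .
  have "\<exists>y. (\<forall>k<length ?fs. y k \<in> vecs {..<n}) \<and> mo.basis_mod n Z {0} {..<length ?fs} (\<lambda>k. ?fs ! k) y \<and>
      mo.spn n Z {..<length ?fs} y = vecs {..<n}"
    unfolding Z_def by (rule similar_companion_diag_imp_basis[OF A _ ss]) (rule fs)
  then obtain y where y: "mo.basis_mod n Z {0} {..<length ?fs} (\<lambda>k. ?fs ! k) y" "mo.spn n Z {..<length ?fs} y = vecs {..<n}"
    by (elim exE conjE)
  have nb: "bij_betw (nth bs) {..<length bs} (set bs)" by (rule bij_betw_nth[OF bs(1)]) auto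
  let ?h = "inv_into {..<length bs} (nth bs)"
  have h: "bij_betw ?h (set bs) {..<length ?fs}" using bij_betw_inv_into[OF nb] by simp
  let ?x = "\<lambda>k. y (?h k)"
  have "mo.basis_mod n Z {0} (set bs) (\<lambda>k. ?fs ! ?h k) ?x" by (rule mo.basis_mod_reindex[OF h y(1)])
  also have "mo.basis_mod n Z {0} (set bs) (\<lambda>k. ?fs ! ?h k) ?x = mo.basis_mod n Z {0} (set bs) ?f ?x"
  proof (rule mo.basis_mod_cong[OF refl])
    fix k assume k: "k \<in> set bs"
    have "?h k < length bs" using bij_betwE[OF h] k by simp
    then show "?fs ! ?h k = ?f k" using bij_betw_inv_into_right[OF nb k] by simp
  qed
  finally have b: "mo.basis_mod n Z {0} (set bs) ?f ?x" .
  moreover have "mo.spn n Z (set bs) ?x = vecs {..<n}" using mo.spn_reindex[OF h, of n Z y] y(2) by simp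
  ultimately show ?thesis unfolding sbs[symmetric] by blast
qed

lemma rational_canonical_data_kernel:
  fixes A :: "'a::{field_gcd,finite} mat"
  defines "Z \<equiv> \<lambda>j i. A $$ (i, j)"
  assumes A: "A \<in> carrier_mat n n" and L: "rational_canonical_data A L"
    and G: "monic G" "Factorial_Ring.irreducible G"
  shows "card {v\<in>vecs {..<n}. pact (mop n Z) (G ^ i) v = 0} =
    CARD('a) ^ (Polynomial.degree G * (\<Sum>j | L G j \<noteq> 0. min (L G j) i))"
proof -
  obtain x where x: "mo.basis_mod n Z {0} (blocks L) (\<lambda>(F, j). F ^ L F j) x" "mo.spn n Z (blocks L) x = vecs {..<n}"
    and fin: "finite (blocks L)"
    using rational_canonical_data_basis[OF A L] unfolding Z_def by blast
  have b: "mo.basis_mod n Z {0} (blocks L) (\<lambda>k. fst k ^ (case k of (F, j) \<Rightarrow> L F j)) x"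
    using x(1) unfolding case_prod_unfold .
  have "card {v\<in>mo.spn n Z (blocks L) x. pact (mop n Z) (G ^ i) v = 0} =
      CARD('a) ^ (Polynomial.degree G * (\<Sum>k\<in>{k\<in>blocks L. fst k = G}. min (case k of (F, j) \<Rightarrow> L F j) i))"
    by (rule mo.card_power_kernel[OF fin b _ G]) (use rational_canonical_data_irreducible[OF L] in auto)
  also have "{k\<in>blocks L. fst k = G} = Pair G ` {j. L G j \<noteq> 0}" by auto
  also have "(\<Sum>k\<in>Pair G ` {j. L G j \<noteq> 0}. min (case k of (F, j) \<Rightarrow> L F j) i) = (\<Sum>j | L G j \<noteq> 0. min (L G j) i)"
    by (subst sum.reindex) (auto simp: inj_on_def)
  finally show ?thesis unfolding x(2) .
qed

text \<open>The kernels of the powers of \<open>G\<close> are intrinsic to \<open>A\<close>. By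
  \<open>partition_eqI\<close> their sizes leave only one partition, which gives uniqueness of the
  form and later identifies it.\<close>

lemma rational_canonical_data_eqI:
  fixes A :: "'a::{field_gcd,finite} mat"
  defines "Z \<equiv> \<lambda>j i. A $$ (i, j)"
  assumes A: "A \<in> carrier_mat n n" and L: "rational_canonical_data A L"
    and G: "monic G" "Factorial_Ring.irreducible G" and l: "l \<in> partitions"
    and eq: "\<And>i. card {v\<in>vecs {..<n}. pact (mop n Z) (G ^ i) v = 0} =
      CARD('a) ^ (Polynomial.degree G * (\<Sum>j | l j \<noteq> 0. min (l j) i))"
  shows "L G = l"
proof (rule partition_eqI[OF rational_canonical_data_partition[OF L] l])
  fix i
  have "CARD('a) ^ (Polynomial.degree G * (\<Sum>j | L G j \<noteq> 0. min (L G j) i)) =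
      CARD('a) ^ (Polynomial.degree G * (\<Sum>j | l j \<noteq> 0. min (l j) i))"
    using rational_canonical_data_kernel[OF A L G, of i] eq[of i] unfolding Z_def by simp
  then have "Polynomial.degree G * (\<Sum>j | L G j \<noteq> 0. min (L G j) i) = Polynomial.degree G * (\<Sum>j | l j \<noteq> 0. min (l j) i)"
    using power_inject_exp[OF card_field_gt_1[where 'a='a]] by blast
  then show "(\<Sum>j | L G j \<noteq> 0. min (L G j) i) = (\<Sum>j | l j \<noteq> 0. min (l j) i)"
    using irreducible_degree_pos[OF G(2)] by simp
qed

lemma rational_canonical_data_unique:
  fixes A :: "'a::{field_gcd,finite} mat"
  assumes A: "A \<in> carrier_mat n n" and L: "rational_canonical_data A L" and L': "rational_canonical_data A L'"
  shows "L = L'"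
proof
  fix F
  show "L F = L' F"
  proof (cases "monic F \<and> Factorial_Ring.irreducible F")
    case True
    then show ?thesis
      using rational_canonical_data_eqI[OF A L _ _ rational_canonical_data_partition[OF L']]
        rational_canonical_data_kernel[OF A L'] by blast
  next
    case False
    then have "L F j = 0" "L' F j = 0" for j
      using rational_canonical_data_irreducible[OF L, of F j] rational_canonical_data_irreducible[OF L', of F j] by auto
    then show ?thesis by auto
  qed
qed

text \<open>A cyclic decomposition of the row module, with the exponents at each irreducible sorted
  into a partition; the sizes agree with the multiplicities because the characteristic polynomial
  can be read off the blocks.\<close>

lemma rational_canonical_data_exists:
  fixes A :: "'a::{field_gcd,finite} mat"
  assumes A: "A \<in> carrier_mat n n"
  shows "\<exists>L. rational_canonical_data A L"
proof -
  let ?Z = "\<lambda>j i. A $$ (i, j)"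
  have "finite (vecs {..<n} :: (nat \<Rightarrow> 'a) set)" by (rule finite_vecs) simp
  from mo.exists_cyclic_decomposition[OF this mo_subspace_vecs, of ?Z]
  obtain K :: "nat set" and F m x where K: "finite K"
    and F: "\<And>k. k \<in> K \<Longrightarrow> monic (F k) \<and> Factorial_Ring.irreducible (F k) \<and> 0 < m k"
    and b: "mo.basis_mod n ?Z {0} K (\<lambda>k. F k ^ m k) x" and s: "mo.spn n ?Z K x = vecs {..<n}" by blast
  have "\<forall>G. \<exists>l \<sigma>. l \<in> partitions \<and> bij_betw \<sigma> {j. 0 < l j} {k\<in>K. F k = G} \<and> (\<forall>j. 0 < l j \<longrightarrow> m (\<sigma> j) = l j)"
    by (intro allI exists_partition_enumeration) (use K F in auto)
  then obtain L where "\<forall>G. \<exists>\<sigma>. L G \<in> partitions \<and> bij_betw \<sigma> {j. 0 < L G j} {k\<in>K. F k = G} \<and> (\<forall>j. 0 < L G j \<longrightarrow> m (\<sigma> j) = L G j)"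
    unfolding choice_iff by (rule exE)
  then obtain \<sigma> where "\<forall>G. L G \<in> partitions \<and> bij_betw (\<sigma> G) {j. 0 < L G j} {k\<in>K. F k = G} \<and> (\<forall>j. 0 < L G j \<longrightarrow> m (\<sigma> G j) = L G j)"
    unfolding choice_iff by (rule exE)
  then have L: "L G \<in> partitions" and \<sigma>: "bij_betw (\<sigma> G) {j. 0 < L G j} {k\<in>K. F k = G}"
    and m: "0 < L G j \<Longrightarrow> m (\<sigma> G j) = L G j" for G j by auto
  let ?h = "\<lambda>(G, j). \<sigma> G j"
  have F\<sigma>: "\<sigma> G j \<in> K \<and> F (\<sigma> G j) = G" if "0 < L G j" for G j using bij_betwE[OF \<sigma>, of G] that by auto
  have h: "bij_betw ?h (blocks L) K"
    unfolding bij_betw_def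
  proof
    show "inj_on ?h (blocks L)"
    proof (rule inj_onI, clarify)
      fix G j G' j' assume a: "0 < L G j" "0 < L G' j'" "\<sigma> G j = \<sigma> G' j'"
      then have "G = G'" using F\<sigma>[OF a(1)] F\<sigma>[OF a(2)] by simp
      moreover from this have "j = j'" using inj_onD[OF bij_betw_imp_inj_on[OF \<sigma>], of G j j'] a by simp
      ultimately show "G = G' \<and> j = j'" ..
    qed
    show "?h ` blocks L = K"
    proof
      show "?h ` blocks L \<subseteq> K" using F\<sigma> by auto
      show "K \<subseteq> ?h ` blocks L"
      proof
        fix k assume k: "k \<in> K"
        then have "k \<in> \<sigma> (F k) ` {j. 0 < L (F k) j}" unfolding bij_betw_imp_surj_on[OF \<sigma>] by simp
        then obtain j where "0 < L (F k) j" "k = \<sigma> (F k) j" by auto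
        then show "k \<in> ?h ` blocks L" by (intro image_eqI[of _ _ "(F k, j)"]) auto
      qed
    qed
  qed
  have finb: "finite (blocks L)" using bij_betw_finite[OF h] K by simp
  obtain bs where bs: "set bs = blocks L" "distinct bs" using finite_distinct_list[OF finb] by blast
  let ?f = "\<lambda>(G, j). G ^ L G j"
  let ?fs = "map ?f bs"
  have irr: "monic G \<and> Factorial_Ring.irreducible G" if "0 < L G j" for G j using F\<sigma>[OF that] F[of "\<sigma> G j"] by simp
  have fs: "monic f \<and> 0 < Polynomial.degree f" if f: "f \<in> set ?fs" for f
  proof -
    obtain G j where G: "0 < L G j" "f = G ^ L G j" using f bs(1) by auto
    have Gi: "monic G" "Factorial_Ring.irreducible G" using irr[OF G(1)] by auto
    have "monic (G ^ L G j)" by (rule monic_power[OF Gi(1)])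
    moreover have "0 < Polynomial.degree (G ^ L G j)"
      using irreducible_degree_pos[OF Gi(2)] mo.irreducible_neq_0[OF Gi(2)] G(1) by (simp add: degree_power_eq)
    ultimately show ?thesis unfolding G(2) by blast
  qed
  have nb: "bij_betw (nth bs) {..<length ?fs} (blocks L)" using bij_betw_nth[OF bs(2), of "{..<length ?fs}" "blocks L"] bs(1) by auto
  let ?g = "\<lambda>i. ?h (bs ! i)"
  have g: "bij_betw ?g {..<length ?fs} K" using bij_betw_trans[OF nb h] by (simp add: comp_def)
  have sim: "similar_mat A (companion_diag ?fs)"
  proof (rule basis_imp_similar_companion_diag[OF A])
    show "monic f \<and> 0 < Polynomial.degree f" if "f \<in> set ?fs" for f by (rule fs[OF that])
    have "mo.basis_mod n ?Z {0} {..<length ?fs} (\<lambda>k. F (?g k) ^ m (?g k)) (\<lambda>k. x (?g k))"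
      by (rule mo.basis_mod_reindex[OF g b])
    also have "mo.basis_mod n ?Z {0} {..<length ?fs} (\<lambda>k. F (?g k) ^ m (?g k)) (\<lambda>k. x (?g k)) =
        mo.basis_mod n ?Z {0} {..<length ?fs} (\<lambda>k. ?fs ! k) (\<lambda>k. x (?g k))"
    proof (rule mo.basis_mod_cong[OF refl])
      fix i assume i: "i \<in> {..<length ?fs}"
      obtain G j where Gj: "bs ! i = (G, j)" by (cases "bs ! i")
      have "bs ! i \<in> blocks L" by (rule bspec[OF bij_betwE[OF nb] i])
      then have p: "0 < L G j" unfolding Gj by simp
      show "F (?g i) ^ m (?g i) = ?fs ! i" using i Gj F\<sigma>[OF p] m[OF p] by simp
    qed
    finally show "mo.basis_mod n ?Z {0} {..<length ?fs} (\<lambda>k. ?fs ! k) (\<lambda>k. x (?g k))" .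
    show "mo.spn n ?Z {..<length ?fs} (\<lambda>k. x (?g k)) = vecs {..<n}" using mo.spn_reindex[OF g, of n ?Z x] s by simp
  qed
  have e: "companion_diag ?fs = diag_block_mat (map (\<lambda>(F, j). companion_matrix (F ^ L F j)) bs)"
    unfolding companion_diag_def map_map comp_def case_prod_unfold ..
  have cp0: "char_poly (companion_diag ?fs) = prod_list ?fs" by (rule char_poly_companion_diag) (rule fs)
  have cp: "char_poly A = (\<Prod>k\<in>blocks L. ?f k)"
    unfolding char_poly_similar[OF sim] cp0 bs(1)[symmetric]
    by (rule prod.distinct_set_conv_list[OF bs(2), symmetric])
  have dvd: "G dvd char_poly A" if p: "0 < L G j" for G j
  proof -
    have "?f (G, j) dvd char_poly A" unfolding cp by (rule dvd_prodI[OF finb]) (use p in simp)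
    moreover have "G dvd ?f (G, j)" using p by (simp add: dvd_power)
    ultimately show ?thesis by (rule dvd_trans[rotated])
  qed
  have mult: "partition_size (L G) = multiplicity G (char_poly A)" if G: "monic G" "Factorial_Ring.irreducible G" for G
  proof -
    have pG: "prime_elem G" using G(2) by (rule irreducible_imp_prime_elem_gcd)
    have "?f k \<noteq> 0" if k: "k \<in> blocks L" for k
    proof -
      obtain H j where Hj: "k = (H, j)" by (cases k)
      then have "0 < L H j" using k by simp
      then show ?thesis using irr[of H j] mo.irreducible_neq_0[of H] Hj by simp
    qed
    then have "0 \<notin> ?f ` blocks L" by (simp add: image_iff eq_commute[of 0])
    then have "multiplicity G (char_poly A) = (\<Sum>k\<in>blocks L. multiplicity G (?f k))"
      unfolding cp by (rule prime_elem_multiplicity_prod_distrib[OF pG _ finb])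
    also have "\<dots> = (\<Sum>k\<in>blocks L. if fst k = G then (case k of (F, j) \<Rightarrow> L F j) else 0)"
    proof (rule sum.cong[OF refl])
      fix k assume "k \<in> blocks L"
      then obtain H j where k: "k = (H, j)" "0 < L H j" by auto
      have H: "monic H" "Factorial_Ring.irreducible H" using irr[OF k(2)] by auto
      have "multiplicity G H = (if H = G then 1 else 0)"
      proof (cases "H = G")
        case True
        then show ?thesis using multiplicity_self[of G] mo.irreducible_neq_0[OF G(2)] irreducible_not_unit[OF G(2)] by simp
      next
        case False
        then have "\<not> G dvd H" using monic_irreducible_dvd_eq[OF G(1) H(1) G(2) H(2)] by blast
        then show ?thesis using False by (simp add: not_dvd_imp_multiplicity_0)
      qed
      then show "multiplicity G (?f k) = (if fst k = G then (case k of (F, j) \<Rightarrow> L F j) else 0)"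
        unfolding k(1) using prime_elem_multiplicity_power_distrib[OF pG mo.irreducible_neq_0[OF H(2)]] by simp
    qed
    also have "\<dots> = (\<Sum>k\<in>{k\<in>blocks L. fst k = G}. case k of (F, j) \<Rightarrow> L F j)" by (rule sum.inter_filter[OF finb, symmetric])
    also have "{k\<in>blocks L. fst k = G} = Pair G ` {j. L G j \<noteq> 0}" by auto
    also have "(\<Sum>k\<in>Pair G ` {j. L G j \<noteq> 0}. case k of (F, j) \<Rightarrow> L F j) = partition_size (L G)"
      unfolding partition_size_def by (subst sum.reindex) (auto simp: inj_on_def)
    finally show ?thesis by simp
  qed
  have "rational_canonical_data A L"
    unfolding rational_canonical_data_def Let_def
  proof (intro conjI ballI allI impI)
    show "L G \<in> partitions" for G by (rule L)
    show "partition_size (L G) = multiplicity G (char_poly A)" if "G \<in> {F. monic F \<and> Factorial_Ring.irreducible F \<and> F dvd char_poly A}" for G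
      using mult that by blast
    show "L G = (\<lambda>_. 0)" if "G \<notin> {F. monic F \<and> Factorial_Ring.irreducible F \<and> F dvd char_poly A}" for G
    proof
      fix j
      show "L G j = 0" using that irr[of G j] dvd[of G j] by auto
    qed
    have "set bs = {(F, j). F \<in> {F. monic F \<and> Factorial_Ring.irreducible F \<and> F dvd char_poly A} \<and> L F j > 0}"
      unfolding bs(1) using irr dvd by auto
    then show "\<exists>bs. distinct bs \<and> set bs = {(F, j). F \<in> {F. monic F \<and> Factorial_Ring.irreducible F \<and> F dvd char_poly A} \<and> L F j > 0} \<and>
        similar_mat A (diag_block_mat (map (\<lambda>(F, j). companion_matrix (F ^ L F j)) bs))"
      using bs(2) sim unfolding e by (intro exI[of _ bs]) simp
  qed
  then show ?thesis by blast
qed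

lemma rcf_partition_eq:
  fixes A :: "'a::{field_gcd,finite} mat"
  assumes "A \<in> carrier_mat n n" "rational_canonical_data A L"
  shows "rcf_partition F A = L F"
  unfolding rcf_partition_def
  using the_equality[of "rational_canonical_data A" L] assms(2) rational_canonical_data_unique[OF assms(1) _ assms(2)] by blast

section \<open>Saturated submodules detect the partitions\<close>

context poly_module
begin

text \<open>The generators left out have orders prime to \<open>G\<close>. If
  \<open>G \<star> v\<close> has no component along them, neither has \<open>v\<close>.\<close>

lemma saturated_subfamily:
  assumes K': "finite K'" and b: "basis_mod {0} K' (\<lambda>k. F k ^ m k) x"
    and F: "\<And>k. k \<in> K' \<Longrightarrow> monic (F k) \<and> Factorial_Ring.irreducible (F k)"
    and G: "monic G" "Factorial_Ring.irreducible G" and K: "K \<subseteq> K'" "\<And>k. k \<in> K' - K \<Longrightarrow> F k \<noteq> G"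
    and v: "v \<in> spn K' x" "G \<star> v \<in> spn K x"
  shows "v \<in> spn K x"
proof -
  obtain c where c: "v = comb K' c x" using v(1) by (auto simp: spn_def)
  obtain d where d: "G \<star> v = comb K d x" using v(2) by (auto simp: spn_def)
  let ?e = "\<lambda>k. if k \<in> K then d k else 0"
  have "comb K' (\<lambda>k. G * c k - ?e k) x = G \<star> v - comb K' ?e x" by (simp only: comb_diff comb_scale c)
  also have "comb K' ?e x = comb K d x" by (rule comb_extend[OF K' K(1)])
  finally have z: "comb K' (\<lambda>k. G * c k - ?e k) x \<in> {0}" using d by simp
  have cz: "c k \<star> x k = 0" if k: "k \<in> K'" "k \<notin> K" for k
  proof -
    have "F k ^ m k dvd G * c k" using basis_mod_D(1)[OF b z k(1)] k(2) by simp
    moreover have "coprime (F k ^ m k) G"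
    proof -
      have "F k \<noteq> G" using K(2) k by blast
      then have "\<not> F k dvd G" using monic_irreducible_dvd_eq[of "F k" G] F[OF k(1)] G by blast
      then have "coprime (F k) G" using F[OF k(1)] prime_elem_imp_coprime irreducible_imp_prime_elem_gcd by blast
      then show ?thesis by simp
    qed
    ultimately have "F k ^ m k dvd c k" by (simp add: coprime_dvd_mult_right_iff)
    then show ?thesis using basis_mod_gen(2)[OF b K' k(1), of "c k"] by simp
  qed
  have "v = comb K' (\<lambda>k. if k \<in> K then c k else 0) x" unfolding c
    by (rule comb_cong) (use cz in auto)
  also have "\<dots> = comb K c x" by (rule comb_extend[OF K' K(1)])
  finally show ?thesis using comb_in_spn[of K c x] by simp
qed

lemma saturated_kernel:
  assumes V: "M.subspace V" and sat: "\<And>v. v \<in> V \<Longrightarrow> G \<star> v \<in> S \<Longrightarrow> v \<in> S" and "0 \<in> S"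
    and "v \<in> V" "G ^ i \<star> v = 0"
  shows "v \<in> S"
  using assms(4,5)
proof (induction i arbitrary: v)
  case 0
  then show ?case using assms(3) by simp
next
  case (Suc i)
  have "G ^ i \<star> (G \<star> v) = 0" using Suc.prems(2) by (simp add: mult.commute)
  then show ?case using Suc.IH[of "G \<star> v"] M.subspace_scale[OF V Suc.prems(1)] sat Suc.prems(1) by blast
qed

text \<open>A high power of the product of all other \<open>F j'\<close> kills every component
  except the one at \<open>j\<close>, and it is prime to \<open>F j\<close>, so divisibility can be
  tested at each \<open>j\<close> separately.\<close>

lemma basis_mod_Sigma:
  assumes J: "finite J" and I: "\<And>j. j \<in> J \<Longrightarrow> finite (I j)"
    and F: "\<And>j. j \<in> J \<Longrightarrow> monic (F j) \<and> Factorial_Ring.irreducible (F j)" and inj: "inj_on F J"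
    and b: "\<And>j. j \<in> J \<Longrightarrow> basis_mod {0} (I j) (\<lambda>i. F j ^ m j i) (\<lambda>i. x (j, i))"
  shows "basis_mod {0} (Sigma J I) (\<lambda>(j, i). F j ^ m j i) x"
  unfolding basis_mod_def
proof
  fix g
  define cc where "cc j = comb (I j) (\<lambda>i. g (j, i)) (\<lambda>i. x (j, i))" for j
  have sm: "comb (Sigma J I) g x = (\<Sum>j\<in>J. cc j)"
    unfolding comb_def cc_def using J I by (simp add: sum.Sigma case_prod_unfold)
  have fin: "finite (Sigma J I)" using J I by auto
  define N where "N = (\<Sum>(j, i)\<in>Sigma J I. m j i)"
  have mN: "m j i \<le> N" if "j \<in> J" "i \<in> I j" for j i
    unfolding N_def using member_le_sum[of "(j, i)" "Sigma J I" "\<lambda>(j, i). m j i"] that fin by simp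
  have kil: "F j ^ N \<star> cc j = 0" if j: "j \<in> J" for j
  proof -
    have "F j ^ N \<star> cc j = comb (I j) (\<lambda>i. F j ^ N * g (j, i)) (\<lambda>i. x (j, i))" by (simp add: cc_def comb_scale)
    also have "\<dots> \<in> {0}" by (rule basis_mod_D(2)[OF b[OF j]]) (use mN[OF j] in \<open>simp add: le_imp_power_dvd\<close>)
    finally show ?thesis by simp
  qed
  show "comb (Sigma J I) g x \<in> {0} \<longleftrightarrow> (\<forall>k\<in>Sigma J I. (case k of (j, i) \<Rightarrow> F j ^ m j i) dvd g k)"
  proof
    assume d: "\<forall>k\<in>Sigma J I. (case k of (j, i) \<Rightarrow> F j ^ m j i) dvd g k"
    have "cc j \<in> {0}" if "j \<in> J" for j
      unfolding cc_def by (rule basis_mod_D(2)[OF b[OF that]]) (use d that in auto)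
    then show "comb (Sigma J I) g x \<in> {0}" unfolding sm by simp
  next
    assume 0: "comb (Sigma J I) g x \<in> {0}"
    show "\<forall>k\<in>Sigma J I. (case k of (j, i) \<Rightarrow> F j ^ m j i) dvd g k"
    proof clarify
      fix j i assume ji: "j \<in> J" "i \<in> I j"
      define P where "P = (\<Prod>j'\<in>J - {j}. F j' ^ N)"
      have Pk: "P \<star> cc j' = 0" if "j' \<in> J - {j}" for j'
      proof -
        have "F j' ^ N dvd P" unfolding P_def by (rule dvd_prodI) (use J that in auto)
        then obtain h where "P = h * F j' ^ N" by (metis dvd_def mult.commute)
        then have "P \<star> cc j' = h \<star> (F j' ^ N \<star> cc j')" by (simp only: M.scale_scale)
        moreover have "F j' ^ N \<star> cc j' = 0" using kil[of j'] that by simp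
        ultimately show ?thesis by (simp only: M.scale_zero_right)
      qed
      have "0 = P \<star> (\<Sum>j\<in>J. cc j)" using 0 unfolding sm by simp
      also have "\<dots> = (\<Sum>j\<in>J. P \<star> cc j)" by (rule M.scale_sum_right)
      also have "\<dots> = P \<star> cc j + (\<Sum>j\<in>J - {j}. P \<star> cc j)" by (rule sum.remove[OF J ji(1)])
      also have "(\<Sum>j\<in>J - {j}. P \<star> cc j) = 0" by (rule sum.neutral) (use Pk in blast)
      finally have "comb (I j) (\<lambda>i. P * g (j, i)) (\<lambda>i. x (j, i)) \<in> {0}" by (simp add: cc_def comb_scale)
      from basis_mod_D(1)[OF b[OF ji(1)] this ji(2)] have "F j ^ m j i dvd P * g (j, i)" .
      moreover have "coprime (F j ^ m j i) P"
        unfolding P_def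
      proof (rule prod_coprime_right)
        fix j' assume j': "j' \<in> J - {j}"
        then have "F j \<noteq> F j'" using inj ji(1) by (auto dest: inj_onD)
        then have "\<not> F j dvd F j'" using monic_irreducible_dvd_eq[of "F j" "F j'"] F[OF ji(1)] F[of j'] j' by blast
        then have "coprime (F j) (F j')" using F[OF ji(1)] prime_elem_imp_coprime irreducible_imp_prime_elem_gcd by blast
        then show "coprime (F j ^ m j i) (F j' ^ N)" by simp
      qed
      ultimately show "F j ^ m j i dvd g (j, i)" by (simp add: coprime_dvd_mult_right_iff)
    qed
  qed
qed

end

lemma card_basis_tuples_Sigma:
  fixes F :: "'j \<Rightarrow> 'a::{field_gcd,finite} poly" and m :: "'j \<Rightarrow> 'i \<Rightarrow> nat"
  assumes J: "finite J" and I: "\<And>j. j \<in> J \<Longrightarrow> finite (I j)"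
    and F: "\<And>j. j \<in> J \<Longrightarrow> monic (F j) \<and> Factorial_Ring.irreducible (F j)" and inj: "inj_on F J"
  shows "card (basis_tuples n Z (Sigma J I) (\<lambda>(j, i). F j ^ m j i)) =
    (\<Prod>j\<in>J. card (basis_tuples n Z (I j) (\<lambda>i. F j ^ m j i)))"
proof -
  let ?f = "\<lambda>(j, i). F j ^ m j i"
  let ?T = "\<lambda>j. basis_tuples n Z (I j) (\<lambda>i. F j ^ m j i)"
  have fin: "finite (Sigma J I)" using J I by auto
  have "bij_betw (\<lambda>x. \<lambda>j\<in>J. \<lambda>i\<in>I j. x (j, i)) (basis_tuples n Z (Sigma J I) ?f) (\<Pi>\<^sub>E j\<in>J. ?T j)"
  proof (rule bij_betwI[where g = "\<lambda>y. \<lambda>k\<in>Sigma J I. y (fst k) (snd k)"])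
    show "(\<lambda>x. \<lambda>j\<in>J. \<lambda>i\<in>I j. x (j, i)) \<in> basis_tuples n Z (Sigma J I) ?f \<rightarrow> (\<Pi>\<^sub>E j\<in>J. ?T j)"
    proof (rule funcsetI)
      fix x assume x: "x \<in> basis_tuples n Z (Sigma J I) ?f"
      have bx: "mo.basis_mod n Z {0} (Sigma J I) ?f x" and xv: "x \<in> Sigma J I \<rightarrow>\<^sub>E vecs {..<n}"
        using x by (auto simp: basis_tuples_def)
      have "(\<lambda>i\<in>I j. x (j, i)) \<in> ?T j" if j: "j \<in> J" for j
      proof -
        have "mo.basis_mod n Z {0} (Pair j ` I j) ?f x" by (rule mo.basis_mod_subset[OF bx fin]) (use j in auto)
        then have "mo.basis_mod n Z {0} (I j) (\<lambda>i. ?f (j, i)) (\<lambda>i. x (j, i))"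
          by (rule mo.basis_mod_reindex[rotated]) (simp add: bij_betw_def inj_on_def)
        also have "mo.basis_mod n Z {0} (I j) (\<lambda>i. ?f (j, i)) (\<lambda>i. x (j, i)) =
            mo.basis_mod n Z {0} (I j) (\<lambda>i. F j ^ m j i) (\<lambda>i\<in>I j. x (j, i))"
          by (rule mo.basis_mod_cong) auto
        finally show ?thesis using j xv by (auto simp: basis_tuples_def)
      qed
      then show "(\<lambda>j\<in>J. \<lambda>i\<in>I j. x (j, i)) \<in> (\<Pi>\<^sub>E j\<in>J. ?T j)" by simp
    qed
    show "(\<lambda>y. \<lambda>k\<in>Sigma J I. y (fst k) (snd k)) \<in> (\<Pi>\<^sub>E j\<in>J. ?T j) \<rightarrow> basis_tuples n Z (Sigma J I) ?f"
    proof (rule funcsetI)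
      fix y assume y: "y \<in> (\<Pi>\<^sub>E j\<in>J. ?T j)"
      let ?x = "\<lambda>k\<in>Sigma J I. y (fst k) (snd k)"
      have yj: "y j \<in> ?T j" if "j \<in> J" for j using y that by (rule PiE_mem)
      have "mo.basis_mod n Z {0} (Sigma J I) ?f ?x"
      proof (rule mo.basis_mod_Sigma[OF J I F inj])
        fix j assume j: "j \<in> J"
        have "mo.basis_mod n Z {0} (I j) (\<lambda>i. F j ^ m j i) (y j)" using yj[OF j] by (simp add: basis_tuples_def)
        also have "mo.basis_mod n Z {0} (I j) (\<lambda>i. F j ^ m j i) (y j) =
            mo.basis_mod n Z {0} (I j) (\<lambda>i. F j ^ m j i) (\<lambda>i. ?x (j, i))"
          by (rule mo.basis_mod_cong) (use j in auto)
        finally show "mo.basis_mod n Z {0} (I j) (\<lambda>i. F j ^ m j i) (\<lambda>i. ?x (j, i))" .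
      qed auto
      moreover have "y j i \<in> vecs {..<n}" if "j \<in> J" "i \<in> I j" for j i
        using yj[OF that(1)] that(2) by (auto simp: basis_tuples_def)
      then have "?x \<in> Sigma J I \<rightarrow>\<^sub>E vecs {..<n}" by auto
      ultimately show "?x \<in> basis_tuples n Z (Sigma J I) ?f" by (simp add: basis_tuples_def)
    qed
    show "(\<lambda>k\<in>Sigma J I. (\<lambda>j\<in>J. \<lambda>i\<in>I j. x (j, i)) (fst k) (snd k)) = x" if "x \<in> basis_tuples n Z (Sigma J I) ?f" for x
    proof
      fix k
      have "x k = undefined" if "k \<notin> Sigma J I" using \<open>x \<in> _\<close> that by (auto simp: basis_tuples_def)
      then show "(\<lambda>k\<in>Sigma J I. (\<lambda>j\<in>J. \<lambda>i\<in>I j. x (j, i)) (fst k) (snd k)) k = x k"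
        by (cases k) (auto simp: restrict_def)
    qed
    show "(\<lambda>j\<in>J. \<lambda>i\<in>I j. (\<lambda>k\<in>Sigma J I. y (fst k) (snd k)) (j, i)) = y" if y: "y \<in> (\<Pi>\<^sub>E j\<in>J. ?T j)" for y
    proof
      fix j
      show "(\<lambda>j\<in>J. \<lambda>i\<in>I j. (\<lambda>k\<in>Sigma J I. y (fst k) (snd k)) (j, i)) j = y j"
      proof (cases "j \<in> J")
        case True
        then have "y j \<in> ?T j" using y by (rule PiE_mem[rotated])
        then have "y j i = undefined" if "i \<notin> I j" for i using that by (auto simp: basis_tuples_def)
        then show ?thesis using True by (auto simp: restrict_def)
      next
        case False
        then show ?thesis using PiE_arb[OF y] by simp
      qed
    qed
  qed
  then show ?thesis by (simp add: bij_betw_same_card card_PiE[OF J])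
qed

text \<open>The blocks of the rational canonical form at the given polynomials; no other block has
  order a power of some \<open>F j\<close>, so \<open>saturated_subfamily\<close> applies.\<close>

lemma rcf_saturated_basis:
  fixes A :: "'a::{field_gcd,finite} mat" and F :: "'j \<Rightarrow> 'a poly" and l :: "'j \<Rightarrow> nat \<Rightarrow> nat"
  defines "Z \<equiv> \<lambda>j i. A $$ (i, j)"
  assumes A: "A \<in> carrier_mat n n" and inj: "inj_on F J"
    and F: "\<And>j. j \<in> J \<Longrightarrow> monic (F j) \<and> Factorial_Ring.irreducible (F j)"
    and l: "\<And>j. j \<in> J \<Longrightarrow> rcf_partition (F j) A = l j"
  defines "K \<equiv> Sigma J (\<lambda>j. {i. 0 < l j i})"
  shows "\<exists>x. mo.basis_mod n Z {0} K (\<lambda>(j, i). F j ^ l j i) x \<and> mo.spn n Z K x \<subseteq> vecs {..<n} \<and>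
    (\<forall>j\<in>J. \<forall>v\<in>vecs {..<n}. pact (mop n Z) (F j) v \<in> mo.spn n Z K x \<longrightarrow> v \<in> mo.spn n Z K x)"
proof -
  obtain L where L: "rational_canonical_data A L" using rational_canonical_data_exists[OF A] by blast
  have Ll: "L (F j) = l j" if "j \<in> J" for j using rcf_partition_eq[OF A L] l[OF that] by simp
  obtain y where fin: "finite (blocks L)" and y0: "mo.basis_mod n Z {0} (blocks L) (\<lambda>(F, j). F ^ L F j) y" "mo.spn n Z (blocks L) y = vecs {..<n}"
    using rational_canonical_data_basis[OF A L] unfolding Z_def by blast
  have y: "mo.basis_mod n Z {0} (blocks L) (\<lambda>k. fst k ^ (case k of (F, j) \<Rightarrow> L F j)) y"
    using y0(1) unfolding case_prod_unfold .
  let ?h = "\<lambda>(j, i). (F j, i)"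
  let ?B = "?h ` K"
  have h: "bij_betw ?h K ?B" using inj by (auto simp: bij_betw_def inj_on_def K_def)
  have B: "?B \<subseteq> blocks L" using Ll by (auto simp: K_def)
  let ?x = "\<lambda>k. y (?h k)"
  have s: "mo.spn n Z K ?x = mo.spn n Z ?B y" by (rule mo.spn_reindex[OF h])
  have "mo.basis_mod n Z {0} ?B (\<lambda>(F, j). F ^ L F j) y" by (rule mo.basis_mod_subset[OF y0(1) fin B])
  then have "mo.basis_mod n Z {0} K (\<lambda>k. (\<lambda>(F, j). F ^ L F j) (?h k)) ?x" by (rule mo.basis_mod_reindex[OF h])
  also have "mo.basis_mod n Z {0} K (\<lambda>k. (\<lambda>(F, j). F ^ L F j) (?h k)) ?x = mo.basis_mod n Z {0} K (\<lambda>(j, i). F j ^ l j i) ?x"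
    by (rule mo.basis_mod_cong) (use Ll in \<open>auto simp: K_def\<close>)
  finally have "mo.basis_mod n Z {0} K (\<lambda>(j, i). F j ^ l j i) ?x" .
  moreover have "mo.spn n Z K ?x \<subseteq> vecs {..<n}"
  proof (rule mo.spn_le[OF mo_subspace_vecs])
    fix k assume "k \<in> K"
    then have "?h k \<in> blocks L" by (rule subsetD[OF B imageI])
    then show "?x k \<in> vecs {..<n}" unfolding y0(2)[symmetric] by (rule mo.spn_gen[OF fin])
  qed
  moreover have "v \<in> mo.spn n Z K ?x" if j: "j \<in> J" and v: "v \<in> vecs {..<n}" "pact (mop n Z) (F j) v \<in> mo.spn n Z K ?x" for j v
    unfolding s
  proof (rule mo.saturated_subfamily[OF fin y _ _ _ B])
    show "monic (fst k) \<and> Factorial_Ring.irreducible (fst k)" if "k \<in> blocks L" for k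
      using rational_canonical_data_irreducible[OF L, of "fst k" "snd k"] that by (cases k) auto
    show "monic (F j)" "Factorial_Ring.irreducible (F j)" using F[OF j] by auto
    show "fst k \<noteq> F j" if k: "k \<in> blocks L - ?B" for k
    proof
      assume e: "fst k = F j"
      obtain i where i: "k = (F j, i)" using e by (cases k) auto
      have "0 < l j i" using k i Ll[OF j] by simp
      then have "(j, i) \<in> K" using j by (simp add: K_def)
      then have "?h (j, i) \<in> ?B" by (rule imageI)
      then show False using k i by simp
    qed
    show "v \<in> mo.spn n Z (blocks L) y" unfolding y0(2) by (rule v(1))
    show "pact (mop n Z) (F j) v \<in> mo.spn n Z ?B y" using v(2) unfolding s .
  qed
  ultimately show ?thesis by (intro exI[of _ ?x]) simp
qed

text \<open>If the partitions agree, the saturated span \<open>S0\<close> of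
  \<open>rcf_saturated_basis\<close> contains every vector killed by a power of some
  \<open>F j\<close>. Every basis tuple thus lies in it and by cardinality spans it, so saturation
  is automatic. Conversely, a saturated span contains all these kernels, and their sizes determine
  the partitions of \<open>A\<close>.\<close>

lemma card_saturated_tuples:
  fixes A :: "'a::{field_gcd,finite} mat" and F :: "'j \<Rightarrow> 'a poly" and l :: "'j \<Rightarrow> nat \<Rightarrow> nat"
  defines "Z \<equiv> \<lambda>j i. A $$ (i, j)"
  assumes A: "A \<in> carrier_mat n n" and J: "finite J" and inj: "inj_on F J"
    and F: "\<And>j. j \<in> J \<Longrightarrow> monic (F j) \<and> Factorial_Ring.irreducible (F j)"
    and l: "\<And>j. j \<in> J \<Longrightarrow> l j \<in> partitions"
  defines "K \<equiv> Sigma J (\<lambda>j. {i. 0 < l j i})"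
  shows "card {x\<in>basis_tuples n Z K (\<lambda>(j, i). F j ^ l j i). \<forall>j\<in>J. mo.tors n Z (F j) (mo.spn n Z K x) (vecs {..<n}) = mo.spn n Z K x} =
    (if \<forall>j\<in>J. rcf_partition (F j) A = l j then \<Prod>j\<in>J. card (basis_tuples n Z {i. 0 < l j i} (\<lambda>i. F j ^ l j i)) else 0)"
proof -
  let ?f = "\<lambda>(j, i). F j ^ l j i" and ?V = "vecs {..<n} :: (nat \<Rightarrow> 'a) set"
  let ?X = "{x\<in>basis_tuples n Z K ?f. \<forall>j\<in>J. mo.tors n Z (F j) (mo.spn n Z K x) ?V = mo.spn n Z K x}"
  have I: "finite {i. 0 < l j i}" if "j \<in> J" for j using l[OF that] by (simp add: partitions_def)
  have K: "finite K" unfolding K_def using J I by auto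
  have fV: "finite ?V" by (rule finite_vecs) simp
  have f0: "?f k \<noteq> 0" if k: "k \<in> K" for k
  proof -
    obtain j i where ji: "k = (j, i)" "j \<in> J" using k by (auto simp: K_def)
    then show ?thesis using mo.irreducible_neq_0[of "F j"] F[OF ji(2)] by simp
  qed
  have spnV: "mo.spn n Z K x \<subseteq> ?V" if "x \<in> basis_tuples n Z K ?f" for x
    by (rule mo.spn_le[OF mo_subspace_vecs]) (use that in \<open>auto simp: basis_tuples_def\<close>)
  show ?thesis
  proof (cases "\<forall>j\<in>J. rcf_partition (F j) A = l j")
    case True
    then have "\<exists>x0. mo.basis_mod n Z {0} K ?f x0 \<and> mo.spn n Z K x0 \<subseteq> ?V \<and>
        (\<forall>j\<in>J. \<forall>v\<in>?V. pact (mop n Z) (F j) v \<in> mo.spn n Z K x0 \<longrightarrow> v \<in> mo.spn n Z K x0)"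
      unfolding Z_def K_def by (intro rcf_saturated_basis[OF A inj]) (use F in auto)
    then obtain x0 where x0: "mo.basis_mod n Z {0} K ?f x0" "mo.spn n Z K x0 \<subseteq> ?V"
      and sat: "\<And>j v. j \<in> J \<Longrightarrow> v \<in> ?V \<Longrightarrow> pact (mop n Z) (F j) v \<in> mo.spn n Z K x0 \<Longrightarrow> v \<in> mo.spn n Z K x0" by blast
    let ?S0 = "mo.spn n Z K x0"
    have S0: "mo.M.subspace n Z ?S0" by (rule mo.subspace_spn)
    have "?X = basis_tuples n Z K ?f"
    proof (rule equalityI)
      show "basis_tuples n Z K ?f \<subseteq> ?X"
      proof
        fix x assume x: "x \<in> basis_tuples n Z K ?f"
        have bx: "mo.basis_mod n Z {0} K ?f x" and xv: "\<And>k. k \<in> K \<Longrightarrow> x k \<in> ?V" using x by (auto simp: basis_tuples_def)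
        have "mo.spn n Z K x = ?S0"
        proof (rule card_subset_eq)
          show "finite ?S0" by (rule finite_subset[OF x0(2) fV])
          show "mo.spn n Z K x \<subseteq> ?S0"
          proof (rule mo.spn_le[OF S0])
            fix k assume k: "k \<in> K"
            obtain j i where ji: "k = (j, i)" "j \<in> J" using k by (auto simp: K_def)
            have "pact (mop n Z) (?f k) (x k) \<in> {0}" by (rule mo.basis_mod_gen(1)[OF bx K k])
            then have "pact (mop n Z) (F j ^ l j i) (x k) = 0" unfolding ji by simp
            then show "x k \<in> ?S0"
              by (intro mo.saturated_kernel[OF mo_subspace_vecs sat mo.M.subspace_0[OF S0] xv[OF k]]) (use ji in auto)
          qed
          show "card (mo.spn n Z K x) = card ?S0"
            using mo.card_spn[OF bx K] mo.card_spn[OF x0(1) K] f0 by simp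
        qed
        moreover have "mo.tors n Z (F j) ?S0 ?V = ?S0" if "j \<in> J" for j
          unfolding mo.tors_def using sat[OF that] x0(2) mo.M.subspace_scale[OF S0] by blast
        ultimately show "x \<in> ?X" using x by simp
      qed
    qed simp
    then show ?thesis
      using True card_basis_tuples_Sigma[OF J I F inj, where m=l and n=n and Z=Z] by (simp add: K_def)
  next
    case False
    have "?X = {}"
    proof (rule ccontr)
      assume "?X \<noteq> {}"
      then obtain x where x: "x \<in> basis_tuples n Z K ?f"
        and sat: "\<And>j. j \<in> J \<Longrightarrow> mo.tors n Z (F j) (mo.spn n Z K x) ?V = mo.spn n Z K x" by blast
      have bx: "mo.basis_mod n Z {0} K ?f x" using x by (simp add: basis_tuples_def)
      have bx': "mo.basis_mod n Z {0} K (\<lambda>k. F (fst k) ^ (case k of (j, i) \<Rightarrow> l j i)) x"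
        using bx unfolding case_prod_unfold .
      obtain L where L: "rational_canonical_data A L" using rational_canonical_data_exists[OF A] by blast
      have "rcf_partition (F j) A = l j" if j: "j \<in> J" for j
      proof -
        have "L (F j) = l j"
        proof (rule rational_canonical_data_eqI[OF A L _ _ l[OF j]])
          show "monic (F j)" "Factorial_Ring.irreducible (F j)" using F[OF j] by auto
          fix i
          have "v \<in> mo.spn n Z K x" if "v \<in> ?V" "pact (mop n Z) (F j ^ i) v = 0" for v
          proof (rule mo.saturated_kernel[OF mo_subspace_vecs _ mo.M.subspace_0[OF mo.subspace_spn] that])
            show "u \<in> mo.spn n Z K x" if "u \<in> ?V" "pact (mop n Z) (F j) u \<in> mo.spn n Z K x" for u
              using that by (subst sat[OF j, symmetric]) (simp add: mo.tors_def)
          qed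
          then have "{v\<in>?V. pact (mop n Z) (F j ^ i) v = 0} = {v\<in>mo.spn n Z K x. pact (mop n Z) (F j ^ i) v = 0}"
            using spnV[OF x] by blast
          also have "card \<dots> = CARD('a) ^ (Polynomial.degree (F j) * (\<Sum>k\<in>{k\<in>K. F (fst k) = F j}. min (case k of (j, i) \<Rightarrow> l j i) i))"
            by (rule mo.card_power_kernel[OF K bx']) (use F j in \<open>auto simp: K_def\<close>)
          also have "{k\<in>K. F (fst k) = F j} = Pair j ` {i. l j i \<noteq> 0}"
            using inj j by (auto simp: K_def dest: inj_onD)
          also have "(\<Sum>k\<in>Pair j ` {i. l j i \<noteq> 0}. min (case k of (j, i) \<Rightarrow> l j i) i) = (\<Sum>i' | l j i' \<noteq> 0. min (l j i') i)"
            by (subst sum.reindex) (auto simp: inj_on_def)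
          finally show "card {v\<in>?V. pact (mop n (\<lambda>j i. A $$ (i, j))) (F j ^ i) v = 0} =
              CARD('a) ^ (Polynomial.degree (F j) * (\<Sum>i' | l j i' \<noteq> 0. min (l j i') i))" unfolding Z_def .
        qed
        then show ?thesis using rcf_partition_eq[OF A L] by simp
      qed
      then show False using False by blast
    qed
    then show ?thesis using False by (simp only: card.empty if_False)
  qed
qed

section \<open>Automorphisms of primary modules\<close>

text \<open>The operations are parameters, so that the record \<open>primary_module\<close> and a
  span of row vectors become instances of one notion; fixing the values off \<open>C\<close> lets
  each automorphism be counted once.\<close>

definition lin_bijs :: "'c set \<Rightarrow> ('c \<Rightarrow> 'c \<Rightarrow> 'c) \<Rightarrow> ('r \<Rightarrow> 'c \<Rightarrow> 'c) \<Rightarrow> ('c \<Rightarrow> 'c) set" where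
  "lin_bijs C pl sm = {\<phi> \<in> extensional C. bij_betw \<phi> C C \<and>
     (\<forall>x\<in>C. \<forall>y\<in>C. \<phi> (pl x y) = pl (\<phi> x) (\<phi> y)) \<and> (\<forall>a. \<forall>x\<in>C. \<phi> (sm a x) = sm a (\<phi> x))}"

lemma lin_bijs_transport:
  assumes \<phi>: "\<phi> \<in> lin_bijs C pl sm"
    and f: "\<And>x. x \<in> C \<Longrightarrow> f x \<in> S" and g: "\<And>v. v \<in> S \<Longrightarrow> g v \<in> C"
    and gf: "\<And>x. x \<in> C \<Longrightarrow> g (f x) = x" and fg: "\<And>v. v \<in> S \<Longrightarrow> f (g v) = v"
    and clS: "\<And>u v. u \<in> S \<Longrightarrow> v \<in> S \<Longrightarrow> pl' u v \<in> S" "\<And>a v. v \<in> S \<Longrightarrow> sm' a v \<in> S"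
    and fpl: "\<And>x y. x \<in> C \<Longrightarrow> y \<in> C \<Longrightarrow> f (pl x y) = pl' (f x) (f y)"
    and fsm: "\<And>a x. x \<in> C \<Longrightarrow> f (sm a x) = sm' a (f x)"
    and gpl: "\<And>u v. u \<in> S \<Longrightarrow> v \<in> S \<Longrightarrow> g (pl' u v) = pl (g u) (g v)"
    and gsm: "\<And>a v. v \<in> S \<Longrightarrow> g (sm' a v) = sm a (g v)"
  shows "(\<lambda>v\<in>S. f (\<phi> (g v))) \<in> lin_bijs S pl' sm'"
proof -
  have b\<phi>: "bij_betw \<phi> C C" using \<phi> by (simp add: lin_bijs_def)
  have \<phi>C: "\<phi> x \<in> C" if "x \<in> C" for x using b\<phi> that by (rule bij_betw_apply)
  have bf: "bij_betw f C S" by (rule bij_betw_byWitness[where f' = g]) (use f g fg gf in auto)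
  have bg: "bij_betw g S C" by (rule bij_betw_byWitness[where f' = f]) (use f g fg gf in auto)
  have "bij_betw (f \<circ> (\<phi> \<circ> g)) S S" by (rule bij_betw_trans[OF bij_betw_trans[OF bg b\<phi>] bf])
  also have "bij_betw (f \<circ> (\<phi> \<circ> g)) S S = bij_betw (\<lambda>v\<in>S. f (\<phi> (g v))) S S" by (rule bij_betw_cong) simp
  finally have "bij_betw (\<lambda>v\<in>S. f (\<phi> (g v))) S S" .
  moreover have "\<phi> (pl x y) = pl (\<phi> x) (\<phi> y)" if "x \<in> C" "y \<in> C" for x y
    using \<phi> that by (simp add: lin_bijs_def)
  moreover have "\<phi> (sm a x) = sm a (\<phi> x)" if "x \<in> C" for x a
    using \<phi> that by (simp add: lin_bijs_def)
  ultimately show ?thesis by (simp add: lin_bijs_def clS gpl gsm fpl fsm g \<phi>C)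
qed

text \<open>Conjugation by the isomorphism \<open>f\<close>.\<close>

lemma card_lin_bijs_transport:
  assumes bf: "bij_betw f C S"
    and clC: "\<And>x y. x \<in> C \<Longrightarrow> y \<in> C \<Longrightarrow> pl x y \<in> C" "\<And>a x. x \<in> C \<Longrightarrow> sm a x \<in> C"
    and fpl: "\<And>x y. x \<in> C \<Longrightarrow> y \<in> C \<Longrightarrow> f (pl x y) = pl' (f x) (f y)"
    and fsm: "\<And>a x. x \<in> C \<Longrightarrow> f (sm a x) = sm' a (f x)"
  shows "card (lin_bijs C pl sm) = card (lin_bijs S pl' sm')"
proof -
  define g where "g = inv_into C f"
  have f: "f x \<in> S" if "x \<in> C" for x using bf that by (rule bij_betw_apply)
  have g: "g v \<in> C" if "v \<in> S" for v unfolding g_def using bij_betw_apply[OF bij_betw_inv_into[OF bf] that] .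
  have gf: "g (f x) = x" if "x \<in> C" for x unfolding g_def by (rule bij_betw_inv_into_left[OF bf that])
  have fg: "f (g v) = v" if "v \<in> S" for v unfolding g_def by (rule bij_betw_inv_into_right[OF bf that])
  have gpl: "g (pl' u v) = pl (g u) (g v)" if "u \<in> S" "v \<in> S" for u v
    using gf[OF clC(1)[OF g[OF that(1)] g[OF that(2)]]] fpl[OF g[OF that(1)] g[OF that(2)]] fg[OF that(1)] fg[OF that(2)] by simp
  have gsm: "g (sm' a v) = sm a (g v)" if "v \<in> S" for a v
    using gf[OF clC(2)[OF g[OF that], of a]] fsm[OF g[OF that], of a] fg[OF that] by simp
  have clS: "pl' u v \<in> S" if "u \<in> S" "v \<in> S" for u v
    using f[OF clC(1)[OF g[OF that(1)] g[OF that(2)]]] fpl[OF g[OF that(1)] g[OF that(2)]] fg[OF that(1)] fg[OF that(2)] by simp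
  have clS': "sm' a v \<in> S" if "v \<in> S" for a v
    using f[OF clC(2)[OF g[OF that], of a]] fsm[OF g[OF that], of a] fg[OF that] by simp
  have "bij_betw (\<lambda>\<phi>. \<lambda>v\<in>S. f (\<phi> (g v))) (lin_bijs C pl sm) (lin_bijs S pl' sm')"
  proof (rule bij_betwI[where g = "\<lambda>h. \<lambda>x\<in>C. g (h (f x))"])
    show "(\<lambda>\<phi>. \<lambda>v\<in>S. f (\<phi> (g v))) \<in> lin_bijs C pl sm \<rightarrow> lin_bijs S pl' sm'"
      by (rule funcsetI, erule lin_bijs_transport) (simp_all add: f g gf fg clS clS' fpl fsm gpl gsm)
    show "(\<lambda>h. \<lambda>x\<in>C. g (h (f x))) \<in> lin_bijs S pl' sm' \<rightarrow> lin_bijs C pl sm"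
      by (rule funcsetI, erule lin_bijs_transport) (simp_all add: f g gf fg clC fpl fsm gpl gsm)
    show "(\<lambda>x\<in>C. g ((\<lambda>v\<in>S. f (\<phi> (g v))) (f x))) = \<phi>" if "\<phi> \<in> lin_bijs C pl sm" for \<phi>
    proof
      fix x
      show "(\<lambda>x\<in>C. g ((\<lambda>v\<in>S. f (\<phi> (g v))) (f x))) x = \<phi> x"
      proof (cases "x \<in> C")
        case True
        have "\<phi> x \<in> C" using that True by (auto simp: lin_bijs_def intro: bij_betw_apply)
        then show ?thesis using True f gf by simp
      qed (use that in \<open>simp add: lin_bijs_def extensional_def\<close>)
    qed
    show "(\<lambda>v\<in>S. f ((\<lambda>x\<in>C. g (h (f x))) (g v))) = h" if "h \<in> lin_bijs S pl' sm'" for h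
    proof
      fix v
      show "(\<lambda>v\<in>S. f ((\<lambda>x\<in>C. g (h (f x))) (g v))) v = h v"
      proof (cases "v \<in> S")
        case True
        have "h v \<in> S" using that True by (auto simp: lin_bijs_def intro: bij_betw_apply)
        then show ?thesis using True g fg by simp
      qed (use that in \<open>simp add: lin_bijs_def extensional_def\<close>)
    qed
  qed
  then show ?thesis by (rule bij_betw_same_card)
qed

context poly_module
begin

lemma comb_eq_iff:
  assumes "basis_mod {0} I f x" shows "comb I g x = comb I h x \<longleftrightarrow> (\<forall>i\<in>I. f i dvd g i - h i)"
proof -
  have "comb I g x = comb I h x \<longleftrightarrow> comb I (\<lambda>i. g i - h i) x \<in> {0}" by (simp add: comb_diff)
  also have "\<dots> \<longleftrightarrow> (\<forall>i\<in>I. f i dvd g i - h i)" using assms unfolding basis_mod_def by (rule spec)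
  finally show ?thesis .
qed

lemma lin_bijs_comb:
  assumes "h \<in> lin_bijs S (+) scale" "M.subspace S" "finite I" "\<And>i. i \<in> I \<Longrightarrow> x i \<in> S"
  shows "h (comb I g x) = comb I g (\<lambda>i. h (x i))"
  using assms(3,4)
proof (induction I)
  case empty
  have "h (0 \<star> 0) = 0 \<star> h 0" using assms(1) M.subspace_0[OF assms(2)] unfolding lin_bijs_def by blast
  then show ?case by simp
next
  case (insert i I)
  have 1: "g i \<star> x i \<in> S" using insert.prems by (intro M.subspace_scale[OF assms(2)]) simp
  have 2: "comb I g x \<in> S" using insert.prems by (intro comb_mem[OF assms(2)] M.subspace_scale[OF assms(2)]) simp
  have "h (g i \<star> x i + comb I g x) = h (g i \<star> x i) + h (comb I g x)" using assms(1) 1 2 by (simp add: lin_bijs_def)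
  moreover have "h (g i \<star> x i) = g i \<star> h (x i)" using assms(1) insert.prems by (simp add: lin_bijs_def)
  ultimately show ?case using insert by (simp add: comb_insert)
qed

text \<open>An automorphism is determined by the images of the generators, which form a basis of the
  same type. Every such basis in \<open>V\<close> occurs: \<open>sat\<close> keeps its vectors
  inside the span, and equality of cardinalities makes them generate it.\<close>

lemma card_lin_bijs_spn:
  assumes I: "finite I" and b: "basis_mod {0} I f x" and f0: "\<And>i. i \<in> I \<Longrightarrow> f i \<noteq> 0"
    and V: "finite V" "spn I x \<subseteq> V" and sat: "\<And>i v. i \<in> I \<Longrightarrow> v \<in> V \<Longrightarrow> f i \<star> v = 0 \<Longrightarrow> v \<in> spn I x"
  shows "card (lin_bijs (spn I x) (+) scale) = card {y\<in>I \<rightarrow>\<^sub>E V. basis_mod {0} I f y}"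
proof -
  let ?S = "spn I x" and ?Y = "{y\<in>I \<rightarrow>\<^sub>E V. basis_mod {0} I f y}"
  have S: "M.subspace ?S" by (rule subspace_spn)
  have xS: "x i \<in> ?S" if "i \<in> I" for i by (rule spn_gen[OF I that])
  have finS: "finite ?S" using V by (rule rev_finite_subset)
  have hc: "h (comb I g x) = comb I g (\<lambda>i. h (x i))" if "h \<in> lin_bijs ?S (+) scale" for h g
    by (rule lin_bijs_comb[OF that S I xS])
  let ?\<Theta> = "\<lambda>h. \<lambda>i\<in>I. h (x i)"
  have cr: "comb I g (\<lambda>i\<in>I. z i) = comb I g z" for g z by (rule comb_cong) simp
  have "bij_betw ?\<Theta> (lin_bijs ?S (+) scale) ?Y"
    unfolding bij_betw_def
  proof
    show "inj_on ?\<Theta> (lin_bijs ?S (+) scale)"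
    proof (rule inj_onI)
      fix h h' assume h: "h \<in> lin_bijs ?S (+) scale" "h' \<in> lin_bijs ?S (+) scale" and e: "?\<Theta> h = ?\<Theta> h'"
      show "h = h'"
      proof
        fix v
        show "h v = h' v"
        proof (cases "v \<in> ?S")
          case True
          then obtain g where g: "v = comb I g x" by (auto simp: spn_def)
          have "comb I g (?\<Theta> h) = comb I g (?\<Theta> h')" unfolding e ..
          then show ?thesis unfolding g hc[OF h(1)] hc[OF h(2)] cr .
        qed (use h in \<open>simp add: lin_bijs_def extensional_def\<close>)
      qed
    qed
    show "?\<Theta> ` lin_bijs ?S (+) scale = ?Y"
    proof
      show "?\<Theta> ` lin_bijs ?S (+) scale \<subseteq> ?Y"
      proof
        fix y assume "y \<in> ?\<Theta> ` lin_bijs ?S (+) scale"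
        then obtain h where y: "y = ?\<Theta> h" and h: "h \<in> lin_bijs ?S (+) scale" by blast
        have bh: "bij_betw h ?S ?S" using h by (simp add: lin_bijs_def)
        have "y \<in> I \<rightarrow>\<^sub>E V" unfolding y using bij_betw_apply[OF bh xS] V(2) by auto
        moreover have "basis_mod {0} I f y"
          unfolding basis_mod_def
        proof
          fix g
          have "comb I g y = h (comb I g x)" unfolding y cr hc[OF h] ..
          moreover have "h (comb I (\<lambda>_. 0) x) = 0" unfolding hc[OF h] by simp
          ultimately have "comb I g y \<in> {0} \<longleftrightarrow> h (comb I g x) = h 0" by simp
          also have "\<dots> \<longleftrightarrow> comb I g x = 0"
            by (rule inj_on_eq_iff[OF bij_betw_imp_inj_on[OF bh] comb_in_spn M.subspace_0[OF S]])
          also have "\<dots> \<longleftrightarrow> (\<forall>i\<in>I. f i dvd g i)" using b by (simp add: basis_mod_def)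
          finally show "comb I g y \<in> {0} \<longleftrightarrow> (\<forall>i\<in>I. f i dvd g i)" .
        qed
        ultimately show "y \<in> ?Y" by simp
      qed
      show "?Y \<subseteq> ?\<Theta> ` lin_bijs ?S (+) scale"
      proof
        fix y assume "y \<in> ?Y"
        then have yV: "y \<in> I \<rightarrow>\<^sub>E V" and by': "basis_mod {0} I f y" by auto
        have yS: "y i \<in> ?S" if "i \<in> I" for i
          using sat[OF that] yV that basis_mod_gen(1)[OF by' I that] by auto
        have spy: "spn I y = ?S"
        proof (rule card_subset_eq[OF finS])
          show "spn I y \<subseteq> ?S" by (rule spn_le[OF S yS])
          show "card (spn I y) = card ?S" using card_spn[OF by' I f0] card_spn[OF b I f0] by simp
        qed
        \<comment> \<open>The choice of coefficients does not matter: two choices differ by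
          multiples of the \<open>f i\<close>, which kill the \<open>x i\<close> and the
          \<open>y i\<close> alike.\<close>
        define h where "h = (\<lambda>v\<in>?S. comb I (SOME g. comb I g x = v) y)"
        have hx: "h (comb I g x) = comb I g y" for g
        proof -
          have "comb I (SOME g'. comb I g' x = comb I g x) x = comb I g x"
            by (rule someI[of "\<lambda>g'. comb I g' x = comb I g x" g]) (rule refl)
          then have "comb I (SOME g'. comb I g' x = comb I g x) y = comb I g y"
            unfolding comb_eq_iff[OF b] comb_eq_iff[OF by'] .
          then show ?thesis by (simp add: h_def comb_in_spn)
        qed
        have rep: "\<exists>g. v = comb I g x" if "v \<in> ?S" for v using that by (auto simp: spn_def)
        have hin: "h \<in> lin_bijs ?S (+) scale"
          unfolding lin_bijs_def
        proof (intro CollectI conjI ballI allI)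
          show "h \<in> extensional ?S" by (simp add: h_def)
          show "h (u + v) = h u + h v" if uv: "u \<in> ?S" "v \<in> ?S" for u v
          proof -
            obtain g g' where "u = comb I g x" "v = comb I g' x" using rep[OF uv(1)] rep[OF uv(2)] by (elim exE)
            then show ?thesis using hx[of "\<lambda>i. g i + g' i"] by (simp add: hx comb_add)
          qed
          show "h (a \<star> v) = a \<star> h v" if v: "v \<in> ?S" for a v
          proof -
            obtain g where "v = comb I g x" using rep[OF v] by (rule exE)
            then show ?thesis using hx[of "\<lambda>i. a * g i"] by (simp add: hx comb_scale)
          qed
          show "bij_betw h ?S ?S"
            unfolding bij_betw_def
          proof
            show "inj_on h ?S"
            proof (rule inj_onI)
              fix u v assume uv: "u \<in> ?S" "v \<in> ?S" "h u = h v"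
              obtain g g' where g: "u = comb I g x" "v = comb I g' x" using rep[OF uv(1)] rep[OF uv(2)] by (elim exE)
              have "comb I g y = comb I g' y" using uv(3) unfolding g hx .
              then show "u = v" unfolding g comb_eq_iff[OF b] comb_eq_iff[OF by'] .
            qed
            have "h ` ?S = range (\<lambda>g. comb I g y)" unfolding spn_def image_image hx ..
            then show "h ` ?S = ?S" using spy by (simp add: spn_def)
          qed
        qed
        have hy: "y = ?\<Theta> h"
        proof
          fix i
          have "h (x i) = y i" if "i \<in> I"
            using hx[of "\<lambda>k. if k = i then 1 else 0"] that I by (simp add: comb_single)
          then show "y i = ?\<Theta> h i" using PiE_arb[OF yV, of i] by simp
        qed
        show "y \<in> ?\<Theta> ` lin_bijs ?S (+) scale" by (subst hy) (rule imageI[OF hin])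
      qed
    qed
  qed
  then show ?thesis by (rule bij_betw_same_card)
qed

end

section \<open>The primary module in coordinates\<close>

definition pcoset :: "'a::comm_ring_1 \<Rightarrow> 'a \<Rightarrow> 'a set" where
  "pcoset f g = {u. f dvd u - g}"

lemma pcoset_eq_iff: "pcoset f g = pcoset f h \<longleftrightarrow> f dvd g - h"
proof
  assume "pcoset f g = pcoset f h"
  moreover have "g \<in> pcoset f g" by (simp add: pcoset_def)
  ultimately show "f dvd g - h" by (simp add: pcoset_def)
next
  assume d: "f dvd g - h"
  have "f dvd u - g \<longleftrightarrow> f dvd u - h" for u
    using dvd_add_right_iff[OF d, of "u - g"] by simp
  then show "pcoset f g = pcoset f h" by (simp add: pcoset_def)
qed

abbreviation tr :: "'a::comm_ring_1 ring" where
  "tr \<equiv> ring_of_type_algebra"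

abbreviation qm :: "'a::comm_ring_1 \<Rightarrow> ('a, 'a set) module" where
  "qm f \<equiv> quotient_module tr (PIdl\<^bsub>tr\<^esub> f)"

lemma PIdl_tr: "PIdl\<^bsub>tr\<^esub> f = {u. f dvd u}" for f :: "'a::comm_ring_1"
  by (auto simp: cgenideal_def ring_of_type_algebra_def dvd_def mult.commute)

lemma coset_tr: "PIdl\<^bsub>tr\<^esub> f +>\<^bsub>tr\<^esub> g = pcoset f g" for f :: "'a::comm_ring_1"
proof -
  have "PIdl\<^bsub>tr\<^esub> f +>\<^bsub>tr\<^esub> g = {h + g |h. f dvd h}"
    unfolding a_r_coset_def' PIdl_tr by (auto simp: ring_of_type_algebra_def)
  also have "\<dots> = pcoset f g"
  proof
    show "pcoset f g \<subseteq> {h + g |h. f dvd h}"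
    proof
      fix u assume "u \<in> pcoset f g"
      then show "u \<in> {h + g |h. f dvd h}" by (intro CollectI exI[of _ "u - g"]) (simp add: pcoset_def)
    qed
  qed (auto simp: pcoset_def)
  finally show ?thesis .
qed

lemma ideal_PIdl_tr: "ideal (PIdl\<^bsub>tr\<^esub> f) tr" for f :: "'a::comm_ring_1"
  by (rule cring.cgenideal_ideal[OF cring_from_type_algebra]) (simp add: ring_of_type_algebra_def)

lemma qm_simps:
  fixes f :: "'a::comm_ring_1"
  shows "carrier (qm f) = range (pcoset f)" "zero (qm f) = pcoset f 0"
    "add (qm f) (pcoset f g) (pcoset f h) = pcoset f (g + h)"
    "module.smult (qm f) a (pcoset f g) = pcoset f (a * g)"
proof -
  interpret ideal "PIdl\<^bsub>tr\<^esub> f" tr by (rule ideal_PIdl_tr)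
  show "carrier (qm f) = range (pcoset f)"
    by (auto simp: quotient_module_def ring.defs module.defs FactRing_def A_RCOSETS_def' coset_tr ring_of_type_algebra_def[where 'a='a, THEN arg_cong[where f=carrier], simplified])
  show "zero (qm f) = pcoset f 0"
    by (auto simp: quotient_module_def ring.defs module.defs FactRing_def PIdl_tr pcoset_def)
  show "add (qm f) (pcoset f g) (pcoset f h) = pcoset f (g + h)"
    using a_rcos_sum[of g h] by (simp add: quotient_module_def ring.defs module.defs FactRing_def coset_tr) (simp add: ring_of_type_algebra_def)
  show "module.smult (qm f) a (pcoset f g) = pcoset f (a * g)"
    using rcoset_mult_add[of a g] by (simp add: quotient_module_def ring.defs module.defs FactRing_def coset_tr) (simp add: ring_of_type_algebra_def)
qed

lemma group_qm: "group (add_monoid (qm f))" for f :: "'a::comm_ring_1"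
proof -
  interpret ideal "PIdl\<^bsub>tr\<^esub> f" tr by (rule ideal_PIdl_tr)
  interpret Q: ring "tr Quot (PIdl\<^bsub>tr\<^esub> f)" by (rule quotient_is_ring)
  show ?thesis using Q.a_group
    by (simp add: group_def monoid_def group_axioms_def Units_def quotient_module_def ring.defs module.defs)
qed

text \<open>At an index with \<open>l i = 0\<close> the modulus is \<open>F ^ 0 = 1\<close> and
  there is only one coset. The finite support required in a direct sum is therefore
  automatic.\<close>

lemma primary_module_simps:
  fixes F :: "'a::field poly"
  assumes l: "finite {i. 0 < l i}"
  defines "\<pi> \<equiv> \<lambda>g i. pcoset (F ^ l i) (g i)"
  shows "carrier (primary_module F l) = range \<pi>"
    "add (primary_module F l) (\<pi> g) (\<pi> h) = \<pi> (\<lambda>i. g i + h i)"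
    "module.smult (primary_module F l) a (\<pi> g) = \<pi> (\<lambda>i. a * g i)"
proof -
  have "carrier (primary_module F l) = carrier (sum_group UNIV (\<lambda>i. add_monoid (qm (F ^ l i))))"
    unfolding primary_module_def direct_sum_module_def by simp
  also have "\<dots> = {x \<in> \<Pi>\<^sub>E i\<in>UNIV. carrier (add_monoid (qm (F ^ l i))). finite {i \<in> UNIV. x i \<noteq> one (add_monoid (qm (F ^ l i)))}}"
    by (rule carrier_sum_group) (rule group_qm)
  also have "\<dots> = {x \<in> \<Pi>\<^sub>E i\<in>UNIV. range (pcoset (F ^ l i)). finite {i \<in> UNIV. x i \<noteq> pcoset (F ^ l i) 0}}"
    by (simp add: qm_simps)
  also have "\<dots> = range \<pi>"
  proof
    show "{x \<in> \<Pi>\<^sub>E i\<in>UNIV. range (pcoset (F ^ l i)). finite {i \<in> UNIV. x i \<noteq> pcoset (F ^ l i) 0}} \<subseteq> range \<pi>"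
    proof
      fix x assume "x \<in> {x \<in> \<Pi>\<^sub>E i\<in>UNIV. range (pcoset (F ^ l i)). finite {i \<in> UNIV. x i \<noteq> pcoset (F ^ l i) 0}}"
      then have "\<forall>i. \<exists>g. x i = pcoset (F ^ l i) g" by auto
      then obtain g where "\<forall>i. x i = pcoset (F ^ l i) (g i)" unfolding choice_iff by (rule exE)
      then have "x = \<pi> g" by (auto simp: \<pi>_def)
      then show "x \<in> range \<pi>" by blast
    qed
    show "range \<pi> \<subseteq> {x \<in> \<Pi>\<^sub>E i\<in>UNIV. range (pcoset (F ^ l i)). finite {i \<in> UNIV. x i \<noteq> pcoset (F ^ l i) 0}}"
    proof
      fix x assume "x \<in> range \<pi>"
      then obtain g where x: "x = \<pi> g" by (rule rangeE)
      have "{i. x i \<noteq> pcoset (F ^ l i) 0} \<subseteq> {i. 0 < l i}"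
      proof
        fix i assume i: "i \<in> {i. x i \<noteq> pcoset (F ^ l i) 0}"
        show "i \<in> {i. 0 < l i}"
        proof (rule ccontr)
          assume "i \<notin> {i. 0 < l i}"
          then have "x i = pcoset (F ^ l i) 0" by (simp add: x \<pi>_def pcoset_eq_iff)
          then show False using i by simp
        qed
      qed
      then have "finite {i. x i \<noteq> pcoset (F ^ l i) 0}" using l by (rule finite_subset)
      then show "x \<in> {x \<in> \<Pi>\<^sub>E i\<in>UNIV. range (pcoset (F ^ l i)). finite {i \<in> UNIV. x i \<noteq> pcoset (F ^ l i) 0}}"
        by (simp add: x \<pi>_def PiE_iff)
    qed
  qed
  finally show "carrier (primary_module F l) = range \<pi>" .
qed (simp_all add: primary_module_def direct_sum_module_def \<pi>_def qm_simps restrict_UNIV)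

lemma Aut_F_eq_lin_bijs:
  fixes F :: "'a::field poly"
  shows "Aut_F F l = lin_bijs (carrier (primary_module F l)) (add (primary_module F l)) (module.smult (primary_module F l))"
  by (auto simp: Aut_F_def module_auto_def auto_def hom_def Bij_def lin_bijs_def ring_of_type_algebra_def dest: bij_betwE)

context poly_module
begin

lemma card_Aut_F_eq_lin_bijs:
  fixes F :: "'a poly"
  assumes l: "finite {i. 0 < l i}" and b: "basis_mod {0} {i. 0 < l i} (\<lambda>i. F ^ l i) x"
  shows "card (Aut_F F l) = card (lin_bijs (spn {i. 0 < l i} x) (+) scale)"
proof -
  let ?I = "{i. 0 < l i}" and ?M = "primary_module F l"
  define \<pi> where "\<pi> = (\<lambda>(g :: nat \<Rightarrow> 'a poly) i. pcoset (F ^ l i) (g i))"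
  have carr: "carrier ?M = range \<pi>" using primary_module_simps(1)[OF l, of F] by (simp add: \<pi>_def)
  have add: "add ?M (\<pi> g) (\<pi> h) = \<pi> (\<lambda>i. g i + h i)" for g h
    using primary_module_simps(2)[OF l, of F g h] by (simp add: \<pi>_def)
  have sm: "module.smult ?M a (\<pi> g) = \<pi> (\<lambda>i. a * g i)" for a g
    using primary_module_simps(3)[OF l, of F a g] by (simp add: \<pi>_def)
  have \<pi>_eq: "\<pi> g = \<pi> h \<longleftrightarrow> comb ?I g x = comb ?I h x" for g h
  proof -
    have "\<pi> g = \<pi> h \<longleftrightarrow> (\<forall>i. F ^ l i dvd g i - h i)" by (simp add: \<pi>_def fun_eq_iff pcoset_eq_iff)
    also have "\<dots> \<longleftrightarrow> (\<forall>i\<in>?I. F ^ l i dvd g i - h i)"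
    proof -
      have "F ^ l i dvd g i - h i" if "\<not> 0 < l i" for i using that by simp
      then show ?thesis by blast
    qed
    finally show ?thesis unfolding comb_eq_iff[OF b] .
  qed
  \<comment> \<open>By \<open>\<pi>_eq\<close> the combination depends only on the cosets, so any
    representatives may be picked.\<close>
  define \<Phi> where "\<Phi> z = comb ?I (SOME g. \<pi> g = z) x" for z
  have \<Phi>: "\<Phi> (\<pi> g) = comb ?I g x" for g
  proof -
    have "\<pi> (SOME g'. \<pi> g' = \<pi> g) = \<pi> g" by (rule someI[of "\<lambda>g'. \<pi> g' = \<pi> g" g]) (rule refl)
    then show ?thesis unfolding \<pi>_eq \<Phi>_def .
  qed
  show ?thesis unfolding Aut_F_eq_lin_bijs
  proof (rule card_lin_bijs_transport)
    show "bij_betw \<Phi> (carrier ?M) (spn ?I x)"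
      unfolding bij_betw_def carr
    proof
      show "inj_on \<Phi> (range \<pi>)" by (rule inj_onI) (use \<Phi> \<pi>_eq in auto)
      show "\<Phi> ` range \<pi> = spn ?I x" unfolding image_image \<Phi> spn_def ..
    qed
  qed (auto simp: carr add sm \<Phi> comb_add comb_scale)
qed

end

text \<open>The saturated span of the blocks at \<open>F\<close> is a copy of
  \<open>primary_module F l\<close>, and all basis tuples of this type lie in it. The index set
  \<open>{()}\<close> specialises \<open>rcf_saturated_basis\<close> to a single polynomial.\<close>

lemma card_basis_tuples_eq_Aut_F:
  fixes A :: "'a::{field_gcd,finite} mat"
  assumes A: "A \<in> carrier_mat n n" and F: "monic F" "Factorial_Ring.irreducible F"
    and l: "l \<in> partitions" "rcf_partition F A = l"
  shows "card (basis_tuples n (\<lambda>j i. A $$ (i, j)) {i. 0 < l i} (\<lambda>i. F ^ l i)) = card (Aut_F F l)"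
proof -
  let ?Z = "\<lambda>j i. A $$ (i, j)" and ?I = "{i. 0 < l i}" and ?V = "vecs {..<n} :: (nat \<Rightarrow> 'a) set"
  let ?K = "Sigma {()} (\<lambda>_. ?I)"
  have I: "finite ?I" using l(1) by (simp add: partitions_def)
  have "\<exists>x. mo.basis_mod n ?Z {0} ?K (\<lambda>(j, i). F ^ l i) x \<and> mo.spn n ?Z ?K x \<subseteq> ?V \<and>
      (\<forall>j\<in>{()}. \<forall>v\<in>?V. pact (mop n ?Z) F v \<in> mo.spn n ?Z ?K x \<longrightarrow> v \<in> mo.spn n ?Z ?K x)"
    using rcf_saturated_basis[OF A, of "\<lambda>_. F" "{()}" "\<lambda>_. l"] F l(2) by simp
  then obtain x where x: "mo.basis_mod n ?Z {0} ?K (\<lambda>(j, i). F ^ l i) x" "mo.spn n ?Z ?K x \<subseteq> ?V"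
    and sat: "\<And>v. v \<in> ?V \<Longrightarrow> pact (mop n ?Z) F v \<in> mo.spn n ?Z ?K x \<Longrightarrow> v \<in> mo.spn n ?Z ?K x" by blast
  have h: "bij_betw (Pair ()) ?I ?K" by (auto simp: bij_betw_def inj_on_def)
  let ?y = "\<lambda>i. x ((), i)"
  have b: "mo.basis_mod n ?Z {0} ?I (\<lambda>i. F ^ l i) ?y" using mo.basis_mod_reindex[OF h x(1)] by simp
  have s: "mo.spn n ?Z ?I ?y = mo.spn n ?Z ?K x" by (rule mo.spn_reindex[OF h])
  have fV: "finite ?V" by (rule finite_vecs) simp
  have "card (lin_bijs (mo.spn n ?Z ?I ?y) (+) (pact (mop n ?Z))) = card {y\<in>?I \<rightarrow>\<^sub>E ?V. mo.basis_mod n ?Z {0} ?I (\<lambda>i. F ^ l i) y}"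
  proof (rule mo.card_lin_bijs_spn[OF I b _ fV])
    show "F ^ l i \<noteq> 0" for i using mo.irreducible_neq_0[OF F(2)] by simp
    show "mo.spn n ?Z ?I ?y \<subseteq> ?V" unfolding s by (rule x(2))
    show "v \<in> mo.spn n ?Z ?I ?y" if "v \<in> ?V" "pact (mop n ?Z) (F ^ l i) v = 0" for i v
      unfolding s by (rule mo.saturated_kernel[OF mo_subspace_vecs sat mo.M.subspace_0[OF mo.subspace_spn] that])
  qed
  then show ?thesis unfolding mo.card_Aut_F_eq_lin_bijs[OF I b] basis_tuples_def by simp
qed

section \<open>Random matrices\<close>

text \<open>Serves the final division: a positive limit excludes that the product of the orders of
  the automorphism groups is 0.\<close>

lemma euler_prod_pos:
  assumes q: "1 < q" shows "0 < euler_prod q"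
proof -
  have qk: "1 < q ^ Suc k" for k using one_less_power[OF q] by blast
  have "summable (\<lambda>k. (1 / q) ^ Suc k)" using q by (subst summable_Suc_iff) (simp add: summable_geometric)
  then have "summable (\<lambda>k. norm ((1 - 1 / q ^ Suc k) - 1))" using q by (simp add: power_one_over)
  then have "convergent_prod (\<lambda>k. 1 - 1 / q ^ Suc k)"
    by (intro abs_convergent_prod_imp_convergent_prod summable_imp_abs_convergent_prod)
  moreover have "0 < 1 - 1 / q ^ Suc k" for k using qk[of k] by (simp add: divide_simps del: power_Suc)
  ultimately show ?thesis unfolding euler_prod_def by (rule less_0_prodinf)
qed

definition std_char :: "'p::prime_card mod_ring \<Rightarrow> complex" where
  "std_char x = cis (2 * pi * (real_of_int (to_int_mod_ring x) / real CARD('p)))"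

text \<open>Reduction modulo the characteristic changes the angle by a multiple of
  \<open>2 * pi\<close>. The character is faithful since the representatives lie between 0 and the
  characteristic.\<close>

lemma add_char_std_char: "add_char (std_char :: 'p::prime_card mod_ring \<Rightarrow> complex)"
proof
  let ?p = "int CARD('p)"
  have p0: "0 < CARD('p)" by (simp add: card_gt_0_iff)
  have red: "cis (2 * pi * (real_of_int (m mod ?p) / real CARD('p))) = cis (2 * pi * (real_of_int m / real CARD('p)))" for m
  proof -
    have "real_of_int m = real_of_int (m mod ?p) + real CARD('p) * real_of_int (m div ?p)"
      by (metis mod_mult_div_eq of_int_add of_int_mult of_int_of_nat_eq)
    then have "real_of_int m / real CARD('p) =
        (real_of_int (m mod ?p) + real CARD('p) * real_of_int (m div ?p)) / real CARD('p)" by (rule arg_cong)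
    also have "\<dots> = real_of_int (m mod ?p) / real CARD('p) + real_of_int (m div ?p)"
      using p0 by (simp only: add_divide_distrib) simp
    finally have e: "real_of_int m / real CARD('p) = real_of_int (m mod ?p) / real CARD('p) + real_of_int (m div ?p)" .
    have "cis (2 * pi * real_of_int (m div ?p)) = 1" by (rule cis_multiple_2pi) simp
    then show ?thesis unfolding e distrib_left cis_mult[symmetric] by (simp only: mult_1_right)
  qed
  show "std_char (x + y) = std_char x * std_char y" for x y :: "'p mod_ring"
  proof -
    have "std_char (x + y) = cis (2 * pi * (real_of_int (to_int_mod_ring x + to_int_mod_ring y) / real CARD('p)))"
    proof -
      have "to_int_mod_ring (x + y) = (to_int_mod_ring x + to_int_mod_ring y) mod ?p"
        unfolding to_int_mod_ring_def using plus_mod_ring.rep_eq by auto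
      then show ?thesis unfolding std_char_def by (simp only: red)
    qed
    then show ?thesis by (simp add: std_char_def cis_mult add_divide_distrib distrib_left)
  qed
  show "cmod (std_char x) = 1" for x :: "'p mod_ring" by (simp add: std_char_def)
  show "std_char x \<noteq> 1" if x: "x \<noteq> 0" for x :: "'p mod_ring"
  proof
    assume "std_char x = 1"
    then have "Re (std_char x) = 1" by simp
    then have "cos (2 * pi * (real_of_int (to_int_mod_ring x) / real CARD('p))) = 1" by (simp add: std_char_def)
    then obtain k :: int where k: "2 * pi * (real_of_int (to_int_mod_ring x) / real CARD('p)) = real_of_int k * 2 * pi"
      using cos_one_2pi_int by blast
    have "2 * pi * (real_of_int (to_int_mod_ring x) / real CARD('p)) = 2 * pi * real_of_int k"
      unfolding k by (simp only: mult_ac)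
    then have "real_of_int (to_int_mod_ring x) / real CARD('p) = real_of_int k"
      by (rule mult_left_cancel[THEN iffD1, rotated]) simp
    then have "real_of_int (to_int_mod_ring x) = real_of_int (k * ?p)" using p0 by (simp add: field_simps)
    then have e: "to_int_mod_ring x = k * ?p" by (simp only: of_int_eq_iff)
    have "to_int_mod_ring x \<in> {0..<?p}" using range_to_int_mod_ring[where 'a='p] by blast
    then have "to_int_mod_ring x mod ?p = to_int_mod_ring x" by simp
    then have "to_int_mod_ring x = 0" unfolding e by simp
    then show False using x by simp
  qed
qed

text \<open>The event is split according to the value of the matrix, with \<open>Z j i\<close> for
  the entry at \<open>(i, j)\<close> as in \<open>mop\<close>. For positive \<open>n\<close> the
  index set of the entries is nonempty, as \<open>indep_varsD\<close> requires.\<close>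

lemma (in prob_space) prob_random_matrix:
  fixes A :: "'a \<Rightarrow> 'f::finite mat"
  assumes n: "0 < n" and A: "balanced_random_matrix M n \<alpha> A"
  defines "w \<equiv> \<lambda>j i a. prob {\<omega>\<in>space M. A \<omega> $$ (i, j) = a}"
  shows "prob {\<omega>\<in>space M. Q (A \<omega>)} = (\<Sum>Z\<in>mats n. mat_wt n w Z * of_bool (Q (mat n n (\<lambda>(i, j). Z j i))))"
proof -
  let ?I = "{..<n} \<times> {..<n}" and ?Y = "\<lambda>(i, j) \<omega>. A \<omega> $$ (i, j)"
  have carr: "A \<omega> \<in> carrier_mat n n" if "\<omega> \<in> space M" for \<omega> using A that by (simp add: balanced_random_matrix_def)
  have ind: "indep_vars (\<lambda>_. count_space UNIV) ?Y ?I" using A by (simp add: balanced_random_matrix_def)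
  define E where "E Z = (\<Inter>k\<in>?I. ?Y k -` {Z (snd k) (fst k)} \<inter> space M)" for Z
  have rv: "?Y k \<in> measurable M (count_space UNIV)" if "k \<in> ?I" for k
    using ind that unfolding indep_vars_def by auto
  have ne: "?I \<noteq> {}" using n by auto
  have sets: "E Z \<in> sets M" for Z
    unfolding E_def by (intro sets.finite_INT) (use ne measurable_sets[OF rv] in auto)
  have prob: "prob (E Z) = mat_wt n w Z" for Z
  proof -
    have "prob (E Z) = (\<Prod>k\<in>?I. prob (?Y k -` {Z (snd k) (fst k)} \<inter> space M))"
      unfolding E_def by (rule indep_varsD[OF ind ne]) auto
    also have "\<dots> = (\<Prod>(i, j)\<in>?I. w j i (Z j i))"
      by (rule prod.cong[OF refl]) (auto simp: w_def vimage_def Int_def conj_commute)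
    also have "\<dots> = (\<Prod>i<n. \<Prod>j<n. w j i (Z j i))" by (rule prod.cartesian_product[symmetric])
    also have "\<dots> = (\<Prod>j<n. \<Prod>i<n. w j i (Z j i))" by (rule prod.swap)
    finally show ?thesis by (simp add: mat_wt_def)
  qed
  have EI: "\<omega> \<in> E Z \<longleftrightarrow> \<omega> \<in> space M \<and> (\<forall>i<n. \<forall>j<n. A \<omega> $$ (i, j) = Z j i)" for \<omega> Z
    using ne by (auto simp: E_def)
  let ?P = "{Z\<in>mats n. Q (mat n n (\<lambda>(i, j). Z j i))} :: (nat \<Rightarrow> nat \<Rightarrow> 'f) set"
  have mE: "A \<omega> = mat n n (\<lambda>(i, j). Z j i)" if "\<omega> \<in> E Z" for \<omega> Z
    by (rule eq_matI) (use that carr[of \<omega>] in \<open>auto simp: EI\<close>)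
  have dis: "Z = Z'" if "Z \<in> mats n" "Z' \<in> mats n" "\<omega> \<in> E Z" "\<omega> \<in> E Z'" for Z Z' :: "nat \<Rightarrow> nat \<Rightarrow> 'f" and \<omega>
  proof (rule PiE_ext[of _ "{..<n}" "\<lambda>_. {..<n} \<rightarrow>\<^sub>E UNIV"])
    show "Z \<in> {..<n} \<rightarrow>\<^sub>E ({..<n} \<rightarrow>\<^sub>E UNIV)" "Z' \<in> {..<n} \<rightarrow>\<^sub>E ({..<n} \<rightarrow>\<^sub>E UNIV)" using that by (auto simp: mats_def)
    fix j assume j: "j \<in> {..<n}"
    show "Z j = Z' j"
    proof (rule PiE_ext[of _ "{..<n}" "\<lambda>_. UNIV"])
      show "Z j \<in> {..<n} \<rightarrow>\<^sub>E UNIV" "Z' j \<in> {..<n} \<rightarrow>\<^sub>E UNIV" using that(1,2) j unfolding mats_def by (auto dest: PiE_mem)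
      show "Z j i = Z' j i" if "i \<in> {..<n}" for i
        using \<open>\<omega> \<in> E Z\<close> \<open>\<omega> \<in> E Z'\<close> that j unfolding EI by (metis lessThan_iff)
    qed
  qed
  have "{\<omega>\<in>space M. Q (A \<omega>)} = (\<Union>Z\<in>?P. E Z)"
  proof
    show "{\<omega>\<in>space M. Q (A \<omega>)} \<subseteq> (\<Union>Z\<in>?P. E Z)"
    proof
      fix \<omega> assume o: "\<omega> \<in> {\<omega>\<in>space M. Q (A \<omega>)}"
      let ?Z = "\<lambda>j\<in>{..<n}. \<lambda>i\<in>{..<n}. A \<omega> $$ (i, j)"
      have "\<omega> \<in> E ?Z" using o by (simp add: EI)
      moreover have "?Z \<in> mats n" by (simp add: mats_def)
      ultimately show "\<omega> \<in> (\<Union>Z\<in>?P. E Z)" using o mE[of \<omega> ?Z] by (intro UN_I[of ?Z]) auto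
    qed
    show "(\<Union>Z\<in>?P. E Z) \<subseteq> {\<omega>\<in>space M. Q (A \<omega>)}"
    proof
      fix \<omega> assume "\<omega> \<in> (\<Union>Z\<in>?P. E Z)"
      then obtain Z where Z: "Q (mat n n (\<lambda>(i, j). Z j i))" "\<omega> \<in> E Z" by auto
      then show "\<omega> \<in> {\<omega>\<in>space M. Q (A \<omega>)}" using mE[OF Z(2)] by (simp add: EI)
    qed
  qed
  also have "prob (\<Union>Z\<in>?P. E Z) = (\<Sum>Z\<in>?P. prob (E Z))"
  proof (rule finite_measure_finite_Union)
    show "finite ?P" using finite_mats by (rule rev_finite_subset) auto
    show "E ` ?P \<subseteq> sets M" using sets by auto
    show "disjoint_family_on E ?P" unfolding disjoint_family_on_def using dis by blast
  qed
  also have "\<dots> = (\<Sum>Z\<in>mats n. if Q (mat n n (\<lambda>(i, j). Z j i)) then mat_wt n w Z else 0)"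
    unfolding prob by (rule sum.inter_filter[OF finite_mats])
  also have "\<dots> = (\<Sum>Z\<in>mats n. mat_wt n w Z * of_bool (Q (mat n n (\<lambda>(i, j). Z j i))))"
    by (rule sum.cong) auto
  finally show ?thesis .
qed

lemma (in prob_space) balanced_wt_prob:
  fixes A :: "'a \<Rightarrow> 'f::finite mat"
  assumes A: "balanced_random_matrix M n \<alpha> A" and ij: "i < n" "j < n" and \<beta>: "\<beta> \<le> \<alpha>"
  shows "balanced_wt \<beta> (\<lambda>a. prob {\<omega>\<in>space M. A \<omega> $$ (i, j) = a})"
proof -
  have rv: "(\<lambda>\<omega>. A \<omega> $$ (i, j)) \<in> measurable M (count_space UNIV)"
    and le: "prob {\<omega>\<in>space M. A \<omega> $$ (i, j) = a} \<le> 1 - \<alpha>" for a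
    using A ij by (auto simp: balanced_random_matrix_def balanced_rv_def)
  have "(\<Sum>a\<in>UNIV. prob {\<omega>\<in>space M. A \<omega> $$ (i, j) = a}) = prob (\<Union>a\<in>UNIV. {\<omega>\<in>space M. A \<omega> $$ (i, j) = a})"
  proof (rule finite_measure_finite_Union[symmetric])
    have "(\<lambda>\<omega>. A \<omega> $$ (i, j)) -` {a} \<inter> space M \<in> sets M" for a by (rule measurable_sets[OF rv]) simp
    moreover have "(\<lambda>\<omega>. A \<omega> $$ (i, j)) -` {a} \<inter> space M = {\<omega>\<in>space M. A \<omega> $$ (i, j) = a}" for a by auto
    ultimately show "(\<lambda>a. {\<omega>\<in>space M. A \<omega> $$ (i, j) = a}) ` UNIV \<subseteq> sets M" by auto
  qed (auto simp: disjoint_family_on_def)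
  also have "(\<Union>a\<in>UNIV. {\<omega>\<in>space M. A \<omega> $$ (i, j) = a}) = space M" by auto
  finally have "(\<Sum>a\<in>UNIV. prob {\<omega>\<in>space M. A \<omega> $$ (i, j) = a}) = 1" by (simp add: prob_space)
  moreover have "prob {\<omega>\<in>space M. A \<omega> $$ (i, j) = a} \<le> 1 - \<beta>" for a using le[of a] \<beta> by linarith
  ultimately show ?thesis by (simp add: balanced_wt_def)
qed

lemma mu_F_eq_euler_prod:
  fixes F :: "'p::prime_card mod_ring poly"
  shows "mu_F F l = euler_prod (real CARD('p mod_ring) ^ Polynomial.degree F) / real (card (Aut_F F l))"
proof -
  have "1 - real CARD('p) powi (- int (Suc k * Polynomial.degree F)) = 1 - 1 / (real CARD('p) ^ Polynomial.degree F) ^ Suc k" for k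
    unfolding power_int_minus power_int_of_nat power_mult[symmetric] mult.commute[of "Suc k"] by (simp only: inverse_eq_divide)
  then show ?thesis by (simp add: mu_F_def euler_prod_def CARD_mod_ring)
qed

theorem theorem1p1:
  fixes \<alpha> :: "nat \<Rightarrow> real"
    and M :: "nat \<Rightarrow> 'w measure"
    and A :: "nat \<Rightarrow> 'w \<Rightarrow> 'p :: prime_card mod_ring mat"
    and r :: nat
    and F :: "nat \<Rightarrow> 'p mod_ring poly"
    and l :: "nat \<Rightarrow> nat \<Rightarrow> nat"
  assumes "\<And>n. n \<ge> 1 \<Longrightarrow> \<alpha> n > 0"
    and "liminf (\<lambda>n. ereal (real n * \<alpha> n / ln (real n))) > 1"
    and "\<And>n. n \<ge> 1 \<Longrightarrow> prob_space (M n)"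
    and "\<And>n. n \<ge> 1 \<Longrightarrow> balanced_random_matrix (M n) n (\<alpha> n) (A n)"
    and "r \<ge> 1"
    and "inj_on F {1..r}"
    and "\<And>j. j \<in> {1..r} \<Longrightarrow>
           monic (F j) \<and> Factorial_Ring.irreducible (F j) \<and> Polynomial.degree (F j) > 0"
    and "\<And>j. j \<in> {1..r} \<Longrightarrow> l j \<in> partitions"
  shows "(\<lambda>n. measure (M n) {\<omega> \<in> space (M n). \<forall>j\<in>{1..r}. rcf_partition (F j) (A n \<omega>) = l j})
           \<longlonglongrightarrow> (\<Prod>j = 1..r. mu_F (F j) (l j))"
proof -
  let ?J = "{1..r}" and ?q = "\<lambda>j. real CARD('p mod_ring) ^ Polynomial.degree (F j)"
  define K where "K = Sigma ?J (\<lambda>j. {i. 0 < l j i})"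
  let ?f = "\<lambda>(j, i). F j ^ l j i"
  let ?Q = "\<lambda>B. \<forall>j\<in>?J. rcf_partition (F j) B = l j"
  define P where "P n = measure (M n) {\<omega> \<in> space (M n). ?Q (A n \<omega>)}" for n
  define C where "C = (\<Prod>j\<in>?J. card (Aut_F (F j) (l j)))"
  define w where "w n j i a = measure (M n) {\<omega>\<in>space (M n). A n \<omega> $$ (i, j) = a}" for n j i a
  have F: "monic (F j) \<and> Factorial_Ring.irreducible (F j)" if "j \<in> ?J" for j using assms(7)[OF that] by blast
  have I: "finite {i. 0 < l j i}" if "j \<in> ?J" for j using assms(8)[OF that] by (simp add: partitions_def)
  have K: "finite K" unfolding K_def using I by (intro finite_SigmaI) auto
  \<comment> \<open>From here on the entries are used only through balancedness at level
    \<open>c * ln n / n\<close>, to which \<open>\<alpha> n\<close> is lowered.\<close>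
  obtain c where c: "1 < ereal c" "ereal c < liminf (\<lambda>n. ereal (real n * \<alpha> n / ln (real n)))"
    using ereal_dense2[OF assms(2)] by blast
  have c1: "1 < c" using c(1) by simp
  have "eventually (\<lambda>n. ereal c < ereal (real n * \<alpha> n / ln (real n))) sequentially"
    using less_LiminfD[OF c(2)] .
  then have bal: "eventually (\<lambda>n. \<forall>i<n. \<forall>j<n. balanced_wt (c * ln (real n) / real n) (w n j i)) sequentially"
    \<comment> \<open>From 2 on \<open>ln n\<close> is positive, so the quotient can be
      cleared.\<close>
    using eventually_ge_at_top[of 2]
  proof eventually_elim
    case (elim n)
    then have n: "2 \<le> n" and "c < real n * \<alpha> n / ln (real n)" by auto
    then have "c * ln (real n) < real n * \<alpha> n" by (simp add: pos_less_divide_eq)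
    then have le: "c * ln (real n) / real n \<le> \<alpha> n" using n by (simp add: pos_divide_le_eq mult.commute)
    have n1: "1 \<le> n" using n by simp
    show ?case unfolding w_def
      using prob_space.balanced_wt_prob[OF assms(3)[OF n1] assms(4)[OF n1] _ _ le] by blast
  qed
  have lim: "(\<lambda>n. \<Sum>Z\<in>mats n. mat_wt n (w n) Z *
      card {x\<in>basis_tuples n Z K ?f. \<forall>j\<in>?J. mo.tors n Z (F j) (mo.spn n Z K x) (vecs {..<n}) = mo.spn n Z K x}) \<longlonglongrightarrow>
    (\<Prod>j\<in>?J. euler_prod (?q j))"
  proof (rule saturated_tuples_tendsto[OF add_char_std_char c1 bal _ K _ _ F])
    show "0 \<le> w n j i a" for n i j a by (simp add: w_def)
    show "monic (?f k) \<and> 0 < Polynomial.degree (?f k)" if k: "k \<in> K" for k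
    proof -
      obtain j i where ji: "k = (j, i)" "j \<in> ?J" "0 < l j i" using k by (auto simp: K_def)
      have Fj: "monic (F j)" "F j \<noteq> 0" "0 < Polynomial.degree (F j)" using assms(7)[OF ji(2)] by auto
      have "monic (F j ^ l j i)" by (rule monic_power[OF Fj(1)])
      moreover have "0 < Polynomial.degree (F j ^ l j i)" using Fj ji(3) by (simp add: degree_power_eq)
      ultimately show ?thesis unfolding ji(1) prod.case by blast
    qed
    show "\<not> F i dvd F j" if ij: "i \<in> ?J" "j \<in> ?J" "i \<noteq> j" for i j
    proof
      assume "F i dvd F j"
      then have "F i = F j" using monic_irreducible_dvd_eq[of "F i" "F j"] F[OF ij(1)] F[OF ij(2)] by blast
      then show False using inj_onD[OF assms(6) _ ij(1,2)] ij(3) by blast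
    qed
  qed simp_all
  \<comment> \<open>The count equals \<open>C\<close> for matrices with the wanted partitions and 0
    for all others.\<close>
  have eq: "(\<Sum>Z\<in>mats n. mat_wt n (w n) Z *
      card {x\<in>basis_tuples n Z K ?f. \<forall>j\<in>?J. mo.tors n Z (F j) (mo.spn n Z K x) (vecs {..<n}) = mo.spn n Z K x}) = P n * real C"
    if n: "1 \<le> n" for n
  proof -
    have cnt: "card {x\<in>basis_tuples n Z K ?f. \<forall>j\<in>?J. mo.tors n Z (F j) (mo.spn n Z K x) (vecs {..<n}) = mo.spn n Z K x} =
        of_bool (?Q (mat n n (\<lambda>(i, j). Z j i))) * C" for Z :: "nat \<Rightarrow> nat \<Rightarrow> 'p mod_ring"
    proof -
      let ?B = "mat n n (\<lambda>(i, j). Z j i)"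
      let ?Z = "\<lambda>j i. ?B $$ (i, j)"
      have B: "?B \<in> carrier_mat n n" by simp
      \<comment> \<open>Sums over matrices use functions \<open>Z\<close>, canonical forms use
        \<open>mat\<close>. Both give the same operator, because \<open>mop\<close> reads only
        entries with indices below \<open>n\<close>.\<close>
      have mop: "mop n Z = mop n ?Z" by (intro ext) (simp add: mop_def)
      have bt: "basis_tuples n Z K ?f = basis_tuples n ?Z K ?f" unfolding basis_tuples_def mop ..
      have "card {x\<in>basis_tuples n Z K ?f. \<forall>j\<in>?J. mo.tors n Z (F j) (mo.spn n Z K x) (vecs {..<n}) = mo.spn n Z K x} =
        (if ?Q ?B then \<Prod>j\<in>?J. card (basis_tuples n ?Z {i. 0 < l j i} (\<lambda>i. F j ^ l j i)) else 0)"
        unfolding bt mop unfolding K_def by (rule card_saturated_tuples[OF B _ assms(6)]) (use F assms(8) in auto)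
      also have "\<dots> = of_bool (?Q ?B) * C"
      proof (cases "?Q ?B")
        case True
        have "card (basis_tuples n ?Z {i. 0 < l j i} (\<lambda>i. F j ^ l j i)) = card (Aut_F (F j) (l j))" if j: "j \<in> ?J" for j
          by (rule card_basis_tuples_eq_Aut_F[OF B]) (use F[OF j] assms(8)[OF j] True j in auto)
        then show ?thesis using True by (simp add: C_def)
      qed (simp only: if_False of_bool_eq mult_zero_left)
      finally show ?thesis .
    qed
    have "P n = (\<Sum>Z\<in>mats n. mat_wt n (w n) Z * of_bool (?Q (mat n n (\<lambda>(i, j). Z j i))))"
      unfolding P_def w_def[abs_def] using n by (intro prob_space.prob_random_matrix[OF assms(3)[OF n] _ assms(4)[OF n]]) simp
    then show ?thesis unfolding cnt by (simp add: sum_distrib_right mult.assoc)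
  qed
  have PC: "(\<lambda>n. P n * real C) \<longlonglongrightarrow> (\<Prod>j\<in>?J. euler_prod (?q j))"
    by (rule Lim_transform_eventually[OF lim], rule eventually_mono[OF eventually_ge_at_top[of 1]], rule eq)
  \<comment> \<open>If \<open>C\<close> were 0, the sequence \<open>P n * real C\<close> would be
    constantly 0 in spite of its positive limit. So the orders of the automorphism groups are
    nonzero and division by \<open>C\<close> is possible.\<close>
  have "0 < (\<Prod>j\<in>?J. euler_prod (?q j))"
  proof (rule prod_pos)
    fix j assume j: "j \<in> ?J"
    have "1 < real CARD('p mod_ring)" using card_field_gt_1[where 'a="'p mod_ring"] by simp
    then have "1 < ?q j" using assms(7)[OF j] by (intro one_less_power) auto
    then show "0 < euler_prod (?q j)" by (rule euler_prod_pos)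
  qed
  then have C0: "real C \<noteq> 0"
  proof (rule contrapos_pn)
    assume "real C = 0"
    then have "(\<lambda>_. 0) \<longlonglongrightarrow> (\<Prod>j\<in>?J. euler_prod (?q j))" using PC by simp
    then have "(\<Prod>j\<in>?J. euler_prod (?q j)) = 0" using LIMSEQ_unique tendsto_const by blast
    then show "\<not> 0 < (\<Prod>j\<in>?J. euler_prod (?q j))" by (simp only: less_irrefl not_False_eq_True)
  qed
  have "(\<lambda>n. P n * real C / real C) \<longlonglongrightarrow> (\<Prod>j\<in>?J. euler_prod (?q j)) / real C"
    by (rule tendsto_divide[OF PC tendsto_const C0])
  then have "P \<longlonglongrightarrow> (\<Prod>j\<in>?J. euler_prod (?q j)) / real C" using C0 by simp
  also have "(\<Prod>j\<in>?J. euler_prod (?q j)) / real C = (\<Prod>j\<in>?J. mu_F (F j) (l j))"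
    unfolding mu_F_eq_euler_prod C_def by (simp only: prod_dividef of_nat_prod)
  finally show ?thesis unfolding P_def[abs_def] .
qed

end
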